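(* Let $\varphi$ be a continuous Hermitian Herz--Schur multiplier on a second countable, locally compact group $G$, and let $d$ be a proper, left invariant metric on $G$ satisfying, for some constants $a,b>0$, $$\mu(B_n(e))\leq a\cdot e^{bn}\qquad(n\in\mathbb N),$$ where $\mu$ is a left invariant Haar measure on $G$ and $B_n(e)=\{g\in G : d(g,e)<n\}$ is the open ball of radius $n$ centered at the identity element $e\in G$. Then there exist a strongly continuous representation $(\pi,\mathscr H)$ of $G$ on a Hilbert space $\mathscr H$ and vectors $\xi,\eta\in\mathscr H$ such that $$\varphi(y^{-1}x)=\langle \pi(x)\xi,\pi(y)\eta\rangle\qquad(x,y\in G),$$ with $$\sup_{x\in G}\|\pi(x)\xi\|=\|\varphi\|_{M_0A(G)}^{1/2}\quad\text{and}\quad \sup_{y\in G}\|\pi(y)\eta\|=\|\varphi\|_{M_0A(G)}^{1/2}.$$ Moreover, for every fixed $c>b$, $(\pi,\mathscr H)$ (together with such $\xi,\eta$) can be chosen such that $$\|\pi(g)\|\leq e^{\frac{c}{2}d(g,e)}\qquad(g\in G).$$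
   Context: Schur multipliers: for a non-empty set $Y$, a function $\psi:Y\times Y\to\mathbb C$ is a Schur multiplier if for every operator $A=(a_{x,y})_{x,y\in Y}\in B(\ell^2(Y))$ the matrix $(\psi(x,y)a_{x,y})_{x,y\in Y}$ represents an operator $M_\psi A\in B(\ell^2(Y))$; then $M_\psi$ is a bounded operator on $B(\ell^2(Y))$ and $\|\psi\|_S=\|M_\psi\|$. Herz--Schur multipliers: a continuous function $\varphi:G\to\mathbb C$ on a locally compact group $G$ is a (continuous) Herz--Schur multiplier if $\hat\varphi(x,y)=\varphi(y^{-1}x)$ $(x,y\in G)$ is a Schur multiplier on $G\times G$ ($G$ viewed as a set), and its Herz--Schur norm is $\|\varphi\|_{HS}=\|\hat\varphi\|_S$. It is Hermitian if $\varphi^*=\varphi$, where $\varphi^*(g)=\overline{\varphi(g^{-1})}$ for $g\in G$. The norm $\|\cdot\|_{M_0A(G)}$: $M_0A(G)$ is the algebra of completely bounded Fourier multipliers, i.e. continuous $\varphi:G\to\mathbb C$ such that $\lambda(g)\mapsto\varphi(g)\lambda(g)$ ($\lambda$ the left regular representation) extends to a $\sigma$-weakly continuous, completely bounded operator $M_\varphi$ on the group von Neumann algebra of $G$, with $\|\varphi\|_{M_0A(G)}=\|M_\varphi\|_{\mathrm{cb}}$. By a known theorem of Bożejko and Fendler, $M_0A(G)$ coincides isometrically with the continuous Herz--Schur multipliers, so $\|\varphi\|_{M_0A(G)}=\|\varphi\|_{HS}$. Representations: a representation $(\pi,\mathscr H)$ of $G$ on a (complex) Hilbert space $\mathscr H$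 is a homomorphism of $G$ into the group of invertible elements of $B(\mathscr H)$ (not assumed unitary or uniformly bounded). It is strongly continuous if $g\mapsto\pi(g)$ is continuous for the strong operator topology on $B(\mathscr H)$. Inner products are linear in the first variable. A metric $d$ on $G$ is understood to induce the topology of $G$; it is left invariant if $d(gx,gy)=d(x,y)$ for all $g,x,y\in G$, and proper if closed balls are compact. *)

theory Defs
  imports "HOL-Analysis.Analysis" "HOL-Algebra.Module"
begin

section \<open>Complex Hilbert spaces with an explicit carrier\<close>

definition complex_ring :: "complex ring"
  where "complex_ring = \<lparr>carrier = UNIV, mult = (*), one = 1, zero = 0, add = (+)\<rparr>"

text \<open>Vectors and scalars are those of a HOL-Algebra module; the ring-multiplication fields
  \<open>mult\<close> and \<open>one\<close> of that record play no role for a Hilbert space.\<close>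

record 'h hilbert = "(complex, 'h) module" +
  cinner :: "'h \<Rightarrow> 'h \<Rightarrow> complex"

definition hnorm :: "('h, 'm) hilbert_scheme \<Rightarrow> 'h \<Rightarrow> real"
  where "hnorm H x = sqrt (Re (cinner H x x))"

definition hdist :: "('h, 'm) hilbert_scheme \<Rightarrow> 'h \<Rightarrow> 'h \<Rightarrow> real"
  where "hdist H x y = hnorm H (x \<ominus>\<^bsub>H\<^esub> y)"

locale complex_hilbert_space = Module.module complex_ring H for H (structure) +
  assumes cinner_add_left:
      "\<lbrakk>x \<in> carrier H; y \<in> carrier H; z \<in> carrier H\<rbrakk>
        \<Longrightarrow> cinner H (x \<oplus> y) z = cinner H x z + cinner H y z"
    and cinner_smult_left:
      "\<lbrakk>x \<in> carrier H; y \<in> carrier H\<rbrakk> \<Longrightarrow> cinner H (c \<odot> x) y = c * cinner H x y"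
    and cinner_commute:
      "\<lbrakk>x \<in> carrier H; y \<in> carrier H\<rbrakk> \<Longrightarrow> cinner H y x = cnj (cinner H x y)"
    and cinner_pos:
      "\<lbrakk>x \<in> carrier H; x \<noteq> \<zero>\<rbrakk> \<Longrightarrow> 0 < Re (cinner H x x)"
    and complete: "Metric_space.mcomplete (carrier H) (hdist H)"

subsection \<open>Bounded operators\<close>

text \<open>Operators are extensional functions on the carrier, so that equality of operators is
  equality of functions.\<close>

definition bounded_op :: "('h, 'm) hilbert_scheme \<Rightarrow> ('h \<Rightarrow> 'h) \<Rightarrow> bool"
  where "bounded_op H A \<longleftrightarrow>
    A \<in> carrier H \<rightarrow>\<^sub>E carrier H \<and>
    (\<forall>x\<in>carrier H. \<forall>y\<in>carrier H. A (x \<oplus>\<^bsub>H\<^esub> y) = A x \<oplus>\<^bsub>H\<^esub> A y) \<and>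
    (\<forall>c. \<forall>x\<in>carrier H. A (c \<odot>\<^bsub>H\<^esub> x) = c \<odot>\<^bsub>H\<^esub> A x) \<and>
    (\<exists>K. \<forall>x\<in>carrier H. hnorm H (A x) \<le> K * hnorm H x)"

definition opnorm :: "('h, 'm) hilbert_scheme \<Rightarrow> ('h \<Rightarrow> 'h) \<Rightarrow> real"
  where "opnorm H A = (SUP x\<in>{x \<in> carrier H. hnorm H x \<le> 1}. hnorm H (A x))"

text \<open>The algebra \<open>B(H)\<close>; its group of invertible elements is \<open>units_of (BH H)\<close>.\<close>

definition BH :: "('h, 'm) hilbert_scheme \<Rightarrow> (complex, 'h \<Rightarrow> 'h) module"
  where "BH H = \<lparr>carrier = {A. bounded_op H A},
    mult = compose (carrier H),
    one = (\<lambda>x\<in>carrier H. x),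
    zero = (\<lambda>x\<in>carrier H. \<zero>\<^bsub>H\<^esub>),
    add = (\<lambda>A B. \<lambda>x\<in>carrier H. A x \<oplus>\<^bsub>H\<^esub> B x),
    smult = (\<lambda>c A. \<lambda>x\<in>carrier H. c \<odot>\<^bsub>H\<^esub> A x)\<rparr>"

definition strong_op_topology :: "('h, 'm) hilbert_scheme \<Rightarrow> ('h \<Rightarrow> 'h) topology"
  where "strong_op_topology H =
    subtopology
      (product_topology (\<lambda>_. Metric_space.mtopology (carrier H) (hdist H)) (carrier H))
      (carrier (BH H))"

text \<open>The initial topology for the functionals
  \<open>A \<mapsto> \<Sum>n. \<langle>A \<xi>\<^sub>n, \<eta>\<^sub>n\<rangle>\<close> with \<open>\<xi>\<close>, \<open>\<eta>\<close> square summable.\<close>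

definition sq_summable_seqs :: "('h, 'm) hilbert_scheme \<Rightarrow> (nat \<Rightarrow> 'h) set"
  where "sq_summable_seqs H =
    {\<xi>. range \<xi> \<subseteq> carrier H \<and> summable (\<lambda>n. (hnorm H (\<xi> n))\<^sup>2)}"

definition sigma_weak_topology :: "('h, 'm) hilbert_scheme \<Rightarrow> ('h \<Rightarrow> 'h) topology"
  where "sigma_weak_topology H =
    pullback_topology (carrier (BH H))
      (\<lambda>A. \<lambda>(\<xi>, \<eta>)\<in>sq_summable_seqs H \<times> sq_summable_seqs H.
             \<Sum>n. cinner H (A (\<xi> n)) (\<eta> n))
      (product_topology (\<lambda>_. euclidean) (sq_summable_seqs H \<times> sq_summable_seqs H))"

subsection \<open>Complete boundedness\<close>

definition hilbert_power :: "('h, 'm) hilbert_scheme \<Rightarrow> nat \<Rightarrow> (nat \<Rightarrow> 'h) hilbert"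
  where "hilbert_power H n =
    \<lparr>carrier = {..<n} \<rightarrow>\<^sub>E carrier H,
     mult = undefined, one = undefined,
     zero = (\<lambda>i\<in>{..<n}. \<zero>\<^bsub>H\<^esub>),
     add = (\<lambda>x y. \<lambda>i\<in>{..<n}. x i \<oplus>\<^bsub>H\<^esub> y i),
     smult = (\<lambda>c x. \<lambda>i\<in>{..<n}. c \<odot>\<^bsub>H\<^esub> x i),
     cinner = (\<lambda>x y. \<Sum>i<n. cinner H (x i) (y i))\<rparr>"

text \<open>The norm of an \<open>n \<times> n\<close> matrix over \<open>B(H)\<close> as an operator on \<open>H\<^sup>n\<close>.\<close>

definition matrix_op ::
    "('h, 'm) hilbert_scheme \<Rightarrow> nat \<Rightarrow> (nat \<Rightarrow> nat \<Rightarrow> 'h \<Rightarrow> 'h) \<Rightarrow> (nat \<Rightarrow> 'h) \<Rightarrow> nat \<Rightarrow> 'h"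
  where "matrix_op H n A =
    (\<lambda>x\<in>carrier (hilbert_power H n). \<lambda>i\<in>{..<n}. \<Oplus>\<^bsub>H\<^esub>j\<in>{..<n}. A i j (x j))"

definition matrix_opnorm ::
    "('h, 'm) hilbert_scheme \<Rightarrow> nat \<Rightarrow> (nat \<Rightarrow> nat \<Rightarrow> 'h \<Rightarrow> 'h) \<Rightarrow> real"
  where "matrix_opnorm H n A = opnorm (hilbert_power H n) (matrix_op H n A)"

definition completely_bounded ::
    "('h, 'm) hilbert_scheme \<Rightarrow> ('h \<Rightarrow> 'h) set \<Rightarrow> (('h \<Rightarrow> 'h) \<Rightarrow> ('h \<Rightarrow> 'h)) \<Rightarrow> bool"
  where "completely_bounded H V M \<longleftrightarrow>
    (\<exists>K. \<forall>n A. (\<forall>i<n. \<forall>j<n. A i j \<in> V) \<longrightarrow>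
       matrix_opnorm H n (\<lambda>i j. M (A i j)) \<le> K * matrix_opnorm H n A)"

definition cb_norm ::
    "('h, 'm) hilbert_scheme \<Rightarrow> ('h \<Rightarrow> 'h) set \<Rightarrow> (('h \<Rightarrow> 'h) \<Rightarrow> ('h \<Rightarrow> 'h)) \<Rightarrow> real"
  where "cb_norm H V M =
    Sup {matrix_opnorm H n (\<lambda>i j. M (A i j)) | n A.
           (\<forall>i<n. \<forall>j<n. A i j \<in> V) \<and> matrix_opnorm H n A \<le> 1}"

section \<open>Schur multipliers\<close>

definition ell2 :: "'y set \<Rightarrow> ('y \<Rightarrow> complex) hilbert"
  where "ell2 Y =
    \<lparr>carrier = {f \<in> extensional Y. (\<lambda>y. (cmod (f y))\<^sup>2) summable_on Y},
     mult = undefined, one = undefined,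
     zero = (\<lambda>y\<in>Y. 0),
     add = (\<lambda>f g. \<lambda>y\<in>Y. f y + g y),
     smult = (\<lambda>c f. \<lambda>y\<in>Y. c * f y),
     cinner = (\<lambda>f g. \<Sum>\<^sub>\<infinity>y\<in>Y. f y * cnj (g y))\<rparr>"

definition ell2_unit :: "'y set \<Rightarrow> 'y \<Rightarrow> 'y \<Rightarrow> complex"
  where "ell2_unit Y y = (\<lambda>z\<in>Y. if z = y then 1 else 0)"

definition matrix_entry ::
    "'y set \<Rightarrow> (('y \<Rightarrow> complex) \<Rightarrow> ('y \<Rightarrow> complex)) \<Rightarrow> 'y \<Rightarrow> 'y \<Rightarrow> complex"
  where "matrix_entry Y A x y = cinner (ell2 Y) (A (ell2_unit Y y)) (ell2_unit Y x)"

definition schur_multiplier :: "'y set \<Rightarrow> ('y \<Rightarrow> 'y \<Rightarrow> complex) \<Rightarrow> bool"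
  where "schur_multiplier Y \<psi> \<longleftrightarrow>
    (\<forall>A\<in>carrier (BH (ell2 Y)). \<exists>B\<in>carrier (BH (ell2 Y)).
       \<forall>x\<in>Y. \<forall>y\<in>Y. matrix_entry Y B x y = \<psi> x y * matrix_entry Y A x y)"

section \<open>Locally compact groups\<close>

locale topological_group = Group.group G for G (structure) +
  fixes T :: "'a topology"
  assumes topspace_eq: "topspace T = carrier G"
    and continuous_mult: "continuous_map (prod_topology T T) T (\<lambda>(x, y). x \<otimes> y)"
    and continuous_inv: "continuous_map T T (\<lambda>x. inv x)"

locale locally_compact_group = topological_group +
  assumes hausdorff: "Hausdorff_space T"
    and locally_compact: "locally_compact_space T"

definition haar_measure ::
    "('g, 'm) monoid_scheme \<Rightarrow> 'g topology \<Rightarrow> 'g measure \<Rightarrow> bool"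
  where "haar_measure G T \<mu> \<longleftrightarrow>
    space \<mu> = topspace T \<and>
    sets \<mu> = sigma_sets (topspace T) {U. openin T U} \<and>
    emeasure \<mu> (space \<mu>) \<noteq> 0 \<and>
    (\<forall>K. compactin T K \<longrightarrow> emeasure \<mu> K < \<infinity>) \<and>
    (\<forall>A\<in>sets \<mu>. emeasure \<mu> A = (INF U\<in>{U. openin T U \<and> A \<subseteq> U}. emeasure \<mu> U)) \<and>
    (\<forall>U. openin T U \<longrightarrow>
       emeasure \<mu> U = (SUP K\<in>{K. compactin T K \<and> K \<subseteq> U}. emeasure \<mu> K)) \<and>
    (\<forall>g\<in>carrier G. \<forall>A\<in>sets \<mu>. emeasure \<mu> ((\<lambda>x. g \<otimes>\<^bsub>G\<^esub> x) ` A) = emeasure \<mu> A)"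

definition herz_schur_multiplier ::
    "('g, 'm) monoid_scheme \<Rightarrow> 'g topology \<Rightarrow> ('g \<Rightarrow> complex) \<Rightarrow> bool"
  where "herz_schur_multiplier G T \<phi> \<longleftrightarrow>
    continuous_map T euclidean \<phi> \<and>
    schur_multiplier (carrier G) (\<lambda>x y. \<phi> (inv\<^bsub>G\<^esub> y \<otimes>\<^bsub>G\<^esub> x))"

definition hermitian_fun :: "('g, 'm) monoid_scheme \<Rightarrow> ('g \<Rightarrow> complex) \<Rightarrow> bool"
  where "hermitian_fun G \<phi> \<longleftrightarrow> (\<forall>g\<in>carrier G. cnj (\<phi> (inv\<^bsub>G\<^esub> g)) = \<phi> g)"

section \<open>The group von Neumann algebra and its completely bounded multipliers\<close>

definition sq_integrable :: "'g measure \<Rightarrow> ('g \<Rightarrow> complex) set"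
  where "sq_integrable \<mu> =
    {f \<in> borel_measurable \<mu>. integrable \<mu> (\<lambda>x. (cmod (f x))\<^sup>2)}"

definition L2_rel :: "'g measure \<Rightarrow> (('g \<Rightarrow> complex) \<times> ('g \<Rightarrow> complex)) set"
  where "L2_rel \<mu> =
    {(f, g). f \<in> sq_integrable \<mu> \<and> g \<in> sq_integrable \<mu> \<and> (AE x in \<mu>. f x = g x)}"

definition L2_class :: "'g measure \<Rightarrow> ('g \<Rightarrow> complex) \<Rightarrow> ('g \<Rightarrow> complex) set"
  where "L2_class \<mu> f = L2_rel \<mu> `` {f}"

definition L2_rep :: "('g \<Rightarrow> complex) set \<Rightarrow> 'g \<Rightarrow> complex"
  where "L2_rep X = (SOME f. f \<in> X)"

text \<open>All operations below are independent of the representatives that \<open>L2_rep\<close> picks.\<close>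

definition L2 :: "'g measure \<Rightarrow> ('g \<Rightarrow> complex) set hilbert"
  where "L2 \<mu> =
    \<lparr>carrier = sq_integrable \<mu> // L2_rel \<mu>,
     mult = undefined, one = undefined,
     zero = L2_class \<mu> (\<lambda>x. 0),
     add = (\<lambda>X Y. L2_class \<mu> (\<lambda>x. L2_rep X x + L2_rep Y x)),
     smult = (\<lambda>c X. L2_class \<mu> (\<lambda>x. c * L2_rep X x)),
     cinner = (\<lambda>X Y. LINT x|\<mu>. L2_rep X x * cnj (L2_rep Y x))\<rparr>"

definition left_regular ::
    "('g, 'm) monoid_scheme \<Rightarrow> 'g measure \<Rightarrow> 'g
      \<Rightarrow> ('g \<Rightarrow> complex) set \<Rightarrow> ('g \<Rightarrow> complex) set"
  where "left_regular G \<mu> g =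
    (\<lambda>X\<in>carrier (L2 \<mu>). L2_class \<mu> (\<lambda>x. L2_rep X (inv\<^bsub>G\<^esub> g \<otimes>\<^bsub>G\<^esub> x)))"

text \<open>The span of \<open>\<lambda>(G)\<close> is a unital *-algebra, so its \<open>\<sigma>\<close>-weak closure is the von Neumann
  algebra generated by \<open>\<lambda>(G)\<close>.\<close>

definition group_vN ::
    "('g, 'm) monoid_scheme \<Rightarrow> 'g measure
      \<Rightarrow> (('g \<Rightarrow> complex) set \<Rightarrow> ('g \<Rightarrow> complex) set) set"
  where "group_vN G \<mu> =
    sigma_weak_topology (L2 \<mu>) closure_of
      {\<Oplus>\<^bsub>BH (L2 \<mu>)\<^esub>g\<in>F. c g \<odot>\<^bsub>BH (L2 \<mu>)\<^esub> left_regular G \<mu> g | F c.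
         finite F \<and> F \<subseteq> carrier G}"

definition fourier_multiplier_op ::
    "('g, 'm) monoid_scheme \<Rightarrow> 'g measure \<Rightarrow> ('g \<Rightarrow> complex)
      \<Rightarrow> ((('g \<Rightarrow> complex) set \<Rightarrow> ('g \<Rightarrow> complex) set)
           \<Rightarrow> (('g \<Rightarrow> complex) set \<Rightarrow> ('g \<Rightarrow> complex) set)) \<Rightarrow> bool"
  where "fourier_multiplier_op G \<mu> \<phi> M \<longleftrightarrow>
    (let V = group_vN G \<mu>; B = BH (L2 \<mu>);
         W = subtopology (sigma_weak_topology (L2 \<mu>)) V
     in M \<in> V \<rightarrow>\<^sub>E V \<and>
        (\<forall>A\<in>V. \<forall>A'\<in>V. M (A \<oplus>\<^bsub>B\<^esub> A') = M A \<oplus>\<^bsub>B\<^esub> M A') \<and>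
        (\<forall>c. \<forall>A\<in>V. M (c \<odot>\<^bsub>B\<^esub> A) = c \<odot>\<^bsub>B\<^esub> M A) \<and>
        continuous_map W W M \<and>
        completely_bounded (L2 \<mu>) V M \<and>
        (\<forall>g\<in>carrier G. M (left_regular G \<mu> g) = \<phi> g \<odot>\<^bsub>B\<^esub> left_regular G \<mu> g))"

text \<open>The norm of \<open>M\<^sub>0A(G)\<close>. There is at most one operator \<open>M\<^sub>\<phi>\<close> as above, since the span of
  \<open>\<lambda>(G)\<close> is \<open>\<sigma>\<close>-weakly dense, and a continuous \<open>\<phi>\<close> belongs to \<open>M\<^sub>0A(G)\<close> iff it exists;
  for other \<open>\<phi>\<close> the value is unspecified. The norm does not depend on the choice of \<open>\<mu>\<close>.\<close>

definition M0A_norm ::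
    "('g, 'm) monoid_scheme \<Rightarrow> 'g measure \<Rightarrow> ('g \<Rightarrow> complex) \<Rightarrow> real"
  where "M0A_norm G \<mu> \<phi> =
    cb_norm (L2 \<mu>) (group_vN G \<mu>) (THE M. fourier_multiplier_op G \<mu> \<phi> M)"

section \<open>Representations\<close>

definition representation ::
    "('g, 'm) monoid_scheme \<Rightarrow> 'h hilbert \<Rightarrow> ('g \<Rightarrow> 'h \<Rightarrow> 'h) \<Rightarrow> bool"
  where "representation G H \<pi> \<longleftrightarrow> complex_hilbert_space H \<and> \<pi> \<in> hom G (units_of (BH H))"

definition strongly_continuous ::
    "'g topology \<Rightarrow> 'h hilbert \<Rightarrow> ('g \<Rightarrow> 'h \<Rightarrow> 'h) \<Rightarrow> bool"
  where "strongly_continuous T H \<pi> \<longleftrightarrow> continuous_map T (strong_op_topology H) \<pi>"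

text \<open>The suprema are taken in \<open>ereal\<close> so that the equations also assert boundedness.\<close>

definition represents_multiplier ::
    "('g, 'm) monoid_scheme \<Rightarrow> 'g topology \<Rightarrow> 'g measure \<Rightarrow> ('g \<Rightarrow> complex)
      \<Rightarrow> 'h hilbert \<Rightarrow> ('g \<Rightarrow> 'h \<Rightarrow> 'h) \<Rightarrow> 'h \<Rightarrow> 'h \<Rightarrow> bool"
  where "represents_multiplier G T \<mu> \<phi> H \<pi> \<xi> \<eta> \<longleftrightarrow>
    representation G H \<pi> \<and> strongly_continuous T H \<pi> \<and>
    \<xi> \<in> carrier H \<and> \<eta> \<in> carrier H \<and>
    (\<forall>x\<in>carrier G. \<forall>y\<in>carrier G.
       \<phi> (inv\<^bsub>G\<^esub> y \<otimes>\<^bsub>G\<^esub> x) = cinner H (\<pi> x \<xi>) (\<pi> y \<eta>)) \<and>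
    (SUP x\<in>carrier G. ereal (hnorm H (\<pi> x \<xi>))) = ereal (sqrt (M0A_norm G \<mu> \<phi>)) \<and>
    (SUP y\<in>carrier G. ereal (hnorm H (\<pi> y \<eta>))) = ereal (sqrt (M0A_norm G \<mu> \<phi>))"

end

theory Submission
 imports Defs
begin

text \<open>A Herz--Schur multiplier \<open>\<phi>\<close> makes Schur multiplication by \<open>\<psi>(x, y) = \<phi>(y\<inverse> x)\<close> bounded,
with some bound \<open>S\<close>. By duality (\<open>schur_bound_decomposition\<close>) a Hermitian \<open>\<psi>\<close> is then a difference
\<open>k - l\<close> of positive kernels with \<open>k(x, x) + l(x, x) \<le> S\<close>. Neither kernel need be invariant under
\<open>G\<close> or continuous, and no invariant mean is available; the growth of \<open>G\<close> replaces it. Averaging a kernel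
over all translates with the integrable weight \<open>exp(-c d(z, 1))\<close>, normalized to mass one, leaves the invariant
difference \<open>\<psi>\<close> alone and costs only the factor \<open>exp(c d(g, 1))\<close> under translation by \<open>g\<close>
(\<open>average_decomposition\<close>). The integrals need measurable kernels, so \<open>k\<close> and \<open>l\<close> are first smoothed
on a scale \<open>1/(n+1)\<close>, which is kept as an additional parameter (\<open>smooth_decomposition\<close>).

The direct sum of the two averaged kernels is the Gram kernel of vectors \<open>v(\<plusminus>, x, n)\<close> in a sequence space. The
growth estimate says exactly that \<open>v(\<plusminus>, x, n) \<mapsto> v(\<plusminus>, g x, n)\<close> extends to a bounded operator \<open>\<pi>(g)\<close>
of norm at most \<open>exp(c d(g, 1)/2)\<close>. If \<open>\<xi>\<^sub>+\<close>, \<open>\<xi>\<^sub>-\<close> are weak limits of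
\<open>v(+, 1, n)\<close>, \<open>v(-, 1, n)\<close>, then \<open>\<xi> = \<xi>\<^sub>+ + \<xi>\<^sub>-\<close> and \<open>\<eta> = \<xi>\<^sub>+ - \<xi>\<^sub>-\<close> satisfy
\<open>\<langle>\<pi>(x)\<xi>, \<pi>(y)\<eta>\<rangle> = \<psi>(x, y)\<close> and \<open>\<parallel>\<pi>(x)\<xi>\<parallel> = \<parallel>\<pi>(x)\<eta>\<parallel> \<le> \<surd>S\<close>
(\<open>representation_from_kernels\<close>).

Such a coefficient formula factors \<open>\<phi>\<close> through bounded square summable families of functions on \<open>G\<close>; row and column
multiplication by these families yields \<open>M\<^sub>\<phi>\<close> with completely bounded norm at most the square of any bound
for the two orbits (\<open>multiplier_from_factorization\<close>). Conversely the completely bounded norm is itself an admissible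
\<open>S\<close> (\<open>schur_bound_if_cb\<close>). So the construction is run twice: once with any \<open>S\<close>, to learn that
\<open>M\<^sub>\<phi>\<close> exists, and once with \<open>S = \<parallel>\<phi>\<parallel>\<close>, where the two inequalities force the suprema to be
\<open>\<parallel>\<phi>\<parallel>\<^sup>1\<^sup>/\<^sup>2\<close>.\<close>

section \<open>A minimax principle and positive kernels\<close>

abbreviation seq_limit  (infix "\<leadsto>" 60) where "X \<leadsto> L \<equiv> (X \<longlongrightarrow> L) sequentially"
abbreviation cm2 :: "complex => real" where "cm2 z \<equiv> (cmod z)\<^sup>2"

text \<open>A point minimizing the total squared violation of the inequalities is feasible: otherwise its violations, used as weights, produce a second point, and moving towards it decreases the total.\<close>

lemma compact_affine_alternative_finite:
 fixes f :: "'i => 'a::topological_space => real"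
 assumes "compact C" and "C ~= {}" and "finite J"
  and cont: "\<And>i. i \<in> J ==> continuous_on C (f i)"
  and mix: "\<And>x y t. [|x \<in> C; y \<in> C; 0 <= t; t <= 1|] ==>
    \<exists>z\<in>C. \<forall>i\<in>J. f i z >= (1 - t) * f i x + t * f i y"
  and weak: "\<And>l. (\<And>i. i \<in> J ==> 0 <= l i) ==> \<exists>x\<in>C. 0 <= (\<Sum>i\<in>J. l i * f i x)"
 shows "\<exists>x\<in>C. \<forall>i\<in>J. 0 <= f i x"
proof -
 define defect where "defect x = (\<Sum>i\<in>J. (max (- f i x) 0)\<^sup>2)" for x
 have "continuous_on C defect"
  unfolding defect_def by (intro continuous_intros cont) auto
 then obtain x0 where x0: "x0 \<in> C" "\<And>y. y \<in> C ==> defect x0 <= defect y"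
  using continuous_attains_inf[OF assms(1,2)] by blast
 define l where "l i = max (- f i x0) 0" for i
 obtain x where x: "x \<in> C" "0 <= (\<Sum>i\<in>J. l i * f i x)"
  using weak[of l] by (auto simp: l_def)
 define \<delta> where "\<delta> i = f i x - f i x0" for i
 define R where "R = (\<Sum>i\<in>J. (\<delta> i)\<^sup>2)"
 have defect_l: "defect x0 = (\<Sum>i\<in>J. (l i)\<^sup>2)" by (simp only: defect_def l_def)
 have lsq: "l i * f i x0 = - (l i)\<^sup>2" for i
  by (auto simp: l_def max_def power2_eq_square)
 have decr: "(\<Sum>i\<in>J. l i * \<delta> i) >= defect x0"
 proof -
  have "l i * \<delta> i = l i * f i x + (l i)^2" for i
   using lsq[of i] unfolding \<delta>_def right_diff_distrib by linarith
  hence "(\<Sum>i\<in>J. l i * \<delta> i) = (\<Sum>i\<in>J. l i * f i x) + defect x0"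
   by (simp only: sum.distrib defect_l)
  thus ?thesis using x by linarith
 qed
 have step: "defect x0 <= defect x0 - 2 * t * defect x0 + t\<^sup>2 * R" if t: "0 <= t" "t <= 1" for t
 proof -
  obtain z where z: "z \<in> C" "\<And>i. i \<in> J ==> f i z >= (1 - t) * f i x0 + t * f i x"
   using mix[OF x0(1) x(1) t] by blast
  have "(max (- f i z) 0)^2 <= (l i - t * \<delta> i)^2" if "i \<in> J" for i
  proof -
   have "max (- f i z) 0 <= \<bar>l i - t * \<delta> i\<bar>"
   proof -
    have "f i z >= f i x0 + t * \<delta> i" using z(2)[OF that] by (simp add: \<delta>_def algebra_simps)
    thus ?thesis unfolding l_def by linarith
   qed
   thus ?thesis by (metis abs_le_square_iff abs_of_nonneg max.cobounded2)
  qed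
  hence "defect z <= (\<Sum>i\<in>J. (l i - t * \<delta> i)\<^sup>2)"
   unfolding defect_def by (rule sum_mono)
  also have "... = (\<Sum>i\<in>J. (l i)\<^sup>2 - 2 * t * (l i * \<delta> i) + t\<^sup>2 * (\<delta> i)^2)"
   by (intro sum.cong refl) (simp only: power2_diff power_mult_distrib mult_ac)
  also have "... = defect x0 - 2 * t * (\<Sum>i\<in>J. l i * \<delta> i) + t\<^sup>2 * R"
   by (simp only: sum.distrib sum_subtractf sum_distrib_left R_def defect_l)
  also have "... <= defect x0 - 2 * t * defect x0 + t\<^sup>2 * R"
   using mult_left_mono[OF decr, of "2 * t"] t by linarith
  finally show ?thesis using x0(2)[OF z(1)] by linarith
 qed
 have "0 <= defect x0" "0 <= R" by (auto simp: defect_def R_def intro!: sum_nonneg)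
 have "defect x0 = 0"
 proof (rule ccontr)
  assume "defect x0 ~= 0"
  hence pos: "0 < defect x0" using \<open>0 <= defect x0\<close> by simp
  define t where "t = min 1 (defect x0 / (R + 1))"
  have t: "0 < t" "t <= 1" using pos \<open>0 <= R\<close> by (auto simp: t_def)
  have "t * R < 2 * defect x0"
  proof -
   have "t * R <= t * (R + 1)" using t by simp
   also have "... <= defect x0" using \<open>0 <= R\<close> unfolding t_def
    by (metis add_nonneg_pos less_numeral_extra(1) min.cobounded2 pos_le_divide_eq)
   finally show ?thesis using pos by linarith
  qed
  hence "t * (t * R) < t * (2 * defect x0)" using t by simp
  thus False using step[of t] t by (simp add: power2_eq_square algebra_simps)
 qed
 hence "(l i)^2 = 0" if "i \<in> J" for i
  using sum_nonneg_eq_0_iff[OF \<open>finite J\<close>, of "%i. (l i)\<^sup>2"] that by (simp add: defect_l)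
 hence "0 <= f i x0" if "i \<in> J" for i
  using that unfolding l_def by (metis linorder_not_le max.absorb_iff2 max_def neg_0_less_iff_less power_eq_0_iff)
 thus ?thesis using x0(1) by blast
qed

proposition compact_affine_alternative:
 fixes f :: "'i => 'a::topological_space => real"
 assumes "compact C"
  and cont: "\<And>i. i \<in> I ==> continuous_on C (f i)"
  and mix: "\<And>x y t. [|x \<in> C; y \<in> C; 0 <= t; t <= 1|] ==>
    \<exists>z\<in>C. \<forall>i\<in>I. f i z >= (1 - t) * f i x + t * f i y"
  and weak: "\<And>J l. [|finite J; J \<subseteq> I; \<And>i. i \<in> J ==> 0 <= l i|] ==>
    \<exists>x\<in>C. 0 <= (\<Sum>i\<in>J. l i * f i x)"
 shows "\<exists>x\<in>C. \<forall>i\<in>I. 0 <= f i x"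
proof -
 have ne: "C ~= {}" using weak[of "{}"] by auto
 have fin: "\<exists>x\<in>C. \<forall>i\<in>J. 0 <= f i x" if "finite J" "J \<subseteq> I" for J
 proof (rule compact_affine_alternative_finite[OF assms(1) ne that(1)])
  show "\<And>i. i \<in> J ==> continuous_on C (f i)" using cont \<open>J \<subseteq> I\<close> by blast
  show "\<exists>z\<in>C. \<forall>i\<in>J. (1 - t) * f i x + t * f i y <= f i z"
   if "x \<in> C" "y \<in> C" "0 <= t" "t <= 1" for x y t
   using mix[OF that] \<open>J \<subseteq> I\<close> by blast
  show "\<exists>x\<in>C. 0 <= (\<Sum>i\<in>J. l i * f i x)" if "\<And>i. i \<in> J ==> 0 <= l i" for l
   using weak[OF \<open>finite J\<close> \<open>J \<subseteq> I\<close> that] .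
 qed
 have cl: "\<exists>F. closed F & C \<inter> F = {x \<in> C. 0 <= f i x}" if i: "i \<in> I" for i
 proof -
  have "closedin (top_of_set C) (C \<inter> f i -` {0..})"
   using cont[OF i] closed_atLeast continuous_on_closed_vimage continuous_closedin_preimage by blast
  then obtain F where "closed F" "C \<inter> f i -` {0..} = C \<inter> F" by (auto simp: closedin_closed)
  thus ?thesis by (intro exI[of _ F]) auto
 qed
 then obtain D where D: "\<And>i. i \<in> I ==> closed (D i) & C \<inter> D i = {x \<in> C. 0 <= f i x}"
  by metis
 have "C \<inter> (\<Inter>i\<in>I. D i) ~= {}"
 proof (rule compact_imp_fip_image[OF assms(1)])
  show "\<And>i. i \<in> I ==> closed (D i)" using D by blast
  fix J assume J: "finite J" "J \<subseteq> I"
  obtain x where x: "x\<in>C" "\<forall>i\<in>J. 0 <= f i x" using fin[OF J] by blast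
  hence "x \<in> D i" if "i \<in> J" for i using D[of i] J that by blast
  thus "C \<inter> \<Inter> (D ` J) ~= {}" using x(1) by auto
 qed
 then obtain x where x: "x \<in> C" "\<forall>i\<in>I. x \<in> D i" by auto
 hence "0 <= f i x" if "i \<in> I" for i using D[OF that] x that by auto
 thus ?thesis using x by blast
qed

definition sesq :: "('x => 'x => complex) => 'x set => ('x => complex) => ('x => complex) => complex"
 where "sesq k F u w = (\<Sum>p\<in>F. \<Sum>q\<in>F. u p * cnj (w q) * k p q)"

abbreviation form_le where "form_le Z F d u \<equiv> \<bar>Re (sesq Z F u u)\<bar> <= (\<Sum>p\<in>F. d p * cm2 (u p))"

definition psd :: "'x set => ('x => 'x => complex) => bool"
 where "psd X k \<longleftrightarrow> (\<forall>F w. finite F --> F \<subseteq> X --> sesq k F w w \<in> \<real>\<^sub>\<ge>\<^sub>0)"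

lemma psdD: "[|psd X k; finite F; F \<subseteq> X|] ==> 0 <= Re (sesq k F w w)"
 and psdD_Im: "[|psd X k; finite F; F \<subseteq> X|] ==> Im (sesq k F w w) = 0"
 by (auto simp: psd_def complex_nonneg_Reals_iff)

lemma sesq_add_kernel: "sesq (%p q. k p q + l p q) F u w = sesq k F u w + sesq l F u w"
 by (simp add: sesq_def sum.distrib algebra_simps)

lemma sesq_diff_kernel: "sesq (%p q. k p q - l p q) F u w = sesq k F u w - sesq l F u w"
 by (simp add: sesq_def sum_subtractf algebra_simps)

lemma sesq_scale_kernel: "sesq (%p q. c * k p q) F u w = c * sesq k F u w"
 by (simp add: sesq_def sum_distrib_left algebra_simps)

lemma sesq_add: "sesq k F (%p. u p + v p) (%p. w p + z p)
  = sesq k F u w + sesq k F u z + sesq k F v w + sesq k F v z"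
 by (simp add: sesq_def sum.distrib algebra_simps)

lemma sesq_scale: "sesq k F (%p. a * u p) (%p. b * w p) = a * cnj b * sesq k F u w"
 by (simp add: sesq_def sum_distrib_left algebra_simps)

lemma sesq_rank_one:
 "sesq (%p q. a p * cnj (a q)) F u w = (\<Sum>p\<in>F. u p * a p) * cnj (\<Sum>p\<in>F. w p * a p)"
 by (simp add: sesq_def sum_product algebra_simps)

lemma sesq_flip:
 assumes "\<And>p q. [|p \<in> F; q \<in> F|] ==> k q p = cnj (k p q)"
 shows "sesq k F w u = cnj (sesq k F u w)"
proof -
 have "sesq k F w u = (\<Sum>q\<in>F. \<Sum>p\<in>F. w p * cnj (u q) * k p q)"
  unfolding sesq_def by (rule sum.swap)
 also have "... = cnj (sesq k F u w)"
  unfolding sesq_def cnj_sum by (intro sum.cong refl) (simp add: assms[symmetric] mult.commute)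
 finally show ?thesis .
qed

lemma sesq_extend:
 assumes "finite F" "E \<subseteq> F"
 shows "sesq k F (%p. if p \<in> E then u p else 0) (%p. if p \<in> E then w p else 0) = sesq k E u w"
proof -
 have "sesq k F (%p. if p \<in> E then u p else 0) (%p. if p \<in> E then w p else 0)
   = (\<Sum>p\<in>F. if p \<in> E then (\<Sum>q\<in>F. if q \<in> E then u p * cnj (w q) * k p q else 0) else 0)"
  unfolding sesq_def by (intro sum.cong refl) (auto intro!: sum.cong)
 also have "... = sesq k E u w"
  using assms by (simp add: sesq_def sum.If_cases Int_absorb1 Int_absorb2 Int_commute)
 finally show ?thesis .
qed

lemma sesq_singleton: "sesq k {p} u w = u p * cnj (w p) * k p p"
 by (simp add: sesq_def)

lemma sesq_doubleton:
 "p ~= q ==> sesq k {p, q} u w =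
   u p * cnj (w p) * k p p + u p * cnj (w q) * k p q + u q * cnj (w p) * k q p + u q * cnj (w q) * k q q"
 by (simp add: sesq_def)

lemma psd_cong:
 assumes "\<And>p q. [|p \<in> X; q \<in> X|] ==> k p q = l p q"
 shows "psd X k \<longleftrightarrow> psd X l"
proof -
 have "sesq k F w w = sesq l F w w" if "F \<subseteq> X" for F w
  unfolding sesq_def using that assms by (intro sum.cong refl) auto
 thus ?thesis unfolding psd_def by auto
qed

lemma psd_add: "[|psd X k; psd X l|] ==> psd X (%p q. k p q + l p q)"
 unfolding psd_def sesq_add_kernel by (auto intro: nonneg_Reals_add_I)

lemma psd_scale: "[|psd X k; 0 <= c|] ==> psd X (%p q. of_real c * k p q)"
 unfolding psd_def sesq_scale_kernel by (auto intro: nonneg_Reals_mult_I)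

lemma psd_zero: "psd X (%p q. 0)"
 by (simp add: psd_def sesq_def)

lemma psd_rank_one: "psd X (%p q. a p * cnj (a q))"
 by (simp add: psd_def sesq_rank_one complex_norm_square[symmetric] del: of_real_power cnj_sum)

lemma psd_sum:
 assumes "\<And>i. i \<in> A ==> psd X (k i)"
 shows "psd X (%p q. \<Sum>i\<in>A. k i p q)"
 using assms by (induction A rule: infinite_finite_induct) (auto intro: psd_add psd_zero)

lemma psd_diag:
 assumes "psd X k" "p \<in> X"
 shows "0 <= Re (k p p)" and "Im (k p p) = 0"
proof -
 have "sesq k {p} (%_. 1) (%_. 1) \<in> \<real>\<^sub>\<ge>\<^sub>0"
  using assms unfolding psd_def by blast
 thus "0 <= Re (k p p)" and "Im (k p p) = 0"
  by (simp_all add: sesq_singleton complex_nonneg_Reals_iff)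
qed

lemma psd_diag_eq:
 "[|psd X k; p \<in> X|] ==> k p p = of_real (Re (k p p))"
 using psd_diag by (simp add: complex_eq_iff)

lemma psd_sym:
 assumes k: "psd X k" and "p \<in> X" "q \<in> X"
 shows "k q p = cnj (k p q)"
proof (cases "p = q")
 case True thus ?thesis using psd_diag[OF k \<open>p \<in> X\<close>] by (simp add: complex_eq_iff)
next
 case False
 have "Im (sesq k {p, q} w w) = 0" for w using psdD_Im[OF k] assms by simp
 from this[of "%_. 1"] this[of "%r. if r = p then 1 else \<i>"] show ?thesis
  using False psd_diag[OF k] assms by (simp add: sesq_doubleton complex_eq_iff)
qed

lemma discriminant_bound:
 fixes b :: complex
 assumes "\<And>t. 0 <= a + 2 * Re (t * b) + cm2 t * c" and "0 <= a" and "0 <= c"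
 shows "cm2 b <= a * c"
proof (cases "c = 0")
 case True
 have "b = 0"
 proof (rule ccontr)
  assume b: "b ~= 0"
  have "of_real (- (a + 1) / cm2 b) * cnj b * b = of_real (- (a + 1) / cm2 b) * of_real (cm2 b)"
   by (simp only: complex_norm_square mult.assoc mult.commute[of "cnj b"])
  also have "... = of_real (- (a + 1))"
   using b by (simp del: of_real_power)
  finally have "Re (of_real (- (a + 1) / cm2 b) * cnj b * b) = - (a + 1)"
   by (metis Re_complex_of_real)
  thus False using assms(1)[of "of_real (- (a + 1) / cm2 b) * cnj b"] True assms(2) by simp
 qed
 thus ?thesis using True by simp
next
 case False
 hence c: "c > 0" using assms(3) by simp
 define t where "t = of_real (- 1 / c) * cnj b"
 have "t * b = of_real (- cm2 b / c)"
 proof -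
  have "t * b = of_real (- 1 / c) * of_real (cm2 b)"
   by (simp only: t_def complex_norm_square mult.assoc mult.commute[of "cnj b"])
  thus ?thesis by (simp del: of_real_power add: of_real_mult[symmetric])
 qed
 hence "Re (t * b) = - cm2 b / c" by (metis Re_complex_of_real)
 moreover have "cm2 t * c = cm2 b / c"
  using c by (simp add: t_def norm_mult norm_divide power_mult_distrib power_divide power2_eq_square)
 ultimately have "0 <= a - cm2 b / c" using assms(1)[of t] by simp
 thus ?thesis using c by (simp add: field_simps)
qed

text \<open>The discriminant of the nonnegative quadratic \<open>t \<mapsto> k(u + t w, u + t w)\<close>.\<close>

lemma psd_Cauchy_Schwarz_sesq:
 assumes k: "psd X k" and F: "finite F" "F \<subseteq> X"
 shows "cm2 (sesq k F u w) <= Re (sesq k F u u) * Re (sesq k F w w)"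
proof (rule discriminant_bound)
 fix t
 have "sesq k F w u = cnj (sesq k F u w)"
  using F psd_sym[OF k] by (intro sesq_flip) auto
 hence "Re (cnj t * sesq k F w u) = Re (t * sesq k F u w)" by simp
 moreover have "Re (sesq k F (%p. 1 * u p + cnj t * w p) (%p. 1 * u p + cnj t * w p))
   = Re (sesq k F u u) + Re (t * sesq k F u w) + Re (cnj t * sesq k F w u)
    + Re (cnj t * t * sesq k F w w)"
  by (simp only: sesq_add sesq_scale) (simp add: algebra_simps)
 moreover have "Re (cnj t * t * sesq k F w w) = cm2 t * Re (sesq k F w w)"
 proof -
  have "cnj t * t = of_real (cm2 t)" by (metis complex_norm_square mult.commute)
  thus ?thesis by (simp del: of_real_power)
 qed
 ultimately show "0 <= Re (sesq k F u u) + 2 * Re (t * sesq k F u w) + cm2 t * Re (sesq k F w w)"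
  using psdD[OF k F, of "%p. 1 * u p + cnj t * w p"] by linarith
qed (use psdD[OF k F] in auto)

lemma psd_Cauchy_Schwarz:
 assumes k: "psd X k" and "p \<in> X" "q \<in> X"
 shows "cm2 (k p q) <= Re (k p p) * Re (k q q)"
proof (cases "p = q")
 case True
 thus ?thesis using psd_diag[OF k \<open>p \<in> X\<close>] cmod_power2[of "k p p"] by (simp add: power2_eq_square)
next
 case False
 thus ?thesis
  using psd_Cauchy_Schwarz_sesq[OF k, of "{p, q}" "%r. if r = p then 1 else 0" "%r. if r = q then 1 else 0"] assms
  by (simp add: sesq_doubleton)
qed

lemma psd_norm_le:
 assumes k: "psd X k" and "p \<in> X" "q \<in> X" and "Re (k p p) <= S" "Re (k q q) <= S"
 shows "cmod (k p q) <= S"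
proof -
 have "cm2 (k p q) <= S * S"
  using psd_Cauchy_Schwarz[OF assms(1-3)] mult_mono[OF assms(4,5)] psd_diag(1)[OF k] assms
  by (meson order_trans)
 thus ?thesis using psd_diag(1)[OF k \<open>p \<in> X\<close>] assms(4)
  by (metis power2_eq_square power2_le_imp_le order_trans)
qed

lemma psd_linear_image:
 assumes k: "psd Y k" and A: "\<And>p. p \<in> X ==> finite (A p) & A p \<subseteq> Y"
 shows "psd X (%p q. \<Sum>i\<in>A p. \<Sum>j\<in>A q. a p i * cnj (a q j) * k i j)"
proof -
 have "sesq (%p q. \<Sum>i\<in>A p. \<Sum>j\<in>A q. a p i * cnj (a q j) * k i j) F w w
   = sesq k (\<Union>p\<in>F. A p) (%i. \<Sum>p\<in>F. if i \<in> A p then w p * a p i else 0)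
     (%i. \<Sum>p\<in>F. if i \<in> A p then w p * a p i else 0)" if F: "finite F" "F \<subseteq> X" for F w
 proof -
  let ?U = "\<Union>p\<in>F. A p"
  define b where "b p i = (if i \<in> A p then a p i else 0)" for p i
  have fin: "finite ?U" using F A by auto
  have "(\<Sum>i\<in>A p. \<Sum>j\<in>A q. a p i * cnj (a q j) * k i j) = sesq k ?U (b p) (b q)"
   if "p \<in> F" "q \<in> F" for p q
  proof -
   have "sesq k ?U (b p) (b q) = (\<Sum>i\<in>?U. if i \<in> A p then (\<Sum>j\<in>?U. if j \<in> A q then a p i * cnj (a q j) * k i j else 0) else 0)"
    unfolding sesq_def b_def by (intro sum.cong refl) (auto intro!: sum.cong)
   also have "... = (\<Sum>i\<in>?U \<inter> A p. \<Sum>j\<in>?U \<inter> A q. a p i * cnj (a q j) * k i j)"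
    using fin by (simp add: sum.If_cases)
   also have "?U \<inter> A p = A p" using that by blast
   also have "?U \<inter> A q = A q" using that by blast
   finally show ?thesis by simp
  qed
  hence "sesq (%p q. \<Sum>i\<in>A p. \<Sum>j\<in>A q. a p i * cnj (a q j) * k i j) F w w
    = (\<Sum>p\<in>F. \<Sum>q\<in>F. w p * cnj (w q) * sesq k ?U (b p) (b q))"
   unfolding sesq_def[of _ F] by (intro sum.cong refl) auto
  also have "... = (\<Sum>p\<in>F. \<Sum>q\<in>F. \<Sum>i\<in>?U. \<Sum>j\<in>?U. (w p * b p i) * cnj (w q * b q j) * k i j)"
   unfolding sesq_def sum_distrib_left by (intro sum.cong refl) simp
  also have "... = (\<Sum>p\<in>F. \<Sum>i\<in>?U. \<Sum>q\<in>F. \<Sum>j\<in>?U. (w p * b p i) * cnj (w q * b q j) * k i j)"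
   by (intro sum.cong refl sum.swap)
  also have "... = (\<Sum>i\<in>?U. \<Sum>p\<in>F. \<Sum>q\<in>F. \<Sum>j\<in>?U. (w p * b p i) * cnj (w q * b q j) * k i j)"
   by (rule sum.swap)
  also have "... = (\<Sum>i\<in>?U. \<Sum>p\<in>F. \<Sum>j\<in>?U. \<Sum>q\<in>F. (w p * b p i) * cnj (w q * b q j) * k i j)"
   by (intro sum.cong refl sum.swap)
  also have "... = (\<Sum>i\<in>?U. \<Sum>j\<in>?U. \<Sum>p\<in>F. \<Sum>q\<in>F. (w p * b p i) * cnj (w q * b q j) * k i j)"
   by (intro sum.cong refl sum.swap)
  also have "... = sesq k ?U (%i. \<Sum>p\<in>F. w p * b p i) (%i. \<Sum>p\<in>F. w p * b p i)"
   unfolding sesq_def by (simp only: cnj_sum sum_product) (simp only: sum_distrib_right)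
  also have "(%i. \<Sum>p\<in>F. w p * b p i) = (%i. \<Sum>p\<in>F. if i \<in> A p then w p * a p i else 0)"
   unfolding b_def by (intro ext sum.cong refl) auto
  finally show ?thesis .
 qed
 moreover have "finite (\<Union>p\<in>F. A p)" if "finite F" "F \<subseteq> X" for F
  using that A by (intro finite_UN_I) auto
 moreover have "(\<Union>p\<in>F. A p) \<subseteq> Y" if "F \<subseteq> X" for F
  using that A by (intro UN_least) auto
 ultimately show ?thesis using k unfolding psd_def by simp
qed

lemma psd_comp:
 assumes "psd Y k" "\<And>p. p \<in> X ==> f p \<in> Y"
 shows "psd X (%p q. k (f p) (f q))"
 using psd_linear_image[OF assms(1), of X "%p. {f p}" "%_ _. 1"] assms(2) by simp

text \<open>Minimizing the form over the multiples of the point \<open>r\<close> leaves a nonnegative remainder. Iterating this is Gram--Schmidt orthogonalization at the level of kernels.\<close>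

lemma psd_Schur_complement:
 assumes k: "psd X k" and r: "r \<in> X"
 shows "psd X (%p q. k p q - k p r * k r q / k r r)" (is "psd X ?l")
proof (cases "k r r = 0")
 case True
 thus ?thesis using k by simp
next
 case False
 define \<kappa> where "\<kappa> = Re (k r r)"
 have koo: "k r r = of_real \<kappa>" using psd_diag_eq[OF k r] by (simp add: \<kappa>_def)
 have "\<kappa> ~= 0" using False koo by auto
 hence \<kappa>: "\<kappa> > 0" using psd_diag(1)[OF k r] by (simp add: \<kappa>_def)
 show ?thesis unfolding psd_def
 proof (intro allI impI)
  fix F w assume F: "finite F" "F \<subseteq> X"
  let ?F = "insert r F"
  define s where "s = (\<Sum>p\<in>F. w p * k p r)"
  define w0 where "w0 = (%p. if p \<in> F then w p else 0)"
  define t where "t = - s / of_real \<kappa>"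
  define e where "e = (%p. if p = r then (1::complex) else 0)"
  have F': "finite ?F" "?F \<subseteq> X" using F r by auto
  have rank: "sesq (%p q. k p r * k r q / k r r) F w w = s * cnj s / of_real \<kappa>"
  proof -
   have "sesq (%p q. k p r * k r q / k r r) F w w
     = sesq (%p q. (1 / of_real \<kappa>) * (k p r * cnj (k q r))) F w w"
    unfolding sesq_def using F psd_sym[OF k _ r] by (intro sum.cong refl) (simp add: koo subset_iff)
   also have "... = (1 / of_real \<kappa>) * (s * cnj s)"
    by (simp only: sesq_scale_kernel sesq_rank_one s_def)
   finally show ?thesis by simp
  qed
  have a: "sesq k ?F w0 w0 = sesq k F w w" unfolding w0_def using F by (intro sesq_extend) auto
  have b: "sesq k ?F w0 e = s"
  proof -
   have "sesq k ?F w0 e = (\<Sum>p\<in>?F. w0 p * k p r)"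
    unfolding sesq_def
   proof (intro sum.cong refl)
    fix p
    have "(\<Sum>q\<in>?F. w0 p * cnj (e q) * k p q) = (\<Sum>q\<in>?F. if q = r then w0 p * k p r else 0)"
     by (intro sum.cong refl) (auto simp: e_def)
    thus "(\<Sum>q\<in>?F. w0 p * cnj (e q) * k p q) = w0 p * k p r" using F' by simp
   qed
   also have "... = (\<Sum>p\<in>F. w0 p * k p r)" using F' F
    by (cases "r \<in> F") (auto simp: insert_absorb w0_def)
   finally show ?thesis by (simp add: s_def w0_def)
  qed
  have c: "sesq k ?F e w0 = cnj s"
   using sesq_flip[of ?F k e w0] psd_sym[OF k] F' b by blast
  have d: "sesq k ?F e e = of_real \<kappa>"
  proof -
   have "sesq k ?F e e = sesq k ?F (%p. if p \<in> {r} then 1 else 0) (%p. if p \<in> {r} then 1 else 0)"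
    by (simp add: e_def)
   thus ?thesis using F' by (subst (asm) sesq_extend) (auto simp: sesq_singleton koo)
  qed
  have "sesq k ?F (%p. 1 * w0 p + t * e p) (%p. 1 * w0 p + t * e p)
    = sesq k F w w + cnj t * s + t * cnj s + t * cnj t * of_real \<kappa>"
   by (simp only: sesq_add sesq_scale a b c d) (simp add: algebra_simps)
  also have "... = sesq k F w w - s * cnj s / of_real \<kappa>"
   using \<kappa> by (simp add: t_def field_simps)
  also have "... = sesq ?l F w w"
   by (simp add: sesq_diff_kernel rank)
  finally show "sesq ?l F w w \<in> \<real>\<^sub>\<ge>\<^sub>0" using k F' unfolding psd_def by metis
 qed
qed

section \<open>Differences of positive kernels\<close>

text \<open>Boundedness of a Schur multiplier, tested on Hermitian matrices: \<open>\<plusminus>Z \<le> diag(d)\<close> says that \<open>Z\<close>, divided by the square roots of the weights, is a contraction, and the conclusion evaluates its Schur product with \<open>\<psi>\<close> at the vector with entries \<open>\<surd>d\<^sub>p\<close>. Stated in this way it suits the duality below.\<close>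

definition schur_bound :: "'x set => ('x => 'x => complex) => real => bool"
 where "schur_bound X \<psi> S \<longleftrightarrow>
  (\<forall>F Z d. finite F --> F \<subseteq> X --> (\<forall>p\<in>F. \<forall>q\<in>F. Z q p = cnj (Z p q)) --> (\<forall>p\<in>F. 0 <= d p) -->
    (\<forall>u. form_le Z F d u) -->
    Re (\<Sum>p\<in>F. \<Sum>q\<in>F. Z p q * \<psi> p q) <= S * (\<Sum>p\<in>F. d p))"

lemma schur_boundD:
 assumes "schur_bound X \<psi> S" "finite F" "F \<subseteq> X" "\<And>p q. [|p \<in> F; q \<in> F|] ==> Z q p = cnj (Z p q)"
  "\<And>p. p \<in> F ==> 0 <= d p" "\<And>u. form_le Z F d u"
 shows "Re (\<Sum>p\<in>F. \<Sum>q\<in>F. Z p q * \<psi> p q) <= S * (\<Sum>p\<in>F. d p)"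
 using assms(1)[unfolded schur_bound_def, rule_format, OF assms(2,3), of Z d] assms(4,5,6) by blast

lemma compact_box:
 fixes B :: "'i => 'a::topological_space set"
 assumes "\<And>i. compact (B i)"
 shows "compact (Pi\<^sub>E UNIV B)"
proof -
 have "compactin (product_topology (%i. euclidean) UNIV) (Pi\<^sub>E UNIV B)"
  using assms by (subst compactin_PiE) (simp add: compactin_euclidean_iff)
 thus ?thesis by (simp add: euclidean_product_topology compactin_euclidean_iff)
qed

definition pairing :: "('x => 'x => complex) => 'x set => ('x => 'x => complex) => real"
 where "pairing Z F k = Re (\<Sum>p\<in>F. \<Sum>q\<in>F. Z p q * k p q)"

lemma pairing_rank_one: "pairing Z F (%p q. u p * cnj (u q)) = Re (sesq Z F u u)"
 by (simp add: pairing_def sesq_def mult.commute)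

lemma pairing_add: "pairing Z F (%p q. k p q + l p q) = pairing Z F k + pairing Z F l"
 by (simp add: pairing_def sum.distrib distrib_left)

lemma pairing_diff: "pairing Z F (%p q. k p q - l p q) = pairing Z F k - pairing Z F l"
 by (simp add: pairing_def sum_subtractf right_diff_distrib)

lemma pairing_scale: "pairing Z F (%p q. of_real c * k p q) = c * pairing Z F k"
proof -
 have "(\<Sum>p\<in>F. \<Sum>q\<in>F. Z p q * (of_real c * k p q)) = of_real c * (\<Sum>p\<in>F. \<Sum>q\<in>F. Z p q * k p q)"
  unfolding sum_distrib_left by (intro sum.cong refl) simp
 thus ?thesis by (simp add: pairing_def)
qed

lemma pairing_sum: "pairing Z F (%p q. \<Sum>i\<in>A. k i p q) = (\<Sum>i\<in>A. pairing Z F (k i))"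
proof (induction A rule: infinite_finite_induct)
 case (insert x A)
 thus ?case by (simp add: pairing_add)
qed (simp_all add: pairing_def)

lemma pairing_cong:
 "(\<And>p q. [|p \<in> F; q \<in> F|] ==> k p q = l p q) ==> pairing Z F k = pairing Z F l"
 unfolding pairing_def by (intro arg_cong[of _ _ Re] sum.cong refl) simp

text \<open>The dual of a linear optimization problem: if \<open>Z\<close> pairs with every difference of positive kernels with diagonal sum at most one to at most \<open>t\<close>, then \<open>\<plusminus>Z\<close> lies below a diagonal matrix of trace at most \<open>t\<close>. Compactness of the simplex of diagonals makes the minimax principle applicable.\<close>

lemma diagonal_majorant:
 assumes F: "finite F" and t: "0 <= t"
  and dual: "\<And>k l. [|psd F k; psd F l; \<And>p. p \<in> F ==> Re (k p p) + Re (l p p) <= 1|]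
    ==> pairing Z F (%p q. k p q - l p q) <= t"
 shows "\<exists>d. (\<forall>p\<in>F. 0 <= d p) & (\<Sum>p\<in>F. d p) <= t &
   (\<forall>u. form_le Z F d u)"
proof (cases "F = {}")
 case True
 thus ?thesis using t by (simp add: sesq_def)
next
 case ne: False
 define sg :: "bool => real" where "sg s = (if s then 1 else -1)" for s
 define C where "C = Pi\<^sub>E UNIV (%p. if p \<in> F then {0..t} else {0}) \<inter> {d. (\<Sum>p\<in>F. d p) <= t}"
 define f where "f i d = (\<Sum>p\<in>F. d p * cm2 (snd i p)) - sg (fst i) * Re (sesq Z F (snd i) (snd i))"
  for i :: "bool \<times> ('a => complex)" and d :: "'a => real"
 have C_D: "d p \<in> (if p \<in> F then {0..t} else {0})" "(\<Sum>p\<in>F. d p) <= t" if "d \<in> C" for d p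
  using that unfolding C_def PiE_iff by blast+
 have coord: "continuous_on A (%d::'a => real. d p)" for A p
  by (rule continuous_on_subset[OF continuous_on_product_coordinates]) simp
 have "compact C"
  unfolding C_def
  by (intro compact_Int_closed compact_box closed_Collect_le continuous_intros coord) auto
 hence "\<exists>d\<in>C. \<forall>i\<in>UNIV. 0 <= f i d"
 proof (rule compact_affine_alternative)
  show "continuous_on C (f i)" for i
   unfolding f_def by (intro continuous_intros coord)
 next
  fix x y and r :: real
  assume xy: "x \<in> C" "y \<in> C" and r: "0 <= r" "r <= 1"
  define z where "z = (%p. (1 - r) * x p + r * y p)"
  have "z \<in> C"
  proof -
   have xF: "0 <= x p" "0 <= y p" "x p <= t" "y p <= t" if "p \<in> F" for p
    using C_D(1)[OF xy(1), of p] C_D(1)[OF xy(2), of p] that by auto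
   have x0: "x p = 0" "y p = 0" if "p \<notin> F" for p
    using C_D(1)[OF xy(1), of p] C_D(1)[OF xy(2), of p] that by auto
   have "0 <= z p" if "p \<in> F" for p
    using xF[OF that] r unfolding z_def by (intro add_nonneg_nonneg mult_nonneg_nonneg) auto
   moreover have "z p = 0" if "p \<notin> F" for p using x0[OF that] by (simp add: z_def)
   moreover have "z p <= t" if "p \<in> F" for p
    using xF[OF that] r unfolding z_def by (intro convex_bound_le) auto
   moreover have "(\<Sum>p\<in>F. z p) = (1 - r) * (\<Sum>p\<in>F. x p) + r * (\<Sum>p\<in>F. y p)"
    unfolding z_def by (simp only: sum.distrib sum_distrib_left)
   moreover have "(1 - r) * (\<Sum>p\<in>F. x p) + r * (\<Sum>p\<in>F. y p) <= t"
    using C_D(2)[OF xy(1)] C_D(2)[OF xy(2)] r by (intro convex_bound_le) auto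
   ultimately show ?thesis unfolding C_def by (auto simp: PiE_iff)
  qed
  moreover have "f i z = (1 - r) * f i x + r * f i y" for i
  proof -
   have "(\<Sum>p\<in>F. z p * cm2 (snd i p))
     = (1 - r) * (\<Sum>p\<in>F. x p * cm2 (snd i p)) + r * (\<Sum>p\<in>F. y p * cm2 (snd i p))"
    unfolding z_def by (simp only: sum.distrib[symmetric] sum_distrib_left) (simp add: algebra_simps)
   thus ?thesis by (simp add: f_def algebra_simps)
  qed
  ultimately show "\<exists>z\<in>C. \<forall>i\<in>UNIV. (1 - r) * f i x + r * f i y <= f i z"
   by (intro bexI[of _ z]) auto
 next
  fix J :: "(bool \<times> ('a => complex)) set" and l
  assume J: "finite J" and l: "\<And>i. i \<in> J ==> 0 <= (l i :: real)"
  define m where "m p = (\<Sum>i\<in>J. l i * cm2 (snd i p))" for p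
  have m0: "0 <= m p" for p unfolding m_def using l by (intro sum_nonneg) auto
  have "Max (m ` F) \<in> m ` F" using F ne by (intro Max_in) auto
  then obtain r where r: "r \<in> F" "m r = Max (m ` F)" by auto
  have mr: "m p <= m r" if "p \<in> F" for p using r F that by simp
  define d where "d = (%p. if p = r then t else 0)"
  define Y where "Y = (\<Sum>i\<in>J. l i * sg (fst i) * Re (sesq Z F (snd i) (snd i)))"
  have scaled: "R * Y <= t" if R: "0 <= R" "R * m r <= 1" for R
  proof -
   define k where "k s = (%p q. \<Sum>i\<in>J. of_real (R * l i * (if fst i = s then 1 else 0)) * (snd i p * cnj (snd i q)))" for s
   have pk: "psd F (k s)" for s
    unfolding k_def using R l by (intro psd_sum psd_scale psd_rank_one) auto
   have "Re (k s p p) = (\<Sum>i\<in>J. R * l i * (if fst i = s then 1 else 0) * cm2 (snd i p))" for s p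
    unfolding k_def by (simp add: complex_norm_square[symmetric] Re_sum del: of_real_mult of_real_power)
   hence "Re (k True p p) + Re (k False p p) = (\<Sum>i\<in>J. R * (l i * cm2 (snd i p)))" for p
    by (simp only: sum.distrib[symmetric]) (intro sum.cong refl, auto)
   hence "Re (k True p p) + Re (k False p p) = R * m p" for p
    by (simp add: m_def sum_distrib_left)
   hence "pairing Z F (%p q. k True p q - k False p q) <= t"
    using mr R by (intro dual pk) (auto intro: order_trans[OF mult_left_mono])
   moreover have tk: "pairing Z F (k s) = (\<Sum>i\<in>J. R * l i * (if fst i = s then 1 else 0) * Re (sesq Z F (snd i) (snd i)))" for s
    unfolding k_def by (simp only: pairing_sum pairing_scale pairing_rank_one)
   have "pairing Z F (%p q. k True p q - k False p q) = R * Y"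
    unfolding pairing_diff tk Y_def sum_distrib_left sum_subtractf[symmetric]
    by (intro sum.cong refl) (auto simp: sg_def)
   ultimately show ?thesis by simp
  qed
  have "Y <= t * m r"
  proof (cases "m r = 0")
   case True
   have "Y <= 0"
   proof (rule ccontr)
    assume "\<not> Y <= 0"
    thus False using scaled[of "(t + 1) / Y"] True t by simp
   qed
   thus ?thesis using True by simp
  next
   case False
   hence "m r > 0" using m0[of r] by simp
   thus ?thesis using scaled[of "1 / m r"] by (simp add: field_simps)
  qed
  moreover have "(\<Sum>i\<in>J. l i * f i d) = t * m r - Y"
  proof -
   have "(\<Sum>p\<in>F. d p * cm2 (u p)) = t * cm2 (u r)" for u :: "'a => complex"
   proof -
    have "(\<Sum>p\<in>F. d p * cm2 (u p)) = (\<Sum>p\<in>F. if p = r then t * cm2 (u r) else 0)"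
     by (intro sum.cong refl) (auto simp: d_def)
    thus ?thesis using F r by simp
   qed
   hence "l i * f i d = t * (l i * cm2 (snd i r)) - l i * sg (fst i) * Re (sesq Z F (snd i) (snd i))" for i
    by (simp add: f_def algebra_simps)
   thus ?thesis by (simp add: sum_subtractf m_def Y_def sum_distrib_left)
  qed
  moreover have "d \<in> C"
   using F r t by (auto simp: C_def d_def PiE_iff)
  ultimately show "\<exists>x\<in>C. 0 <= (\<Sum>i\<in>J. l i * f i x)" by (intro bexI[of _ d]) auto
 qed
 then obtain d where d: "d \<in> C" "\<And>i. 0 <= f i d" by auto
 have "form_le Z F d u" for u
  using d(2)[of "(True, u)"] d(2)[of "(False, u)"] by (auto simp: f_def sg_def abs_le_iff)
 moreover have "(\<forall>p\<in>F. 0 <= d p) & (\<Sum>p\<in>F. d p) <= t"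
 proof
  show "\<forall>p\<in>F. 0 <= d p"
  proof
   fix p assume "p \<in> F" thus "0 <= d p" using C_D(1)[OF d(1), of p] by simp
  qed
 qed (use C_D(2)[OF d(1)] in simp)
 ultimately show ?thesis by blast
qed

lemma psd_extend_zero:
 assumes "psd F k" "F \<subseteq> X"
 shows "psd X (%p q. if p \<in> F & q \<in> F then k p q else 0)"
proof -
 have "psd X (%p q. \<Sum>i\<in>(if p \<in> F then {p} else {}). \<Sum>j\<in>(if q \<in> F then {q} else {}). 1 * cnj 1 * k i j)"
  by (rule psd_linear_image[OF assms(1)]) auto
 also have "(%p q. \<Sum>i\<in>(if p \<in> F then {p} else {}). \<Sum>j\<in>(if q \<in> F then {q} else {}). 1 * cnj 1 * k i j)
   = (%p q. if p \<in> F & q \<in> F then k p q else 0)" by (auto simp: fun_eq_iff)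
 finally show ?thesis .
qed

lemma closed_psd:
 "closed {k :: bool \<times> 'x \<times> 'x => complex. psd X (%p q. k (s, p, q))}"
proof -
 have coord: "continuous_on A (%k :: bool \<times> 'x \<times> 'x => complex. k i)" for A i
  by (rule continuous_on_subset[OF continuous_on_product_coordinates]) simp
 have "{k :: bool \<times> 'x \<times> 'x => complex. psd X (%p q. k (s, p, q))} =
   (\<Inter>(F, w)\<in>{(F, w). finite F & F \<subseteq> X}. (%k. sesq (%p q. k (s, p, q)) F w w) -` \<real>\<^sub>\<ge>\<^sub>0)"
  by (auto simp: psd_def)
 also have "closed ..."
 proof (intro closed_INT ballI)
  fix i :: "'x set \<times> ('x => complex)"
  obtain F w where i: "i = (F, w)" by fastforce
  have "closed ((%k. sesq (%p q. k (s, p, q)) F w w) -` \<real>\<^sub>\<ge>\<^sub>0)"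
   unfolding sesq_def by (intro closed_vimage closed_nonneg_Reals_complex continuous_intros coord)
  thus "closed (case i of (F, w) => (%k. sesq (%p q. k (s, p, q)) F w w) -` \<real>\<^sub>\<ge>\<^sub>0)"
   by (simp add: i)
 qed
 finally show ?thesis .
qed

text \<open>Pairs \<open>(k, l)\<close> with bounded diagonal form a compact convex set. For a single test matrix \<open>Z\<close> the best pair beats \<open>\<psi>\<close>, since the diagonal majorant of \<open>Z\<close> is a legitimate test for the Schur bound; minimax gives one pair for all \<open>Z\<close>, and \<open>Z\<close>, \<open>-Z\<close> together give equality.\<close>

theorem schur_bound_decomposition:
 assumes bd: "schur_bound X \<psi> S" and S: "0 <= S"
  and herm: "\<And>p q. [|p \<in> X; q \<in> X|] ==> \<psi> q p = cnj (\<psi> p q)"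
 shows "\<exists>k l. psd X k & psd X l & (\<forall>p\<in>X. Re (k p p) + Re (l p p) <= S) &
   (\<forall>p\<in>X. \<forall>q\<in>X. k p q - l p q = \<psi> p q)"
proof -
 define box where "box = (%(s::bool, p, q). if p \<in> X & q \<in> X then cball (0::complex) S else {0})"
 define C where "C = Pi\<^sub>E UNIV box \<inter> ({k. psd X (%p q. k (True, p, q))} \<inter>
   {k. psd X (%p q. k (False, p, q))}) \<inter> (\<Inter>p\<in>X. {k. Re (k (True, p, p)) + Re (k (False, p, p)) <= S})"
 have C_iff: "k \<in> C \<longleftrightarrow> psd X (%p q. k (True, p, q)) & psd X (%p q. k (False, p, q)) &
   (\<forall>p\<in>X. Re (k (True, p, p)) + Re (k (False, p, p)) <= S) & (\<forall>s p q. p \<notin> X \<or> q \<notin> X --> k (s, p, q) = 0)" for k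
 proof
  assume "k \<in> C"
  thus "psd X (%p q. k (True, p, q)) & psd X (%p q. k (False, p, q)) &
   (\<forall>p\<in>X. Re (k (True, p, p)) + Re (k (False, p, p)) <= S) & (\<forall>s p q. p \<notin> X \<or> q \<notin> X --> k (s, p, q) = 0)"
  proof -
   have "k (s, p, q) = 0" if "p \<notin> X \<or> q \<notin> X" for s p q
   proof -
    have "k (s, p, q) \<in> box (s, p, q)" using \<open>k \<in> C\<close> unfolding C_def PiE_iff by blast
    thus ?thesis using that by (auto simp: box_def)
   qed
   thus ?thesis using \<open>k \<in> C\<close> unfolding C_def by blast
  qed
 next
  assume R: "psd X (%p q. k (True, p, q)) & psd X (%p q. k (False, p, q)) &
   (\<forall>p\<in>X. Re (k (True, p, p)) + Re (k (False, p, p)) <= S) & (\<forall>s p q. p \<notin> X \<or> q \<notin> X --> k (s, p, q) = 0)"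
  have ps: "psd X (%p q. k (s, p, q))" for s using R by (cases s) auto
  have diag: "Re (k (s, p, p)) <= S" if "p \<in> X" for s p
  proof -
   have "Re (k (True, p, p)) + Re (k (False, p, p)) <= S" using R that by blast
   thus ?thesis using psd_diag(1)[OF ps that, of True] psd_diag(1)[OF ps that, of False]
    by (cases s) auto
  qed
  have "cmod (k (s, p, q)) <= S" if "p \<in> X" "q \<in> X" for s p q
   using psd_norm_le[OF ps that, of s S] diag that by blast
  hence "k (s, p, q) \<in> box (s, p, q)" for s p q using R by (simp add: box_def)
  hence "k \<in> Pi\<^sub>E UNIV box" unfolding PiE_iff by (metis UNIV_I extensional_UNIV prod_cases3)
  thus "k \<in> C" unfolding C_def using R by blast
 qed
 have coord: "continuous_on A (%k :: bool \<times> 'a \<times> 'a => complex. k i)" for A i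
  by (rule continuous_on_subset[OF continuous_on_product_coordinates]) simp
 have "compact C"
  unfolding C_def
 proof (intro compact_Int_closed compact_box closed_Int closed_psd closed_INT ballI)
  show "compact (box i)" for i by (cases i) (simp add: box_def)
  show "closed {k. Re (k (True, p, p)) + Re (k (False, p, p)) <= S}" for p :: 'a
   by (intro closed_Collect_le continuous_intros coord)
 qed
 define df where "df k = (%p q. k (True, p, q) - k (False, p, q))" for k :: "bool \<times> 'a \<times> 'a => complex"
 define I where "I = {(F, Z). finite F & F \<subseteq> X & (\<forall>p\<in>F. \<forall>q\<in>F. Z q p = cnj (Z p q))}"
 define f where "f i k = pairing (snd i) (fst i) (df k) - pairing (snd i) (fst i) \<psi>"
  for i :: "'a set \<times> ('a => 'a => complex)" and k
 have contT: "continuous_on C (%k. pairing Z F (df k))" for Z F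
  unfolding pairing_def df_def by (intro continuous_intros coord)
 have zero: "(%_. 0) \<in> C" unfolding C_iff using S by (simp add: psd_zero)
 have single: "\<exists>k\<in>C. 0 <= f (F, Z) k" if FZ: "(F, Z) \<in> I" for F Z
 proof -
  have F: "finite F" "F \<subseteq> X" and Z: "\<And>p q. [|p \<in> F; q \<in> F|] ==> Z q p = cnj (Z p q)"
   using FZ unfolding I_def by blast+
  obtain k0 where k0: "k0 \<in> C" "\<And>k. k \<in> C ==> pairing Z F (df k) <= pairing Z F (df k0)"
   using continuous_attains_sup[OF \<open>compact C\<close> _ contT[of Z F]] zero by blast
  define t where "t = pairing Z F (df k0)"
  have "0 <= t" using k0(2)[OF zero] by (simp add: t_def df_def pairing_def)
  have inC: "S * pairing Z F (%p q. k p q - l p q) <= t"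
   if kl: "psd F k" "psd F l" "\<And>p. p \<in> F ==> Re (k p p) + Re (l p p) <= 1" for k l
  proof -
   define h where "h = (%(s, p, q). if p \<in> F & q \<in> F then of_real S * (if s then k p q else l p q) else 0)"
   have "h \<in> C"
    unfolding C_iff
   proof (intro conjI ballI)
    show "psd X (%p q. h (True, p, q))" "psd X (%p q. h (False, p, q))"
     using psd_extend_zero[OF psd_scale[OF kl(1) S] F(2)]
      psd_extend_zero[OF psd_scale[OF kl(2) S] F(2)] by (simp_all add: h_def cong: if_cong)
    show "\<forall>s p q. p \<notin> X \<or> q \<notin> X --> h (s, p, q) = 0" using F by (auto simp: h_def)
    fix p assume "p \<in> X"
    show "Re (h (True, p, p)) + Re (h (False, p, p)) <= S"
    proof (cases "p \<in> F")
     case True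
     hence "S * (Re (k p p) + Re (l p p)) <= S * 1" using kl(3) S by (intro mult_left_mono) auto
     thus ?thesis using True by (simp add: h_def distrib_left)
    qed (use S in \<open>simp add: h_def\<close>)
   qed
   hence "pairing Z F (df h) <= t" using k0(2) t_def by blast
   also have "pairing Z F (df h) = pairing Z F (%p q. of_real S * (k p q - l p q))"
    by (rule pairing_cong) (simp add: df_def h_def right_diff_distrib)
   finally show ?thesis by (simp only: pairing_scale)
  qed
  have "pairing Z F \<psi> <= t"
  proof (cases "S = 0")
   case True
   define B where "B = (\<Sum>p\<in>F. \<Sum>q\<in>F. cmod (Z p q) * 2)"
   have "\<exists>d. (\<forall>p\<in>F. 0 <= d p) & (\<Sum>p\<in>F. d p) <= B &
     (\<forall>u. form_le Z F d u)"
   proof (rule diagonal_majorant[OF F(1)])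
    show "0 <= B" unfolding B_def by (intro sum_nonneg) auto
    fix k l :: "'a => 'a => complex" assume kl: "psd F k" "psd F l" "\<And>p. p \<in> F ==> Re (k p p) + Re (l p p) <= 1"
    have "pairing Z F (%p q. k p q - l p q) <= cmod (\<Sum>p\<in>F. \<Sum>q\<in>F. Z p q * (k p q - l p q))"
     unfolding pairing_def by (rule complex_Re_le_cmod)
    also have "... <= (\<Sum>p\<in>F. \<Sum>q\<in>F. cmod (Z p q * (k p q - l p q)))"
     by (intro order_trans[OF norm_sum] sum_mono norm_sum)
    also have "... <= B" unfolding B_def
    proof (intro sum_mono)
     fix p q assume pq: "p \<in> F" "q \<in> F"
     have "Re (k r r) <= 1" "Re (l r r) <= 1" if "r \<in> F" for r
      using kl(3)[OF that] psd_diag(1)[OF kl(1) that] psd_diag(1)[OF kl(2) that] by linarith+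
     hence "cmod (k p q) <= 1" "cmod (l p q) <= 1"
      using psd_norm_le[OF kl(1) pq] psd_norm_le[OF kl(2) pq] pq by blast+
     hence "cmod (k p q - l p q) <= 2" using norm_triangle_ineq4[of "k p q" "l p q"] by linarith
     thus "cmod (Z p q * (k p q - l p q)) <= cmod (Z p q) * 2"
      by (simp add: norm_mult mult_left_mono)
    qed
    finally show "pairing Z F (%p q. k p q - l p q) <= B" .
   qed
   then obtain d where "\<forall>p\<in>F. 0 <= d p" "\<And>u. form_le Z F d u" by blast
   hence "pairing Z F \<psi> <= S * sum d F"
    unfolding pairing_def by (intro schur_boundD[OF bd F Z]) auto
   thus ?thesis using True \<open>0 <= t\<close> by simp
  next
   case False
   hence S0: "0 < S" using S by simp
   have "\<exists>d. (\<forall>p\<in>F. 0 <= d p) & (\<Sum>p\<in>F. d p) <= t / S &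
     (\<forall>u. form_le Z F d u)"
    using inC S0 \<open>0 <= t\<close> by (intro diagonal_majorant[OF F(1)]) (auto simp: field_simps)
   then obtain d where d: "\<forall>p\<in>F. 0 <= d p" "sum d F <= t / S" "\<And>u. form_le Z F d u" by blast
   hence "pairing Z F \<psi> <= S * sum d F"
    unfolding pairing_def by (intro schur_boundD[OF bd F Z]) auto
   also have "... <= t" using d(2) S0 by (simp add: field_simps)
   finally show ?thesis .
  qed
  thus ?thesis using k0(1) unfolding f_def t_def by (intro bexI[of _ k0]) auto
 qed
 have "\<exists>k\<in>C. \<forall>i\<in>I. 0 <= f i k"
 proof (rule compact_affine_alternative[OF \<open>compact C\<close>])
  show "continuous_on C (f i)" for i unfolding f_def by (intro continuous_intros contT)
 next
  fix x y and r :: real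
  assume xy: "x \<in> C" "y \<in> C" and r: "0 <= r" "r <= 1"
  define z where "z = (%i. of_real (1 - r) * x i + of_real r * y i)"
  have "z \<in> C" unfolding C_iff
  proof (intro conjI ballI)
   show "psd X (%p q. z (True, p, q))" "psd X (%p q. z (False, p, q))"
    using xy r unfolding z_def C_iff by (intro psd_add psd_scale; simp)+
   show "\<forall>s p q. p \<notin> X \<or> q \<notin> X --> z (s, p, q) = 0"
    using xy by (simp add: z_def C_iff)
   fix p assume p: "p \<in> X"
   have "(1 - r) * (Re (x (True, p, p)) + Re (x (False, p, p))) + r * (Re (y (True, p, p)) + Re (y (False, p, p))) <= S"
    using xy r p unfolding C_iff by (intro convex_bound_le) auto
   thus "Re (z (True, p, p)) + Re (z (False, p, p)) <= S" by (simp add: z_def algebra_simps)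
  qed
  moreover have "f i z = (1 - r) * f i x + r * f i y" for i
  proof -
   have "df z = (%p q. of_real (1 - r) * df x p q + of_real r * df y p q)"
    by (simp add: df_def z_def fun_eq_iff algebra_simps)
   hence "pairing (snd i) (fst i) (df z) = (1 - r) * pairing (snd i) (fst i) (df x) + r * pairing (snd i) (fst i) (df y)"
    by (simp only: pairing_add pairing_scale)
   thus ?thesis by (simp add: f_def algebra_simps)
  qed
  ultimately show "\<exists>z\<in>C. \<forall>i\<in>I. (1 - r) * f i x + r * f i y <= f i z"
   by (intro bexI[of _ z]) auto
 next
  fix J and l :: "_ => real"
  assume J: "finite J" "J \<subseteq> I" and l: "\<And>i. i \<in> J ==> 0 <= l i"
  define U where "U = (\<Union>i\<in>J. fst i)"
  define W where "W p q = (\<Sum>i\<in>J. of_real (l i) * (if p \<in> fst i & q \<in> fst i then snd i p q else 0))" for p q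
  have JI: "finite (fst i)" "fst i \<subseteq> X" "\<And>p q. [|p \<in> fst i; q \<in> fst i|] ==> snd i q p = cnj (snd i p q)"
   if "i \<in> J" for i
  proof -
   obtain F Z where "i = (F, Z)" by fastforce
   thus "finite (fst i)" "fst i \<subseteq> X" "\<And>p q. [|p \<in> fst i; q \<in> fst i|] ==> snd i q p = cnj (snd i p q)"
    using that J unfolding I_def by fastforce+
  qed
  have U: "finite U" "U \<subseteq> X" unfolding U_def using J JI by (blast intro: finite_UN_I)+
  have "W q p = cnj (W p q)" for p q
   unfolding W_def cnj_sum
  proof (intro sum.cong refl)
   fix i assume "i \<in> J"
   hence "snd i q p = cnj (snd i p q)" if "p \<in> fst i" "q \<in> fst i"
    using JI(3) that by blast
   thus "of_real (l i) * (if q \<in> fst i & p \<in> fst i then snd i q p else 0) =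
     cnj (of_real (l i) * (if p \<in> fst i & q \<in> fst i then snd i p q else 0))" by simp
  qed
  hence "(U, W) \<in> I" using U unfolding I_def by blast
  then obtain k where k: "k \<in> C" "0 <= f (U, W) k" using single by blast
  have tr: "pairing W U g = (\<Sum>i\<in>J. l i * pairing (snd i) (fst i) g)" for g
  proof -
   have sub: "fst i \<subseteq> U" if "i \<in> J" for i using that by (auto simp: U_def)
   have "(\<Sum>p\<in>U. \<Sum>q\<in>U. W p q * g p q) = (\<Sum>p\<in>U. \<Sum>q\<in>U. \<Sum>i\<in>J. of_real (l i) * (if p \<in> fst i & q \<in> fst i then snd i p q * g p q else 0))"
    unfolding W_def sum_distrib_right by (intro sum.cong refl) auto
   also have "... = (\<Sum>p\<in>U. \<Sum>i\<in>J. \<Sum>q\<in>U. of_real (l i) * (if p \<in> fst i & q \<in> fst i then snd i p q * g p q else 0))"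
    by (intro sum.cong refl sum.swap)
   also have "... = (\<Sum>i\<in>J. \<Sum>p\<in>U. \<Sum>q\<in>U. of_real (l i) * (if p \<in> fst i & q \<in> fst i then snd i p q * g p q else 0))"
    by (rule sum.swap)
   also have "... = (\<Sum>i\<in>J. of_real (l i) * (\<Sum>p\<in>fst i. \<Sum>q\<in>fst i. snd i p q * g p q))"
   proof (intro sum.cong refl)
    fix i assume i: "i \<in> J"
    have "(\<Sum>p\<in>U. \<Sum>q\<in>U. of_real (l i) * (if p \<in> fst i & q \<in> fst i then snd i p q * g p q else 0))
      = of_real (l i) * (\<Sum>p\<in>U. if p \<in> fst i then (\<Sum>q\<in>U. if q \<in> fst i then snd i p q * g p q else 0) else 0)"
     unfolding sum_distrib_left by (intro sum.cong refl) (auto simp: sum_distrib_left intro!: sum.cong)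
    also have "... = of_real (l i) * (\<Sum>p\<in>U \<inter> fst i. \<Sum>q\<in>U \<inter> fst i. snd i p q * g p q)"
     using U by (simp add: sum.If_cases)
    also have "U \<inter> fst i = fst i" using sub[OF i] by blast
    finally show "(\<Sum>p\<in>U. \<Sum>q\<in>U. of_real (l i) * (if p \<in> fst i & q \<in> fst i then snd i p q * g p q else 0))
      = of_real (l i) * (\<Sum>p\<in>fst i. \<Sum>q\<in>fst i. snd i p q * g p q)" .
   qed
   finally show ?thesis unfolding pairing_def by (simp add: Re_sum)
  qed
  have "(\<Sum>i\<in>J. l i * f i k) = f (U, W) k"
   by (simp add: f_def tr right_diff_distrib sum_subtractf)
  thus "\<exists>x\<in>C. 0 <= (\<Sum>i\<in>J. l i * f i x)" using k by (intro bexI[of _ k]) auto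
 qed
 then obtain k where k: "k \<in> C" "\<And>i. i \<in> I ==> 0 <= f i k" by blast
 define D where "D p q = df k p q - \<psi> p q" for p q
 have ps: "psd X (%p q. k (s, p, q))" for s using k(1) unfolding C_iff by (cases s) auto
 have D_herm: "D q p = cnj (D p q)" if "p \<in> X" "q \<in> X" for p q
  using psd_sym[OF ps that] herm[OF that] by (simp add: D_def df_def)
 have D0: "D p q = 0" if pq: "p \<in> X" "q \<in> X" for p q
 proof -
  define Z where "Z = (%a b. - cnj (D a b))"
  have ZI: "({p, q}, Z) \<in> I"
  proof -
   have "Z b a = cnj (Z a b)" if "a \<in> {p, q}" "b \<in> {p, q}" for a b
    unfolding Z_def using that pq by (metis D_herm complex_cnj_minus insertE singletonD)
   thus ?thesis using pq unfolding I_def by blast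
  qed
  have "f ({p, q}, Z) k = pairing Z {p, q} D"
   unfolding f_def D_def by (simp add: pairing_diff)
  also have "... = - (\<Sum>a\<in>{p, q}. \<Sum>b\<in>{p, q}. cm2 (D a b))"
  proof -
   have "Z a b * D a b = - of_real (cm2 (D a b))" for a b
    by (simp only: Z_def complex_norm_square mult_minus_left mult_minus_right mult.commute)
   thus ?thesis unfolding pairing_def by (simp only: sum_negf Re_sum uminus_complex.simps Re_complex_of_real)
  qed
  finally have "(\<Sum>a\<in>{p, q}. \<Sum>b\<in>{p, q}. cm2 (D a b)) <= 0" using k(2)[OF ZI] by simp
  moreover have "cm2 (D p q) <= (\<Sum>b\<in>{p, q}. cm2 (D p b))"
   by (rule member_le_sum) auto
  moreover have "(\<Sum>b\<in>{p, q}. cm2 (D p b)) <= (\<Sum>a\<in>{p, q}. \<Sum>b\<in>{p, q}. cm2 (D a b))"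
   by (rule member_le_sum[of p]) (auto intro: sum_nonneg)
  ultimately have "cm2 (D p q) <= 0" by linarith
  thus ?thesis by simp
 qed
 show ?thesis
 proof (intro exI conjI)
  show "psd X (%p q. k (True, p, q))" "psd X (%p q. k (False, p, q))" by (fact ps)+
  show "\<forall>p\<in>X. Re (k (True, p, p)) + Re (k (False, p, p)) <= S" using k(1) unfolding C_iff by blast
  show "\<forall>p\<in>X. \<forall>q\<in>X. k (True, p, q) - k (False, p, q) = \<psi> p q"
   using D0 by (simp add: D_def df_def)
 qed
qed

section \<open>Smoothing kernels on a metric space\<close>

lemma norm_double_sum_le:
 fixes f :: "'i => 'j => complex"
 shows "cmod (\<Sum>i\<in>A. \<Sum>j\<in>B. f i j) <= (\<Sum>i\<in>A. \<Sum>j\<in>B. cmod (f i j))"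
proof -
 have "cmod (\<Sum>i\<in>A. \<Sum>j\<in>B. f i j) <= (\<Sum>i\<in>A. cmod (\<Sum>j\<in>B. f i j))" by (rule norm_sum)
 also have "... <= (\<Sum>i\<in>A. \<Sum>j\<in>B. cmod (f i j))" by (intro sum_mono norm_sum)
 finally show ?thesis .
qed

context Metric_space
begin

text \<open>Convergence of sequences in the metric \<open>d\<close>. All continuity arguments are sequential, which is enough in a metric space and keeps the dominated convergence arguments elementary.\<close>

definition conv :: "(nat => 'a) => 'a => bool"
 where "conv \<sigma> x \<longleftrightarrow> range \<sigma> \<subseteq> M & x \<in> M & (%i. d (\<sigma> i) x) \<leadsto> 0"

lemma convD: "conv \<sigma> x ==> \<sigma> i \<in> M" "conv \<sigma> x ==> x \<in> M" "conv \<sigma> x ==> (%i. d (\<sigma> i) x) \<leadsto> 0"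
 by (auto simp: conv_def)

lemma conv_const: "x \<in> M ==> conv (%_. x) x"
 by (auto simp: conv_def)

lemma conv_eventually: "conv \<sigma> x ==> 0 < e ==> \<forall>\<^sub>F i in sequentially. d (\<sigma> i) x < e"
 using order_tendstoD(2)[OF convD(3)] by blast

lemma conv_continuous_map:
 assumes "continuous_map mtopology mtopology f" "conv \<sigma> x"
 shows "conv (%i. f (\<sigma> i)) (f x)"
proof -
 have f: "f \<in> M \<rightarrow> M" "\<And>a e. [|a \<in> M; 0 < e|] ==> \<exists>\<delta>>0. \<forall>x. x \<in> M & d a x < \<delta> --> d (f a) (f x) < e"
  using assms(1) metric_continuous_map[OF Metric_space_axioms] by auto
 have "(%i. d (f (\<sigma> i)) (f x)) \<leadsto> 0"
 proof (rule tendstoI)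
  fix e :: real assume "0 < e"
  then obtain \<delta> where \<delta>: "\<delta> > 0" "\<And>y. y \<in> M & d x y < \<delta> ==> d (f x) (f y) < e"
   using f(2) convD(2)[OF assms(2)] by blast
  show "\<forall>\<^sub>F i in sequentially. dist (d (f (\<sigma> i)) (f x)) 0 < e"
   using conv_eventually[OF assms(2) \<delta>(1)]
  proof (rule eventually_mono)
   fix i assume "d (\<sigma> i) x < \<delta>"
   hence "d (f x) (f (\<sigma> i)) < e" using \<delta>(2)[of "\<sigma> i"] convD(1)[OF assms(2)] by (simp add: commute)
   thus "dist (d (f (\<sigma> i)) (f x)) 0 < e" by (simp add: commute)
  qed
 qed
 thus ?thesis using f(1) convD[OF assms(2)] by (auto simp: conv_def)
qed

lemma conv_tendsto:
 fixes f :: "'a => 'b::metric_space"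
 assumes "continuous_map mtopology euclidean f" "conv \<sigma> x"
 shows "(%i. f (\<sigma> i)) \<leadsto> f x"
proof (rule topological_tendstoI)
 fix U assume U: "open U" "f x \<in> U"
 hence "openin mtopology {y \<in> M. f y \<in> U}"
  using openin_continuous_map_preimage[OF assms(1), of U] by simp
 then obtain r where r: "r > 0" "mball x r \<subseteq> {y \<in> M. f y \<in> U}"
  using U convD(2)[OF assms(2)] by (auto simp: openin_mtopology)
 show "\<forall>\<^sub>F i in sequentially. f (\<sigma> i) \<in> U"
  using conv_eventually[OF assms(2) r(1)]
 proof (rule eventually_mono)
  fix i assume "d (\<sigma> i) x < r"
  hence "\<sigma> i \<in> mball x r" using convD[OF assms(2)] commute by simp
  thus "f (\<sigma> i) \<in> U" using r(2) by blast
 qed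
qed

lemma continuous_map_if_conv:
 fixes f :: "'a => 'b::metric_space"
 assumes "\<And>\<sigma> x. conv \<sigma> x ==> (%i. f (\<sigma> i)) \<leadsto> f x"
 shows "continuous_map mtopology euclidean f"
 unfolding continuous_map_def
proof (intro conjI allI impI)
 fix U :: "'b set" assume "openin euclidean U"
 hence U: "open U" by simp
 show "openin mtopology {x \<in> topspace mtopology. f x \<in> U}"
  unfolding openin_mtopology topspace_mtopology
 proof (intro conjI allI impI)
  fix x assume "x \<in> {x \<in> M. f x \<in> U}"
  hence x: "x \<in> M" "f x \<in> U" by auto
  show "\<exists>r>0. mball x r \<subseteq> {x \<in> M. f x \<in> U}"
  proof (rule ccontr)
   assume "\<not> (\<exists>r>0. mball x r \<subseteq> {x \<in> M. f x \<in> U})"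
   hence "\<exists>y. y \<in> mball x (1 / real (Suc i)) & f y \<notin> U" for i
    by (metis (mono_tags, lifting) in_mball mem_Collect_eq of_nat_0_less_iff subsetI zero_less_Suc zero_less_divide_1_iff)
   then obtain \<sigma> where \<sigma>: "\<And>i. \<sigma> i \<in> mball x (1 / real (Suc i))" "\<And>i. f (\<sigma> i) \<notin> U" by metis
   have "(%i. d (\<sigma> i) x) \<leadsto> 0"
   proof (rule tendsto_sandwich[of "%_. 0" _ _ "%i. 1 / real (Suc i)"])
    show "(%i. 1 / real (Suc i)) \<leadsto> 0" using LIMSEQ_inverse_real_of_nat by (simp add: inverse_eq_divide)
    show "\<forall>\<^sub>F i in sequentially. d (\<sigma> i) x <= 1 / real (Suc i)"
     using \<sigma>(1) commute by (auto simp: less_imp_le)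
   qed auto
   hence "conv \<sigma> x" using \<sigma>(1) x by (auto simp: conv_def)
   hence "\<forall>\<^sub>F i in sequentially. f (\<sigma> i) \<in> U"
    using topological_tendstoD[OF assms] U x by blast
   thus False using \<sigma>(2) by simp
  qed
 qed auto
qed simp

lemma abs_mdist_diff_le: "[|x \<in> M; y \<in> M; z \<in> M|] ==> \<bar>d x z - d y z\<bar> <= d x y"
 using triangle[of x y z] triangle[of y x z] commute by (auto simp: abs_le_iff)

lemma conv_mdist_tendsto:
 assumes "conv \<sigma> x" "z \<in> M"
 shows "(%i. d (\<sigma> i) z) \<leadsto> d x z"
proof -
 have "(%i. d (\<sigma> i) z - d x z) \<leadsto> 0"
  using abs_mdist_diff_le convD(1,2)[OF assms(1)] assms(2)
  by (intro Lim_null_comparison[OF _ convD(3)[OF assms(1)]] always_eventually) simp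
 thus ?thesis by (simp add: LIM_zero_iff)
qed

lemma separable_sequence:
 assumes "second_countable mtopology" "M ~= {}"
 shows "\<exists>\<xi> :: nat => 'a. range \<xi> \<subseteq> M & (\<forall>x\<in>M. \<forall>e>0. \<exists>i. d x (\<xi> i) < e)"
proof -
 obtain C where C: "countable C" "C \<subseteq> M" "mtopology closure_of C = M"
  using second_countable_imp_separable_space[OF assms(1)] by (auto simp: separable_space_def)
 hence "C ~= {}" using assms(2) by auto
 then obtain \<xi> :: "nat => 'a" where \<xi>: "range \<xi> = C"
  using range_from_nat_into[OF _ C(1)] by blast
 have "\<exists>i. d x (\<xi> i) < e" if xe: "x \<in> M" "0 < e" for x e
 proof -
  have "x \<in> mtopology closure_of C" using C xe by simp
  then obtain y where "y \<in> C" "y \<in> mball x e"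
   using xe(2) unfolding metric_closure_of by blast
  hence "y \<in> C" "d x y < e" by auto
  thus ?thesis using \<xi> by auto
 qed
 moreover have "range \<xi> \<subseteq> M" using \<xi> C by simp
 ultimately show ?thesis by blast
qed

end

locale dense_sequence = Metric_space M d for M :: "'a set" and d +
 fixes \<xi> :: "nat => 'a"
 assumes dense_in: "\<And>i. \<xi> i \<in> M" and dense: "\<And>x e. [|x \<in> M; 0 < e|] ==> \<exists>i. d x (\<xi> i) < e"
begin

definition bump :: "nat => nat => 'a => real"
 where "bump n i x = min 1 (max 0 (2 - 2 * real (Suc n) * d x (\<xi> i)))"

text \<open>A partition of unity on the scale \<open>1/(n+1)\<close>, subordinate to balls around a dense sequence. The product form makes all members after the first bump with value one vanish, so every sum is locally finite and adds up to one.\<close>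

definition pu :: "nat => nat => 'a => real"
 where "pu n i x = bump n i x * (\<Prod>j<i. 1 - bump n j x)"

lemma bump_range: "0 <= bump n i x" "bump n i x <= 1" by (auto simp: bump_def)

lemma pu_nonneg: "0 <= pu n i x"
 unfolding pu_def using bump_range by (intro mult_nonneg_nonneg prod_nonneg) auto

lemma sum_pu: "(\<Sum>i<m. pu n i x) = 1 - (\<Prod>j<m. 1 - bump n j x)"
 by (induction m) (simp_all add: pu_def algebra_simps)

lemma bump_one: "d x (\<xi> i) < 1 / (2 * real (Suc n)) ==> bump n i x = 1"
proof -
 assume "d x (\<xi> i) < 1 / (2 * real (Suc n))"
 hence "d x (\<xi> i) * (2 * real (Suc n)) < 1" by (simp add: pos_less_divide_eq)
 hence "2 * real (Suc n) * d x (\<xi> i) < 1" by (simp only: mult.commute)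
 thus ?thesis unfolding bump_def by linarith
qed

lemma pu_support:
 assumes "pu n i x ~= 0"
 shows "d x (\<xi> i) < 1 / real (Suc n)"
proof -
 have "bump n i x ~= 0" using assms by (auto simp: pu_def)
 hence "real (Suc n) * d x (\<xi> i) < 1" unfolding bump_def by linarith
 hence "d x (\<xi> i) * real (Suc n) < 1" by (simp only: mult.commute)
 thus ?thesis by (simp add: pos_less_divide_eq)
qed

lemma pu_zero_beyond: "[|bump n j x = 1; j < i|] ==> pu n i x = 0"
 by (auto simp: pu_def)

lemma sum_pu_one:
 assumes "bump n j x = 1" shows "(\<Sum>i\<le>j. pu n i x) = 1"
proof -
 have "(\<Prod>i<Suc j. 1 - bump n i x) = 0" using assms by auto
 thus ?thesis using sum_pu[of n x "Suc j"] by (simp add: lessThan_Suc_atMost)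
qed

definition cut :: "nat => 'a => nat" where "cut n x = (SOME j. d x (\<xi> j) < 1 / (2 * real (Suc n)))"

lemma cut: "x \<in> M ==> d x (\<xi> (cut n x)) < 1 / (2 * real (Suc n))"
 unfolding cut_def by (rule someI_ex, rule dense) simp_all

lemma bump_cut: "x \<in> M ==> bump n (cut n x) x = 1"
 using cut bump_one by blast

lemma sum_pu_cong:
 fixes g :: "nat => complex"
 assumes "bump n j x = 1" "bump n k x = 1"
 shows "(\<Sum>i\<le>j. of_real (pu n i x) * g i) = (\<Sum>i\<le>k. of_real (pu n i x) * g i)"
proof -
 have *: "(\<Sum>i\<le>j. of_real (pu n i x) * g i) = (\<Sum>i\<le>k. of_real (pu n i x) * g i)"
  if "bump n j x = 1" "j <= k" for j k
  using that pu_zero_beyond[OF that(1)] by (intro sum.mono_neutral_left) auto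
 show ?thesis
 proof (cases "j <= k")
  case True show ?thesis by (rule *[OF assms(1) True])
 next
  case False thus ?thesis by (intro *[OF assms(2), symmetric]) simp
 qed
qed

text \<open>The kernel averaged in each variable over the partition of unity; the sums stop at an index beyond which all members vanish.\<close>

definition smooth :: "('a => 'a => complex) => 'a \<times> nat => 'a \<times> nat => complex"
 where "smooth k p q = (\<Sum>i\<le>cut (snd p) (fst p). \<Sum>j\<le>cut (snd q) (fst q).
   of_real (pu (snd p) i (fst p)) * cnj (of_real (pu (snd q) j (fst q))) * k (\<xi> i) (\<xi> j))"

lemma psd_smooth:
 assumes "psd M k" shows "psd X (smooth k)"
proof -
 have "psd UNIV (%i j. k (\<xi> i) (\<xi> j))"
  by (rule psd_comp[OF assms dense_in])
 from psd_linear_image[OF this, of X "%p. {..cut (snd p) (fst p)}" "%p i. of_real (pu (snd p) i (fst p))"]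
 show ?thesis unfolding smooth_def[abs_def] by simp
qed

lemma smooth_eq:
 assumes "bump n a x = 1" "bump m b y = 1" "x \<in> M" "y \<in> M"
 shows "smooth k (x, n) (y, m) =
  (\<Sum>i\<le>a. of_real (pu n i x) * (\<Sum>j\<le>b. of_real (pu m j y) * k (\<xi> i) (\<xi> j)))"
proof -
 have "smooth k (x, n) (y, m) =
  (\<Sum>i\<le>cut n x. of_real (pu n i x) * (\<Sum>j\<le>cut m y. of_real (pu m j y) * k (\<xi> i) (\<xi> j)))"
  unfolding smooth_def sum_distrib_left by (simp add: mult.assoc)
 also have "... = (\<Sum>i\<le>cut n x. of_real (pu n i x) * (\<Sum>j\<le>b. of_real (pu m j y) * k (\<xi> i) (\<xi> j)))"
  by (intro sum.cong refl arg_cong2[of _ _ _ _ "(*)"] sum_pu_cong bump_cut assms)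
 also have "... = (\<Sum>i\<le>a. of_real (pu n i x) * (\<Sum>j\<le>b. of_real (pu m j y) * k (\<xi> i) (\<xi> j)))"
  by (intro sum_pu_cong bump_cut assms)
 finally show ?thesis .
qed

lemma conv_pu: "conv \<sigma> x ==> (%l. pu n i (\<sigma> l)) \<leadsto> pu n i x"
 unfolding pu_def bump_def by (intro tendsto_intros conv_mdist_tendsto dense_in)

lemma conv_bump_cut:
 assumes "conv \<sigma> x"
 shows "\<forall>\<^sub>F l in sequentially. bump n (cut n x) (\<sigma> l) = 1"
proof -
 have "\<forall>\<^sub>F l in sequentially. d (\<sigma> l) (\<xi> (cut n x)) < 1 / (2 * real (Suc n))"
  using order_tendstoD(2)[OF conv_mdist_tendsto[OF assms dense_in] cut] convD(2)[OF assms] by blast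
 thus ?thesis by (rule eventually_mono) (rule bump_one)
qed

lemma conv_smooth:
 assumes "conv \<sigma> x" "conv \<tau> y"
 shows "(%l. smooth k (\<sigma> l, n) (\<tau> l, m)) \<leadsto> smooth k (x, n) (y, m)"
proof -
 let ?a = "cut n x" and ?b = "cut m y"
 let ?f = "%x y. (\<Sum>i\<le>?a. of_real (pu n i x) * (\<Sum>j\<le>?b. of_real (pu m j y) * k (\<xi> i) (\<xi> j)))"
 have "\<forall>\<^sub>F l in sequentially. ?f (\<sigma> l) (\<tau> l) = smooth k (\<sigma> l, n) (\<tau> l, m)"
  using conv_bump_cut[OF assms(1), of n] conv_bump_cut[OF assms(2), of m]
 proof eventually_elim
  case (elim l)
  thus ?case by (intro smooth_eq[symmetric] convD(1)[OF assms(1)] convD(1)[OF assms(2)])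
 qed
 moreover have "(%l. ?f (\<sigma> l) (\<tau> l)) \<leadsto> ?f x y"
  by (intro tendsto_intros conv_pu assms)
 moreover have "?f x y = smooth k (x, n) (y, m)"
  by (intro smooth_eq[symmetric] bump_cut convD(2)[OF assms(1)] convD(2)[OF assms(2)])
 ultimately show ?thesis using Lim_transform_eventually by fastforce
qed

lemma smooth_approx:
 assumes xy: "x \<in> M" "y \<in> M"
  and e: "\<And>u v. [|u \<in> M; v \<in> M; d x u < 1 / real (Suc n); d y v < 1 / real (Suc m)|] ==> cmod (k u v - c) <= e"
 shows "cmod (smooth k (x, n) (y, m) - c) <= e"
proof -
 let ?a = "cut n x" and ?b = "cut m y"
 have one: "(\<Sum>i\<le>?a. pu n i x) = 1" "(\<Sum>j\<le>?b. pu m j y) = 1"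
  using sum_pu_one bump_cut xy by blast+
 have "(\<Sum>i\<le>?a. \<Sum>j\<le>?b. of_real (pu n i x) * of_real (pu m j y) * c) = c"
 proof -
  have "(\<Sum>i\<le>?a. \<Sum>j\<le>?b. of_real (pu n i x) * of_real (pu m j y) * c)
   = of_real (\<Sum>i\<le>?a. pu n i x) * of_real (\<Sum>j\<le>?b. pu m j y) * c"
   by (simp only: of_real_sum sum_product) (simp only: sum_distrib_right)
  thus ?thesis by (simp only: one of_real_1 mult_1_left)
 qed
 moreover have "smooth k (x, n) (y, m) = (\<Sum>i\<le>?a. \<Sum>j\<le>?b. of_real (pu n i x) * of_real (pu m j y) * k (\<xi> i) (\<xi> j))"
  by (simp add: smooth_def)
 ultimately have eq: "smooth k (x, n) (y, m) - c
   = (\<Sum>i\<le>?a. \<Sum>j\<le>?b. of_real (pu n i x) * of_real (pu m j y) * (k (\<xi> i) (\<xi> j) - c))"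
  by (simp only: right_diff_distrib sum_subtractf)
 have "cmod (smooth k (x, n) (y, m) - c) <= (\<Sum>i\<le>?a. \<Sum>j\<le>?b. cmod (of_real (pu n i x) * of_real (pu m j y) * (k (\<xi> i) (\<xi> j) - c)))"
  unfolding eq by (rule norm_double_sum_le)
 also have "... <= (\<Sum>i\<le>?a. \<Sum>j\<le>?b. pu n i x * pu m j y * e)"
 proof (rule sum_mono, rule sum_mono)
  fix i j
  show "cmod (of_real (pu n i x) * of_real (pu m j y) * (k (\<xi> i) (\<xi> j) - c)) <= pu n i x * pu m j y * e"
  proof (cases "pu n i x = 0 \<or> pu m j y = 0")
   case False
   hence nz: "pu n i x ~= 0" "pu m j y ~= 0" by blast+
   have "cmod (k (\<xi> i) (\<xi> j) - c) <= e"
    by (rule e[OF dense_in dense_in pu_support[OF nz(1)] pu_support[OF nz(2)]])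
   hence "pu n i x * pu m j y * cmod (k (\<xi> i) (\<xi> j) - c) <= pu n i x * pu m j y * e"
    by (intro mult_left_mono mult_nonneg_nonneg pu_nonneg)
   thus ?thesis by (simp add: norm_mult pu_nonneg)
  next
   case True
   thus ?thesis by (elim disjE) simp_all
  qed
 qed
 also have "... = (\<Sum>i\<le>?a. pu n i x) * (\<Sum>j\<le>?b. pu m j y) * e"
  by (simp only: sum_product) (simp only: sum_distrib_right)
 also have "... = e" by (simp only: one mult_1_left)
 finally show ?thesis .
qed

lemma smooth_diff: "smooth (%x y. k x y - l x y) p q = smooth k p q - smooth l p q"
 by (simp add: smooth_def right_diff_distrib sum_subtractf)

lemma smooth_add: "smooth (%x y. k x y + l x y) p q = smooth k p q + smooth l p q"
 by (simp add: smooth_def distrib_left sum.distrib)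

text \<open>The form of a positive kernel at a probability vector is at most the largest diagonal value.\<close>

lemma smooth_diag_le:
 assumes k: "psd M k" and S: "\<And>x. x \<in> M ==> Re (k x x) <= S" and x: "x \<in> M"
 shows "Re (smooth k (x, n) (x, n)) <= S"
proof -
 have "cmod (smooth k (x, n) (x, n) - 0) <= S"
 proof (rule smooth_approx[OF x x])
  fix u v assume "u \<in> M" "v \<in> M"
  thus "cmod (k u v - 0) <= S" using psd_norm_le[OF k] S by simp
 qed
 thus ?thesis using complex_Re_le_cmod[of "smooth k (x, n) (x, n)"] by simp
qed

end

text \<open>The value of \<open>K\<close> at scales \<open>n\<close>, \<open>m\<close> lies no farther from \<open>\<psi>\<close> than \<open>\<psi>\<close> itself oscillates on balls of radii \<open>1/(n+1)\<close>, \<open>1/(m+1)\<close>. This form survives averaging over isometries.\<close>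

definition approximates :: "'a set => ('a => 'a => real) => ('a => 'a => complex) => ('a \<times> nat => 'a \<times> nat => complex) => bool"
 where "approximates M d \<psi> K \<longleftrightarrow> (\<forall>x\<in>M. \<forall>y\<in>M. \<forall>n m e.
  (\<forall>u\<in>M. \<forall>v\<in>M. d x u < 1 / real (Suc n) --> d y v < 1 / real (Suc m) --> cmod (\<psi> u v - \<psi> x y) <= e) -->
  cmod (K (x, n) (y, m) - \<psi> x y) <= e)"

definition (in Metric_space) seq_cont :: "('a \<times> nat => 'a \<times> nat => complex) => bool"
 where "seq_cont K \<longleftrightarrow> (\<forall>\<sigma> \<tau> x y n m. conv \<sigma> x --> conv \<tau> y -->
   (%l. K (\<sigma> l, n) (\<tau> l, m)) \<leadsto> K (x, n) (y, m))"

theorem (in Metric_space) smooth_decomposition: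
 assumes sc: "second_countable mtopology" "M ~= {}"
  and k: "psd M k" and l: "psd M l"
  and S: "\<And>x. x \<in> M ==> Re (k x x) + Re (l x x) <= S"
  and kl: "\<And>x y. [|x \<in> M; y \<in> M|] ==> k x y - l x y = \<psi> x y"
 shows "\<exists>K L. psd (M \<times> UNIV) K & psd (M \<times> UNIV) L &
   (\<forall>p\<in>M \<times> UNIV. Re (K p p) + Re (L p p) <= S) & seq_cont K & seq_cont L &
   approximates M d \<psi> (%p q. K p q - L p q)"
proof -
 obtain \<xi> :: "nat => 'a" where \<xi>: "range \<xi> \<subseteq> M" "\<forall>x\<in>M. \<forall>e>0. \<exists>i. d x (\<xi> i) < e"
  using separable_sequence[OF sc] by (elim exE conjE)
 interpret dense_sequence M d \<xi>
 proof
  show "\<xi> i \<in> M" for i using \<xi>(1) by blast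
  show "\<exists>i. d x (\<xi> i) < e" if "x \<in> M" "0 < e" for x e using \<xi>(2) that by blast
 qed
 show ?thesis
 proof (intro exI conjI ballI)
  show "psd (M \<times> UNIV) (smooth k)" "psd (M \<times> UNIV) (smooth l)"
   by (rule psd_smooth[OF k], rule psd_smooth[OF l])
  show "seq_cont (smooth k)" "seq_cont (smooth l)"
   unfolding seq_cont_def using conv_smooth by blast+
  show "Re (smooth k p p) + Re (smooth l p p) <= S" if p: "p \<in> M \<times> UNIV" for p
  proof -
   have "Re (smooth (%x y. k x y + l x y) (fst p, snd p) (fst p, snd p)) <= S"
    using S p by (intro smooth_diag_le[OF psd_add[OF k l]]) auto
   thus ?thesis by (simp add: smooth_add)
  qed
  show "approximates M d \<psi> (%p q. smooth k p q - smooth l p q)"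
   unfolding approximates_def
  proof (intro ballI allI impI)
   fix x y n m e
   assume xy: "x \<in> M" "y \<in> M" and
    e: "\<forall>u\<in>M. \<forall>v\<in>M. d x u < 1 / real (Suc n) --> d y v < 1 / real (Suc m) --> cmod (\<psi> u v - \<psi> x y) <= e"
   have "cmod (smooth (%x y. k x y - l x y) (x, n) (y, m) - \<psi> x y) <= e"
    by (rule smooth_approx[OF xy]) (use e kl in simp)
   thus "cmod (smooth k (x, n) (y, m) - smooth l (x, n) (y, m) - \<psi> x y) <= e"
    by (simp add: smooth_diff)
  qed
 qed
qed

section \<open>Averaging kernels over the group\<close>

locale invariant_metric_group = Group.group G + Metric_space "carrier G" d
 for G (structure) and d +
 assumes left_invariant: "[|g \<in> carrier G; x \<in> carrier G; y \<in> carrier G|] ==> d (g \<otimes> x) (g \<otimes> y) = d x y"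
  and continuous_group: "topological_group G mtopology"
begin

abbreviation \<G> where "\<G> \<equiv> carrier G"
abbreviation GN :: "('a \<times> nat) set" where "GN \<equiv> \<G> \<times> UNIV"

text \<open>Translation moves the group variable and keeps the scale.\<close>

definition act :: "'a => 'a \<times> nat => 'a \<times> nat" where "act g p = (g \<otimes> fst p, snd p)"

lemma act_closed: "[|g \<in> \<G>; p \<in> GN|] ==> act g p \<in> GN"
 by (auto simp: act_def)

lemma continuous_inv_mult:
 assumes x: "x \<in> \<G>" shows "continuous_map mtopology mtopology (%z. inv z \<otimes> x)"
proof -
 interpret T: topological_group G mtopology by (rule continuous_group)
 have c: "continuous_map mtopology mtopology (%_. x)" using x by simp
 have "continuous_map mtopology mtopology ((%(u, v). u \<otimes> v) \<circ> (%z. (inv z, x)))"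
  by (rule continuous_map_compose[OF continuous_map_pairedI[OF T.continuous_inv c] T.continuous_mult])
 thus ?thesis by (simp add: comp_def)
qed

lemma continuous_left_mult:
 assumes x: "x \<in> \<G>" shows "continuous_map mtopology mtopology (%z. x \<otimes> z)"
proof -
 interpret T: topological_group G mtopology by (rule continuous_group)
 have c: "continuous_map mtopology mtopology (%_. x)" using x by simp
 have "continuous_map mtopology mtopology ((%(u, v). u \<otimes> v) \<circ> (%z. (x, z)))"
  by (rule continuous_map_compose[OF continuous_map_pairedI[OF c] T.continuous_mult]) simp
 thus ?thesis by (simp add: comp_def)
qed

lemma conv_inv_mult: "[|conv \<sigma> z; x \<in> \<G>|] ==> conv (%l. inv (\<sigma> l) \<otimes> x) (inv z \<otimes> x)"
 using conv_continuous_map[OF continuous_inv_mult] by blast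

lemma conv_left_mult: "[|conv \<sigma> z; x \<in> \<G>|] ==> conv (%l. x \<otimes> \<sigma> l) (x \<otimes> z)"
 using conv_continuous_map[OF continuous_left_mult] by blast

lemma conv_right_mult:
 assumes "conv \<sigma> z" "x \<in> \<G>" shows "conv (%l. \<sigma> l \<otimes> x) (z \<otimes> x)"
proof -
 interpret T: topological_group G mtopology by (rule continuous_group)
 have c: "continuous_map mtopology mtopology (%_. x)" using assms by simp
 have "continuous_map mtopology mtopology ((%(u, v). u \<otimes> v) \<circ> (%z. (z, x)))"
  by (rule continuous_map_compose[OF continuous_map_pairedI[OF _ c] T.continuous_mult]) simp
 hence "continuous_map mtopology mtopology (%z. z \<otimes> x)" by (simp add: comp_def)
 thus ?thesis using conv_continuous_map assms(1) by blast
qed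

lemma mdist_translate: "[|g \<in> \<G>; z \<in> \<G>|] ==> d z \<one> - d g \<one> <= d (g \<otimes> z) \<one>"
proof -
 assume gz: "g \<in> \<G>" "z \<in> \<G>"
 have "d (g \<otimes> z) \<one> = d (inv g \<otimes> (g \<otimes> z)) (inv g \<otimes> \<one>)"
  using gz by (intro left_invariant[symmetric]) auto
 also have "... = d z (inv g)" using gz by (simp add: m_assoc[symmetric])
 finally have 1: "d (g \<otimes> z) \<one> = d z (inv g)" .
 have "d (inv g) \<one> = d (g \<otimes> inv g) (g \<otimes> \<one>)" using gz by (intro left_invariant[symmetric]) auto
 hence 2: "d (inv g) \<one> = d g \<one>" using gz commute by simp
 have "d z \<one> <= d z (inv g) + d (inv g) \<one>" using gz by (intro triangle) auto
 thus ?thesis using 1 2 by simp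
qed

end

locale invariant_measure_group = invariant_metric_group +
 fixes \<mu> :: "'a measure"
 assumes haar: "haar_measure G mtopology \<mu>"
begin

lemma space_haar: "space \<mu> = \<G>"
 and sets_haar: "sets \<mu> = sigma_sets (\<G>) {U. openin mtopology U}"
 and haar_nonzero: "emeasure \<mu> (\<G>) ~= 0"
 and haar_image: "[|g \<in> \<G>; A \<in> sets \<mu>|] ==> emeasure \<mu> ((%x. g \<otimes> x) ` A) = emeasure \<mu> A"
 using haar unfolding haar_measure_def by auto

lemma openin_sets: "openin mtopology U ==> U \<in> sets \<mu>"
 unfolding sets_haar by (rule sigma_sets.Basic) simp

lemma continuous_measurable:
 fixes f :: "'a => 'v::topological_space"
 assumes "continuous_map mtopology euclidean f" shows "f \<in> borel_measurable \<mu>"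
proof (rule borel_measurableI)
 fix U :: "'v set" assume "open U"
 hence "openin mtopology {x \<in> topspace mtopology. f x \<in> U}"
  using assms by (intro openin_continuous_map_preimage) auto
 hence "{x \<in> \<G>. f x \<in> U} \<in> sets \<mu>" using openin_sets by simp
 moreover have "f -` U \<inter> space \<mu> = {x \<in> \<G>. f x \<in> U}" using space_haar by auto
 ultimately show "f -` U \<inter> space \<mu> \<in> sets \<mu>" by simp
qed

lemma continuous_measurable_map:
 assumes "continuous_map mtopology mtopology f" shows "f \<in> measurable \<mu> \<mu>"
proof (rule measurable_sigma_sets[OF sets_haar])
 show "{U. openin mtopology U} \<subseteq> Pow (\<G>)"
  using openin_subset[of mtopology] by auto
 show "f \<in> space \<mu> \<rightarrow> \<G>"
  using assms by (auto simp: continuous_map_def space_haar)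
 fix U assume "U \<in> {U. openin mtopology U}"
 hence "openin mtopology {x \<in> topspace mtopology. f x \<in> U}"
  using assms by (intro openin_continuous_map_preimage) auto
 hence "{x \<in> \<G>. f x \<in> U} \<in> sets \<mu>" using openin_sets by simp
 moreover have "f -` U \<inter> space \<mu> = {x \<in> \<G>. f x \<in> U}" using space_haar by auto
 ultimately show "f -` U \<inter> space \<mu> \<in> sets \<mu>" by simp
qed

lemma distr_translate:
 assumes g: "g \<in> \<G>" shows "distr \<mu> \<mu> (%x. g \<otimes> x) = \<mu>"
proof (rule measure_eqI)
 have meas: "(%x. g \<otimes> x) \<in> measurable \<mu> \<mu>"
  by (rule continuous_measurable_map[OF continuous_left_mult[OF g]])
 fix A assume "A \<in> sets (distr \<mu> \<mu> (%x. g \<otimes> x))"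
 hence A: "A \<in> sets \<mu>" by simp
 hence sub: "A \<subseteq> \<G>" using sets.sets_into_space space_haar by blast
 have "(%x. g \<otimes> x) -` A \<inter> space \<mu> = (%x. inv g \<otimes> x) ` A"
 proof (intro equalityI subsetI)
  fix x assume "x \<in> (%x. g \<otimes> x) -` A \<inter> space \<mu>"
  hence x: "x \<in> \<G>" "g \<otimes> x \<in> A" using space_haar by auto
  hence "x = inv g \<otimes> (g \<otimes> x)" using g by (simp add: m_assoc[symmetric])
  thus "x \<in> (%x. inv g \<otimes> x) ` A" using x by blast
 next
  fix x assume "x \<in> (%x. inv g \<otimes> x) ` A"
  then obtain a where a: "a \<in> A" "x = inv g \<otimes> a" by auto
  hence "g \<otimes> x = a" using g sub by (simp add: m_assoc[symmetric] subset_iff)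
  thus "x \<in> (%x. g \<otimes> x) -` A \<inter> space \<mu>" using a g sub space_haar by auto
 qed
 thus "emeasure (distr \<mu> \<mu> (%x. g \<otimes> x)) A = emeasure \<mu> A"
  using emeasure_distr[OF meas A] haar_image[OF inv_closed[OF g] A] by simp
qed simp

lemma integral_translate:
 fixes f :: "'a => 'v::{banach, second_countable_topology}"
 assumes "g \<in> \<G>" "f \<in> borel_measurable \<mu>"
 shows "(LINT z|\<mu>. f (g \<otimes> z)) = (LINT z|\<mu>. f z)"
 using integral_distr[OF continuous_measurable_map[OF continuous_left_mult[OF assms(1)]] assms(2)]
  distr_translate[OF assms(1)] by simp

end

locale exponential_growth_group = invariant_measure_group +
 fixes a b c :: real
 assumes a: "0 < a" and b: "0 < b" and bc: "b < c"
  and growth: "emeasure \<mu> {g \<in> \<G>. d g \<one> < real n} <= ennreal (a * exp (b * real n))"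
begin

text \<open>The hypothesis on the volume of balls makes this integrable exactly because \<open>c > b\<close>.\<close>

definition weight0 :: "'a => real" where "weight0 z = exp (- c * d z \<one>)"

lemma ball_sets: "{g \<in> \<G>. d g \<one> < r} \<in> sets \<mu>"
proof -
 have "{g \<in> \<G>. d g \<one> < r} = mball \<one> r" using commute by auto
 thus ?thesis using openin_sets[OF openin_mball] by simp
qed

lemma conv_one_mdist: "conv \<sigma> x ==> (%i. d (\<sigma> i) \<one>) \<leadsto> d x \<one>"
 by (rule conv_mdist_tendsto) auto

lemma weight0_measurable: "weight0 \<in> borel_measurable \<mu>"
 unfolding weight0_def
 by (intro continuous_measurable continuous_map_if_conv tendsto_intros conv_one_mdist)

lemma weight0_integrable: "integrable \<mu> weight0"
proof (rule integrableI_bounded[OF weight0_measurable])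
 let ?B = "%n. {g \<in> \<G>. d g \<one> < real n}"
 \<comment> \<open>The shell between the radii \<open>n\<close> and \<open>n + 1\<close> contributes at most \<open>a e\<^sup>b q\<^sup>n\<close>.\<close>
 define q where "q = exp (- (c - b))"
 have q: "0 <= q" "q < 1" using bc by (auto simp: q_def)
 have le: "ennreal (norm (weight0 z)) <= (\<Sum>n. ennreal (exp (- c * real n)) * indicator (?B (Suc n)) z)"
  if z: "z \<in> space \<mu>" for z
 proof -
  define n where "n = nat \<lfloor>d z \<one>\<rfloor>"
  have n: "real n <= d z \<one>" "d z \<one> < real (Suc n)" unfolding n_def using nonneg[of z \<one>] by linarith+
  have "weight0 z <= exp (- c * real n)" using n b bc by (simp add: weight0_def)
  hence "ennreal (norm (weight0 z)) <= ennreal (exp (- c * real n)) * indicator (?B (Suc n)) z"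
   using z n space_haar by (auto simp: weight0_def intro!: ennreal_leI)
  also have "... <= (\<Sum>n. ennreal (exp (- c * real n)) * indicator (?B (Suc n)) z)"
  proof -
   have "sum f {n} <= suminf f" for f :: "nat => ennreal"
    by (rule sum_le_suminf) auto
   thus ?thesis by (simp only: sum.insert sum.empty finite.emptyI empty_iff not_False_eq_True add_0_right)
  qed
  finally show ?thesis .
 qed
 have "(\<integral>\<^sup>+ z. ennreal (norm (weight0 z)) \<partial>\<mu>)
   <= (\<integral>\<^sup>+ z. (\<Sum>n. ennreal (exp (- c * real n)) * indicator (?B (Suc n)) z) \<partial>\<mu>)"
  by (rule nn_integral_mono) (rule le)
 also have "... = (\<Sum>n. \<integral>\<^sup>+ z. ennreal (exp (- c * real n)) * indicator (?B (Suc n)) z \<partial>\<mu>)"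
 proof (rule nn_integral_suminf)
  fix n
  have [measurable]: "?B (Suc n) \<in> sets \<mu>" by (rule ball_sets)
  show "(%z. ennreal (exp (- c * real n)) * indicator (?B (Suc n)) z) \<in> borel_measurable \<mu>" by measurable
 qed
 also have "... = (\<Sum>n. ennreal (exp (- c * real n)) * emeasure \<mu> (?B (Suc n)))"
  using ball_sets by (simp only: nn_integral_cmult_indicator)
 also have "... <= (\<Sum>n. ennreal (a * exp b * q ^ n))"
 proof (rule suminf_le)
  fix n
  have "ennreal (exp (- c * real n)) * emeasure \<mu> (?B (Suc n))
    <= ennreal (exp (- c * real n)) * ennreal (a * exp (b * real (Suc n)))"
   by (intro mult_left_mono growth) simp
  also have "... = ennreal (exp (- c * real n) * (a * exp (b * real (Suc n))))"
   using a by (intro ennreal_mult[symmetric]) auto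
  also have "exp (- c * real n) * (a * exp (b * real (Suc n))) = a * exp b * q ^ n"
  proof -
   have "exp (- c * real n) * exp (b * real (Suc n)) = exp b * q ^ n"
    unfolding q_def exp_of_nat_mult[symmetric] exp_add[symmetric] by (simp add: algebra_simps)
   thus ?thesis by (simp add: mult_ac)
  qed
  finally show "ennreal (exp (- c * real n)) * emeasure \<mu> (?B (Suc n)) <= ennreal (a * exp b * q ^ n)" .
 qed simp_all
 also have "... = ennreal (\<Sum>n. a * exp b * q ^ n)"
  using a q by (intro suminf_ennreal2 summable_mult summable_geometric) auto
 also have "... < \<infinity>" by simp
 finally show "(\<integral>\<^sup>+ z. ennreal (norm (weight0 z)) \<partial>\<mu>) < \<infinity>" .
qed

lemma weight0_integral_pos: "0 < (LINT z|\<mu>. weight0 z)"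
proof -
 have "(LINT z|\<mu>. weight0 z) ~= 0"
 proof
  assume "(LINT z|\<mu>. weight0 z) = 0"
  moreover have "AE z in \<mu>. 0 <= weight0 z" by (simp add: weight0_def)
  ultimately have "AE z in \<mu>. weight0 z = 0"
   using integral_nonneg_eq_0_iff_AE[OF weight0_integrable] by blast
  hence "AE z in \<mu>. z \<notin> \<G>" by (rule AE_mp) (simp add: weight0_def)
  moreover have "\<G> \<in> sets \<mu>" using sets.top[of \<mu>] space_haar by simp
  ultimately have "emeasure \<mu> (\<G>) = 0" using AE_iff_null_sets by (metis null_setsD1)
  thus False using haar_nonzero by simp
 qed
 moreover have "0 <= (LINT z|\<mu>. weight0 z)" by (rule integral_nonneg_AE) (simp add: weight0_def)
 ultimately show ?thesis by simp
qed

definition weight :: "'a => real" where "weight z = weight0 z / (LINT z|\<mu>. weight0 z)"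

lemma weight_nonneg: "0 <= weight z"
 unfolding weight_def using weight0_integral_pos by (simp add: weight0_def)

lemma weight_integrable: "integrable \<mu> weight"
 unfolding weight_def using weight0_integrable by (intro integrable_divide)

lemma weight_integral: "(LINT z|\<mu>. weight z) = 1"
 unfolding weight_def using weight0_integral_pos by simp

lemma weight_measurable: "weight \<in> borel_measurable \<mu>"
 using weight_integrable by (rule borel_measurable_integrable)

text \<open>The triangle inequality for \<open>d\<close>, exponentiated. This is the only property of the weight that enters the norm estimate for the representation.\<close>

lemma weight_translate:
 assumes "g \<in> \<G>" "z \<in> \<G>"
 shows "weight (g \<otimes> z) <= exp (c * d g \<one>) * weight z"
proof -
 have "- c * d (g \<otimes> z) \<one> <= c * d g \<one> + - c * d z \<one>"
  using mult_left_mono[OF mdist_translate[OF assms], of c] b bc by (simp add: algebra_simps)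
 hence "weight0 (g \<otimes> z) <= exp (c * d g \<one>) * weight0 z"
  unfolding weight0_def exp_add[symmetric] by simp
 thus ?thesis
  unfolding weight_def using weight0_integral_pos by (simp add: divide_right_mono)
qed

text \<open>The average of the translated kernels; for invariant kernels and a weight of mass one it changes nothing.\<close>

definition avg :: "('a => real) => ('a \<times> nat => 'a \<times> nat => complex) => 'a \<times> nat => 'a \<times> nat => complex"
 where "avg w k p q = (LINT z|\<mu>. of_real (w z) * k (act (inv z) p) (act (inv z) q))"

context
 fixes k :: "'a \<times> nat => 'a \<times> nat => complex" and S :: real
 assumes k: "psd GN k" and kc: "seq_cont k"
  and kS: "\<And>p. p \<in> GN ==> Re (k p p) <= S"
begin

lemma translate_measurable:
 assumes "p \<in> GN" "q \<in> GN"
 shows "(%z. k (act (inv z) p) (act (inv z) q)) \<in> borel_measurable \<mu>"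
proof -
 obtain x n y m where p: "p = (x, n)" "x \<in> \<G>" and q: "q = (y, m)" "y \<in> \<G>"
  using assms by (cases p, cases q) auto
 show ?thesis unfolding p q act_def fst_conv snd_conv
 proof (intro continuous_measurable continuous_map_if_conv)
  fix \<sigma> z assume "conv \<sigma> z"
  hence "conv (%l. inv (\<sigma> l) \<otimes> x) (inv z \<otimes> x)" "conv (%l. inv (\<sigma> l) \<otimes> y) (inv z \<otimes> y)"
   using conv_inv_mult p(2) q(2) by blast+
  thus "(%l. k (inv \<sigma> l \<otimes> x, n) (inv \<sigma> l \<otimes> y, m)) \<leadsto> k (inv z \<otimes> x, n) (inv z \<otimes> y, m)"
   using kc unfolding seq_cont_def by blast
 qed
qed

lemma translate_bound:
 assumes "p \<in> GN" "q \<in> GN" "z \<in> \<G>"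
 shows "cmod (k (act (inv z) p) (act (inv z) q)) <= S"
 using assms act_closed[OF inv_closed] by (intro psd_norm_le[OF k] kS) auto

lemma avg_integrable:
 assumes "p \<in> GN" "q \<in> GN" and w: "integrable \<mu> w"
 shows "integrable \<mu> (%z. of_real (w z) * k (act (inv z) p) (act (inv z) q))"
proof (rule Bochner_Integration.integrable_bound)
 show "integrable \<mu> (%z. \<bar>w z\<bar> * S)" using w by simp
 show "(%z. of_real (w z) * k (act (inv z) p) (act (inv z) q)) \<in> borel_measurable \<mu>"
  using translate_measurable[OF assms(1,2)] borel_measurable_integrable[OF w]
  by (intro borel_measurable_times) simp_all
 show "AE z in \<mu>. norm (of_real (w z) * k (act (inv z) p) (act (inv z) q)) <= norm (\<bar>w z\<bar> * S)"
 proof (rule AE_I2)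
  fix z assume "z \<in> space \<mu>"
  hence "cmod (k (act (inv z) p) (act (inv z) q)) <= S" using translate_bound assms space_haar by simp
  moreover from this have "S = \<bar>S\<bar>" using norm_ge_zero[of "k (act (inv z) p) (act (inv z) q)"] by linarith
  ultimately show "norm (of_real (w z) * k (act (inv z) p) (act (inv z) q)) <= norm (\<bar>w z\<bar> * S)"
   by (simp add: norm_mult abs_mult mult_left_mono)
 qed
qed

lemma sesq_avg:
 assumes F: "F \<subseteq> GN" and w: "integrable \<mu> w"
 shows "integrable \<mu> (%z. of_real (w z) * sesq (%p q. k (act (inv z) p) (act (inv z) q)) F u v)"
  and "sesq (avg w k) F u v = (LINT z|\<mu>. of_real (w z) * sesq (%p q. k (act (inv z) p) (act (inv z) q)) F u v)"
proof -
 have eq: "of_real (w z) * sesq (%p q. k (act (inv z) p) (act (inv z) q)) F u v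
   = (\<Sum>p\<in>F. \<Sum>q\<in>F. u p * cnj (v q) * (of_real (w z) * k (act (inv z) p) (act (inv z) q)))" for z
  unfolding sesq_def sum_distrib_left by (intro sum.cong refl) simp
 have int: "integrable \<mu> (%z. u p * cnj (v q) * (of_real (w z) * k (act (inv z) p) (act (inv z) q)))"
  if "p \<in> F" "q \<in> F" for p q
  by (intro integrable_mult_right avg_integrable w) (use that F in auto)
 show "integrable \<mu> (%z. of_real (w z) * sesq (%p q. k (act (inv z) p) (act (inv z) q)) F u v)"
  unfolding eq using int by (intro Bochner_Integration.integrable_sum)
 have "(LINT z|\<mu>. of_real (w z) * sesq (%p q. k (act (inv z) p) (act (inv z) q)) F u v)
   = (\<Sum>p\<in>F. LINT z|\<mu>. (\<Sum>q\<in>F. u p * cnj (v q) * (of_real (w z) * k (act (inv z) p) (act (inv z) q))))"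
  unfolding eq using int by (intro Bochner_Integration.integral_sum Bochner_Integration.integrable_sum)
 also have "... = (\<Sum>p\<in>F. \<Sum>q\<in>F. LINT z|\<mu>. u p * cnj (v q) * (of_real (w z) * k (act (inv z) p) (act (inv z) q)))"
  using int by (intro sum.cong refl Bochner_Integration.integral_sum)
 also have "... = sesq (avg w k) F u v"
  unfolding sesq_def avg_def by (intro sum.cong refl integral_mult_right_zero)
 finally show "sesq (avg w k) F u v = (LINT z|\<mu>. of_real (w z) * sesq (%p q. k (act (inv z) p) (act (inv z) q)) F u v)"
  by simp
qed

lemma psd_avg:
 assumes w: "integrable \<mu> w" and w0: "\<And>z. z \<in> \<G> ==> 0 <= w z"
 shows "psd GN (avg w k)"
 unfolding psd_def
proof (intro allI impI)
 fix F u assume F: "finite F" "F \<subseteq> \<G> \<times> (UNIV :: nat set)"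
 let ?f = "%z. of_real (w z) * sesq (%p q. k (act (inv z) p) (act (inv z) q)) F u u"
 have int: "integrable \<mu> ?f" by (rule sesq_avg(1)[OF F(2) w])
 have pos: "?f z \<in> \<real>\<^sub>\<ge>\<^sub>0" if z: "z \<in> space \<mu>" for z
 proof -
  have "psd GN (%p q. k (act (inv z) p) (act (inv z) q))"
   by (rule psd_comp[OF k]) (use act_closed[OF inv_closed] z space_haar in simp)
  hence "sesq (%p q. k (act (inv z) p) (act (inv z) q)) F u u \<in> \<real>\<^sub>\<ge>\<^sub>0"
   using F unfolding psd_def by blast
  thus ?thesis using w0 z space_haar by (intro nonneg_Reals_mult_I) auto
 qed
 have "0 <= (LINT z|\<mu>. Re (?f z))"
  using pos by (intro integral_nonneg_AE AE_I2) (auto simp: complex_nonneg_Reals_iff)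
 moreover have "(LINT z|\<mu>. Im (?f z)) = (LINT z|\<mu>. 0)"
  using pos by (intro Bochner_Integration.integral_cong refl) (auto simp: complex_nonneg_Reals_iff)
 ultimately have "(LINT z|\<mu>. ?f z) \<in> \<real>\<^sub>\<ge>\<^sub>0"
  using integral_Re[OF int] integral_Im[OF int] by (simp add: complex_nonneg_Reals_iff del: integral_Re integral_Im)
 thus "sesq (avg w k) F u u \<in> \<real>\<^sub>\<ge>\<^sub>0" by (simp only: sesq_avg(2)[OF F(2) w])
qed

lemma avg_translate:
 assumes g: "g \<in> \<G>" and pq: "p \<in> GN" "q \<in> GN" and w: "integrable \<mu> w"
 shows "avg w k (act g p) (act g q) = avg (%z. w (g \<otimes> z)) k p q"
proof -
 let ?f = "%z. of_real (w z) * k (act (inv z) (act g p)) (act (inv z) (act g q))"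
 have "avg w k (act g p) (act g q) = (LINT z|\<mu>. ?f (g \<otimes> z))"
  unfolding avg_def
  by (rule integral_translate[OF g, symmetric])
   (rule borel_measurable_integrable[OF avg_integrable[OF act_closed[OF g pq(1)] act_closed[OF g pq(2)] w]])
 also have "... = avg (%z. w (g \<otimes> z)) k p q"
  unfolding avg_def
 proof (intro Bochner_Integration.integral_cong refl)
  fix z assume "z \<in> space \<mu>"
  hence z: "z \<in> \<G>" using space_haar by simp
  have "act (inv (g \<otimes> z)) (act g p) = act (inv z) p" if "p \<in> \<G> \<times> (UNIV :: nat set)" for p
  proof -
   have "inv (g \<otimes> z) \<otimes> (g \<otimes> x) = inv z \<otimes> x" if "x \<in> \<G>" for x
    using g z that by (metis inv_closed inv_mult_group inv_solve_left' m_assoc m_closed)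
   thus ?thesis using that by (auto simp: act_def)
  qed
  thus "?f (g \<otimes> z) = of_real (w (g \<otimes> z)) * k (act (inv z) p) (act (inv z) q)" using pq by simp
 qed
 finally show ?thesis .
qed

text \<open>Translating the average by \<open>g\<close> shifts the weight, which costs the factor \<open>exp(c d(g, 1))\<close>; the difference of the two weights is nonnegative and so averages to a positive kernel.\<close>

lemma avg_growth:
 assumes g: "g \<in> \<G>"
 shows "psd GN
  (%p q. of_real (exp (c * d g \<one>)) * avg weight k p q - avg weight k (act g p) (act g q))"
proof -
 have int: "integrable \<mu> (%z. weight (g \<otimes> z))"
  using integrable_distr[OF continuous_measurable_map[OF continuous_left_mult[OF g]], of weight]
   distr_translate[OF g] weight_integrable by simp
 define w where "w z = exp (c * d g \<one>) * weight z - weight (g \<otimes> z)" for z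
 have wi: "integrable \<mu> w" unfolding w_def using int weight_integrable by simp
 have "psd GN (avg w k)"
  using weight_translate[OF g] by (intro psd_avg wi) (simp add: w_def)
 moreover have "avg w k p q = of_real (exp (c * d g \<one>)) * avg weight k p q - avg weight k (act g p) (act g q)"
  if pq: "p \<in> GN" "q \<in> GN" for p q
 proof -
  let ?k = "%z. k (act (inv z) p) (act (inv z) q)"
  have "avg w k p q = (LINT z|\<mu>. of_real (exp (c * d g \<one>)) * (of_real (weight z) * ?k z) - of_real (weight (g \<otimes> z)) * ?k z)"
   unfolding avg_def w_def by (intro Bochner_Integration.integral_cong refl) (simp add: algebra_simps)
  also have "... = (LINT z|\<mu>. of_real (exp (c * d g \<one>)) * (of_real (weight z) * ?k z)) - (LINT z|\<mu>. of_real (weight (g \<otimes> z)) * ?k z)"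
   by (intro Bochner_Integration.integral_diff integrable_mult_right avg_integrable pq int weight_integrable)
  also have "... = of_real (exp (c * d g \<one>)) * avg weight k p q - avg (%z. weight (g \<otimes> z)) k p q"
   unfolding avg_def by (simp only: integral_mult_right_zero)
  finally show ?thesis by (simp only: avg_translate[OF g pq weight_integrable])
 qed
 ultimately show ?thesis by (subst (asm) psd_cong) auto
qed

text \<open>Dominated convergence: positive kernels are bounded by their diagonal.\<close>

lemma seq_cont_avg: "seq_cont (avg weight k)"
 unfolding seq_cont_def
proof (intro allI impI)
 fix \<sigma> \<tau> x y n m assume \<sigma>: "conv \<sigma> x" and \<tau>: "conv \<tau> y"
 have in_carrier: "\<sigma> l \<in> \<G>" "\<tau> l \<in> \<G>" "x \<in> \<G>" "y \<in> \<G>" for l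
  using convD[OF \<sigma>] convD[OF \<tau>] by auto
 show "(%l. avg weight k (\<sigma> l, n) (\<tau> l, m)) \<leadsto> avg weight k (x, n) (y, m)"
  unfolding avg_def
 proof (rule integral_dominated_convergence[where w = "%z. weight z * S"])
  show "(%z. of_real (weight z) * k (act (inv z) (x, n)) (act (inv z) (y, m))) \<in> borel_measurable \<mu>"
   by (rule borel_measurable_integrable, rule avg_integrable) (use in_carrier weight_integrable in auto)
  show "(%z. of_real (weight z) * k (act (inv z) (\<sigma> l, n)) (act (inv z) (\<tau> l, m))) \<in> borel_measurable \<mu>" for l
   by (rule borel_measurable_integrable, rule avg_integrable) (use in_carrier weight_integrable in auto)
  show "integrable \<mu> (%z. weight z * S)" using weight_integrable by simp
  show "AE z in \<mu>. (%l. of_real (weight z) * k (act (inv z) (\<sigma> l, n)) (act (inv z) (\<tau> l, m)))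
    \<leadsto> of_real (weight z) * k (act (inv z) (x, n)) (act (inv z) (y, m))"
  proof (rule AE_I2)
   fix z assume "z \<in> space \<mu>"
   hence "inv z \<in> \<G>" using space_haar by simp
   hence "conv (%l. inv z \<otimes> \<sigma> l) (inv z \<otimes> x)" "conv (%l. inv z \<otimes> \<tau> l) (inv z \<otimes> y)"
    using conv_left_mult \<sigma> \<tau> by blast+
   hence "(%l. k (inv z \<otimes> \<sigma> l, n) (inv z \<otimes> \<tau> l, m)) \<leadsto> k (inv z \<otimes> x, n) (inv z \<otimes> y, m)"
    using kc unfolding seq_cont_def by blast
   thus "(%l. of_real (weight z) * k (act (inv z) (\<sigma> l, n)) (act (inv z) (\<tau> l, m)))
    \<leadsto> of_real (weight z) * k (act (inv z) (x, n)) (act (inv z) (y, m))"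
    unfolding act_def fst_conv snd_conv by (rule tendsto_mult_left)
  qed
  show "AE z in \<mu>. norm (of_real (weight z) * k (act (inv z) (\<sigma> l, n)) (act (inv z) (\<tau> l, m))) <= weight z * S" for l
  proof (rule AE_I2)
   fix z assume "z \<in> space \<mu>"
   hence "cmod (k (act (inv z) (\<sigma> l, n)) (act (inv z) (\<tau> l, m))) <= S"
    using translate_bound in_carrier space_haar by simp
   thus "norm (of_real (weight z) * k (act (inv z) (\<sigma> l, n)) (act (inv z) (\<tau> l, m))) <= weight z * S"
    using weight_nonneg[of z] by (simp add: norm_mult mult_left_mono)
  qed
 qed
qed

end

theorem average_decomposition:
 assumes k: "psd GN k" "seq_cont k"
  and l: "psd GN l" "seq_cont l"
  and S: "\<And>p. p \<in> GN ==> Re (k p p) + Re (l p p) <= S"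
  and ap: "approximates (\<G>) d (%x y. \<phi> (inv y \<otimes> x)) (%p q. k p q - l p q)"
 shows "\<exists>K L. psd GN K & psd GN L &
   seq_cont K & seq_cont L &
   (\<forall>p\<in>GN. Re (K p p) + Re (L p p) <= S) &
   approximates (\<G>) d (%x y. \<phi> (inv y \<otimes> x)) (%p q. K p q - L p q) &
   (\<forall>g\<in>\<G>. psd GN (%p q. of_real (exp (c * d g \<one>)) * K p q - K (act g p) (act g q)) &
    psd GN (%p q. of_real (exp (c * d g \<one>)) * L p q - L (act g p) (act g q)))"
proof -
 have kS: "Re (k p p) <= S" and lS: "Re (l p p) <= S" if p: "p \<in> GN" for p
  using S[OF p] psd_diag(1)[OF k(1) p] psd_diag(1)[OF l(1) p] by linarith+
 note wi = weight_integrable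
 have eval: "Re (avg weight k p p) + Re (avg weight l p p) <= S" if p: "p \<in> GN" for p
 proof -
  let ?k = "%z. of_real (weight z) * k (act (inv z) p) (act (inv z) p)"
  let ?l = "%z. of_real (weight z) * l (act (inv z) p) (act (inv z) p)"
  have ik: "integrable \<mu> ?k" by (rule avg_integrable[OF k kS p p wi])
  have il: "integrable \<mu> ?l" by (rule avg_integrable[OF l lS p p wi])
  have "Re (avg weight k p p) + Re (avg weight l p p) = (LINT z|\<mu>. Re (?k z)) + (LINT z|\<mu>. Re (?l z))"
   unfolding avg_def by (simp only: integral_Re[OF ik] integral_Re[OF il])
  also have "... = (LINT z|\<mu>. Re (?k z) + Re (?l z))"
   by (rule Bochner_Integration.integral_add[symmetric]) (rule integrable_Re[OF ik], rule integrable_Re[OF il])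
  also have "... <= (LINT z|\<mu>. weight z * S)"
  proof (rule integral_mono)
   show "integrable \<mu> (%z. Re (?k z) + Re (?l z))"
    by (intro Bochner_Integration.integrable_add integrable_Re ik il)
   show "integrable \<mu> (%z. weight z * S)" using wi by simp
   fix z assume "z \<in> space \<mu>"
   hence "act (inv z) p \<in> GN" using act_closed[OF inv_closed p] space_haar by simp
   from mult_left_mono[OF S[OF this] weight_nonneg[of z]]
   show "Re (?k z) + Re (?l z) <= weight z * S" by (simp add: algebra_simps)
  qed
  also have "... = S" by (simp add: weight_integral)
  finally show ?thesis .
 qed
 have approx: "approximates (\<G>) d (%x y. \<phi> (inv y \<otimes> x)) (%p q. avg weight k p q - avg weight l p q)"
  unfolding approximates_def
 proof (intro ballI allI impI)
  fix x y n m e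
  assume xy: "x \<in> \<G>" "y \<in> \<G>"
   and e: "\<forall>u\<in>\<G>. \<forall>v\<in>\<G>. d x u < 1 / real (Suc n) --> d y v < 1 / real (Suc m) -->
     cmod (\<phi> (inv v \<otimes> u) - \<phi> (inv y \<otimes> x)) <= e"
  let ?p = "(x, n)" and ?q = "(y, m)"
  let ?k = "%z. of_real (weight z) * k (act (inv z) ?p) (act (inv z) ?q)"
  let ?l = "%z. of_real (weight z) * l (act (inv z) ?p) (act (inv z) ?q)"
  let ?c = "\<phi> (inv y \<otimes> x)"
  have pq: "?p \<in> GN" "?q \<in> GN" using xy by auto
  have ik: "integrable \<mu> ?k" by (rule avg_integrable[OF k kS pq wi])
  have il: "integrable \<mu> ?l" by (rule avg_integrable[OF l lS pq wi])
  have iw: "integrable \<mu> (%z. complex_of_real (weight z) * ?c)" using wi by simp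
  have "avg weight k ?p ?q - avg weight l ?p ?q - ?c
    = (LINT z|\<mu>. ?k z) - (LINT z|\<mu>. ?l z) - (LINT z|\<mu>. complex_of_real (weight z) * ?c)"
   unfolding avg_def by (simp add: weight_integral)
  also have "... = (LINT z|\<mu>. ?k z - ?l z - complex_of_real (weight z) * ?c)"
   using ik il iw by simp
  finally have eq: "avg weight k ?p ?q - avg weight l ?p ?q - ?c = (LINT z|\<mu>. ?k z - ?l z - complex_of_real (weight z) * ?c)" .
  have "cmod (LINT z|\<mu>. ?k z - ?l z - complex_of_real (weight z) * ?c)
    <= (LINT z|\<mu>. cmod (?k z - ?l z - complex_of_real (weight z) * ?c))"
   by (rule integral_norm_bound)
  also have "... <= (LINT z|\<mu>. weight z * e)"
  proof (rule integral_mono)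
   show "integrable \<mu> (%z. cmod (?k z - ?l z - complex_of_real (weight z) * ?c))"
    by (intro integrable_norm Bochner_Integration.integrable_diff ik il iw)
   show "integrable \<mu> (%z. weight z * e)" using wi by simp
   fix z assume "z \<in> space \<mu>"
   hence z: "z \<in> \<G>" using space_haar by simp
   let ?x = "inv z \<otimes> x" and ?y = "inv z \<otimes> y"
   have can: "inv (inv z \<otimes> v) \<otimes> (inv z \<otimes> u) = inv v \<otimes> u" if "u \<in> \<G>" "v \<in> \<G>" for u v
    using z that by (metis inv_closed inv_mult_group inv_solve_left' m_assoc m_closed)
   have "cmod (k (?x, n) (?y, m) - l (?x, n) (?y, m) - \<phi> (inv ?y \<otimes> ?x)) <= e"
   proof (rule ap[unfolded approximates_def, rule_format])
    show "?x \<in> \<G>" "?y \<in> \<G>" using z xy by auto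
    fix u v assume uv: "u \<in> \<G>" "v \<in> \<G>" "d ?x u < 1 / real (Suc n)" "d ?y v < 1 / real (Suc m)"
    have zz: "inv z \<otimes> (z \<otimes> t) = t" if "t \<in> \<G>" for t using z that by (simp add: m_assoc[symmetric])
    have "d ?x u = d x (z \<otimes> u)" "d ?y v = d y (z \<otimes> v)"
     using left_invariant[of "inv z" x "z \<otimes> u"] left_invariant[of "inv z" y "z \<otimes> v"] zz z xy uv by simp_all
    hence "cmod (\<phi> (inv (z \<otimes> v) \<otimes> (z \<otimes> u)) - ?c) <= e" using e uv z by simp
    moreover have "inv (z \<otimes> v) \<otimes> (z \<otimes> u) = inv v \<otimes> u"
     using can[of "z \<otimes> u" "z \<otimes> v"] zz uv z by simp
    ultimately show "cmod (\<phi> (inv v \<otimes> u) - \<phi> (inv ?y \<otimes> ?x)) <= e" by (simp only: can[OF xy])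
   qed
   hence "weight z * cmod (k (?x, n) (?y, m) - l (?x, n) (?y, m) - ?c) <= weight z * e"
    using weight_nonneg[of z] by (intro mult_left_mono) (simp_all only: can[OF xy])
   moreover have "?k z - ?l z - complex_of_real (weight z) * ?c
     = of_real (weight z) * (k (?x, n) (?y, m) - l (?x, n) (?y, m) - ?c)"
    by (simp add: act_def right_diff_distrib)
   ultimately show "norm (?k z - ?l z - complex_of_real (weight z) * ?c) <= weight z * e"
    using weight_nonneg[of z] by (simp add: norm_mult)
  qed
  also have "... = e" by (simp add: weight_integral)
  finally show "cmod (avg weight k ?p ?q - avg weight l ?p ?q - ?c) <= e" by (simp only: eq)
 qed
 show ?thesis
 proof (intro exI conjI ballI)
  show "psd GN (avg weight k)"
   by (rule psd_avg[OF k kS wi]) (use weight_nonneg in auto)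
  show "psd GN (avg weight l)"
   by (rule psd_avg[OF l lS wi]) (use weight_nonneg in auto)
  show "seq_cont (avg weight k)" by (rule seq_cont_avg[OF k kS])
  show "seq_cont (avg weight l)" by (rule seq_cont_avg[OF l lS])
  show "approximates (\<G>) d (%x y. \<phi> (inv y \<otimes> x)) (%p q. avg weight k p q - avg weight l p q)" by (rule approx)
  show "Re (avg weight k p p) + Re (avg weight l p p) <= S" if "p \<in> GN" for p by (rule eval[OF that])
  fix g assume g: "g \<in> \<G>"
  show "psd GN (%p q. of_real (exp (c * d g \<one>)) * avg weight k p q - avg weight k (act g p) (act g q))"
   by (rule avg_growth[OF k kS g])
  show "psd GN (%p q. of_real (exp (c * d g \<one>)) * avg weight l p q - avg weight l (act g p) (act g q))"
   by (rule avg_growth[OF l lS g])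
 qed
qed

end

section \<open>Complex inner product spaces\<close>

lemma complex_ring_simps [simp]:
 "carrier complex_ring = UNIV" "x \<otimes>\<^bsub>complex_ring\<^esub> y = x * y" "\<one>\<^bsub>complex_ring\<^esub> = 1"
 "\<zero>\<^bsub>complex_ring\<^esub> = 0" "x \<oplus>\<^bsub>complex_ring\<^esub> y = x + y"
 by (simp_all add: complex_ring_def)

lemma cring_complex_ring: "cring complex_ring"
proof (rule cringI)
 show "abelian_group complex_ring"
 proof (rule abelian_groupI)
  show "\<exists>y\<in>carrier complex_ring. y \<oplus>\<^bsub>complex_ring\<^esub> x = \<zero>\<^bsub>complex_ring\<^esub>" for x
   by (intro bexI[of _ "- x"]) auto
 qed (auto simp: algebra_simps)
 show "comm_monoid complex_ring" by (rule comm_monoidI) auto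
qed (auto simp: algebra_simps)

text \<open>The common setting of \<open>H\<^sup>n\<close>, \<open>L\<^sup>2\<close> and \<open>\<ell>\<^sup>2(Y)\<close>, which enter through inequalities between norms and inner products.\<close>

locale inner_space = Module.module complex_ring H for H (structure) +
 assumes cinner_add_left:
   "[|x \<in> carrier H; y \<in> carrier H; z \<in> carrier H|]
    ==> cinner H (x \<oplus> y) z = cinner H x z + cinner H y z"
  and cinner_smult_left:
   "[|x \<in> carrier H; y \<in> carrier H|] ==> cinner H (c \<odot> x) y = c * cinner H x y"
  and cinner_commute:
   "[|x \<in> carrier H; y \<in> carrier H|] ==> cinner H y x = cnj (cinner H x y)"
  and cinner_pos:
   "[|x \<in> carrier H; x ~= \<zero>|] ==> 0 < Re (cinner H x x)"
begin

abbreviation \<H> where "\<H> \<equiv> carrier H"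
abbreviation ip :: "'a => 'a => complex" where "ip \<equiv> cinner H"
abbreviation nm :: "'a => real" where "nm \<equiv> hnorm H"

lemma scale_closed [simp]: "x \<in> \<H> ==> c \<odot> x \<in> \<H>"
 using smult_closed[of c x] by simp

lemma scale_one [simp]: "x \<in> \<H> ==> 1 \<odot> x = x"
 using smult_one[of x] by simp

lemma scale_scale: "x \<in> \<H> ==> c \<odot> (e \<odot> x) = (c * e) \<odot> x"
 using smult_assoc1[of c e x] by simp

lemma scale_add_left: "x \<in> \<H> ==> (c + e) \<odot> x = c \<odot> x \<oplus> e \<odot> x"
 using smult_l_distr[of c e x] by simp

lemma scale_add_right: "[|x \<in> \<H>; y \<in> \<H>|] ==> c \<odot> (x \<oplus> y) = c \<odot> x \<oplus> c \<odot> y"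
 using smult_r_distr[of c x y] by simp

lemma scale_zero [simp]: "x \<in> \<H> ==> 0 \<odot> x = \<zero>"
 using smult_l_null[of x] by simp

lemma ip_add_right:
 assumes "x \<in> \<H>" "y \<in> \<H>" "z \<in> \<H>" shows "ip z (x \<oplus> y) = ip z x + ip z y"
proof -
 have "ip z (x \<oplus> y) = cnj (ip (x \<oplus> y) z)" using assms by (intro cinner_commute) auto
 also have "... = cnj (ip x z) + cnj (ip y z)" using assms by (simp add: cinner_add_left)
 also have "... = ip z x + ip z y" using assms cinner_commute[of x z] cinner_commute[of y z] by simp
 finally show ?thesis .
qed

lemma ip_smult_right:
 assumes "x \<in> \<H>" "z \<in> \<H>" shows "ip z (c \<odot> x) = cnj c * ip z x"
proof -
 have "ip z (c \<odot> x) = cnj (ip (c \<odot> x) z)" using assms by (intro cinner_commute) auto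
 also have "... = cnj c * cnj (ip x z)" using assms by (simp add: cinner_smult_left)
 also have "... = cnj c * ip z x" using assms cinner_commute[of x z] by simp
 finally show ?thesis .
qed

lemma ip_zero_left [simp]: "y \<in> \<H> ==> ip \<zero> y = 0"
 using cinner_smult_left[of \<zero> y 0] by simp

lemma ip_zero_right [simp]: "y \<in> \<H> ==> ip y \<zero> = 0"
 using cinner_commute[of \<zero> y] by simp

lemma uminus_eq: "x \<in> \<H> ==> \<ominus> x = (- 1) \<odot> x"
proof -
 assume x: "x \<in> \<H>"
 have "(-1) \<odot> x \<oplus> x = ((-1) + 1) \<odot> x" using scale_add_left[OF x, of "-1" 1] x by simp
 hence "(-1) \<odot> x \<oplus> x = \<zero>" using x by simp
 thus ?thesis using x by (intro M.minus_equality) auto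
qed

lemma minus_eq': "[|x \<in> \<H>; y \<in> \<H>|] ==> x \<ominus> y = x \<oplus> (- 1) \<odot> y"
 by (simp add: a_minus_def uminus_eq)

lemma ip_minus_left: "[|x \<in> \<H>; y \<in> \<H>; z \<in> \<H>|] ==> ip (x \<ominus> y) z = ip x z - ip y z"
 by (simp add: minus_eq' cinner_add_left cinner_smult_left)

lemma ip_self_nonneg: "x \<in> \<H> ==> 0 <= Re (ip x x)"
 using cinner_pos[of x] by (cases "x = \<zero>") auto

lemma nm_nonneg: "x \<in> \<H> ==> 0 <= nm x"
 by (simp add: hnorm_def ip_self_nonneg)

lemma nm_square: "x \<in> \<H> ==> (nm x)\<^sup>2 = Re (ip x x)"
 by (simp add: hnorm_def ip_self_nonneg)

lemma ip_self: "x \<in> \<H> ==> ip x x = of_real ((nm x)^2)"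
proof -
 assume x: "x \<in> \<H>"
 have "Im (ip x x) = 0" using arg_cong[OF cinner_commute[OF x x], of Im] by simp
 thus ?thesis using nm_square[OF x] by (simp add: complex_eq_iff del: of_real_power)
qed

lemma nm_eq_zero: "x \<in> \<H> ==> nm x = 0 \<longleftrightarrow> x = \<zero>"
 using cinner_pos[of x] by (cases "x = \<zero>") (simp_all add: hnorm_def)

lemma nm_zero [simp]: "nm \<zero> = 0" using nm_eq_zero[of \<zero>] by simp

lemma nm_scale: "x \<in> \<H> ==> nm (c \<odot> x) = cmod c * nm x"
proof -
 assume x: "x \<in> \<H>"
 have "ip (c \<odot> x) (c \<odot> x) = c * cnj c * ip x x" using x by (simp add: cinner_smult_left ip_smult_right)
 also have "... = of_real (cm2 c * (nm x)^2)" by (simp only: ip_self[OF x] complex_norm_square of_real_mult)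
 finally have "ip (c \<odot> x) (c \<odot> x) = of_real ((cmod c * nm x)^2)" by (simp add: power_mult_distrib)
 thus ?thesis unfolding hnorm_def[of H "c \<odot> x"] using nm_nonneg[OF x] by (simp del: of_real_power)
qed

lemma nm_add_square: "[|x \<in> \<H>; y \<in> \<H>|] ==> (nm (x \<oplus> y))\<^sup>2 = (nm x)^2 + 2 * Re (ip x y) + (nm y)^2"
 using cinner_commute[of x y] by (simp add: nm_square cinner_add_left ip_add_right)

lemma Cauchy_Schwarz: 
 assumes x: "x \<in> \<H>" and y: "y \<in> \<H>"
 shows "cmod (ip x y) <= nm x * nm y"
proof -
 have "cm2 (ip x y) <= (nm x)^2 * (nm y)^2"
 proof (rule discriminant_bound)
  fix t
  have "0 <= (nm (x \<oplus> cnj t \<odot> y))^2" by simp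
  also have "... = (nm x)^2 + 2 * Re (t * ip x y) + (cmod t * nm y)^2"
   using x y by (simp add: nm_add_square ip_smult_right nm_scale)
  finally show "0 <= (nm x)^2 + 2 * Re (t * ip x y) + cm2 t * (nm y)^2" by (simp add: power_mult_distrib)
 qed auto
 hence "cm2 (ip x y) <= (nm x * nm y)^2" by (simp add: power_mult_distrib)
 thus ?thesis using nm_nonneg[OF x] nm_nonneg[OF y] by (meson mult_nonneg_nonneg power2_le_imp_le)
qed

lemma nm_triangle:
 assumes x: "x \<in> \<H>" and y: "y \<in> \<H>" shows "nm (x \<oplus> y) <= nm x + nm y"
proof -
 have "(nm (x \<oplus> y))^2 <= (nm x + nm y)^2"
  using Cauchy_Schwarz[OF x y] complex_Re_le_cmod[of "ip x y"]
  by (simp add: nm_add_square[OF x y] power2_sum)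
 thus ?thesis using nm_nonneg[OF x] nm_nonneg[OF y] by (meson add_nonneg_nonneg power2_le_imp_le)
qed

lemma eq_if_ip_eq:
 assumes "u \<in> \<H>" "v \<in> \<H>" "\<And>h. h \<in> \<H> ==> ip u h = ip v h"
 shows "u = v"
proof -
 have "ip (u \<ominus> v) (u \<ominus> v) = 0" using assms by (simp add: ip_minus_left)
 hence "u \<ominus> v = \<zero>" using cinner_pos[of "u \<ominus> v"] assms by fastforce
 hence "u \<oplus> \<ominus> v = \<zero>" by (simp add: a_minus_def)
 hence "\<ominus> (\<ominus> v) = u" using assms by (intro M.minus_equality) auto
 thus ?thesis using assms by simp
qed

lemma nm_le_if_ip_le:
 assumes u: "u \<in> \<H>" and R: "\<And>h. h \<in> \<H> ==> cmod (ip u h) <= R * nm h"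
 shows "nm u <= R \<or> u = \<zero>"
proof (cases "nm u = 0")
 case True thus ?thesis using nm_eq_zero[OF u] by simp
next
 case False
 hence pos: "0 < nm u" using nm_nonneg[OF u] by simp
 have "(nm u)^2 <= R * nm u" using R[OF u] ip_self[OF u] nm_nonneg[OF u] by (simp add: norm_power)
 thus ?thesis using pos by (simp add: power2_eq_square)
qed

lemma ip_finsum_left:
 assumes "finite A" "f \<in> A \<rightarrow> \<H>" "y \<in> \<H>"
 shows "ip (\<Oplus>i\<in>A. f i) y = (\<Sum>i\<in>A. ip (f i) y)"
 using assms(1,2)
proof (induction A rule: finite_induct)
 case empty thus ?case using assms(3) by simp
next
 case (insert a A)
 hence "f a \<in> \<H>" "f \<in> A \<rightarrow> \<H>" by auto
 thus ?case using insert assms(3) by (simp add: M.finsum_insert cinner_add_left)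
qed

lemma ip_finsum_right:
 assumes "finite A" "f \<in> A \<rightarrow> \<H>" "y \<in> \<H>"
 shows "ip y (\<Oplus>i\<in>A. f i) = (\<Sum>i\<in>A. ip y (f i))"
 using assms(1,2)
proof (induction A rule: finite_induct)
 case empty thus ?case using assms(3) by simp
next
 case (insert a A)
 hence "f a \<in> \<H>" "f \<in> A \<rightarrow> \<H>" by auto
 thus ?case using insert assms(3) by (simp add: M.finsum_insert ip_add_right)
qed

lemma bounded_opD:
 assumes "bounded_op H A"
 shows "x \<in> \<H> ==> A x \<in> \<H>"
  and "[|x \<in> \<H>; y \<in> \<H>|] ==> A (x \<oplus> y) = A x \<oplus> A y"
  and "x \<in> \<H> ==> A (c \<odot> x) = c \<odot> A x"
  and "A \<in> extensional (\<H>)"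
 using assms unfolding bounded_op_def by (auto simp: PiE_iff)

lemma bounded_opI:
 assumes "A \<in> extensional (\<H>)" "\<And>x. x \<in> \<H> ==> A x \<in> \<H>"
  and "\<And>x y. [|x \<in> \<H>; y \<in> \<H>|] ==> A (x \<oplus> y) = A x \<oplus> A y"
  and "\<And>c x. x \<in> \<H> ==> A (c \<odot> x) = c \<odot> A x"
  and "\<And>x. x \<in> \<H> ==> nm (A x) <= K * nm x"
 shows "bounded_op H A"
 unfolding bounded_op_def PiE_iff using assms by (intro conjI exI[of _ K] ballI allI) auto

lemma bounded_op_of_zero:
 assumes "bounded_op H A" shows "A \<zero> = \<zero>"
proof -
 have "A (0 \<odot> \<zero>) = 0 \<odot> A \<zero>" by (rule bounded_opD(3)[OF assms]) simp
 thus ?thesis using bounded_opD(1)[OF assms, of \<zero>] by simp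
qed

lemma bounded_op_bound:
 assumes "bounded_op H A"
 obtains K where "0 <= K" "\<And>x. x \<in> \<H> ==> nm (A x) <= K * nm x"
proof -
 obtain K where K: "\<forall>x\<in>\<H>. nm (A x) <= K * nm x"
  using assms unfolding bounded_op_def by blast
 have "nm (A x) <= max K 0 * nm x" if x: "x \<in> \<H>" for x
  using K x mult_right_mono[OF max.cobounded1 nm_nonneg[OF x], of K 0] by fastforce
 thus ?thesis using that[of "max K 0"] by simp
qed

lemma opnorm_bdd:
 assumes "bounded_op H A" shows "bdd_above ((%x. nm (A x)) ` {x \<in> \<H>. nm x <= 1})"
proof -
 obtain K where K: "0 <= K" "\<And>x. x \<in> \<H> ==> nm (A x) <= K * nm x"
  using bounded_op_bound[OF assms] by blast
 show ?thesis
 proof (rule bdd_aboveI2)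
  fix x assume x: "x \<in> {x \<in> \<H>. nm x <= 1}"
  hence "nm (A x) <= K * nm x" using K(2) by simp
  also have "... <= K" using x K(1) by (simp add: mult_left_le)
  finally show "nm (A x) <= K" .
 qed
qed

lemma opnorm_upper:
 assumes A: "bounded_op H A" and x: "x \<in> \<H>"
 shows "nm (A x) <= opnorm H A * nm x"
proof (cases "x = \<zero>")
 case True
 thus ?thesis using bounded_op_of_zero[OF A] by simp
next
 case False
 hence pos: "0 < nm x" using nm_eq_zero[OF x] nm_nonneg[OF x] by simp
 let ?c = "complex_of_real (1 / nm x)"
 have "nm (?c \<odot> x) = 1" using pos by (simp add: nm_scale[OF x] norm_divide)
 hence "nm (A (?c \<odot> x)) <= opnorm H A"
  unfolding opnorm_def using x by (intro cSUP_upper opnorm_bdd[OF A]) simp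
 moreover have "nm (A (?c \<odot> x)) = nm (A x) / nm x"
  using bounded_opD[OF A] x pos by (simp add: nm_scale norm_divide)
 ultimately show ?thesis using pos by (simp add: pos_divide_le_eq)
qed

lemma opnorm_nonneg:
 assumes A: "bounded_op H A" shows "0 <= opnorm H A"
proof -
 have "nm (A \<zero>) <= opnorm H A"
  unfolding opnorm_def by (intro cSUP_upper opnorm_bdd[OF A]) simp
 thus ?thesis using nm_nonneg[OF bounded_opD(1)[OF A M.zero_closed]] by linarith
qed

lemma opnorm_le:
 assumes "0 <= K" "\<And>x. x \<in> \<H> ==> nm (A x) <= K * nm x"
 shows "opnorm H A <= K"
 unfolding opnorm_def
proof (rule cSUP_least)
 show "{x \<in> \<H>. nm x <= 1} ~= {}" using nm_zero by (metis (mono_tags, lifting) M.zero_closed empty_Collect_eq zero_le_one)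
 fix x assume x: "x \<in> {x \<in> \<H>. nm x <= 1}"
 hence "nm (A x) <= K * nm x" using assms by simp
 also have "... <= K" using x assms(1) by (simp add: mult_left_le)
 finally show "nm (A x) <= K" .
qed

lemma bounded_op_finsum:
 assumes A: "bounded_op H A" and F: "finite F" "f \<in> F \<rightarrow> \<H>"
 shows "A (\<Oplus>i\<in>F. f i) = (\<Oplus>i\<in>F. A (f i))"
 using F
proof (induction F rule: finite_induct)
 case empty
 show ?case using bounded_op_of_zero[OF A] by simp
next
 case (insert a F)
 hence f: "f a \<in> \<H>" "f \<in> F \<rightarrow> \<H>" by auto
 hence "(%i. A (f i)) \<in> F \<rightarrow> \<H>" using bounded_opD(1)[OF A] by auto
 thus ?case using insert f bounded_opD[OF A] by (simp add: M.finsum_insert)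
qed

lemma BH_simps:
 "carrier (BH H) = {A. bounded_op H A}"
 "A \<oplus>\<^bsub>BH H\<^esub> B = (\<lambda>x\<in>\<H>. A x \<oplus> B x)"
 "c \<odot>\<^bsub>BH H\<^esub> A = (\<lambda>x\<in>\<H>. c \<odot> A x)"
 "A \<otimes>\<^bsub>BH H\<^esub> B = compose (\<H>) A B"
 "\<one>\<^bsub>BH H\<^esub> = (\<lambda>x\<in>\<H>. x)"
 "\<zero>\<^bsub>BH H\<^esub> = (\<lambda>x\<in>\<H>. \<zero>)"
 by (simp_all add: BH_def)

lemma bounded_op_add:
 assumes A: "bounded_op H A" and B: "bounded_op H B"
 shows "bounded_op H (\<lambda>x\<in>\<H>. A x \<oplus> B x)"
proof -
 obtain K where K: "0 <= K" "\<And>x. x \<in> \<H> ==> nm (A x) <= K * nm x"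
  using bounded_op_bound[OF A] by blast
 obtain L where L: "0 <= L" "\<And>x. x \<in> \<H> ==> nm (B x) <= L * nm x"
  using bounded_op_bound[OF B] by blast
 note AB = bounded_opD[OF A] bounded_opD[OF B]
 show ?thesis
 proof (rule bounded_opI[where K = "K + L"])
  fix x y assume xy: "x \<in> \<H>" "y \<in> \<H>"
  show "(\<lambda>x\<in>\<H>. A x \<oplus> B x) (x \<oplus> y) = (\<lambda>x\<in>\<H>. A x \<oplus> B x) x \<oplus> (\<lambda>x\<in>\<H>. A x \<oplus> B x) y"
   using xy AB by (simp add: M.a_ac)
 next
  fix x assume x: "x \<in> \<H>"
  have "nm (A x \<oplus> B x) <= nm (A x) + nm (B x)" using x AB by (intro nm_triangle) auto
  also have "... <= (K + L) * nm x" using K(2)[OF x] L(2)[OF x] by (simp add: distrib_right)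
  finally show "nm ((\<lambda>x\<in>\<H>. A x \<oplus> B x) x) <= (K + L) * nm x" using x by simp
 qed (use AB in \<open>auto simp: scale_add_right\<close>)
qed

lemma bounded_op_scale:
 assumes A: "bounded_op H A"
 shows "bounded_op H (\<lambda>x\<in>\<H>. c \<odot> A x)"
proof -
 obtain K where K: "0 <= K" "\<And>x. x \<in> \<H> ==> nm (A x) <= K * nm x"
  using bounded_op_bound[OF A] by blast
 note AB = bounded_opD[OF A]
 show ?thesis
 proof (rule bounded_opI[where K = "cmod c * K"])
  fix x assume x: "x \<in> \<H>"
  show "nm ((\<lambda>x\<in>\<H>. c \<odot> A x) x) <= cmod c * K * nm x"
   using x AB K(2)[OF x] by (simp add: nm_scale mult.assoc mult_left_mono)
 qed (use AB in \<open>auto simp: scale_add_right scale_scale mult.commute\<close>)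
qed

lemma bounded_op_zero: "bounded_op H (\<lambda>x\<in>\<H>. \<zero>)"
 by (rule bounded_opI[where K = 0]) (auto simp: scale_add_right[of \<zero> \<zero>, symmetric] intro!: eq_if_ip_eq simp: cinner_smult_left)

lemma op_eqI:
 assumes "bounded_op H A" "bounded_op H B" "\<And>x. x \<in> \<H> ==> A x = B x"
 shows "A = B"
 by (rule extensionalityI[OF bounded_opD(4)[OF assms(1)] bounded_opD(4)[OF assms(2)] assms(3)])

lemma BH_add_closed: "[|A \<in> carrier (BH H); B \<in> carrier (BH H)|] ==> A \<oplus>\<^bsub>BH H\<^esub> B \<in> carrier (BH H)"
 by (simp add: BH_simps bounded_op_add)

lemma BH_scale_closed: "A \<in> carrier (BH H) ==> c \<odot>\<^bsub>BH H\<^esub> A \<in> carrier (BH H)"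
 by (simp add: BH_simps bounded_op_scale)

lemma BH_abelian_monoid: "abelian_monoid (BH H)"
proof (rule abelian_monoidI)
 fix A B C assume ABC: "A \<in> carrier (BH H)" "B \<in> carrier (BH H)" "C \<in> carrier (BH H)"
 hence b: "bounded_op H A" "bounded_op H B" "bounded_op H C" by (simp_all add: BH_simps)
 note D = bounded_opD[OF b(1)] bounded_opD[OF b(2)] bounded_opD[OF b(3)]
 show "A \<oplus>\<^bsub>BH H\<^esub> B \<oplus>\<^bsub>BH H\<^esub> C = A \<oplus>\<^bsub>BH H\<^esub> (B \<oplus>\<^bsub>BH H\<^esub> C)"
  using D by (auto simp: BH_simps M.a_assoc intro!: restrict_ext)
 show "A \<oplus>\<^bsub>BH H\<^esub> B = B \<oplus>\<^bsub>BH H\<^esub> A"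
  using D by (auto simp: BH_simps M.a_comm intro!: restrict_ext)
next
 fix A assume "A \<in> carrier (BH H)"
 hence b: "bounded_op H A" by (simp add: BH_simps)
 note D = bounded_opD[OF b]
 show "\<zero>\<^bsub>BH H\<^esub> \<oplus>\<^bsub>BH H\<^esub> A = A"
  using D by (intro extensionalityI[of _ "\<H>"]) (auto simp: BH_simps)
qed (auto simp: BH_add_closed, simp add: BH_simps bounded_op_zero)

lemma BH_finsum_closed: "f \<in> F \<rightarrow> carrier (BH H) ==> (\<Oplus>\<^bsub>BH H\<^esub>i\<in>F. f i) \<in> carrier (BH H)"
 using abelian_monoid.finsum_closed[OF BH_abelian_monoid] by blast

lemma BH_finsum_apply:
 assumes F: "finite F" "f \<in> F \<rightarrow> carrier (BH H)" and x: "x \<in> \<H>" and y: "y \<in> \<H>"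
 shows "ip ((\<Oplus>\<^bsub>BH H\<^esub>i\<in>F. f i) x) y = (\<Sum>i\<in>F. ip (f i x) y)"
 using F
proof (induction F rule: finite_induct)
 case empty
 thus ?case using x y by (simp add: abelian_monoid.finsum_empty[OF BH_abelian_monoid] BH_simps)
next
 case (insert a F)
 hence f: "f a \<in> carrier (BH H)" "f \<in> F \<rightarrow> carrier (BH H)" by auto
 hence c: "f a x \<in> \<H>" "(\<Oplus>\<^bsub>BH H\<^esub>i\<in>F. f i) x \<in> \<H>"
  using BH_finsum_closed[OF f(2)] bounded_opD(1) x by (auto simp: BH_simps)
 show ?case
  using insert f c x y
  by (simp add: abelian_monoid.finsum_insert[OF BH_abelian_monoid] BH_simps(2) cinner_add_left)
qed

lemma op_eq_if_ip_eq:
 assumes A: "bounded_op H A" and B: "bounded_op H B"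
  and "\<And>x y. [|x \<in> \<H>; y \<in> \<H>|] ==> ip (A x) y = ip (B x) y"
 shows "A = B"
 using assms bounded_opD(1) by (intro op_eqI eq_if_ip_eq) auto

end

section \<open>Spaces of square summable sequences\<close>

text \<open>Sequences supported in \<open>I\<close>; the index set is the set of nonzero steps of a Gram--Schmidt process, so finite and infinite dimensions are treated alike.\<close>

definition l2 :: "nat set => (nat => complex) set"
 where "l2 I = {f. (\<forall>i. i \<notin> I --> f i = 0) & summable (%i. cm2 (f i))}"

text \<open>Arguments outside the space are replaced by zero, so that the distance on the carrier comes from total operations and satisfies the metric axioms, symmetry and nonnegativity included, for arbitrary arguments.\<close>

definition l2_proj :: "nat set => (nat => complex) => nat => complex"
 where "l2_proj I f = (if f \<in> l2 I then f else (%_. 0))"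

definition Ltwo :: "nat set => (nat => complex) hilbert"
 where "Ltwo I = \<lparr>carrier = l2 I, mult = undefined, one = undefined, zero = (%_. 0),
   add = (%f g i. l2_proj I f i + l2_proj I g i),
   smult = (%c f i. c * l2_proj I f i),
   cinner = (%f g. \<Sum>i. l2_proj I f i * cnj (l2_proj I g i))\<rparr>"

abbreviation l2n where "l2n I \<equiv> hnorm (Ltwo I)"

lemma l2_memI:
 assumes "\<And>i. i \<notin> I ==> f i = 0" "\<And>n. (\<Sum>i<n. cm2 (f i)) <= B"
 shows "f \<in> l2 I" and "(\<Sum>i. cm2 (f i)) <= B"
proof -
 have "summable (%i. cm2 (f i))" by (rule summableI_nonneg_bounded[OF _ assms(2)]) simp
 thus "f \<in> l2 I" "(\<Sum>i. cm2 (f i)) <= B"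
  using assms by (auto simp: l2_def intro: suminf_le_const)
qed

lemma l2_summable: "f \<in> l2 I ==> summable (%i. cm2 (f i))" by (simp add: l2_def)

lemma l2_outside: "f \<in> l2 I ==> i \<notin> I ==> f i = 0" by (simp add: l2_def)

lemma cmod_mult_le_squares: "cmod (a * cnj b) <= cm2 a + cm2 b"
proof -
 have "0 <= (cmod a - cmod b)^2 + cm2 a + cm2 b" by simp
 thus ?thesis by (simp add: norm_mult power2_diff)
qed

lemma cmod_add_square_le: "cm2 (a + b) <= 2 * cm2 a + 2 * cm2 b"
proof -
 have "cm2 (a + b) <= (cmod a + cmod b)^2" by (intro power_mono norm_triangle_ineq) simp
 also have "... <= (cmod a + cmod b)^2 + (cmod a - cmod b)^2" by simp
 also have "... = 2 * cm2 a + 2 * cm2 b" by (simp add: power2_eq_square algebra_simps)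
 finally show ?thesis .
qed

lemma l2_mult_summable:
 assumes "f \<in> l2 I" "g \<in> l2 J" shows "summable (%i. f i * cnj (g i))"
 by (rule summable_comparison_test'[OF summable_add[OF l2_summable[OF assms(1)] l2_summable[OF assms(2)]]])
  (use cmod_mult_le_squares in auto)

lemma l2_zero: "(%_. 0) \<in> l2 I" by (simp add: l2_def)

lemma l2_add: assumes "f \<in> l2 I" "g \<in> l2 I" shows "(%i. f i + g i) \<in> l2 I"
proof -
 have "summable (%i. cm2 (f i + g i))"
  by (rule summable_comparison_test'[OF summable_add[OF summable_mult[OF l2_summable[OF assms(1)], of 2] summable_mult[OF l2_summable[OF assms(2)], of 2]]])
   (use cmod_add_square_le in auto)
 thus ?thesis using assms by (auto simp: l2_def)
qed

lemma l2_scale: assumes "f \<in> l2 I" shows "(%i. c * f i) \<in> l2 I"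
 using summable_mult[OF l2_summable[OF assms], of "cm2 c"] assms
 by (auto simp: l2_def norm_mult power_mult_distrib)

lemma l2_diff: assumes "f \<in> l2 I" "g \<in> l2 I" shows "(%i. f i - g i) \<in> l2 I"
 using l2_add[OF assms(1) l2_scale[OF assms(2), of "-1"]] by simp

lemma l2_sum: "(\<And>p. p \<in> F ==> v p \<in> l2 I) ==> (%i. \<Sum>p\<in>F. c p * v p i) \<in> l2 I"
proof (induction F rule: infinite_finite_induct)
 case (insert p F)
 thus ?case using l2_add[OF l2_scale[of "v p" I "c p"], of "%i. \<Sum>p\<in>F. c p * v p i"] by simp
qed (simp_all add: l2_zero)

lemma l2_proj_id [simp]: "f \<in> l2 I ==> l2_proj I f = f" by (simp add: l2_proj_def)

lemma l2_proj_mem: "l2_proj I f \<in> l2 I" by (simp add: l2_proj_def l2_zero)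

lemma Ltwo_simps:
 "carrier (Ltwo I) = l2 I" "\<zero>\<^bsub>Ltwo I\<^esub> = (%_. 0)"
 "f \<oplus>\<^bsub>Ltwo I\<^esub> g = (%i. l2_proj I f i + l2_proj I g i)"
 "c \<odot>\<^bsub>Ltwo I\<^esub> f = (%i. c * l2_proj I f i)"
 "cinner (Ltwo I) f g = (\<Sum>i. l2_proj I f i * cnj (l2_proj I g i))"
 by (simp_all add: Ltwo_def)

lemma l2_abelian_group: "abelian_group (Ltwo I)"
proof (rule abelian_groupI)
 fix f assume f: "f \<in> carrier (Ltwo I)"
 hence "(%i. - f i) \<in> l2 I" using l2_scale[of f I "-1"] by (simp add: Ltwo_simps)
 thus "\<exists>g\<in>carrier (Ltwo I). g \<oplus>\<^bsub>Ltwo I\<^esub> f = \<zero>\<^bsub>Ltwo I\<^esub>"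
  using f by (intro bexI[of _ "%i. - f i"]) (auto simp: Ltwo_simps)
qed (auto simp: Ltwo_simps l2_add l2_zero fun_eq_iff algebra_simps)

lemma l2_inner_self: "f \<in> l2 I ==> cinner (Ltwo I) f f = of_real (\<Sum>i. cm2 (f i))"
proof -
 assume f: "f \<in> l2 I"
 have "cinner (Ltwo I) f f = (\<Sum>i. of_real (cm2 (f i)))"
  using f by (simp only: Ltwo_simps l2_proj_id complex_norm_square)
 also have "... = of_real (\<Sum>i. cm2 (f i))" by (rule suminf_of_real[OF l2_summable[OF f], symmetric])
 finally show ?thesis .
qed

lemma l2_inner_space: "inner_space (Ltwo I)"
proof -
 have "Module.module complex_ring (Ltwo I)"
  by (rule moduleI[OF cring_complex_ring l2_abelian_group])
   (auto simp: Ltwo_simps l2_scale l2_add fun_eq_iff algebra_simps)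
 thus ?thesis
 proof (rule inner_space.intro, unfold_locales)
  fix f g h assume "f \<in> carrier (Ltwo I)" "g \<in> carrier (Ltwo I)" "h \<in> carrier (Ltwo I)"
  hence m: "f \<in> l2 I" "g \<in> l2 I" "h \<in> l2 I" by (simp_all add: Ltwo_simps)
  show "cinner (Ltwo I) (f \<oplus>\<^bsub>Ltwo I\<^esub> g) h = cinner (Ltwo I) f h + cinner (Ltwo I) g h"
   using suminf_add[OF l2_mult_summable[OF m(1,3)] l2_mult_summable[OF m(2,3)]] m l2_add[OF m(1,2)]
   by (simp add: Ltwo_simps algebra_simps)
 next
  fix f g c assume "f \<in> carrier (Ltwo I)" "g \<in> carrier (Ltwo I)"
  hence m: "f \<in> l2 I" "g \<in> l2 I" by (simp_all add: Ltwo_simps)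
  show "cinner (Ltwo I) (c \<odot>\<^bsub>Ltwo I\<^esub> f) g = c * cinner (Ltwo I) f g"
   using suminf_mult[OF l2_mult_summable[OF m], of c] m l2_scale[OF m(1), of c]
   by (simp add: Ltwo_simps algebra_simps)
 next
  fix f g assume "f \<in> carrier (Ltwo I)" "g \<in> carrier (Ltwo I)"
  hence m: "f \<in> l2 I" "g \<in> l2 I" by (simp_all add: Ltwo_simps)
  have "(%i. cnj (f i * cnj (g i))) sums cnj (\<Sum>i. f i * cnj (g i))"
   using summable_sums[OF l2_mult_summable[OF m]] by (simp only: sums_cnj)
  thus "cinner (Ltwo I) g f = cnj (cinner (Ltwo I) f g)"
   using m by (simp add: Ltwo_simps sums_iff mult.commute)
 next
  fix f assume f: "f \<in> carrier (Ltwo I)" "f ~= \<zero>\<^bsub>Ltwo I\<^esub>"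
  hence m: "f \<in> l2 I" by (simp add: Ltwo_simps)
  obtain i where i: "f i ~= 0" using f(2) by (auto simp: Ltwo_simps)
  have "0 < (\<Sum>i. cm2 (f i))"
   by (rule suminf_pos2[OF l2_summable[OF m], of i]) (use i in auto)
  thus "0 < Re (cinner (Ltwo I) f f)" by (simp add: l2_inner_self[OF m])
 qed
qed

context
 fixes I :: "nat set"
begin

interpretation H: inner_space "Ltwo I" by (rule l2_inner_space)

lemma l2_norm_square: "f \<in> l2 I ==> (l2n I f)\<^sup>2 = (\<Sum>i. cm2 (f i))"
 using H.nm_square[of f] l2_inner_self[of f I] by (simp add: Ltwo_simps(1))

lemma l2_norm_leI:
 assumes "\<And>i. i \<notin> I ==> f i = 0" "\<And>n. (\<Sum>i<n. cm2 (f i)) <= B\<^sup>2" "0 <= B"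
 shows "f \<in> l2 I" "l2n I f <= B"
proof -
 show f: "f \<in> l2 I" using l2_memI[of I f "B\<^sup>2"] assms by blast
 have "(l2n I f)^2 <= B\<^sup>2" using l2_norm_square[OF f] l2_memI(2)[of I f "B\<^sup>2"] assms by simp
 thus "l2n I f <= B" using assms(3) by (rule power2_le_imp_le)
qed

lemma l2_partial_sum_le: "f \<in> l2 I ==> finite E ==> (\<Sum>i\<in>E. cm2 (f i)) <= (l2n I f)^2"
 unfolding l2_norm_square by (rule sum_le_suminf[OF l2_summable]) auto

lemma l2_coord_le: "f \<in> l2 I ==> cmod (f i) <= l2n I f"
proof (rule power2_le_imp_le)
 assume f: "f \<in> l2 I"
 show "cm2 (f i) <= (l2n I f)^2" using l2_partial_sum_le[OF f, of "{i}"] by simp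
 show "0 <= l2n I f" using H.nm_nonneg[of f] f by (simp add: Ltwo_simps(1))
qed

lemma l2_neg: "\<ominus>\<^bsub>Ltwo I\<^esub> f = (%i. - l2_proj I f i)"
proof -
 have n: "(%i. - l2_proj I f i) \<in> l2 I" using l2_scale[OF l2_proj_mem, of "-1" I f] by simp
 have "(THE y. y \<in> l2 I & f \<oplus>\<^bsub>Ltwo I\<^esub> y = (%_. 0) & y \<oplus>\<^bsub>Ltwo I\<^esub> f = (%_. 0)) = (%i. - l2_proj I f i)"
 proof (rule the_equality)
  show "(%i. - l2_proj I f i) \<in> l2 I & f \<oplus>\<^bsub>Ltwo I\<^esub> (%i. - l2_proj I f i) = (%_. 0) &
    (%i. - l2_proj I f i) \<oplus>\<^bsub>Ltwo I\<^esub> f = (%_. 0)"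
   using n by (simp add: Ltwo_simps)
  fix y assume "y \<in> l2 I & f \<oplus>\<^bsub>Ltwo I\<^esub> y = (%_. 0) & y \<oplus>\<^bsub>Ltwo I\<^esub> f = (%_. 0)"
  hence y: "y \<in> l2 I" "y \<oplus>\<^bsub>Ltwo I\<^esub> f = (%_. 0)" by auto
  hence "y i + l2_proj I f i = 0" for i by (simp add: Ltwo_simps fun_eq_iff)
  thus "y = (%i. - l2_proj I f i)" by (simp add: fun_eq_iff eq_neg_iff_add_eq_0)
 qed
 thus ?thesis by (simp add: a_inv_def m_inv_def Ltwo_simps(1,2))
qed

lemma l2_minus: "f \<ominus>\<^bsub>Ltwo I\<^esub> g = (%i. l2_proj I f i - l2_proj I g i)"
proof -
 have "(%i. - l2_proj I g i) \<in> l2 I" using l2_scale[OF l2_proj_mem, of "-1" I g] by simp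
 thus ?thesis by (simp add: a_minus_def l2_neg Ltwo_simps(3))
qed

lemma l2_hdist: "hdist (Ltwo I) f g = l2n I (%i. l2_proj I f i - l2_proj I g i)"
 by (simp add: hdist_def l2_minus)

lemma l2_norm_minus_commute:
 assumes "f \<in> l2 I" "g \<in> l2 I"
 shows "l2n I (%i. f i - g i) = l2n I (%i. g i - f i)"
proof -
 have "(l2n I (%i. f i - g i))^2 = (l2n I (%i. g i - f i))^2"
  using assms by (simp add: l2_norm_square l2_diff norm_minus_commute)
 thus ?thesis
  using H.nm_nonneg[of "%i. f i - g i"] H.nm_nonneg[of "%i. g i - f i"] assms
  by (simp add: Ltwo_simps(1) l2_diff power2_eq_iff_nonneg)
qed

lemma l2_norm_triangle:
 assumes "f \<in> l2 I" "g \<in> l2 I"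
 shows "l2n I (%i. f i + g i) <= l2n I f + l2n I g"
 using H.nm_triangle[of f g] assms by (simp add: Ltwo_simps)

lemma l2_norm_scale: "f \<in> l2 I ==> l2n I (%i. c * f i) = cmod c * l2n I f"
 using H.nm_scale[of f c] by (simp add: Ltwo_simps)

lemma l2_norm_nonneg: "f \<in> l2 I ==> 0 <= l2n I f"
 using H.nm_nonneg[of f] by (simp add: Ltwo_simps)

lemma l2_norm_eq_0: "f \<in> l2 I ==> l2n I f = 0 \<longleftrightarrow> f = (%_. 0)"
 using H.nm_eq_zero[of f] by (simp add: Ltwo_simps)

lemma l2_Metric_space: "Metric_space (carrier (Ltwo I)) (hdist (Ltwo I))"
proof
 fix f g h
 note pm = l2_proj_mem[of I]
 show "0 <= hdist (Ltwo I) f g" unfolding l2_hdist by (intro l2_norm_nonneg l2_diff pm)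
 show "hdist (Ltwo I) f g = hdist (Ltwo I) g f"
  unfolding l2_hdist by (intro l2_norm_minus_commute pm)
 assume "f \<in> carrier (Ltwo I)" "g \<in> carrier (Ltwo I)"
 hence fg: "f \<in> l2 I" "g \<in> l2 I" by (simp_all add: Ltwo_simps)
 show "hdist (Ltwo I) f g = 0 \<longleftrightarrow> f = g"
  using fg by (simp add: l2_hdist l2_norm_eq_0 l2_diff fun_eq_iff)
 assume "h \<in> carrier (Ltwo I)"
 hence h: "h \<in> l2 I" by (simp add: Ltwo_simps)
 show "hdist (Ltwo I) f h <= hdist (Ltwo I) f g + hdist (Ltwo I) g h"
  using l2_norm_triangle[OF l2_diff[OF fg] l2_diff[OF fg(2) h]] fg h by (simp add: l2_hdist)
qed

lemma l2_complete: "Metric_space.mcomplete (carrier (Ltwo I)) (hdist (Ltwo I))"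
proof -
 interpret M: Metric_space "carrier (Ltwo I)" "hdist (Ltwo I)" by (rule l2_Metric_space)
 show ?thesis unfolding M.mcomplete_def
 proof (intro allI impI)
  fix \<sigma> assume C: "M.MCauchy \<sigma>"
  have mem: "\<sigma> n \<in> l2 I" for n 
  proof -
   have "range \<sigma> \<subseteq> carrier (Ltwo I)" using C unfolding M.MCauchy_def by blast
   thus ?thesis by (auto simp: Ltwo_simps(1))
  qed
  have cau: "\<exists>N. \<forall>n m. N <= n --> N <= m --> l2n I (%i. \<sigma> n i - \<sigma> m i) < e" if "0 < e" for e
   using C that unfolding M.MCauchy_def l2_hdist l2_proj_id[OF mem] by blast
  have "Cauchy (%n. \<sigma> n i)" for i
  proof (rule CauchyI)
   fix e :: real assume "0 < e"
   then obtain N where N: "\<forall>n m. N <= n --> N <= m --> l2n I (%i. \<sigma> n i - \<sigma> m i) < e" using cau by blast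
   show "\<exists>M. \<forall>m\<ge>M. \<forall>n\<ge>M. norm (\<sigma> m i - \<sigma> n i) < e"
    using N l2_coord_le[OF l2_diff[OF mem mem]] by (intro exI[of _ N]) (meson le_less_trans)
  qed
  hence "\<exists>l. (%n. \<sigma> n i) \<leadsto> l" for i using Cauchy_convergent_iff convergent_def by blast
  then obtain f where f: "\<And>i. (%n. \<sigma> n i) \<leadsto> f i" by metis
  have f0: "f i = 0" if "i \<notin> I" for i
   using f[of i] l2_outside[OF mem that] by (simp add: LIMSEQ_const_iff)
  have close: "(%i. \<sigma> n i - f i) \<in> l2 I & l2n I (%i. \<sigma> n i - f i) <= e"
   if N: "\<forall>n m. N <= n --> N <= m --> l2n I (%i. \<sigma> n i - \<sigma> m i) < e" and n: "N <= n" and e: "0 < e" for N n e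
  proof -
   have "(\<Sum>i<k. cm2 (\<sigma> n i - f i)) <= e\<^sup>2" for k
   proof (rule tendsto_upperbound)
    show "(%m. \<Sum>i<k. cm2 (\<sigma> n i - \<sigma> m i)) \<leadsto> (\<Sum>i<k. cm2 (\<sigma> n i - f i))"
     by (intro tendsto_intros f)
    show "\<forall>\<^sub>F m in sequentially. (\<Sum>i<k. cm2 (\<sigma> n i - \<sigma> m i)) <= e\<^sup>2"
     unfolding eventually_sequentially
    proof (intro exI[of _ N] allI impI)
     fix m assume m: "N <= m"
     have "(\<Sum>i<k. cm2 (\<sigma> n i - \<sigma> m i)) <= (l2n I (%i. \<sigma> n i - \<sigma> m i))^2"
      by (rule l2_partial_sum_le[OF l2_diff[OF mem mem]]) simp
     also have "... <= e\<^sup>2"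
      using N n m l2_norm_nonneg[OF l2_diff[OF mem mem]] by (intro power_mono) (auto simp: less_imp_le)
     finally show "(\<Sum>i<k. cm2 (\<sigma> n i - \<sigma> m i)) <= e\<^sup>2" .
    qed
   qed simp
   thus ?thesis
    using l2_norm_leI[of "%i. \<sigma> n i - f i" e] f0 l2_outside[OF mem] e by simp
  qed
  obtain N1 where N1: "\<forall>n m. N1 <= n --> N1 <= m --> l2n I (%i. \<sigma> n i - \<sigma> m i) < 1" using cau[of 1] by auto
  have fm: "f \<in> l2 I"
   using l2_diff[OF mem[of N1], of "%i. \<sigma> N1 i - f i"] close[OF N1 order_refl] by simp
  show "\<exists>x. limitin M.mtopology \<sigma> x sequentially"
  proof (intro exI[of _ f])
   show "limitin M.mtopology \<sigma> f sequentially"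
    unfolding M.limit_metric_sequentially
   proof (intro conjI allI impI)
    show "f \<in> carrier (Ltwo I)" using fm by (simp add: Ltwo_simps)
    fix e :: real assume e: "0 < e"
    then obtain N where N: "\<forall>n m. N <= n --> N <= m --> l2n I (%i. \<sigma> n i - \<sigma> m i) < e / 2" using cau[of "e/2"] by auto
    show "\<exists>N. \<forall>n\<ge>N. \<sigma> n \<in> carrier (Ltwo I) & hdist (Ltwo I) (\<sigma> n) f < e"
    proof (intro exI[of _ N] allI impI conjI)
     fix n assume n: "N <= n"
     show "\<sigma> n \<in> carrier (Ltwo I)" using mem by (simp add: Ltwo_simps)
     show "hdist (Ltwo I) (\<sigma> n) f < e"
      using close[OF N n] e fm mem by (simp add: l2_hdist)
    qed
   qed
  qed
 qed
qed

theorem l2_hilbert: "complex_hilbert_space (Ltwo I)"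
proof -
 have "module complex_ring (Ltwo I)"
  by (rule inner_space.axioms(1)[OF l2_inner_space])
 moreover have "complex_hilbert_space_axioms (Ltwo I)"
  by (rule complex_hilbert_space_axioms.intro)
   (fact H.cinner_add_left H.cinner_smult_left H.cinner_commute H.cinner_pos l2_complete)+
 ultimately show ?thesis by (rule complex_hilbert_space.intro)
qed

end

section \<open>Kolmogorov decompositions and lifted operators\<close>

text \<open>The squared distance of the vectors that represent two points.\<close>

definition kdist :: "('x => 'x => complex) => 'x => 'x => real"
 where "kdist k p q = Re (k p p) + Re (k q q) - 2 * Re (k p q)"

primrec residual :: "('x => 'x => complex) => (nat => 'x) => nat => 'x => 'x => complex" where
 "residual K e 0 = K"
| "residual K e (Suc n) = (%p q. residual K e n p q -
   residual K e n p (e n) * residual K e n (e n) q / residual K e n (e n) (e n))"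

text \<open>The coordinate of the \<open>n\<close>th orthonormal vector obtained from the sequence \<open>e\<close>; it is zero, by division by zero, where a vector depends on the previous ones.\<close>

definition feature :: "('x => 'x => complex) => (nat => 'x) => 'x => nat => complex"
 where "feature K e p n = residual K e n p (e n) / of_real (sqrt (Re (residual K e n (e n) (e n))))"

definition pivots :: "('x => 'x => complex) => (nat => 'x) => nat set"
 where "pivots K e = {n. residual K e n (e n) (e n) ~= 0}"

context
 fixes X :: "'x set" and K :: "'x => 'x => complex" and e :: "nat => 'x"
 assumes K: "psd X K" and e: "\<And>n. e n \<in> X"
begin

lemma psd_residual: "psd X (residual K e n)"
proof (induction n)
 case 0 thus ?case using K by simp
next
 case (Suc n) thus ?case using psd_Schur_complement[OF Suc e[of n]] by simp
qed

lemma residual_step: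
 assumes p: "p \<in> X" and q: "q \<in> X"
 shows "residual K e n p q = feature K e p n * cnj (feature K e q n) + residual K e (Suc n) p q"
proof -
 let ?r = "residual K e n" and ?\<kappa> = "Re (residual K e n (e n) (e n))"
 note R = psd_residual[of n]
 have \<kappa>: "0 <= ?\<kappa>" by (rule psd_diag(1)[OF R e])
 have fc: "cnj (feature K e q n) = ?r (e n) q / of_real (sqrt ?\<kappa>)"
  unfolding psd_sym[OF R q e[of n]] feature_def by simp
 have "feature K e p n * cnj (feature K e q n) = ?r p (e n) * ?r (e n) q / (of_real (sqrt ?\<kappa>) * of_real (sqrt ?\<kappa>))"
  unfolding fc by (simp only: feature_def times_divide_times_eq)
 also have "complex_of_real (sqrt ?\<kappa>) * of_real (sqrt ?\<kappa>) = of_real ?\<kappa>"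
  using \<kappa> by (simp only: of_real_mult[symmetric] real_sqrt_mult_self abs_of_nonneg)
 also have "complex_of_real ?\<kappa> = ?r (e n) (e n)" by (rule psd_diag_eq[OF R e, symmetric])
 finally show ?thesis by simp
qed

lemma residual_sum:
 assumes "p \<in> X" "q \<in> X"
 shows "K p q = (\<Sum>i<n. feature K e p i * cnj (feature K e q i)) + residual K e n p q"
proof (induction n)
 case (Suc n)
 thus ?case unfolding residual_step[OF assms, of n] by (simp only: sum.lessThan_Suc add.assoc)
qed simp

lemma residual_zero_row:
 assumes "q \<in> X" and "m < n"
 shows "residual K e n (e m) q = 0"
 using assms
proof (induction n arbitrary: q)
 case (Suc n)
 show ?case
 proof (cases "m = n")
  case True
  show ?thesis
  proof (cases "residual K e n (e n) (e n) = 0")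
   case z: True
   have "cm2 (residual K e n (e n) q) <= 0"
    using psd_Cauchy_Schwarz[OF psd_residual e[of n] Suc.prems(1), of n] z by simp
   thus ?thesis using True z by simp
  qed (use True in simp)
 next
  case False
  hence "m < n" using Suc.prems by simp
  thus ?thesis using Suc.IH[OF Suc.prems(1)] Suc.IH[OF e] by simp
 qed
qed simp

lemma feature_partial_le:
 assumes p: "p \<in> X" shows "(\<Sum>i<n. cm2 (feature K e p i)) = Re (K p p) - Re (residual K e n p p)"
proof -
 have "K p p = (\<Sum>i<n. of_real (cm2 (feature K e p i))) + residual K e n p p"
  using residual_sum[OF p p, of n] by (simp only: complex_norm_square)
 hence "Re (K p p) = Re (\<Sum>i<n. complex_of_real (cm2 (feature K e p i))) + Re (residual K e n p p)"
  by (metis plus_complex.simps(1))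
 thus ?thesis by (simp only: Re_sum Re_complex_of_real)
qed

lemma feature_l2:
 assumes p: "p \<in> X" shows "feature K e p \<in> l2 (pivots K e)"
proof (rule l2_memI(1))
 show "(\<Sum>i<n. cm2 (feature K e p i)) <= Re (K p p)" for n
  using feature_partial_le[OF p, of n] psd_diag(1)[OF psd_residual p, of n] by linarith
 fix i assume "i \<notin> pivots K e"
 thus "feature K e p i = 0" by (simp add: feature_def pivots_def)
qed

text \<open>After step \<open>m\<close> the vector at \<open>e m\<close> has been projected away, so the remainder at \<open>p\<close> is at most the squared distance from \<open>p\<close> to \<open>e m\<close>.\<close>

lemma residual_diag_le:
 assumes p: "p \<in> X" and mn: "m < n"
 shows "Re (residual K e n p p) <= kdist K p (e m)"
proof -
 let ?v = "feature K e"
 have row: "residual K e n (e m) q = 0" if "q \<in> X" for q by (rule residual_zero_row[OF that mn])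
 have "residual K e n p (e m) = 0"
  using row[OF p] psd_sym[OF psd_residual e p, of n m] by simp
 hence "K p (e m) = (\<Sum>i<n. ?v p i * cnj (?v (e m) i))"
  using residual_sum[OF p e[of m], of n] by simp
 moreover have "K (e m) (e m) = (\<Sum>i<n. ?v (e m) i * cnj (?v (e m) i))"
  using residual_sum[OF e[of m] e[of m], of n] row[OF e[of m]] by simp
 moreover have "K p p = (\<Sum>i<n. ?v p i * cnj (?v p i)) + residual K e n p p"
  by (rule residual_sum[OF p p])
 ultimately have "kdist K p (e m) = Re (residual K e n p p)
   + (\<Sum>i<n. Re (?v p i * cnj (?v p i)) + Re (?v (e m) i * cnj (?v (e m) i)) - 2 * Re (?v p i * cnj (?v (e m) i)))"
  by (simp add: kdist_def sum.distrib sum_subtractf sum_distrib_left)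
 moreover have "0 <= Re (a * cnj a) + Re (b * cnj b) - 2 * Re (a * cnj b)" for a b :: complex
 proof -
  have "Re (a * cnj a) + Re (b * cnj b) - 2 * Re (a * cnj b) = (Re a - Re b)^2 + (Im a - Im b)^2"
   by (simp add: power2_eq_square algebra_simps)
  thus ?thesis by simp
 qed
 hence "0 <= (\<Sum>i<n. Re (?v p i * cnj (?v p i)) + Re (?v (e m) i * cnj (?v (e m) i)) - 2 * Re (?v p i * cnj (?v (e m) i)))"
  by (intro sum_nonneg) simp
 ultimately show ?thesis by linarith
qed

lemma feature_sums:
 assumes dense: "\<And>p \<epsilon>. [|p \<in> X; 0 < \<epsilon>|] ==> \<exists>m. kdist K p (e m) < \<epsilon>"
  and p: "p \<in> X" and q: "q \<in> X"
 shows "(%i. feature K e p i * cnj (feature K e q i)) sums K p q"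
proof -
 have to0: "(%n. Re (residual K e n p p)) \<leadsto> 0" if p: "p \<in> X" for p
 proof (rule LIMSEQ_I)
  fix r :: real assume "0 < r"
  then obtain m where m: "kdist K p (e m) < r" using dense[OF p] by blast
  have "norm (Re (residual K e n p p) - 0) < r" if "Suc m <= n" for n
   using residual_diag_le[OF p, of m n] that m psd_diag(1)[OF psd_residual p, of n] by simp
  thus "\<exists>no. \<forall>n\<ge>no. norm (Re (residual K e n p p) - 0) < r" by blast
 qed
 have "(%n. cm2 (residual K e n p q)) \<leadsto> 0"
 proof (rule tendsto_sandwich[of "%_. 0" _ _ "%n. Re (residual K e n p p) * Re (residual K e n q q)"])
  show "(%n. Re (residual K e n p p) * Re (residual K e n q q)) \<leadsto> 0"
   using tendsto_mult[OF to0[OF p] to0[OF q]] by simp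
  show "\<forall>\<^sub>F n in sequentially. cm2 (residual K e n p q) <= Re (residual K e n p p) * Re (residual K e n q q)"
   using psd_Cauchy_Schwarz[OF psd_residual p q] by simp
 qed simp_all
 hence "(%n. residual K e n p q) \<leadsto> 0"
  by (simp add: tendsto_norm_zero_iff)
 from tendsto_diff[OF tendsto_const[of "K p q"] this]
 have "(%n. K p q - residual K e n p q) \<leadsto> K p q" by simp
 moreover have "K p q - residual K e n p q = (\<Sum>i<n. feature K e p i * cnj (feature K e q i))" for n
  using residual_sum[OF p q, of n] by simp
 ultimately show ?thesis by (simp add: sums_def)
qed

lemma feature_triangular:
 "m < n ==> feature K e (e m) n = 0"
 using residual_zero_row[OF e] by (simp add: feature_def)

lemma feature_pivot: "m \<in> pivots K e ==> feature K e (e m) m ~= 0"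
 using psd_diag_eq[OF psd_residual e, of m m]
 by (auto simp: feature_def pivots_def)

end

text \<open>Pairs of corresponding linear combinations of two families of vectors: the graph of the operator that should send \<open>v p\<close> to \<open>w p\<close>.\<close>

definition graph :: "('x => nat => complex) => ('x => nat => complex) => 'x set => (nat => complex) => (nat => complex) => bool"
 where "graph v w X a b \<longleftrightarrow> (\<exists>F c. finite F & F \<subseteq> X &
   a = (%i. \<Sum>p\<in>F. c p * v p i) & b = (%i. \<Sum>p\<in>F. c p * w p i))"

lemma graph_zero: "graph v w X (%_. 0) (%_. 0)"
 unfolding graph_def by (intro exI[of _ "{}"]) auto

lemma graph_point: "p \<in> X ==> graph v w X (v p) (w p)"
 unfolding graph_def by (intro exI[of _ "{p}"] exI[of _ "%_. 1"]) auto

lemma graph_scale: "graph v w X a b ==> graph v w X (%i. r * a i) (%i. r * b i)"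
 unfolding graph_def
proof (elim exE conjE)
 fix F c assume F: "finite F" "F \<subseteq> X" "a = (%i. \<Sum>p\<in>F. c p * v p i)" "b = (%i. \<Sum>p\<in>F. c p * w p i)"
 show "\<exists>F c. finite F & F \<subseteq> X & (%i. r * a i) = (%i. \<Sum>p\<in>F. c p * v p i) & (%i. r * b i) = (%i. \<Sum>p\<in>F. c p * w p i)"
  using F by (intro exI[of _ F] exI[of _ "%p. r * c p"]) (simp add: sum_distrib_left mult.assoc)
qed

lemma graph_add:
 assumes "graph v w X a b" "graph v w X a' b'"
 shows "graph v w X (%i. a i + a' i) (%i. b i + b' i)"
proof -
 obtain F c where F: "finite F" "F \<subseteq> X" "a = (%i. \<Sum>p\<in>F. c p * v p i)" "b = (%i. \<Sum>p\<in>F. c p * w p i)"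
  using assms(1) unfolding graph_def by blast
 obtain E h where E: "finite E" "E \<subseteq> X" "a' = (%i. \<Sum>p\<in>E. h p * v p i)" "b' = (%i. \<Sum>p\<in>E. h p * w p i)"
  using assms(2) unfolding graph_def by blast
 define k where "k p = (if p \<in> F then c p else 0) + (if p \<in> E then h p else 0)" for p
 have sum: "(\<Sum>p\<in>F \<union> E. k p * u p) = (\<Sum>p\<in>F. c p * u p) + (\<Sum>p\<in>E. h p * u p)" for u :: "_ => complex"
 proof -
  have "(\<Sum>p\<in>F \<union> E. (if p \<in> F then c p else 0) * u p) = (\<Sum>p\<in>F. c p * u p)"
   using F(1) E(1) by (intro sum.mono_neutral_cong_right) auto
  moreover have "(\<Sum>p\<in>F \<union> E. (if p \<in> E then h p else 0) * u p) = (\<Sum>p\<in>E. h p * u p)"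
   using F(1) E(1) by (intro sum.mono_neutral_cong_right) auto
  ultimately show ?thesis unfolding k_def distrib_right sum.distrib by simp
 qed
 show ?thesis unfolding graph_def
  using F E by (intro exI[of _ "F \<union> E"] exI[of _ k]) (simp add: sum)
qed

lemma graph_sum:
 assumes "finite J" "\<And>j. j \<in> J ==> graph v w X (a j) (b j)"
 shows "graph v w X (%i. \<Sum>j\<in>J. r j * a j i) (%i. \<Sum>j\<in>J. r j * b j i)"
 using assms
proof (induction J rule: finite_induct)
 case empty thus ?case by (simp add: graph_zero)
next
 case (insert x J)
 have "graph v w X (%i. r x * a x i) (%i. r x * b x i)" using insert by (intro graph_scale) auto
 moreover have "graph v w X (%i. \<Sum>j\<in>J. r j * a j i) (%i. \<Sum>j\<in>J. r j * b j i)" using insert by auto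
 ultimately show ?case unfolding sum.insert[OF insert(1,2)] by (rule graph_add)
qed

lemma graph_diff:
 assumes "graph v w X a b" "graph v w X a' b'"
 shows "graph v w X (%i. a i - a' i) (%i. b i - b' i)"
 using graph_add[OF assms(1) graph_scale[OF assms(2), of "-1"]] by simp

lemma graph_change: "graph v w X a b ==> \<exists>b'. graph v w' X a b'"
 unfolding graph_def by blast

abbreviation basis_vec :: "nat => nat => complex" where "basis_vec m \<equiv> (%i. if i = m then 1 else 0)"

text \<open>Coordinate vectors are finite combinations of the \<open>v p\<close>, because Gram--Schmidt is triangular. This makes density a statement about truncated sequences.\<close>

definition spanning :: "('x => nat => complex) => 'x set => nat set => bool"
 where "spanning v X I \<longleftrightarrow> (\<forall>m\<in>I. \<exists>b. graph v v X (basis_vec m) b)"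

lemma feature_spanning:
 assumes K: "psd X K" and e: "\<And>n. e n \<in> X"
 shows "spanning (feature K e) X (pivots K e)"
 unfolding spanning_def
proof
 fix m assume "m \<in> pivots K e"
 thus "\<exists>b. graph (feature K e) (feature K e) X (basis_vec m) b"
 proof (induction m rule: less_induct)
  case (less m)
  let ?v = "feature K e"
  let ?J = "{i \<in> pivots K e. i < m}"
  have "\<forall>i. \<exists>b. i \<in> ?J --> graph ?v ?v X (basis_vec i) b" using less.IH by blast
  then obtain b where b: "\<And>i. i \<in> ?J ==> graph ?v ?v X (basis_vec i) (b i)" by metis
  have fin: "finite ?J" by simp
  let ?s = "%j. \<Sum>i\<in>?J. ?v (e m) i * basis_vec i j"
  have "graph ?v ?v X (%j. (1 / ?v (e m) m) * (?v (e m) j - ?s j))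
    (%j. (1 / ?v (e m) m) * (?v (e m) j - (\<Sum>i\<in>?J. ?v (e m) i * b i j)))"
   by (intro graph_scale graph_diff graph_point e graph_sum fin b)
  moreover have "(%j. (1 / ?v (e m) m) * (?v (e m) j - ?s j)) = basis_vec m"
  proof
   fix j
   have s: "?s j = (if j \<in> ?J then ?v (e m) j else 0)"
   proof -
    have "?s j = (\<Sum>i\<in>?J. if i = j then ?v (e m) i else 0)" by (intro sum.cong refl) auto
    thus ?thesis using fin by simp
   qed
   have nz: "?v (e m) m ~= 0" using feature_pivot[OF K e less.prems] .
   consider "j = m" | "m < j" | "j < m" "j \<in> pivots K e" | "j < m" "j \<notin> pivots K e" by linarith
   thus "(1 / ?v (e m) m) * (?v (e m) j - ?s j) = basis_vec m j"
   proof cases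
    case 1 thus ?thesis using s nz by simp
   next
    case 2 thus ?thesis using s feature_triangular[where e = e, OF K e 2] by simp
   next
    case 3 thus ?thesis using s by simp
   next
    case 4 thus ?thesis using s l2_outside[OF feature_l2[OF K e e]] by simp
   qed
  qed
  ultimately show ?case by auto
 qed
qed

text \<open>Orthogonalize along a sequence that is dense for the distance of the kernel: the features account for all of \<open>K\<close>, since the residual tends to zero on the dense sequence and hence everywhere.\<close>

theorem Kolmogorov_decomposition:
 fixes e :: "nat => 'x"
 assumes K: "psd X K" and e: "\<And>n. e n \<in> X"
  and dense: "\<And>p \<epsilon>. [|p \<in> X; 0 < \<epsilon>|] ==> \<exists>m. kdist K p (e m) < \<epsilon>"
 shows "\<exists>I v. (\<forall>p\<in>X. v p \<in> l2 I) & spanning v X I &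
   (\<forall>p\<in>X. \<forall>q\<in>X. (%i. v p i * cnj (v q i)) sums K p q)"
proof (intro exI conjI ballI)
 show "feature K e p \<in> l2 (pivots K e)" if "p \<in> X" for p by (rule feature_l2[OF K e that])
 show "spanning (feature K e) X (pivots K e)" by (rule feature_spanning[OF K e])
 show "(%i. feature K e p i * cnj (feature K e q i)) sums K p q" if "p \<in> X" "q \<in> X" for p q
  by (rule feature_sums[OF K e _ that]) (rule dense)
qed

lemma combination_norm:
 assumes v: "\<And>p. p \<in> X ==> v p \<in> l2 I"
  and K: "\<And>p q. [|p \<in> X; q \<in> X|] ==> (%i. v p i * cnj (v q i)) sums K p q"
  and F: "F \<subseteq> X"
 shows "(l2n I (%i. \<Sum>p\<in>F. c p * v p i))^2 = Re (sesq K F c c)"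
proof -
 let ?a = "%i. \<Sum>p\<in>F. c p * v p i"
 have mem: "?a \<in> l2 I" using v F by (intro l2_sum) auto
 have "(%i. \<Sum>p\<in>F. \<Sum>q\<in>F. c p * cnj (c q) * (v p i * cnj (v q i))) sums (\<Sum>p\<in>F. \<Sum>q\<in>F. c p * cnj (c q) * K p q)"
  using F by (intro sums_sum sums_mult K) auto
 moreover have "(\<Sum>p\<in>F. \<Sum>q\<in>F. c p * cnj (c q) * (v p i * cnj (v q i))) = of_real (cm2 (?a i))" for i
  unfolding complex_norm_square cnj_sum sum_product by (intro sum.cong refl) simp
 ultimately have "(%i. complex_of_real (cm2 (?a i))) sums sesq K F c c"
  by (simp only: sesq_def)
 hence "(%i. cm2 (?a i)) sums Re (sesq K F c c)"
  using sums_Re by fastforce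
 thus ?thesis using l2_norm_square[OF mem] by (simp add: sums_iff)
qed

lemma kdist_norm:
 assumes v: "\<And>p. p \<in> X ==> v p \<in> l2 I"
  and K: "\<And>p q. [|p \<in> X; q \<in> X|] ==> (%i. v p i * cnj (v q i)) sums K p q"
  and p: "p \<in> X" and q: "q \<in> X"
 shows "(l2n I (%i. v p i - v q i))^2 = kdist K p q"
proof (cases "p = q")
 case True
 have "l2n I (%_. 0) = 0" using l2_norm_eq_0[OF l2_zero] by simp
 thus ?thesis using True by (simp add: kdist_def)
next
 case False
 have qp: "K q p = cnj (K p q)"
 proof -
  have "(%i. cnj (v p i * cnj (v q i))) sums cnj (K p q)" using K[OF p q] by (simp only: sums_cnj)
  hence "(%i. v q i * cnj (v p i)) sums cnj (K p q)" by (simp add: mult.commute)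
  thus ?thesis using K[OF q p] sums_unique2 by blast
 qed
 have "(l2n I (%i. \<Sum>r\<in>{p, q}. (if r = p then 1 else - 1) * v r i))^2
   = Re (sesq K {p, q} (%r. if r = p then 1 else - 1) (%r. if r = p then 1 else - 1))"
  using p q by (intro combination_norm[OF v K]) auto
 thus ?thesis using False qp by (simp add: sesq_doubleton kdist_def)
qed

definition trunc :: "nat => (nat => complex) => nat => complex"
 where "trunc n x i = (if i < n then x i else 0)"

lemma trunc_l2: "x \<in> l2 I ==> trunc n x \<in> l2 I"
proof -
 assume x: "x \<in> l2 I"
 have "summable (%i. cm2 (trunc n x i))"
  by (rule summable_comparison_test'[OF l2_summable[OF x]]) (simp add: trunc_def)
 thus ?thesis using x by (auto simp: l2_def trunc_def)
qed

lemma trunc_converges: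
 assumes x: "x \<in> l2 I" shows "(%n. l2n I (%i. x i - trunc n x i)) \<leadsto> 0"
proof -
 have eq: "(l2n I (%i. x i - trunc n x i))^2 = (\<Sum>i. cm2 (x i)) - (\<Sum>i<n. cm2 (x i))" for n
 proof -
  have "(%i. cm2 (trunc n x i)) sums (\<Sum>i<n. cm2 (trunc n x i))"
   by (rule sums_finite) (auto simp: trunc_def)
  also have "(\<Sum>i<n. cm2 (trunc n x i)) = (\<Sum>i<n. cm2 (x i))"
   by (intro sum.cong refl) (simp add: trunc_def)
  finally have "(%i. cm2 (x i) - cm2 (trunc n x i)) sums ((\<Sum>i. cm2 (x i)) - (\<Sum>i<n. cm2 (x i)))"
   by (intro sums_diff summable_sums l2_summable[OF x])
  moreover have "cm2 (x i) - cm2 (trunc n x i) = cm2 (x i - trunc n x i)" for i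
   by (simp add: trunc_def)
  ultimately show ?thesis using l2_norm_square[OF l2_diff[OF x trunc_l2[OF x]], of n] by (simp add: sums_iff)
 qed
 have "(%n. (l2n I (%i. x i - trunc n x i))\<^sup>2) \<leadsto> (\<Sum>i. cm2 (x i)) - (\<Sum>i. cm2 (x i))"
  unfolding eq by (intro tendsto_diff tendsto_const summable_LIMSEQ l2_summable[OF x])
 thus ?thesis by simp
qed

lemma graph_truncation:
 assumes "\<And>m. m \<in> I ==> graph v w X (basis_vec m) (u m)" and x: "x \<in> l2 I" and fin: "finite E"
 shows "graph v w X (%i. if i \<in> E then x i else 0) (%i. \<Sum>m\<in>E \<inter> I. x m * u m i)"
proof -
 have "graph v w X (%i. \<Sum>m\<in>E \<inter> I. x m * basis_vec m i) (%i. \<Sum>m\<in>E \<inter> I. x m * u m i)"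
  using assms by (intro graph_sum) auto
 moreover have "(\<Sum>m\<in>E \<inter> I. x m * basis_vec m i) = (if i \<in> E then x i else 0)" for i
 proof -
  have "(\<Sum>m\<in>E \<inter> I. x m * basis_vec m i) = (\<Sum>m\<in>E \<inter> I. if m = i then x m else 0)"
   by (intro sum.cong refl) auto
  thus ?thesis using fin l2_outside[OF x, of i] by auto
 qed
 ultimately show ?thesis by simp
qed

text \<open>Positivity of \<open>M\<^sup>2 K - L\<close> is the norm inequality on combinations of the \<open>v p\<close>. The operator is defined on coordinate vectors, is bounded by \<open>M\<close> on truncations, and extends by the convergence of truncations.\<close>

theorem operator_from_graph:
 assumes v: "\<And>p. p \<in> X ==> v p \<in> l2 I" and w: "\<And>p. p \<in> X ==> w p \<in> l2 I"
  and K: "\<And>p q. [|p \<in> X; q \<in> X|] ==> (%i. v p i * cnj (v q i)) sums K p q"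
  and L: "\<And>p q. [|p \<in> X; q \<in> X|] ==> (%i. w p i * cnj (w q i)) sums L p q"
  and sp: "spanning v X I"
  and M: "0 <= M" "psd X (%p q. of_real (M\<^sup>2) * K p q - L p q)"
 shows "\<exists>A. bounded_op (Ltwo I) A & (\<forall>p\<in>X. A (v p) = w p) &
   (\<forall>x\<in>l2 I. l2n I (A x) <= M * l2n I x)"
proof -
 interpret H: inner_space "Ltwo I" by (rule l2_inner_space)
 let ?n = "l2n I"
 have mem: "a \<in> l2 I" "b \<in> l2 I" if "graph v w X a b" for a b
  using that v w unfolding graph_def by (auto intro!: l2_sum)
 have contr: "?n b <= M * ?n a" if g: "graph v w X a b" for a b
 proof -
  obtain F c where F: "finite F" "F \<subseteq> X" and a: "a = (%i. \<Sum>p\<in>F. c p * v p i)" and b: "b = (%i. \<Sum>p\<in>F. c p * w p i)"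
   using g unfolding graph_def by blast
  have "0 <= Re (sesq (%p q. of_real (M\<^sup>2) * K p q - L p q) F c c)" by (rule psdD[OF M(2) F])
  hence "Re (sesq L F c c) <= M\<^sup>2 * Re (sesq K F c c)"
   by (simp add: sesq_diff_kernel sesq_scale_kernel del: of_real_power)
  moreover have "(?n a)^2 = Re (sesq K F c c)"
   unfolding a by (rule combination_norm[of X v, OF _ _ F(2)]) (fact v K)+
  moreover have "(?n b)^2 = Re (sesq L F c c)"
   unfolding b by (rule combination_norm[of X w, OF _ _ F(2)]) (fact w L)+
  ultimately have "(?n b)^2 <= (M * ?n a)^2" by (simp only: power_mult_distrib)
  thus ?thesis by (rule power2_le_imp_le) (use M(1) l2_norm_nonneg[OF mem(1)[OF g]] in simp)
 qed
 have "\<forall>m. \<exists>b. m \<in> I --> graph v w X (basis_vec m) b"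
  using sp graph_change unfolding spanning_def by metis
 then obtain u0 where u0: "\<And>m. m \<in> I ==> graph v w X (basis_vec m) (u0 m)" by metis
 define u where "u m i = (if m \<in> I then u0 m i else 0)" for m i
 have cut: "(\<Sum>m\<in>E \<inter> I. x m * u0 m i) = (\<Sum>m\<in>E. x m * u m i)" if "finite E" for E i and x :: "nat => complex"
  using that by (intro sum.mono_neutral_cong_left) (auto simp: u_def)
 have gr: "graph v w X (%i. if i \<in> E then x i else 0) (%i. \<Sum>m\<in>E. x m * u m i)" if "x \<in> l2 I" "finite E" for x E
  using graph_truncation[OF u0 that] unfolding cut[OF that(2)] .
 have block: "cmod (\<Sum>m\<in>E. x m * u m i) <= M * sqrt (\<Sum>m\<in>E. cm2 (x m))" if x: "x \<in> l2 I" and E: "finite E" for x E i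
 proof -
  note g = gr[OF x E]
  have "(%i. cm2 (if i \<in> E then x i else 0)) sums (\<Sum>i\<in>E. cm2 (if i \<in> E then x i else 0))"
   by (rule sums_finite[OF E]) auto
  hence "(?n (%i. if i \<in> E then x i else 0))^2 = (\<Sum>m\<in>E. cm2 (x m))"
   using l2_norm_square[OF mem(1)[OF g]] by (simp add: sums_iff)
  hence "?n (%i. if i \<in> E then x i else 0) = sqrt (\<Sum>m\<in>E. cm2 (x m))"
   using l2_norm_nonneg[OF mem(1)[OF g]] by (metis real_sqrt_unique)
  thus ?thesis using order_trans[OF l2_coord_le[OF mem(2)[OF g]] contr[OF g]] by simp
 qed
 have sm: "summable (%m. x m * u m i)" if x: "x \<in> l2 I" for x i
  unfolding summable_Cauchy
 proof (intro allI impI)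
  fix r :: real assume r: "0 < r"
  define s where "s = (r / (M + 1))^2"
  have s: "0 < s" using r M(1) by (simp add: s_def)
  obtain N where N: "\<And>m n. N <= m ==> norm (\<Sum>i=m..<n. cm2 (x i)) < s"
   using l2_summable[OF x] s unfolding summable_Cauchy by blast
  have "norm (\<Sum>m=k..<n. x m * u m i) < r" if k: "N <= k" for k n
  proof -
   have "sqrt (\<Sum>i=k..<n. cm2 (x i)) < sqrt s"
    using N[OF k, of n] by (intro real_sqrt_less_mono) (simp add: sum_nonneg)
   also have "sqrt s = r / (M + 1)" using r M(1) by (simp add: s_def)
   finally have "M * sqrt (\<Sum>i=k..<n. cm2 (x i)) <= M * (r / (M + 1))"
    using M(1) by (intro mult_left_mono) auto
   also have "... < r" using r M(1) by (simp add: field_simps)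
   finally show ?thesis using block[OF x, of "{k..<n}" i] by simp
  qed
  thus "\<exists>N. \<forall>m\<ge>N. \<forall>n. norm (\<Sum>m=m..<n. x m * u m i) < r" by blast
 qed
 define A where "A = (\<lambda>x\<in>l2 I. (%i. \<Sum>m. x m * u m i))"
 have lim: "(%N. \<Sum>m<N. x m * u m i) \<leadsto> A x i" if "x \<in> l2 I" for x i
  using summable_LIMSEQ[OF sm[OF that]] that by (simp add: A_def)
 have trunc_eq: "(%i. if i \<in> {..<N} then x i else 0) = trunc N x" for N x by (auto simp: trunc_def)
 have grt: "graph v w X (trunc N x) (%i. \<Sum>m<N. x m * u m i)" if "x \<in> l2 I" for x N
  using gr[OF that, of "{..<N}"] unfolding trunc_eq by simp
 have bd: "A x \<in> l2 I" "?n (A x) <= M * ?n x" if x: "x \<in> l2 I" for x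
 proof -
  have zero: "A x i = 0" if "i \<notin> I" for i
  proof -
   have "(\<Sum>m<N. x m * u m i) = 0" for N by (rule l2_outside[OF mem(2)[OF grt[OF x]] that])
   thus ?thesis using lim[OF x, of i] by (simp add: LIMSEQ_const_iff)
  qed
  have "(\<Sum>i<k. cm2 (A x i)) <= (M * ?n x)^2" for k
  proof (rule tendsto_upperbound)
   show "(%N. \<Sum>i<k. cm2 (\<Sum>m<N. x m * u m i)) \<leadsto> (\<Sum>i<k. cm2 (A x i))"
    by (intro tendsto_intros lim x)
   show "\<forall>\<^sub>F N in sequentially. (\<Sum>i<k. cm2 (\<Sum>m<N. x m * u m i)) <= (M * ?n x)^2"
   proof (rule always_eventually, rule allI)
    fix N
    have "(?n (trunc N x))^2 <= (?n x)^2"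
     unfolding l2_norm_square[OF x] l2_norm_square[OF trunc_l2[OF x]]
     by (intro suminf_le l2_summable[OF x] l2_summable[OF trunc_l2[OF x]]) (simp add: trunc_def)
    hence tr: "?n (trunc N x) <= ?n x" by (rule power2_le_imp_le) (rule l2_norm_nonneg[OF x])
    have "(\<Sum>i<k. cm2 (\<Sum>m<N. x m * u m i)) <= (?n (%i. \<Sum>m<N. x m * u m i))^2"
     by (rule l2_partial_sum_le[OF mem(2)[OF grt[OF x]]]) simp
    also have "... <= (M * ?n x)^2"
     using contr[OF grt[OF x, of N]] mult_left_mono[OF tr M(1)] l2_norm_nonneg[OF mem(2)[OF grt[OF x, of N]]]
     by (intro power_mono) auto
    finally show "(\<Sum>i<k. cm2 (\<Sum>m<N. x m * u m i)) <= (M * ?n x)^2" .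
   qed
  qed simp
  thus "A x \<in> l2 I" "?n (A x) <= M * ?n x"
   using l2_norm_leI[of I "A x" "M * ?n x"] zero M(1) l2_norm_nonneg[OF x] by simp_all
 qed
 have agree: "A a = b" if g: "graph v w X a b" for a b
 proof
  fix i
  note a = mem(1)[OF g]
  have "(%N. (\<Sum>m<N. a m * u m i) - b i) \<leadsto> 0"
  proof (rule Lim_null_comparison)
   show "(%N. M * ?n (%i. a i - trunc N a i)) \<leadsto> 0"
    using tendsto_mult_left[OF trunc_converges[OF a], of M] by simp
   show "\<forall>\<^sub>F N in sequentially. norm ((\<Sum>m<N. a m * u m i) - b i) <= M * ?n (%i. a i - trunc N a i)"
   proof (rule always_eventually, rule allI)
    fix N
    note g2 = graph_diff[OF g grt[OF a, of N]]
    have "norm (b i - (\<Sum>m<N. a m * u m i)) <= M * ?n (%i. a i - trunc N a i)"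
     using order_trans[OF l2_coord_le[OF mem(2)[OF g2]] contr[OF g2]] .
    thus "norm ((\<Sum>m<N. a m * u m i) - b i) <= M * ?n (%i. a i - trunc N a i)"
     by (simp add: norm_minus_commute)
   qed
  qed
  hence "(%N. \<Sum>m<N. a m * u m i) \<leadsto> b i" by (simp add: LIM_zero_iff)
  thus "A a i = b i" using lim[OF a] LIMSEQ_unique by blast
 qed
 have "bounded_op (Ltwo I) A"
 proof (rule H.bounded_opI[where K = M])
  show "A \<in> extensional (carrier (Ltwo I))" by (simp add: A_def Ltwo_simps(1))
  show "A x \<in> carrier (Ltwo I)" if "x \<in> carrier (Ltwo I)" for x using bd that by (simp add: Ltwo_simps(1))
  show "?n (A x) <= M * ?n x" if "x \<in> carrier (Ltwo I)" for x using bd that by (simp add: Ltwo_simps(1))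
  fix x assume "x \<in> carrier (Ltwo I)"
  hence x: "x \<in> l2 I" by (simp add: Ltwo_simps(1))
  show "A (c \<odot>\<^bsub>Ltwo I\<^esub> x) = c \<odot>\<^bsub>Ltwo I\<^esub> A x" for c
   using suminf_mult[OF sm[OF x], of c] x bd(1)[OF x] l2_scale[OF x, of c]
   by (simp add: Ltwo_simps fun_eq_iff) (simp add: A_def mult.assoc)
  fix y assume "y \<in> carrier (Ltwo I)"
  hence y: "y \<in> l2 I" by (simp add: Ltwo_simps(1))
  show "A (x \<oplus>\<^bsub>Ltwo I\<^esub> y) = A x \<oplus>\<^bsub>Ltwo I\<^esub> A y"
   using suminf_add[OF sm[OF x] sm[OF y]] x y bd(1)[OF x] bd(1)[OF y] l2_add[OF x y]
   by (simp add: Ltwo_simps fun_eq_iff) (simp add: A_def distrib_right)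
 qed
 thus ?thesis using bd agree graph_point[of _ X v w] by blast
qed

lemma spanning_dense:
 assumes sp: "spanning v X I" and x: "x \<in> l2 I" and r: "0 < r"
 shows "\<exists>a b. graph v v X a b & l2n I (%i. x i - a i) < r"
proof -
 have "\<forall>m. \<exists>b. m \<in> I --> graph v v X (basis_vec m) b"
  using sp unfolding spanning_def by metis
 then obtain u where u: "\<And>m. m \<in> I ==> graph v v X (basis_vec m) (u m)" by metis
 have "\<forall>\<^sub>F n in sequentially. l2n I (%i. x i - trunc n x i) < r"
  by (rule order_tendstoD(2)[OF trunc_converges[OF x] r])
 then obtain n where n: "l2n I (%i. x i - trunc n x i) < r"
  by (meson eventually_sequentially order_refl)
 have "(%i. if i \<in> {..<n} then x i else 0) = trunc n x" by (auto simp: trunc_def)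
 thus ?thesis using graph_truncation[OF u x, of "{..<n}"] n by auto
qed

lemma bounded_op_l2:
 assumes "bounded_op (Ltwo I) A"
 shows "x \<in> l2 I ==> A x \<in> l2 I"
  and "[|x \<in> l2 I; y \<in> l2 I|] ==> A (%i. x i - y i) = (%i. A x i - A y i)"
  and "(\<And>p. p \<in> F ==> v p \<in> l2 I) ==> A (%i. \<Sum>p\<in>F. c p * v p i) = (%i. \<Sum>p\<in>F. c p * A (v p) i)"
proof -
 interpret H: inner_space "Ltwo I" by (rule l2_inner_space)
 note D = H.bounded_opD[OF assms, unfolded Ltwo_simps]
 show mem: "x \<in> l2 I ==> A x \<in> l2 I" for x by (rule D(1))
 have add: "A (%i. x i + y i) = (%i. A x i + A y i)" if "x \<in> l2 I" "y \<in> l2 I" for x y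
  using D(2)[OF that] that mem by simp
 have scale: "A (%i. c * x i) = (%i. c * A x i)" if "x \<in> l2 I" for x c
  using D(3)[OF that, of c] that mem by simp
 show "A (%i. x i - y i) = (%i. A x i - A y i)" if "x \<in> l2 I" "y \<in> l2 I"
  using add[OF that(1) l2_scale[OF that(2), of "-1"]] scale[OF that(2), of "-1"] by simp
 have z: "A (%_. 0) = (%_. 0)" using scale[OF l2_zero, of 0] by simp
 show "A (%i. \<Sum>p\<in>F. c p * v p i) = (%i. \<Sum>p\<in>F. c p * A (v p) i)" if "\<And>p. p \<in> F ==> v p \<in> l2 I"
  using that
 proof (induction F rule: infinite_finite_induct)
  case (insert p F)
  thus ?case using add[OF l2_scale[of "v p" I "c p"] l2_sum[of F v I c]] scale[of "v p" "c p"] by simp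
 qed (simp_all add: z)
qed

lemma spanning_op_eq:
 assumes sp: "spanning v X I" and v: "\<And>p. p \<in> X ==> v p \<in> l2 I"
  and A: "bounded_op (Ltwo I) A" and B: "bounded_op (Ltwo I) B"
  and eq: "\<And>p. p \<in> X ==> A (v p) = B (v p)"
 shows "A = B"
proof -
 interpret H: inner_space "Ltwo I" by (rule l2_inner_space)
 let ?n = "l2n I"
 obtain S where S: "0 <= S" "\<And>x. x \<in> carrier (Ltwo I) ==> ?n (A x) <= S * ?n x" using H.bounded_op_bound[OF A] by blast
 obtain R where R: "0 <= R" "\<And>x. x \<in> carrier (Ltwo I) ==> ?n (B x) <= R * ?n x" using H.bounded_op_bound[OF B] by blast
 note lA = bounded_op_l2[OF A] and lB = bounded_op_l2[OF B]
 show ?thesis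
 proof (rule H.op_eqI[OF A B])
  fix x assume "x \<in> carrier (Ltwo I)"
  hence x: "x \<in> l2 I" by (simp add: Ltwo_simps(1))
  have d: "(%i. A x i - B x i) \<in> l2 I" by (intro l2_diff lA(1) lB(1) x)
  have "?n (%i. A x i - B x i) <= 0 + r" if r: "0 < r" for r
  proof -
   have "0 < r / (S + R + 1)" using r S R by (intro divide_pos_pos) auto
   then obtain a b where g: "graph v v X a b" and a: "?n (%i. x i - a i) < r / (S + R + 1)"
    using spanning_dense[OF sp x] by blast
   obtain F c where F: "F \<subseteq> X" "a = (%i. \<Sum>p\<in>F. c p * v p i)" using g unfolding graph_def by blast
   have am: "a \<in> l2 I" unfolding F(2) using v F by (intro l2_sum) auto
   have vF: "\<And>p. p \<in> F ==> v p \<in> l2 I" using v F by auto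
   have "A a = (%i. \<Sum>p\<in>F. c p * A (v p) i)" unfolding F(2) by (rule lA(3)) (rule vF)
   also have "... = (%i. \<Sum>p\<in>F. c p * B (v p) i)" using eq F by (intro ext sum.cong refl) auto
   also have "... = B a" unfolding F(2) by (rule lB(3)[symmetric]) (rule vF)
   finally have "A a = B a" .
   let ?y = "%i. x i - a i"
   have y: "?y \<in> l2 I" by (rule l2_diff[OF x am])
   have "(%i. A x i - B x i) = (%i. A ?y i + (- 1) * B ?y i)"
    unfolding lA(2)[OF x am] lB(2)[OF x am] \<open>A a = B a\<close> by simp
   hence "?n (%i. A x i - B x i) <= ?n (A ?y) + ?n (%i. (- 1) * B ?y i)"
    using l2_norm_triangle[OF lA(1)[OF y] l2_scale[OF lB(1)[OF y], of "-1"]] by simp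
   also have "?n (%i. (- 1) * B ?y i) = ?n (B ?y)" using l2_norm_scale[OF lB(1)[OF y], of "-1"] by simp
   also have "?n (A ?y) + ?n (B ?y) <= (S + R) * ?n ?y"
    using S(2)[of ?y] R(2)[of ?y] y by (simp add: Ltwo_simps(1) distrib_right)
   also have "... <= (S + R + 1) * ?n ?y"
    using l2_norm_nonneg[OF y] by (simp add: distrib_right)
   also have "... <= (S + R + 1) * (r / (S + R + 1))"
    using a S(1) R(1) by (intro mult_left_mono) auto
   also have "... = r" using S(1) R(1) by simp
   finally show ?thesis by simp
  qed
  hence "?n (%i. A x i - B x i) <= 0" by (rule field_le_epsilon)
  hence "(%i. A x i - B x i) = (%_. 0)" using l2_norm_eq_0[OF d] l2_norm_nonneg[OF d] by linarith
  thus "A x = B x" by (simp add: fun_eq_iff)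
 qed
qed

section \<open>Amplifications and normal maps\<close>

context inner_space
begin

abbreviation (in -) swt where "swt \<equiv> sigma_weak_topology"
abbreviation Hn where "Hn \<equiv> hilbert_power H"

lemma power_simps:
 "carrier (Hn n) = {..<n} \<rightarrow>\<^sub>E \<H>"
 "\<zero>\<^bsub>Hn n\<^esub> = (\<lambda>i\<in>{..<n}. \<zero>)"
 "x \<oplus>\<^bsub>Hn n\<^esub> y = (\<lambda>i\<in>{..<n}. x i \<oplus> y i)"
 "c \<odot>\<^bsub>Hn n\<^esub> x = (\<lambda>i\<in>{..<n}. c \<odot> x i)"
 "cinner (Hn n) x y = (\<Sum>i<n. cinner H (x i) (y i))"
 by (simp_all add: hilbert_power_def)

lemma power_comp: "x \<in> carrier (Hn n) ==> i < n ==> x i \<in> \<H>"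
 by (auto simp: power_simps PiE_iff)

lemma power_eqI:
 "[|x \<in> carrier (Hn n); y \<in> carrier (Hn n); \<And>i. i < n ==> x i = y i|] ==> x = y"
 unfolding power_simps by (rule PiE_ext) auto

lemma power_abelian_group: "abelian_group (Hn n)"
proof (rule abelian_groupI)
 fix x assume x: "x \<in> carrier (Hn n)"
 have m: "(\<lambda>i\<in>{..<n}. \<ominus> x i) \<in> carrier (Hn n)"
  using power_comp[OF x] by (auto simp: power_simps)
 show "\<exists>y\<in>carrier (Hn n). y \<oplus>\<^bsub>Hn n\<^esub> x = \<zero>\<^bsub>Hn n\<^esub>"
  using power_comp[OF x] m
  by (intro bexI[OF _ m]) (auto simp: power_simps M.l_neg intro!: restrict_ext)
 show "\<zero>\<^bsub>Hn n\<^esub> \<oplus>\<^bsub>Hn n\<^esub> x = x"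
 proof (rule power_eqI)
  show "\<zero>\<^bsub>Hn n\<^esub> \<oplus>\<^bsub>Hn n\<^esub> x \<in> carrier (Hn n)"
   using power_comp[OF x] by (auto simp: power_simps)
 qed (use x power_comp[OF x] in \<open>auto simp: power_simps(2,3)\<close>)
next
 fix x y assume xy: "x \<in> carrier (Hn n)" "y \<in> carrier (Hn n)"
 note c = power_comp[OF xy(1)] power_comp[OF xy(2)]
 show "x \<oplus>\<^bsub>Hn n\<^esub> y \<in> carrier (Hn n)" using c by (auto simp: power_simps)
 show "x \<oplus>\<^bsub>Hn n\<^esub> y = y \<oplus>\<^bsub>Hn n\<^esub> x"
  using c by (auto simp: power_simps(3) M.a_comm intro!: restrict_ext)
 fix z assume z: "z \<in> carrier (Hn n)"
 show "x \<oplus>\<^bsub>Hn n\<^esub> y \<oplus>\<^bsub>Hn n\<^esub> z = x \<oplus>\<^bsub>Hn n\<^esub> (y \<oplus>\<^bsub>Hn n\<^esub> z)"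
  using c power_comp[OF z] by (auto simp: power_simps(3) M.a_assoc intro!: restrict_ext)
qed (auto simp: power_simps)

lemma power_inner_space: "inner_space (Hn n)"
proof -
 have m: "Module.module complex_ring (Hn n)"
 proof (rule moduleI[OF cring_complex_ring power_abelian_group])
  fix a b :: complex and x y
  assume "x \<in> carrier (Hn n)" hence x: "\<And>i. i < n ==> x i \<in> \<H>" and X: "x \<in> carrier (Hn n)" by (auto dest: power_comp)
  show "a \<odot>\<^bsub>Hn n\<^esub> x \<in> carrier (Hn n)" using x by (auto simp: power_simps)
  show "(a \<oplus>\<^bsub>complex_ring\<^esub> b) \<odot>\<^bsub>Hn n\<^esub> x = a \<odot>\<^bsub>Hn n\<^esub> x \<oplus>\<^bsub>Hn n\<^esub> b \<odot>\<^bsub>Hn n\<^esub> x"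
   using x by (auto simp: power_simps(3,4) scale_add_left intro!: restrict_ext)
  show "(a \<otimes>\<^bsub>complex_ring\<^esub> b) \<odot>\<^bsub>Hn n\<^esub> x = a \<odot>\<^bsub>Hn n\<^esub> (b \<odot>\<^bsub>Hn n\<^esub> x)"
   using x by (auto simp: power_simps(3,4) scale_scale intro!: restrict_ext)
  show "\<one>\<^bsub>complex_ring\<^esub> \<odot>\<^bsub>Hn n\<^esub> x = x"
   using x X by (intro power_eqI[OF _ X]) (auto simp: power_simps)
  assume "y \<in> carrier (Hn n)" hence y: "\<And>i. i < n ==> y i \<in> \<H>" by (auto dest: power_comp)
  show "a \<odot>\<^bsub>Hn n\<^esub> (x \<oplus>\<^bsub>Hn n\<^esub> y) = a \<odot>\<^bsub>Hn n\<^esub> x \<oplus>\<^bsub>Hn n\<^esub> a \<odot>\<^bsub>Hn n\<^esub> y"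
   using x y by (auto simp: power_simps(3,4) scale_add_right intro!: restrict_ext)
 qed
 have "inner_space_axioms (Hn n)"
 proof (rule inner_space_axioms.intro)
  fix x y z and c :: complex
  assume X: "x \<in> carrier (Hn n)" hence x: "\<And>i. i < n ==> x i \<in> \<H>" by (auto dest: power_comp)
  {
   assume "x ~= \<zero>\<^bsub>Hn n\<^esub>"
   moreover have "\<zero>\<^bsub>Hn n\<^esub> \<in> carrier (Hn n)" by (auto simp: power_simps)
   ultimately have "\<not> (\<forall>i<n. x i = \<zero>)" using power_eqI[OF X, of "\<zero>\<^bsub>Hn n\<^esub>"]
    by (metis lessThan_iff power_simps(2) restrict_apply')
   then obtain i where i: "i < n" "x i ~= \<zero>" by blast
   have "0 < (\<Sum>i<n. Re (cinner H (x i) (x i)))"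
    using i x ip_self_nonneg cinner_pos by (intro sum_pos2[of _ i]) auto
   thus "0 < Re (cinner (Hn n) x x)" by (simp add: power_simps Re_sum)
  }
  assume "y \<in> carrier (Hn n)" hence y: "\<And>i. i < n ==> y i \<in> \<H>" by (auto dest: power_comp)
  show "cinner (Hn n) (c \<odot>\<^bsub>Hn n\<^esub> x) y = c * cinner (Hn n) x y"
   using x y by (simp add: power_simps cinner_smult_left sum_distrib_left)
  show "cinner (Hn n) y x = cnj (cinner (Hn n) x y)"
   unfolding power_simps cnj_sum using x y by (intro sum.cong refl cinner_commute) auto
  assume "z \<in> carrier (Hn n)" hence z: "\<And>i. i < n ==> z i \<in> \<H>" by (auto dest: power_comp)
  show "cinner (Hn n) (x \<oplus>\<^bsub>Hn n\<^esub> y) z = cinner (Hn n) x z + cinner (Hn n) y z"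
   using x y z by (simp add: power_simps cinner_add_left sum.distrib)
 qed
 with m show ?thesis by (rule inner_space.intro)
qed

lemma power_norm_square:
 assumes x: "x \<in> carrier (Hn n)"
 shows "(hnorm (Hn n) x)^2 = (\<Sum>i<n. (nm (x i))\<^sup>2)"
proof -
 interpret P: inner_space "Hn n" by (rule power_inner_space)
 have "(hnorm (Hn n) x)^2 = Re (\<Sum>i<n. cinner H (x i) (x i))"
  using P.nm_square[OF x] by (simp add: power_simps)
 also have "... = (\<Sum>i<n. (nm (x i))\<^sup>2)"
  unfolding Re_sum using power_comp[OF x] by (intro sum.cong refl) (simp add: nm_square)
 finally show ?thesis .
qed

lemma power_comp_norm_le:
 assumes x: "x \<in> carrier (Hn n)" and i: "i < n"
 shows "nm (x i) <= hnorm (Hn n) x"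
proof (rule power2_le_imp_le)
 interpret P: inner_space "Hn n" by (rule power_inner_space)
 show "0 <= hnorm (Hn n) x" by (rule P.nm_nonneg[OF x])
 show "(nm (x i))^2 <= (hnorm (Hn n) x)^2"
  unfolding power_norm_square[OF x] using i by (intro member_le_sum) auto
qed

lemma matrix_op_mem:
 assumes A: "\<forall>i<n. \<forall>j<n. bounded_op H (A i j)" and x: "x \<in> carrier (Hn n)"
 shows "matrix_op H n A x \<in> carrier (Hn n)"
proof -
 have "(\<Oplus>j\<in>{..<n}. A i j (x j)) \<in> \<H>" if "i < n" for i
  using that A power_comp[OF x] bounded_opD(1) by (intro M.finsum_closed) auto
 thus ?thesis using x unfolding matrix_op_def power_simps by auto
qed

lemma matrix_op_inner:
 assumes A: "\<forall>i<n. \<forall>j<n. bounded_op H (A i j)"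
  and x: "x \<in> carrier (Hn n)" and h: "h \<in> carrier (Hn n)"
 shows "cinner (Hn n) (matrix_op H n A x) h = (\<Sum>i<n. \<Sum>j<n. ip (A i j (x j)) (h i))"
proof -
 have "ip (matrix_op H n A x i) (h i) = (\<Sum>j<n. ip (A i j (x j)) (h i))" if i: "i < n" for i
 proof -
  have "matrix_op H n A x i = (\<Oplus>j\<in>{..<n}. A i j (x j))" using x i by (simp add: matrix_op_def)
  thus ?thesis
   using i A power_comp[OF x] power_comp[OF h] bounded_opD(1) by (simp add: ip_finsum_left Pi_iff)
 qed
 thus ?thesis unfolding power_simps by (intro sum.cong refl) auto
qed

text \<open>Any matrix of bounded operators is bounded, with the crude bound given by the sum of the norms of the entries.\<close>

lemma matrix_op_bounded:
 assumes A: "\<forall>i<n. \<forall>j<n. bounded_op H (A i j)"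
 shows "bounded_op (Hn n) (matrix_op H n A)"
proof -
 interpret P: inner_space "Hn n" by (rule power_inner_space)
 let ?C = "carrier (Hn n)" and ?N = "hnorm (Hn n)"
 define S where "S = (\<Sum>i<n. \<Sum>j<n. opnorm H (A i j))"
 have S0: "0 <= S" unfolding S_def using A opnorm_nonneg by (intro sum_nonneg) auto
 note mem = matrix_op_mem[OF A]
 show ?thesis
 proof (rule P.bounded_opI[where K = S])
  show "matrix_op H n A \<in> extensional ?C" by (simp add: matrix_op_def)
  show "matrix_op H n A x \<in> ?C" if "x \<in> ?C" for x using A that by (intro matrix_op_mem) auto
 next
  fix x y assume x: "x \<in> ?C" and y: "y \<in> ?C"
  have xy: "x \<oplus>\<^bsub>Hn n\<^esub> y \<in> ?C" using x y by simp
  show "matrix_op H n A (x \<oplus>\<^bsub>Hn n\<^esub> y) = matrix_op H n A x \<oplus>\<^bsub>Hn n\<^esub> matrix_op H n A y"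
  proof (rule P.eq_if_ip_eq)
   fix h assume h: "h \<in> ?C"
   have "cinner (Hn n) (matrix_op H n A (x \<oplus>\<^bsub>Hn n\<^esub> y)) h
     = (\<Sum>i<n. \<Sum>j<n. ip (A i j (x j)) (h i) + ip (A i j (y j)) (h i))"
    unfolding matrix_op_inner[OF A xy h]
   proof (intro sum.cong refl)
    fix i j assume ij: "i \<in> {..<n}" "j \<in> {..<n}"
    hence b: "bounded_op H (A i j)" using A by auto
    show "ip (A i j ((x \<oplus>\<^bsub>Hn n\<^esub> y) j)) (h i) = ip (A i j (x j)) (h i) + ip (A i j (y j)) (h i)"
     using ij power_comp[OF x] power_comp[OF y] power_comp[OF h] bounded_opD[OF b]
     by (simp add: power_simps(3) cinner_add_left)
   qed
   also have "... = cinner (Hn n) (matrix_op H n A x) h + cinner (Hn n) (matrix_op H n A y) h"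
    unfolding matrix_op_inner[OF A x h] matrix_op_inner[OF A y h] by (simp add: sum.distrib)
   also have "... = cinner (Hn n) (matrix_op H n A x \<oplus>\<^bsub>Hn n\<^esub> matrix_op H n A y) h"
    using P.cinner_add_left[OF matrix_op_mem[OF A x] matrix_op_mem[OF A y] h] by simp
   finally show "cinner (Hn n) (matrix_op H n A (x \<oplus>\<^bsub>Hn n\<^esub> y)) h
     = cinner (Hn n) (matrix_op H n A x \<oplus>\<^bsub>Hn n\<^esub> matrix_op H n A y) h" .
  qed (use A x y xy matrix_op_mem[OF A] in auto)
 next
  fix c x assume x: "x \<in> ?C"
  have cx: "c \<odot>\<^bsub>Hn n\<^esub> x \<in> ?C" using x by simp
  show "matrix_op H n A (c \<odot>\<^bsub>Hn n\<^esub> x) = c \<odot>\<^bsub>Hn n\<^esub> matrix_op H n A x"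
  proof (rule P.eq_if_ip_eq)
   fix h assume h: "h \<in> ?C"
   have "cinner (Hn n) (matrix_op H n A (c \<odot>\<^bsub>Hn n\<^esub> x)) h
     = (\<Sum>i<n. \<Sum>j<n. c * ip (A i j (x j)) (h i))"
    unfolding matrix_op_inner[OF A cx h]
   proof (intro sum.cong refl)
    fix i j assume ij: "i \<in> {..<n}" "j \<in> {..<n}"
    hence b: "bounded_op H (A i j)" using A by auto
    show "ip (A i j ((c \<odot>\<^bsub>Hn n\<^esub> x) j)) (h i) = c * ip (A i j (x j)) (h i)"
     using ij power_comp[OF x] power_comp[OF h] bounded_opD[OF b]
     by (simp add: power_simps(4) cinner_smult_left)
   qed
   also have "... = c * cinner (Hn n) (matrix_op H n A x) h"
    unfolding matrix_op_inner[OF A x h] by (simp add: sum_distrib_left)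
   also have "... = cinner (Hn n) (c \<odot>\<^bsub>Hn n\<^esub> matrix_op H n A x) h"
    using P.cinner_smult_left[OF matrix_op_mem[OF A x] h] by simp
   finally show "cinner (Hn n) (matrix_op H n A (c \<odot>\<^bsub>Hn n\<^esub> x)) h
     = cinner (Hn n) (c \<odot>\<^bsub>Hn n\<^esub> matrix_op H n A x) h" .
  qed (use A x cx matrix_op_mem[OF A] in auto)
 next
  fix x assume x: "x \<in> ?C"
  have "?N (matrix_op H n A x) <= S * ?N x \<or> matrix_op H n A x = \<zero>\<^bsub>Hn n\<^esub>"
  proof (rule P.nm_le_if_ip_le[OF matrix_op_mem[OF A x]])
   fix h assume h: "h \<in> ?C"
   have "cmod (cinner (Hn n) (matrix_op H n A x) h) <= (\<Sum>i<n. \<Sum>j<n. cmod (ip (A i j (x j)) (h i)))"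
    unfolding matrix_op_inner[OF A x h] by (rule norm_double_sum_le)
   also have "... <= (\<Sum>i<n. \<Sum>j<n. opnorm H (A i j) * ?N x * ?N h)"
   proof (rule sum_mono, rule sum_mono)
    fix i j assume ij: "i \<in> {..<n}" "j \<in> {..<n}"
    hence b: "bounded_op H (A i j)" and xj: "x j \<in> \<H>" and hi: "h i \<in> \<H>"
     using A power_comp[OF x] power_comp[OF h] by auto
    have "cmod (ip (A i j (x j)) (h i)) <= nm (A i j (x j)) * nm (h i)"
     by (rule Cauchy_Schwarz[OF bounded_opD(1)[OF b xj] hi])
    also have "... <= (opnorm H (A i j) * nm (x j)) * nm (h i)"
     by (intro mult_right_mono opnorm_upper b xj nm_nonneg hi)
    also have "... <= (opnorm H (A i j) * ?N x) * ?N h"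
     using ij by (intro mult_mono mult_left_mono power_comp_norm_le x h opnorm_nonneg b mult_nonneg_nonneg P.nm_nonneg nm_nonneg hi) auto
    finally show "cmod (ip (A i j (x j)) (h i)) <= opnorm H (A i j) * ?N x * ?N h" .
   qed
   also have "... = S * ?N x * ?N h" unfolding S_def by (simp only: sum_distrib_right)
   finally show "cmod (cinner (Hn n) (matrix_op H n A x) h) <= S * ?N x * ?N h" .
  qed
  thus "?N (matrix_op H n A x) <= S * ?N x"
   using S0 P.nm_nonneg[OF x] by auto
 qed
qed

end

text \<open>The column \<open>(p\<^sub>k)\<close> is an operator of norm at most \<open>s\<close> into the sum of countably many copies of \<open>H\<close>.\<close>

definition (in inner_space) column_bounded :: "(nat => 'a => 'a) => real => bool"
 where "column_bounded p s \<longleftrightarrow> 0 <= s & (\<forall>k. \<forall>f\<in>\<H>. p k f \<in> \<H>) &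
   (\<forall>f\<in>\<H>. \<forall>N. (\<Sum>k<N. (nm (p k f))\<^sup>2) <= s\<^sup>2 * (nm f)^2)"

text \<open>The map \<open>A \<mapsto> \<Sum>\<^sub>k q\<^sub>k\<^sup>* A p\<^sub>k\<close>, written through matrix coefficients. Its form shows complete boundedness and normality at once.\<close>

locale symbol_map = inner_space +
 fixes p q :: "nat => 'a => 'a" and s :: real and \<Phi> :: "('a => 'a) => 'a => 'a"
 assumes p: "column_bounded p s" and q: "column_bounded q s"
  and \<Phi>: "bounded_op H A ==> bounded_op H (\<Phi> A)"
  and \<Phi>_sums: "[|bounded_op H A; f \<in> \<H>; h \<in> \<H>|] ==>
   (%k. ip (A (p k f)) (q k h)) sums ip (\<Phi> A f) h"
begin

lemma p_mem: "f \<in> \<H> ==> p k f \<in> \<H>"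
 and q_mem: "f \<in> \<H> ==> q k f \<in> \<H>"
 using p q by (auto simp: column_bounded_def)

lemma p_le: "f \<in> \<H> ==> (\<Sum>k<N. (nm (p k f))\<^sup>2) <= s\<^sup>2 * (nm f)^2"
 and q_le: "f \<in> \<H> ==> (\<Sum>k<N. (nm (q k f))\<^sup>2) <= s\<^sup>2 * (nm f)^2"
 using p q by (auto simp: column_bounded_def)

text \<open>Columns apply entrywise to \<open>H\<^sup>n\<close>, so the estimate for \<open>n = 1\<close>, Cauchy--Schwarz over the column index, holds verbatim for matrices.\<close>

lemma matrix_opnorm_le:
 assumes A: "\<forall>i<n. \<forall>j<n. bounded_op H (A i j)"
 shows "matrix_opnorm H n (%i j. \<Phi> (A i j)) <= s\<^sup>2 * matrix_opnorm H n A"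
proof -
 interpret P: inner_space "Hn n" by (rule power_inner_space)
 let ?C = "carrier (Hn n)" and ?N = "hnorm (Hn n)"
 let ?a = "matrix_opnorm H n A" and ?B = "%i j. \<Phi> (A i j)"
 have B: "\<forall>i<n. \<forall>j<n. bounded_op H (?B i j)" using A \<Phi> by blast
 have bA: "bounded_op (Hn n) (matrix_op H n A)" by (rule matrix_op_bounded[OF A])
 have a0: "0 <= ?a" unfolding matrix_opnorm_def by (rule P.opnorm_nonneg[OF bA])
 define lift where "lift r x = (\<lambda>i\<in>{..<n}. r (x i))" for r :: "'a => 'a" and x :: "nat => 'a"
 have liftp: "lift (p k) x \<in> ?C" and liftq: "lift (q k) x \<in> ?C" if "x \<in> ?C" for k x
  using power_comp[OF that] p_mem q_mem by (auto simp: lift_def power_simps)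
 have sum_lift: "(\<Sum>k<N. (?N (lift (r k) x))\<^sup>2) <= s\<^sup>2 * (?N x)^2"
  if x: "x \<in> ?C" and r: "\<And>f N. f \<in> \<H> ==> (\<Sum>k<N. (nm (r k f))\<^sup>2) <= s\<^sup>2 * (nm f)^2"
   and rl: "\<And>k. lift (r k) x \<in> ?C" for r x N
 proof -
  have "(\<Sum>k<N. (?N (lift (r k) x))\<^sup>2) = (\<Sum>k<N. \<Sum>i<n. (nm (r k (x i)))\<^sup>2)"
   unfolding power_norm_square[OF rl] by (simp add: lift_def)
  also have "... = (\<Sum>i<n. \<Sum>k<N. (nm (r k (x i)))\<^sup>2)" by (rule sum.swap)
  also have "... <= (\<Sum>i<n. s\<^sup>2 * (nm (x i))^2)"
   using power_comp[OF x] by (intro sum_mono r) auto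
  also have "... = s\<^sup>2 * (?N x)^2" unfolding power_norm_square[OF x] by (simp add: sum_distrib_left)
  finally show ?thesis .
 qed
 show ?thesis unfolding matrix_opnorm_def[of H n ?B]
 proof (rule P.opnorm_le)
  show "0 <= s\<^sup>2 * ?a" using a0 by simp
  fix x assume x: "x \<in> ?C"
  have out: "matrix_op H n ?B x \<in> ?C" using matrix_op_mem[OF B x] by simp
  have "?N (matrix_op H n ?B x) <= s\<^sup>2 * ?a * ?N x \<or> matrix_op H n ?B x = \<zero>\<^bsub>Hn n\<^esub>"
  proof (rule P.nm_le_if_ip_le[OF out])
   fix h assume h: "h \<in> ?C"
   let ?t = "%k. cinner (Hn n) (matrix_op H n A (lift (p k) x)) (lift (q k) h)"
   have t_eq: "?t k = (\<Sum>i<n. \<Sum>j<n. ip (A i j (p k (x j))) (q k (h i)))" for k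
    unfolding matrix_op_inner[OF A liftp[OF x] liftq[OF h]] by (simp add: lift_def)
   have "(%k. \<Sum>i<n. \<Sum>j<n. ip (A i j (p k (x j))) (q k (h i))) sums (\<Sum>i<n. \<Sum>j<n. ip (?B i j (x j)) (h i))"
    using A power_comp[OF x] power_comp[OF h] by (intro sums_sum \<Phi>_sums) auto
   hence sm: "?t sums cinner (Hn n) (matrix_op H n ?B x) h"
    unfolding t_eq matrix_op_inner[OF B x h] .
   have "cmod (\<Sum>k<N. ?t k) <= s\<^sup>2 * ?a * ?N x * ?N h" for N
   proof -
    let ?y = "%k. ?N (lift (p k) x)" and ?z = "%k. ?N (lift (q k) h)"
    have "cmod (?t k) <= ?a * (?y k * ?z k)" for k
    proof -
     have "cmod (?t k) <= ?N (matrix_op H n A (lift (p k) x)) * ?z k"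
      by (rule P.Cauchy_Schwarz[OF P.bounded_opD(1)[OF bA liftp[OF x]] liftq[OF h]])
     also have "... <= (?a * ?y k) * ?z k"
      unfolding matrix_opnorm_def
      by (intro mult_right_mono P.opnorm_upper[OF bA liftp[OF x]] P.nm_nonneg liftq h)
     finally show ?thesis by (simp add: mult.assoc)
    qed
    hence "cmod (\<Sum>k<N. ?t k) <= (\<Sum>k<N. ?a * (?y k * ?z k))"
     by (intro order_trans[OF norm_sum[of ?t] sum_mono])
    also have "... = ?a * (\<Sum>k<N. ?y k * ?z k)" by (simp add: sum_distrib_left)
    also have "... <= ?a * (s\<^sup>2 * ?N x * ?N h)"
    proof (intro mult_left_mono a0)
     have "(\<Sum>k<N. ?y k * ?z k)^2 <= (\<Sum>k<N. (?y k)\<^sup>2) * (\<Sum>k<N. (?z k)\<^sup>2)" by (rule Cauchy_Schwarz_ineq_sum)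
     also have "... <= (s\<^sup>2 * (?N x)^2) * (s\<^sup>2 * (?N h)^2)"
      using sum_lift[OF x p_le liftp[OF x]] sum_lift[OF h q_le liftq[OF h]]
      by (intro mult_mono) (auto intro: sum_nonneg)
     also have "... = (s\<^sup>2 * ?N x * ?N h)^2" by (simp add: power_mult_distrib power2_eq_square)
     finally show "(\<Sum>k<N. ?y k * ?z k) <= s\<^sup>2 * ?N x * ?N h"
      by (rule power2_le_imp_le) (use P.nm_nonneg[OF x] P.nm_nonneg[OF h] in simp)
    qed
    finally show ?thesis by (simp add: mult_ac)
   qed
   moreover have "(%N. cmod (\<Sum>k<N. ?t k)) \<leadsto> cmod (cinner (Hn n) (matrix_op H n ?B x) h)"
    using sm unfolding sums_def by (rule tendsto_norm)
   ultimately show "cmod (cinner (Hn n) (matrix_op H n ?B x) h) <= s\<^sup>2 * ?a * ?N x * ?N h"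
    by (intro LIMSEQ_le_const2) auto
  qed
  thus "?N (matrix_op H n ?B x) <= s\<^sup>2 * ?a * ?N x"
   using a0 P.nm_nonneg[OF x] by auto
 qed
qed

end

context inner_space
begin

abbreviation sq_pairs :: "((nat => 'a) \<times> (nat => 'a)) set"
 where "sq_pairs \<equiv> sq_summable_seqs H \<times> sq_summable_seqs H"

definition normal_fun :: "(nat => 'a) => (nat => 'a) => ('a => 'a) => complex"
 where "normal_fun \<xi> \<eta> A = (\<Sum>n. ip (A (\<xi> n)) (\<eta> n))"

lemma sq_summableD:
 "\<xi> \<in> sq_summable_seqs H ==> \<xi> n \<in> \<H>" "\<xi> \<in> sq_summable_seqs H ==> summable (%n. (nm (\<xi> n))\<^sup>2)"
 by (auto simp: sq_summable_seqs_def)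

lemma normal_summable:
 assumes A: "bounded_op H A" and x: "\<xi> \<in> sq_summable_seqs H" and y: "\<eta> \<in> sq_summable_seqs H"
 shows "summable (%n. cmod (ip (A (\<xi> n)) (\<eta> n)))"
proof (rule summable_comparison_test')
 show "summable (%n. opnorm H A * ((nm (\<xi> n))^2 + (nm (\<eta> n))^2))"
  by (intro summable_mult summable_add sq_summableD(2) x y)
 fix n
 have m: "\<xi> n \<in> \<H>" "\<eta> n \<in> \<H>" using sq_summableD(1) x y by auto
 have "cmod (ip (A (\<xi> n)) (\<eta> n)) <= nm (A (\<xi> n)) * nm (\<eta> n)"
  by (rule Cauchy_Schwarz[OF bounded_opD(1)[OF A m(1)] m(2)])
 also have "... <= (opnorm H A * nm (\<xi> n)) * nm (\<eta> n)"
  by (intro mult_right_mono opnorm_upper A m nm_nonneg)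
 also have "... <= opnorm H A * ((nm (\<xi> n))^2 + (nm (\<eta> n))^2)"
 proof -
  have "0 <= (nm (\<xi> n) - nm (\<eta> n))^2 + (nm (\<xi> n))^2 + (nm (\<eta> n))^2" by simp
  hence "nm (\<xi> n) * nm (\<eta> n) <= (nm (\<xi> n))^2 + (nm (\<eta> n))^2" by (simp add: power2_diff)
  thus ?thesis using opnorm_nonneg[OF A] by (simp add: mult.assoc mult_left_mono)
 qed
 finally show "norm (cmod (ip (A (\<xi> n)) (\<eta> n))) <= opnorm H A * ((nm (\<xi> n))^2 + (nm (\<eta> n))^2)" by simp
qed

lemma normal_sums:
 assumes "bounded_op H A" "\<xi> \<in> sq_summable_seqs H" "\<eta> \<in> sq_summable_seqs H"
 shows "(%n. ip (A (\<xi> n)) (\<eta> n)) sums normal_fun \<xi> \<eta> A"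
 unfolding normal_fun_def by (rule summable_sums[OF summable_norm_cancel[OF normal_summable[OF assms]]])

abbreviation evaluation :: "('a => 'a) => (nat => 'a) \<times> (nat => 'a) => complex"
 where "evaluation \<equiv> (%A. \<lambda>(\<xi>, \<eta>)\<in>sq_pairs. \<Sum>n. cinner H (A (\<xi> n)) (\<eta> n))"

lemma sigma_weak_eq:
 "swt H = pullback_topology (carrier (BH H)) evaluation (product_topology (%_. euclidean) sq_pairs)"
 by (simp add: sigma_weak_topology_def)

lemma evaluation_apply: "(\<xi>, \<eta>) \<in> sq_pairs ==> evaluation A (\<xi>, \<eta>) = normal_fun \<xi> \<eta> A"
 by (simp add: normal_fun_def)

lemma topspace_sigma_weak: "topspace (swt H) = carrier (BH H)"
 unfolding sigma_weak_eq topspace_pullback_topology by auto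

lemma continuous_evaluation: "continuous_map (swt H) (product_topology (%_. euclidean) sq_pairs) evaluation"
 unfolding sigma_weak_eq using continuous_map_pullback[OF continuous_map_id] by (simp only: comp_id id_comp)

lemma continuous_normal_fun:
 assumes "\<xi> \<in> sq_summable_seqs H" "\<eta> \<in> sq_summable_seqs H"
 shows "continuous_map (swt H) euclidean (normal_fun \<xi> \<eta>)"
proof -
 have m: "(\<xi>, \<eta>) \<in> sq_pairs" using assms by auto
 have "continuous_map (swt H) euclidean ((%x. x (\<xi>, \<eta>)) \<circ> evaluation)"
  by (rule continuous_map_compose[OF continuous_evaluation continuous_map_product_projection[OF m]])
 moreover have "(%x. x (\<xi>, \<eta>)) \<circ> evaluation = normal_fun \<xi> \<eta>"
  unfolding comp_def evaluation_apply[OF m] ..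
 ultimately show ?thesis by simp
qed

lemma continuous_into_sigma_weak:
 assumes f: "f \<in> topspace X \<rightarrow> carrier (BH H)"
  and c: "\<And>\<xi> \<eta>. [|\<xi> \<in> sq_summable_seqs H; \<eta> \<in> sq_summable_seqs H|] ==> continuous_map X euclidean (%x. normal_fun \<xi> \<eta> (f x))"
 shows "continuous_map X (swt H) f"
 unfolding sigma_weak_eq
proof (rule continuous_map_pullback')
 show "topspace X \<subseteq> f -` carrier (BH H)" using f by auto
 show "continuous_map X (product_topology (%_. euclidean) sq_pairs) (evaluation \<circ> f)"
  unfolding continuous_map_componentwise
 proof (intro conjI ballI)
  show "(evaluation \<circ> f) ` topspace X \<subseteq> extensional sq_pairs" by auto
  fix k assume k: "k \<in> sq_pairs"
  obtain \<xi> \<eta> where xe: "k = (\<xi>, \<eta>)" by fastforce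
  have "(%x. (evaluation \<circ> f) x k) = (%x. normal_fun \<xi> \<eta> (f x))"
   using evaluation_apply k unfolding xe comp_def by blast
  thus "continuous_map X euclidean (%x. (evaluation \<circ> f) x k)" using c k xe by auto
 qed
qed

text \<open>Normal functionals with a single nonzero entry in both sequences recover all matrix coefficients.\<close>

lemma Hausdorff_sigma_weak: "Hausdorff_space (swt H)"
proof (rule Hausdorff_space_injective_preimage[OF _ continuous_evaluation])
 show "Hausdorff_space (product_topology (%_. euclidean :: complex topology) sq_pairs)"
  unfolding Hausdorff_space_product_topology by simp
 show "inj_on evaluation (topspace (swt H))"
  unfolding topspace_sigma_weak
 proof (rule inj_onI)
  fix A B assume AB: "A \<in> carrier (BH H)" "B \<in> carrier (BH H)" and eq: "evaluation A = evaluation B"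
  hence b: "bounded_op H A" "bounded_op H B" by (auto simp: BH_simps)
  show "A = B"
  proof (rule op_eq_if_ip_eq[OF b])
   fix x y assume xy: "x \<in> \<H>" "y \<in> \<H>"
   define e where "e z = (%n::nat. if n = 0 then z else \<zero>)" for z
   have e: "e z \<in> sq_summable_seqs H" if z: "z \<in> \<H>" for z
   proof -
    have "(%n. (nm (e z n))\<^sup>2) sums (\<Sum>n\<in>{0}. (nm (e z n))\<^sup>2)"
     by (rule sums_finite) (auto simp: e_def)
    thus ?thesis using z unfolding sq_summable_seqs_def by (auto simp: e_def sums_iff)
   qed
   have val: "normal_fun (e x) (e y) C = ip (C x) y" if "bounded_op H C" for C
   proof -
    have "(%n. ip (C (e x n)) (e y n)) sums (\<Sum>n\<in>{0}. ip (C (e x n)) (e y n))"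
     by (rule sums_finite) (use bounded_opD(1)[OF that] xy in \<open>auto simp: e_def\<close>)
    thus ?thesis by (simp add: normal_fun_def sums_iff e_def)
   qed
   have m: "(e x, e y) \<in> sq_pairs" using e xy by auto
   have "evaluation A (e x, e y) = evaluation B (e x, e y)" by (simp only: eq)
   thus "ip (A x) y = ip (B x) y" unfolding evaluation_apply[OF m] val[OF b(1)] val[OF b(2)] .
  qed
 qed
qed

lemma sigma_weak_add_continuous:
 assumes B: "B \<in> carrier (BH H)"
 shows "continuous_map (swt H) (swt H) (%A. A \<oplus>\<^bsub>BH H\<^esub> B)"
proof (rule continuous_into_sigma_weak)
 show "(%A. A \<oplus>\<^bsub>BH H\<^esub> B) \<in> topspace (swt H) \<rightarrow> carrier (BH H)"
  using B BH_add_closed by (auto simp: topspace_sigma_weak)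
 fix \<xi> \<eta> assume x: "\<xi> \<in> sq_summable_seqs H" and y: "\<eta> \<in> sq_summable_seqs H"
 have "continuous_map (swt H) euclidean (%A. normal_fun \<xi> \<eta> A + normal_fun \<xi> \<eta> B)"
  by (intro continuous_map_add continuous_normal_fun x y) simp
 thus "continuous_map (swt H) euclidean (%A. normal_fun \<xi> \<eta> (A \<oplus>\<^bsub>BH H\<^esub> B))"
 proof (rule continuous_map_eq)
  fix A assume "A \<in> topspace (swt H)"
  hence A: "bounded_op H A" by (simp add: topspace_sigma_weak BH_simps)
  have B': "bounded_op H B" using B by (simp add: BH_simps)
  have "(%n. ip (A (\<xi> n)) (\<eta> n) + ip (B (\<xi> n)) (\<eta> n)) sums (normal_fun \<xi> \<eta> A + normal_fun \<xi> \<eta> B)"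
   by (intro sums_add normal_sums A B' x y)
  moreover have "ip (A (\<xi> n)) (\<eta> n) + ip (B (\<xi> n)) (\<eta> n) = ip ((A \<oplus>\<^bsub>BH H\<^esub> B) (\<xi> n)) (\<eta> n)" for n
   using sq_summableD(1)[OF x] sq_summableD(1)[OF y] bounded_opD(1)[OF A] bounded_opD(1)[OF B']
   by (simp add: BH_simps(2) cinner_add_left)
  ultimately show "normal_fun \<xi> \<eta> A + normal_fun \<xi> \<eta> B = normal_fun \<xi> \<eta> (A \<oplus>\<^bsub>BH H\<^esub> B)"
   by (simp add: normal_fun_def[of \<xi> \<eta> "A \<oplus>\<^bsub>BH H\<^esub> B"] sums_iff)
 qed
qed

lemma sigma_weak_scale_continuous:
 "continuous_map (swt H) (swt H) (%A. c \<odot>\<^bsub>BH H\<^esub> A)"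
proof (rule continuous_into_sigma_weak)
 show "(%A. c \<odot>\<^bsub>BH H\<^esub> A) \<in> topspace (swt H) \<rightarrow> carrier (BH H)"
  using BH_scale_closed by (auto simp: topspace_sigma_weak)
 fix \<xi> \<eta> assume x: "\<xi> \<in> sq_summable_seqs H" and y: "\<eta> \<in> sq_summable_seqs H"
 have "continuous_map euclidean euclidean (%z. c * z)"
  by (simp add: continuous_map_iff_continuous2 continuous_intros)
 hence "continuous_map (swt H) euclidean ((%z. c * z) \<circ> normal_fun \<xi> \<eta>)"
  by (rule continuous_map_compose[OF continuous_normal_fun[OF x y]])
 thus "continuous_map (swt H) euclidean (%A. normal_fun \<xi> \<eta> (c \<odot>\<^bsub>BH H\<^esub> A))"
 proof (rule continuous_map_eq)
  fix A assume "A \<in> topspace (swt H)"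
  hence A: "bounded_op H A" by (simp add: topspace_sigma_weak BH_simps)
  have "(%n. c * ip (A (\<xi> n)) (\<eta> n)) sums (c * normal_fun \<xi> \<eta> A)"
   by (intro sums_mult normal_sums A x y)
  moreover have "c * ip (A (\<xi> n)) (\<eta> n) = ip ((c \<odot>\<^bsub>BH H\<^esub> A) (\<xi> n)) (\<eta> n)" for n
   using sq_summableD(1)[OF x] sq_summableD(1)[OF y] bounded_opD(1)[OF A]
   by (simp add: BH_simps(3) cinner_smult_left)
  ultimately show "((%z. c * z) \<circ> normal_fun \<xi> \<eta>) A = normal_fun \<xi> \<eta> (c \<odot>\<^bsub>BH H\<^esub> A)"
   by (simp add: normal_fun_def[of \<xi> \<eta> "c \<odot>\<^bsub>BH H\<^esub> A"] sums_iff)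
 qed
qed

lemma closure_scale:
 assumes U: "\<And>A. A \<in> U ==> c \<odot>\<^bsub>BH H\<^esub> A \<in> U" and A: "A \<in> swt H closure_of U"
 shows "c \<odot>\<^bsub>BH H\<^esub> A \<in> swt H closure_of U"
proof -
 have "(%A. c \<odot>\<^bsub>BH H\<^esub> A) ` (swt H closure_of U) \<subseteq> swt H closure_of ((%A. c \<odot>\<^bsub>BH H\<^esub> A) ` U)"
  by (rule continuous_map_image_closure_subset[OF sigma_weak_scale_continuous])
 also have "... \<subseteq> swt H closure_of U" using U by (intro closure_of_mono) auto
 finally show ?thesis using A by auto
qed

lemma closure_add:
 assumes sub: "U \<subseteq> carrier (BH H)" and U: "\<And>A B. [|A \<in> U; B \<in> U|] ==> A \<oplus>\<^bsub>BH H\<^esub> B \<in> U"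
  and A: "A \<in> swt H closure_of U" and B: "B \<in> swt H closure_of U"
 shows "A \<oplus>\<^bsub>BH H\<^esub> B \<in> swt H closure_of U"
proof -
 let ?V = "swt H closure_of U"
 have V: "?V \<subseteq> carrier (BH H)" using closure_of_subset_topspace[of "swt H" U] by (simp only: topspace_sigma_weak)
 have comm: "C \<oplus>\<^bsub>BH H\<^esub> D = D \<oplus>\<^bsub>BH H\<^esub> C" if "C \<in> carrier (BH H)" "D \<in> carrier (BH H)" for C D
  by (rule abelian_monoid.a_comm[OF BH_abelian_monoid that])
 have step: "A \<oplus>\<^bsub>BH H\<^esub> B \<in> ?V" if A: "A \<in> ?V" and B: "B \<in> U" for A B
 proof -
  have "(%A. A \<oplus>\<^bsub>BH H\<^esub> B) ` ?V \<subseteq> swt H closure_of ((%A. A \<oplus>\<^bsub>BH H\<^esub> B) ` U)"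
   by (rule continuous_map_image_closure_subset[OF sigma_weak_add_continuous]) (use sub B in blast)
  also have "... \<subseteq> ?V" using U B by (intro closure_of_mono) auto
  finally show ?thesis using A by auto
 qed
 have "(%B. B \<oplus>\<^bsub>BH H\<^esub> A) ` ?V \<subseteq> swt H closure_of ((%B. B \<oplus>\<^bsub>BH H\<^esub> A) ` U)"
  by (rule continuous_map_image_closure_subset[OF sigma_weak_add_continuous]) (use V A in blast)
 also have "... \<subseteq> swt H closure_of ?V"
 proof (intro closure_of_mono subsetI)
  fix C assume "C \<in> (%B. B \<oplus>\<^bsub>BH H\<^esub> A) ` U"
  then obtain D where D: "D \<in> U" "C = D \<oplus>\<^bsub>BH H\<^esub> A" by auto
  have "D \<oplus>\<^bsub>BH H\<^esub> A = A \<oplus>\<^bsub>BH H\<^esub> D" by (rule comm) (use sub V A D(1) in blast)+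
  hence "C = A \<oplus>\<^bsub>BH H\<^esub> D" using D(2) by (simp only:)
  thus "C \<in> ?V" using step[OF A D(1)] by simp
 qed
 also have "... = ?V" by simp
 finally have "B \<oplus>\<^bsub>BH H\<^esub> A \<in> ?V" using B by auto
 moreover have "B \<oplus>\<^bsub>BH H\<^esub> A = A \<oplus>\<^bsub>BH H\<^esub> B" by (rule comm) (use V A B in blast)+
 ultimately show ?thesis by simp
qed

end

context symbol_map
begin

text \<open>A square summable double family, enumerated by pairs, is a square summable sequence. With it a normal functional composed with a symbol map is again a normal functional.\<close>

lemma interleave_sq_summable:
 assumes x: "\<xi> \<in> sq_summable_seqs H"
  and r: "\<And>f k. f \<in> \<H> ==> r k f \<in> \<H>"
   "\<And>f N. f \<in> \<H> ==> (\<Sum>k<N. (nm (r k f))\<^sup>2) <= s\<^sup>2 * (nm f)^2"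
 shows "(%m. r (snd (prod_decode m)) (\<xi> (fst (prod_decode m)))) \<in> sq_summable_seqs H"
proof -
 let ?g = "%(n, k). (nm (r k (\<xi> n)))\<^sup>2"
 have "(\<Sum>m<M. ?g (prod_decode m)) <= s\<^sup>2 * (\<Sum>n. (nm (\<xi> n))\<^sup>2)" for M
 proof -
  define N where "N = Suc (Max (insert 0 ((%m. max (fst (prod_decode m)) (snd (prod_decode m))) ` {..<M})))"
  have sub: "prod_decode ` {..<M} \<subseteq> {..<N} \<times> {..<N}"
  proof
   fix z assume "z \<in> prod_decode ` {..<M}"
   then obtain m where m: "m < M" "z = prod_decode m" by auto
   hence "max (fst z) (snd z) <= Max (insert 0 ((%m. max (fst (prod_decode m)) (snd (prod_decode m))) ` {..<M}))"
    by (intro Max_ge) auto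
   thus "z \<in> {..<N} \<times> {..<N}" by (cases z) (auto simp: N_def)
  qed
  have "(\<Sum>m<M. ?g (prod_decode m)) = sum ?g (prod_decode ` {..<M})"
   by (subst sum.reindex) (auto intro: inj_onI simp: prod_decode_eq)
  also have "... <= sum ?g ({..<N} \<times> {..<N})" using sub by (intro sum_mono2) auto
  also have "... = (\<Sum>n<N. \<Sum>k<N. (nm (r k (\<xi> n)))\<^sup>2)" by (simp add: sum.cartesian_product)
  also have "... <= (\<Sum>n<N. s\<^sup>2 * (nm (\<xi> n))^2)" by (intro sum_mono r(2) sq_summableD(1) x)
  also have "... = s\<^sup>2 * (\<Sum>n<N. (nm (\<xi> n))\<^sup>2)" by (simp add: sum_distrib_left)
  also have "... <= s\<^sup>2 * (\<Sum>n. (nm (\<xi> n))\<^sup>2)"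
   by (intro mult_left_mono sum_le_suminf sq_summableD(2) x) auto
  finally show ?thesis .
 qed
 hence "summable (%m. ?g (prod_decode m))"
  by (intro summableI_nonneg_bounded) (auto simp: split_beta)
 thus ?thesis
  using r(1) sq_summableD(1)[OF x] unfolding sq_summable_seqs_def by (auto simp: split_beta)
qed

text \<open>Composing a normal functional with the map gives a normal functional, whose sequences are all \<open>p\<^sub>k \<xi>\<^sub>n\<close> and \<open>q\<^sub>k \<eta>\<^sub>n\<close>.\<close>

lemma symbol_map_continuous: "continuous_map (swt H) (swt H) \<Phi>"
proof (rule continuous_into_sigma_weak)
 show "\<Phi> \<in> topspace (swt H) \<rightarrow> carrier (BH H)"
  using \<Phi> by (auto simp: topspace_sigma_weak BH_simps)
 fix \<xi> \<eta> assume x: "\<xi> \<in> sq_summable_seqs H" and y: "\<eta> \<in> sq_summable_seqs H"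
 let ?\<xi> = "%m. p (snd (prod_decode m)) (\<xi> (fst (prod_decode m)))"
 let ?\<eta> = "%m. q (snd (prod_decode m)) (\<eta> (fst (prod_decode m)))"
 have x': "?\<xi> \<in> sq_summable_seqs H" by (rule interleave_sq_summable[OF x]) (fact p_mem p_le)+
 have y': "?\<eta> \<in> sq_summable_seqs H" by (rule interleave_sq_summable[OF y]) (fact q_mem q_le)+
 from continuous_normal_fun[OF x' y']
 show "continuous_map (swt H) euclidean (%A. normal_fun \<xi> \<eta> (\<Phi> A))"
 proof (rule continuous_map_eq)
  fix A assume "A \<in> topspace (swt H)"
  hence A: "bounded_op H A" by (simp add: topspace_sigma_weak BH_simps)
  let ?c = "%(n, k). ip (A (p k (\<xi> n))) (q k (\<eta> n))"
  have "((%m. ip (A (?\<xi> m)) (?\<eta> m)) has_sum normal_fun ?\<xi> ?\<eta> A) UNIV"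
   by (rule norm_summable_imp_has_sum[OF normal_summable[OF A x' y'] normal_sums[OF A x' y']])
  hence "((%m. ?c (prod_decode m)) has_sum normal_fun ?\<xi> ?\<eta> A) UNIV"
   by (simp add: split_beta)
  hence tot: "(?c has_sum normal_fun ?\<xi> ?\<eta> A) (UNIV \<times> UNIV)"
   using has_sum_reindex_bij_betw[OF bij_prod_decode, of ?c] by simp
  have "((%k. ?c (n, k)) has_sum ip (\<Phi> A (\<xi> n)) (\<eta> n)) UNIV" for n
  proof -
   have fs: "\<xi> n \<in> \<H>" "\<eta> n \<in> \<H>" using sq_summableD(1) x y by auto
   have "(%k. ?c (n, k)) summable_on UNIV"
   proof -
    have "?c summable_on (Pair n ` UNIV)"
     by (rule summable_on_subset_banach[OF has_sum_imp_summable[OF tot]]) auto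
    hence "(?c \<circ> Pair n) summable_on UNIV" by (subst (asm) summable_on_reindex) (auto intro: inj_onI)
    thus ?thesis by (simp add: comp_def)
   qed
   hence "((%k. ?c (n, k)) has_sum (infsum (%k. ?c (n, k)) UNIV)) UNIV" by simp
   moreover from has_sum_imp_sums[OF this]
   have "infsum (%k. ?c (n, k)) UNIV = ip (\<Phi> A (\<xi> n)) (\<eta> n)"
    using \<Phi>_sums[OF A fs] sums_unique2 by fastforce
   ultimately show ?thesis by simp
  qed
  hence "((%n. ip (\<Phi> A (\<xi> n)) (\<eta> n)) has_sum normal_fun ?\<xi> ?\<eta> A) UNIV"
   using has_sum_SigmaD[OF tot] by auto
  from has_sum_imp_sums[OF this]
  show "normal_fun ?\<xi> ?\<eta> A = normal_fun \<xi> \<eta> (\<Phi> A)"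
   by (simp add: normal_fun_def[of \<xi> \<eta>] sums_iff)
 qed
qed

lemma symbol_map_add:
 assumes A: "bounded_op H A" and B: "bounded_op H B"
 shows "\<Phi> (A \<oplus>\<^bsub>BH H\<^esub> B) = \<Phi> A \<oplus>\<^bsub>BH H\<^esub> \<Phi> B"
proof (rule op_eq_if_ip_eq)
 have AB: "bounded_op H (A \<oplus>\<^bsub>BH H\<^esub> B)" using bounded_op_add[OF A B] by (simp add: BH_simps)
 thus "bounded_op H (\<Phi> (A \<oplus>\<^bsub>BH H\<^esub> B))" by (rule \<Phi>)
 show "bounded_op H (\<Phi> A \<oplus>\<^bsub>BH H\<^esub> \<Phi> B)" using bounded_op_add[OF \<Phi>[OF A] \<Phi>[OF B]] by (simp add: BH_simps)
 fix f h assume f: "f \<in> \<H>" and h: "h \<in> \<H>"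
 have "(%k. ip (A (p k f)) (q k h) + ip (B (p k f)) (q k h)) sums (ip (\<Phi> A f) h + ip (\<Phi> B f) h)"
  by (intro sums_add \<Phi>_sums A B f h)
 moreover have "ip (A (p k f)) (q k h) + ip (B (p k f)) (q k h) = ip ((A \<oplus>\<^bsub>BH H\<^esub> B) (p k f)) (q k h)" for k
  using p_mem[OF f] q_mem[OF h] bounded_opD(1)[OF A] bounded_opD(1)[OF B] by (simp add: BH_simps(2) cinner_add_left)
 ultimately have "ip (\<Phi> (A \<oplus>\<^bsub>BH H\<^esub> B) f) h = ip (\<Phi> A f) h + ip (\<Phi> B f) h"
  using \<Phi>_sums[OF AB f h] sums_unique2 by fastforce
 thus "ip (\<Phi> (A \<oplus>\<^bsub>BH H\<^esub> B) f) h = ip ((\<Phi> A \<oplus>\<^bsub>BH H\<^esub> \<Phi> B) f) h"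
  using f h bounded_opD(1)[OF \<Phi>[OF A] f] bounded_opD(1)[OF \<Phi>[OF B] f] by (simp add: BH_simps(2) cinner_add_left)
qed

lemma symbol_map_scale:
 assumes A: "bounded_op H A"
 shows "\<Phi> (c \<odot>\<^bsub>BH H\<^esub> A) = c \<odot>\<^bsub>BH H\<^esub> \<Phi> A"
proof (rule op_eq_if_ip_eq)
 have cA: "bounded_op H (c \<odot>\<^bsub>BH H\<^esub> A)" using bounded_op_scale[OF A] by (simp add: BH_simps)
 thus "bounded_op H (\<Phi> (c \<odot>\<^bsub>BH H\<^esub> A))" by (rule \<Phi>)
 show "bounded_op H (c \<odot>\<^bsub>BH H\<^esub> \<Phi> A)" using bounded_op_scale[OF \<Phi>[OF A]] by (simp add: BH_simps)
 fix f h assume f: "f \<in> \<H>" and h: "h \<in> \<H>"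
 have "(%k. c * ip (A (p k f)) (q k h)) sums (c * ip (\<Phi> A f) h)"
  by (intro sums_mult \<Phi>_sums A f h)
 moreover have "c * ip (A (p k f)) (q k h) = ip ((c \<odot>\<^bsub>BH H\<^esub> A) (p k f)) (q k h)" for k
  using p_mem[OF f] q_mem[OF h] bounded_opD(1)[OF A] by (simp add: BH_simps(3) cinner_smult_left)
 ultimately have "ip (\<Phi> (c \<odot>\<^bsub>BH H\<^esub> A) f) h = c * ip (\<Phi> A f) h"
  using \<Phi>_sums[OF cA f h] sums_unique2 by fastforce
 thus "ip (\<Phi> (c \<odot>\<^bsub>BH H\<^esub> A) f) h = ip ((c \<odot>\<^bsub>BH H\<^esub> \<Phi> A) f) h"
  using f h bounded_opD(1)[OF \<Phi>[OF A] f] by (simp add: BH_simps(3) cinner_smult_left)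
qed

end

section \<open>Multiplication by rows and columns of functions\<close>

abbreviation SQ where "SQ \<mu> \<equiv> sq_integrable \<mu>"
abbreviation CL where "CL \<mu> \<equiv> carrier (L2 \<mu>)"

lemma borel_measurable_cnj [measurable (raw)]:
 "f \<in> borel_measurable M ==> (%x. cnj (f x)) \<in> borel_measurable M"
 by (rule borel_measurable_continuous_on[of cnj]) (intro continuous_intros)

lemma SQ_D:
 "f \<in> SQ \<mu> ==> f \<in> borel_measurable \<mu>"
 "f \<in> SQ \<mu> ==> integrable \<mu> (%x. cm2 (f x))"
 by (auto simp: sq_integrable_def)

lemma SQ_bound:
 assumes "f \<in> borel_measurable \<mu>" "integrable \<mu> w" "AE x in \<mu>. cm2 (f x) <= w x"
 shows "f \<in> SQ \<mu>"
proof -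
 have "integrable \<mu> (%x. cm2 (f x))"
 proof (rule Bochner_Integration.integrable_bound[OF assms(2)])
  show "(%x. cm2 (f x)) \<in> borel_measurable \<mu>" using assms(1) by measurable
  show "AE x in \<mu>. norm (cm2 (f x)) <= norm (w x)"
   using assms(3) by eventually_elim simp
 qed
 thus ?thesis using assms(1) by (simp add: sq_integrable_def)
qed

lemma SQ_add:
 assumes f: "f \<in> SQ \<mu>" and g: "g \<in> SQ \<mu>"
 shows "(%x. f x + g x) \<in> SQ \<mu>"
proof (rule SQ_bound)
 show "(%x. f x + g x) \<in> borel_measurable \<mu>"
  using SQ_D(1)[OF f] SQ_D(1)[OF g] by measurable
 show "integrable \<mu> (%x. 2 * cm2 (f x) + 2 * cm2 (g x))"
  by (intro Bochner_Integration.integrable_add integrable_mult_right SQ_D(2) f g)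
 show "AE x in \<mu>. cm2 (f x + g x) <= 2 * cm2 (f x) + 2 * cm2 (g x)"
  by (simp add: cmod_add_square_le)
qed

lemma SQ_scale:
 assumes f: "f \<in> SQ \<mu>" shows "(%x. c * f x) \<in> SQ \<mu>"
proof (rule SQ_bound)
 show "(%x. c * f x) \<in> borel_measurable \<mu>" using SQ_D(1)[OF f] by measurable
 show "integrable \<mu> (%x. cm2 c * cm2 (f x))" by (intro integrable_mult_right SQ_D(2) f)
qed (simp add: norm_mult power_mult_distrib)

lemma SQ_zero: "(%_. 0) \<in> SQ \<mu>" by (simp add: sq_integrable_def)

lemma SQ_mult_bounded:
 assumes f: "f \<in> SQ \<mu>" and P: "P \<in> borel_measurable \<mu>" "\<And>x. x \<in> space \<mu> ==> cmod (P x) <= s"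
 shows "(%x. P x * f x) \<in> SQ \<mu>"
proof (rule SQ_bound)
 show "(%x. P x * f x) \<in> borel_measurable \<mu>" using SQ_D(1)[OF f] P(1) by measurable
 show "integrable \<mu> (%x. s\<^sup>2 * cm2 (f x))" by (intro integrable_mult_right SQ_D(2) f)
 show "AE x in \<mu>. cm2 (P x * f x) <= s\<^sup>2 * cm2 (f x)"
 proof (rule AE_I2)
  fix x assume "x \<in> space \<mu>"
  hence "cm2 (P x) <= s\<^sup>2" using P(2) by (intro power_mono) auto
  thus "cm2 (P x * f x) <= s\<^sup>2 * cm2 (f x)"
   by (simp add: norm_mult power_mult_distrib mult_right_mono)
 qed
qed

lemma SQ_mult:
 assumes f: "f \<in> SQ \<mu>" and g: "g \<in> SQ \<mu>"
 shows "integrable \<mu> (%x. f x * cnj (g x))"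
proof (rule Bochner_Integration.integrable_bound)
 show "integrable \<mu> (%x. cm2 (f x) + cm2 (g x))"
  by (intro Bochner_Integration.integrable_add SQ_D(2) f g)
 show "(%x. f x * cnj (g x)) \<in> borel_measurable \<mu>"
  using SQ_D(1)[OF f] SQ_D(1)[OF g] by measurable
 show "AE x in \<mu>. norm (f x * cnj (g x)) <= norm (cm2 (f x) + cm2 (g x))"
  using cmod_mult_le_squares by (auto intro!: AE_I2)
qed

lemma L2_rel_equiv: "equiv (SQ \<mu>) (L2_rel \<mu>)"
proof (rule equivI)
 show "L2_rel \<mu> \<subseteq> SQ \<mu> \<times> SQ \<mu>" by (auto simp: L2_rel_def)
 show "refl_on (SQ \<mu>) (L2_rel \<mu>)" by (auto simp: refl_on_def L2_rel_def)
 show "sym (L2_rel \<mu>)"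
 proof (rule symI)
  fix f g assume "(f, g) \<in> L2_rel \<mu>"
  hence fg: "f \<in> SQ \<mu>" "g \<in> SQ \<mu>" "AE x in \<mu>. f x = g x" by (auto simp: L2_rel_def)
  have "AE x in \<mu>. g x = f x" using fg(3) by eventually_elim simp
  thus "(g, f) \<in> L2_rel \<mu>" using fg by (simp add: L2_rel_def)
 qed
 show "trans (L2_rel \<mu>)"
 proof (rule transI)
  fix f g h assume "(f, g) \<in> L2_rel \<mu>" "(g, h) \<in> L2_rel \<mu>"
  hence fg: "f \<in> SQ \<mu>" "AE x in \<mu>. f x = g x" and gh: "h \<in> SQ \<mu>" "AE x in \<mu>. g x = h x"
   by (auto simp: L2_rel_def)
  have "AE x in \<mu>. f x = h x" using fg(2) gh(2) by eventually_elim simp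
  thus "(f, h) \<in> L2_rel \<mu>" using fg gh by (simp add: L2_rel_def)
 qed
qed

lemma L2_class_eq_iff:
 "[|f \<in> SQ \<mu>; g \<in> SQ \<mu>|] ==> L2_class \<mu> f = L2_class \<mu> g \<longleftrightarrow> (AE x in \<mu>. f x = g x)"
 unfolding L2_class_def by (subst eq_equiv_class_iff[OF L2_rel_equiv]) (auto simp: L2_rel_def)

lemma L2_carrier: "CL \<mu> = SQ \<mu> // L2_rel \<mu>"
 by (simp add: L2_def)

lemma L2_class_mem: "f \<in> SQ \<mu> ==> L2_class \<mu> f \<in> CL \<mu>"
 unfolding L2_carrier L2_class_def by (rule quotientI)

lemma L2_rep_class:
 assumes f: "f \<in> SQ \<mu>"
 shows "L2_rep (L2_class \<mu> f) \<in> SQ \<mu>" "AE x in \<mu>. L2_rep (L2_class \<mu> f) x = f x"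
proof -
 have "f \<in> L2_class \<mu> f" unfolding L2_class_def by (rule equiv_class_self[OF L2_rel_equiv f])
 hence "L2_rep (L2_class \<mu> f) \<in> L2_class \<mu> f" unfolding L2_rep_def by (rule someI[of "%g. g \<in> L2_class \<mu> f"])
 hence r: "(f, L2_rep (L2_class \<mu> f)) \<in> L2_rel \<mu>" by (simp add: L2_class_def)
 thus "L2_rep (L2_class \<mu> f) \<in> SQ \<mu>" by (simp add: L2_rel_def)
 have "AE x in \<mu>. f x = L2_rep (L2_class \<mu> f) x" using r by (simp add: L2_rel_def)
 thus "AE x in \<mu>. L2_rep (L2_class \<mu> f) x = f x" by eventually_elim simp
qed

lemma L2_rep:
 assumes X: "X \<in> CL \<mu>"
 shows "L2_rep X \<in> SQ \<mu>" "L2_class \<mu> (L2_rep X) = X"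
proof -
 obtain f where f: "f \<in> SQ \<mu>" "X = L2_class \<mu> f"
  using X unfolding L2_carrier L2_class_def by (blast elim: quotientE)
 show m: "L2_rep X \<in> SQ \<mu>" using L2_rep_class(1)[OF f(1)] f(2) by simp
 show "L2_class \<mu> (L2_rep X) = X"
  using L2_class_eq_iff[OF m f(1)] L2_rep_class(2)[OF f(1)] f(2) by simp
qed

lemma L2_cases:
 assumes "X \<in> CL \<mu>" obtains f where "f \<in> SQ \<mu>" "X = L2_class \<mu> f"
 using L2_rep[OF assms] that by metis

lemma L2_add:
 assumes f: "f \<in> SQ \<mu>" and g: "g \<in> SQ \<mu>"
 shows "L2_class \<mu> f \<oplus>\<^bsub>L2 \<mu>\<^esub> L2_class \<mu> g = L2_class \<mu> (%x. f x + g x)"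
proof -
 have "AE x in \<mu>. L2_rep (L2_class \<mu> f) x + L2_rep (L2_class \<mu> g) x = f x + g x"
  using L2_rep_class(2)[OF f] L2_rep_class(2)[OF g] by eventually_elim simp
 hence "L2_class \<mu> (%x. L2_rep (L2_class \<mu> f) x + L2_rep (L2_class \<mu> g) x) = L2_class \<mu> (%x. f x + g x)"
  unfolding L2_class_eq_iff[OF SQ_add[OF L2_rep_class(1)[OF f] L2_rep_class(1)[OF g]] SQ_add[OF f g]] .
 thus ?thesis by (simp add: L2_def)
qed

lemma L2_smult:
 assumes f: "f \<in> SQ \<mu>"
 shows "c \<odot>\<^bsub>L2 \<mu>\<^esub> L2_class \<mu> f = L2_class \<mu> (%x. c * f x)"
proof -
 have "AE x in \<mu>. c * L2_rep (L2_class \<mu> f) x = c * f x"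
  using L2_rep_class(2)[OF f] by eventually_elim simp
 hence "L2_class \<mu> (%x. c * L2_rep (L2_class \<mu> f) x) = L2_class \<mu> (%x. c * f x)"
  unfolding L2_class_eq_iff[OF SQ_scale[OF L2_rep_class(1)[OF f]] SQ_scale[OF f]] .
 thus ?thesis by (simp add: L2_def)
qed

lemma L2_zero: "\<zero>\<^bsub>L2 \<mu>\<^esub> = L2_class \<mu> (%_. 0)" by (simp add: L2_def)

lemma L2_inner:
 assumes f: "f \<in> SQ \<mu>" and g: "g \<in> SQ \<mu>"
 shows "cinner (L2 \<mu>) (L2_class \<mu> f) (L2_class \<mu> g) = (LINT x|\<mu>. f x * cnj (g x))"
proof -
 have "(LINT x|\<mu>. L2_rep (L2_class \<mu> f) x * cnj (L2_rep (L2_class \<mu> g) x)) = (LINT x|\<mu>. f x * cnj (g x))"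
 proof (rule integral_cong_AE)
  show "(%x. L2_rep (L2_class \<mu> f) x * cnj (L2_rep (L2_class \<mu> g) x)) \<in> borel_measurable \<mu>"
   by (rule borel_measurable_integrable[OF SQ_mult[OF L2_rep_class(1)[OF f] L2_rep_class(1)[OF g]]])
  show "(%x. f x * cnj (g x)) \<in> borel_measurable \<mu>"
   by (rule borel_measurable_integrable[OF SQ_mult[OF f g]])
  show "AE x in \<mu>. L2_rep (L2_class \<mu> f) x * cnj (L2_rep (L2_class \<mu> g) x) = f x * cnj (g x)"
   using L2_rep_class(2)[OF f] L2_rep_class(2)[OF g] by eventually_elim simp
 qed
 thus ?thesis by (simp add: L2_def)
qed

lemma L2_inner_self:
 assumes f: "f \<in> SQ \<mu>"
 shows "cinner (L2 \<mu>) (L2_class \<mu> f) (L2_class \<mu> f) = of_real (LINT x|\<mu>. cm2 (f x))"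
proof -
 have "cinner (L2 \<mu>) (L2_class \<mu> f) (L2_class \<mu> f) = (LINT x|\<mu>. complex_of_real (cm2 (f x)))"
  unfolding L2_inner[OF f f] by (simp only: complex_norm_square)
 thus ?thesis by (simp only: integral_complex_of_real)
qed

lemma L2_abelian_group: "abelian_group (L2 \<mu>)"
proof (rule abelian_groupI)
 fix X Y Z assume XYZ: "X \<in> CL \<mu>" "Y \<in> CL \<mu>"
 obtain f where f: "f \<in> SQ \<mu>" "X = L2_class \<mu> f" using L2_cases[OF XYZ(1)] .
 obtain g where g: "g \<in> SQ \<mu>" "Y = L2_class \<mu> g" using L2_cases[OF XYZ(2)] .
 show "X \<oplus>\<^bsub>L2 \<mu>\<^esub> Y \<in> CL \<mu>"
  unfolding f(2) g(2) L2_add[OF f(1) g(1)] by (intro L2_class_mem SQ_add f g)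
 show "X \<oplus>\<^bsub>L2 \<mu>\<^esub> Y = Y \<oplus>\<^bsub>L2 \<mu>\<^esub> X"
  unfolding f(2) g(2) L2_add[OF f(1) g(1)] L2_add[OF g(1) f(1)] by (simp add: add.commute)
 assume "Z \<in> CL \<mu>"
 then obtain h where h: "h \<in> SQ \<mu>" "Z = L2_class \<mu> h" using L2_cases by blast
 show "X \<oplus>\<^bsub>L2 \<mu>\<^esub> Y \<oplus>\<^bsub>L2 \<mu>\<^esub> Z = X \<oplus>\<^bsub>L2 \<mu>\<^esub> (Y \<oplus>\<^bsub>L2 \<mu>\<^esub> Z)"
  unfolding f(2) g(2) h(2) L2_add[OF f(1) g(1)] L2_add[OF g(1) h(1)]
   L2_add[OF SQ_add[OF f(1) g(1)] h(1)] L2_add[OF f(1) SQ_add[OF g(1) h(1)]]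
  by (simp add: add.assoc)
next
 fix X assume X: "X \<in> CL \<mu>"
 obtain f where f: "f \<in> SQ \<mu>" "X = L2_class \<mu> f" using L2_cases[OF X] .
 show "\<zero>\<^bsub>L2 \<mu>\<^esub> \<oplus>\<^bsub>L2 \<mu>\<^esub> X = X"
  unfolding f(2) L2_zero L2_add[OF SQ_zero f(1)] by simp
 show "\<exists>Y\<in>CL \<mu>. Y \<oplus>\<^bsub>L2 \<mu>\<^esub> X = \<zero>\<^bsub>L2 \<mu>\<^esub>"
 proof (rule bexI)
  show "L2_class \<mu> (%x. (-1) * f x) \<oplus>\<^bsub>L2 \<mu>\<^esub> X = \<zero>\<^bsub>L2 \<mu>\<^esub>"
   unfolding f(2) L2_zero L2_add[OF SQ_scale[OF f(1)] f(1)] by simp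
  show "L2_class \<mu> (%x. (-1) * f x) \<in> CL \<mu>" by (rule L2_class_mem[OF SQ_scale[OF f(1)]])
 qed
qed (simp add: L2_zero L2_class_mem SQ_zero)

lemma L2_inner_space: "inner_space (L2 \<mu>)"
proof -
 have m: "Module.module complex_ring (L2 \<mu>)"
 proof (rule moduleI[OF cring_complex_ring L2_abelian_group])
  fix a b :: complex and X Y assume X: "X \<in> CL \<mu>"
  obtain f where f: "f \<in> SQ \<mu>" "X = L2_class \<mu> f" using L2_cases[OF X] .
  note sc = SQ_scale[OF f(1)]
  show "a \<odot>\<^bsub>L2 \<mu>\<^esub> X \<in> CL \<mu>" unfolding f(2) L2_smult[OF f(1)] by (rule L2_class_mem[OF sc])
  show "(a \<oplus>\<^bsub>complex_ring\<^esub> b) \<odot>\<^bsub>L2 \<mu>\<^esub> X = a \<odot>\<^bsub>L2 \<mu>\<^esub> X \<oplus>\<^bsub>L2 \<mu>\<^esub> b \<odot>\<^bsub>L2 \<mu>\<^esub> X"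
   unfolding f(2) L2_smult[OF f(1)] L2_add[OF sc sc] by (simp add: distrib_right)
  show "(a \<otimes>\<^bsub>complex_ring\<^esub> b) \<odot>\<^bsub>L2 \<mu>\<^esub> X = a \<odot>\<^bsub>L2 \<mu>\<^esub> (b \<odot>\<^bsub>L2 \<mu>\<^esub> X)"
   unfolding f(2) L2_smult[OF f(1)] L2_smult[OF sc] by (simp add: mult.assoc)
  show "\<one>\<^bsub>complex_ring\<^esub> \<odot>\<^bsub>L2 \<mu>\<^esub> X = X" unfolding f(2) L2_smult[OF f(1)] by simp
  assume "Y \<in> CL \<mu>"
  then obtain g where g: "g \<in> SQ \<mu>" "Y = L2_class \<mu> g" using L2_cases by blast
  show "a \<odot>\<^bsub>L2 \<mu>\<^esub> (X \<oplus>\<^bsub>L2 \<mu>\<^esub> Y) = a \<odot>\<^bsub>L2 \<mu>\<^esub> X \<oplus>\<^bsub>L2 \<mu>\<^esub> a \<odot>\<^bsub>L2 \<mu>\<^esub> Y"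
   unfolding f(2) g(2) L2_add[OF f(1) g(1)] L2_smult[OF f(1)] L2_smult[OF g(1)]
    L2_smult[OF SQ_add[OF f(1) g(1)]] L2_add[OF sc SQ_scale[OF g(1)]]
   by (simp add: distrib_left)
 qed
 have "inner_space_axioms (L2 \<mu>)"
 proof (rule inner_space_axioms.intro)
  fix X Y Z and c :: complex assume X: "X \<in> CL \<mu>"
  obtain f where f: "f \<in> SQ \<mu>" "X = L2_class \<mu> f" using L2_cases[OF X] .
  {
   assume nz: "X ~= \<zero>\<^bsub>L2 \<mu>\<^esub>"
   have "(LINT x|\<mu>. cm2 (f x)) ~= 0"
   proof
    assume "(LINT x|\<mu>. cm2 (f x)) = 0"
    hence "AE x in \<mu>. cm2 (f x) = 0"
     using integral_nonneg_eq_0_iff_AE[OF SQ_D(2)[OF f(1)]] by simp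
    hence "AE x in \<mu>. f x = 0" by eventually_elim simp
    hence "X = \<zero>\<^bsub>L2 \<mu>\<^esub>" unfolding f(2) L2_zero L2_class_eq_iff[OF f(1) SQ_zero] .
    thus False using nz by simp
   qed
   moreover have "0 <= (LINT x|\<mu>. cm2 (f x))" by (rule integral_nonneg_AE) simp
   ultimately show "0 < Re (cinner (L2 \<mu>) X X)" unfolding f(2) L2_inner_self[OF f(1)] by (simp add: less_le)
  }
  assume Y: "Y \<in> CL \<mu>"
  obtain g where g: "g \<in> SQ \<mu>" "Y = L2_class \<mu> g" using L2_cases[OF Y] .
  show "cinner (L2 \<mu>) (c \<odot>\<^bsub>L2 \<mu>\<^esub> X) Y = c * cinner (L2 \<mu>) X Y"
   unfolding f(2) g(2) L2_smult[OF f(1)] L2_inner[OF SQ_scale[OF f(1)] g(1)] L2_inner[OF f(1) g(1)]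
   by (simp add: mult.assoc)
  have "(LINT x|\<mu>. cnj (f x * cnj (g x))) = cnj (LINT x|\<mu>. f x * cnj (g x))"
   by (rule integral_bounded_linear[OF bounded_linear_cnj SQ_mult[OF f(1) g(1)]])
  thus "cinner (L2 \<mu>) Y X = cnj (cinner (L2 \<mu>) X Y)"
   unfolding f(2) g(2) L2_inner[OF g(1) f(1)] L2_inner[OF f(1) g(1)] by (simp add: mult.commute)
  assume "Z \<in> CL \<mu>"
  then obtain h where h: "h \<in> SQ \<mu>" "Z = L2_class \<mu> h" using L2_cases by blast
  show "cinner (L2 \<mu>) (X \<oplus>\<^bsub>L2 \<mu>\<^esub> Y) Z = cinner (L2 \<mu>) X Z + cinner (L2 \<mu>) Y Z"
   unfolding f(2) g(2) h(2) L2_add[OF f(1) g(1)] L2_inner[OF SQ_add[OF f(1) g(1)] h(1)]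
    L2_inner[OF f(1) h(1)] L2_inner[OF g(1) h(1)] distrib_right
   by (rule Bochner_Integration.integral_add[OF SQ_mult[OF f(1) h(1)] SQ_mult[OF g(1) h(1)]])
 qed
 with m show ?thesis by (rule inner_space.intro)
qed

lemma L2_norm_square:
 assumes f: "f \<in> SQ \<mu>"
 shows "(hnorm (L2 \<mu>) (L2_class \<mu> f))^2 = (LINT x|\<mu>. cm2 (f x))"
proof -
 interpret inner_space "L2 \<mu>" by (rule L2_inner_space)
 show ?thesis unfolding nm_square[OF L2_class_mem[OF f]] L2_inner_self[OF f] by simp
qed

lemma L2_norm_rep: "X \<in> CL \<mu> ==> (LINT x|\<mu>. cm2 (L2_rep X x)) = (hnorm (L2 \<mu>) X)^2"
 using L2_norm_square[OF L2_rep(1)] L2_rep(2) by metis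

text \<open>A row of functions, pointwise bounded by \<open>s\<close> in \<open>\<ell>\<^sup>2\<close>, applied to a square summable column of \<open>L\<^sup>2\<close> functions: pointwise Cauchy--Schwarz and monotone convergence.\<close>

lemma row_times_column:
 assumes Q: "\<And>k. Q k \<in> borel_measurable \<mu>" and s: "0 <= s"
  and Qs': "\<forall>x\<in>space \<mu>. \<forall>N. (\<Sum>k<N. cm2 (Q k x)) <= s\<^sup>2"
  and g: "\<And>k. g k \<in> SQ \<mu>" and B: "\<And>N. (\<Sum>k<N. LINT x|\<mu>. cm2 (g k x)) <= B"
 defines "F \<equiv> %x. \<Sum>k. cnj (Q k x) * g k x"
 shows "F \<in> SQ \<mu>"
  and "h \<in> SQ \<mu> ==> (%k. LINT x|\<mu>. g k x * cnj (Q k x * h x)) sums (LINT x|\<mu>. F x * cnj (h x))"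
proof -
 note Qs = Qs'[rule_format]
 note gm = SQ_D(1)[OF g] and gi = SQ_D(2)[OF g]
 have gn: "0 <= (LINT x|\<mu>. cm2 (g k x))" for k by (rule integral_nonneg_AE) simp
 have gs: "summable (%k. LINT x|\<mu>. cm2 (g k x))"
  by (rule summableI_nonneg_bounded[OF gn B])
 have gAE: "AE x in \<mu>. summable (%k. cm2 (g k x))"
 proof -
  have "(\<integral>\<^sup>+ x. (\<Sum>k. ennreal (cm2 (g k x))) \<partial>\<mu>) = (\<Sum>k. \<integral>\<^sup>+ x. ennreal (cm2 (g k x)) \<partial>\<mu>)"
   using gm by (intro nn_integral_suminf) measurable
  also have "... = (\<Sum>k. ennreal (LINT x|\<mu>. cm2 (g k x)))"
   using nn_integral_eq_integral[OF gi] by simp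
  also have "... = ennreal (\<Sum>k. LINT x|\<mu>. cm2 (g k x))" by (rule suminf_ennreal2[OF gn gs])
  finally have "(\<integral>\<^sup>+ x. (\<Sum>k. ennreal (cm2 (g k x))) \<partial>\<mu>) ~= \<infinity>" by simp
  hence "AE x in \<mu>. (\<Sum>k. ennreal (cm2 (g k x))) ~= \<infinity>"
   using gm by (intro nn_integral_noteq_infinite) (measurable, assumption)
  thus ?thesis by eventually_elim (auto intro: summable_suminf_not_top)
 qed
 have Qsum: "summable (%k. cm2 (Q k x))" if "x \<in> space \<mu>" for x
  by (rule summableI_nonneg_bounded[OF _ Qs[OF that]]) simp
 have Fm: "F \<in> borel_measurable \<mu>"
  unfolding F_def using Q gm by measurable
 have gint: "integrable \<mu> (%x. \<Sum>k. cm2 (g k x))"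
  by (rule integrable_suminf[OF gi]) (use gAE gs in auto)
 have ptw: "AE x in \<mu>. summable (%k. cnj (Q k x) * g k x) & cm2 (F x) <= s\<^sup>2 * (\<Sum>k. cm2 (g k x))"
  using gAE AE_space
 proof eventually_elim
  case (elim x)
  have sm: "summable (%k. cnj (Q k x) * g k x)"
   by (rule summable_comparison_test'[OF summable_add[OF elim(1) Qsum[OF elim(2)]]])
    (use cmod_mult_le_squares[of "g _ x" "Q _ x"] in \<open>simp add: mult.commute\<close>)
  have "cm2 (F x) <= s\<^sup>2 * (\<Sum>k. cm2 (g k x))"
  proof (rule LIMSEQ_le_const2)
   show "(%N. cm2 (\<Sum>k<N. cnj (Q k x) * g k x)) \<leadsto> cm2 (F x)"
    unfolding F_def by (intro tendsto_intros summable_LIMSEQ sm)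
   have "cm2 (\<Sum>k<N. cnj (Q k x) * g k x) <= s\<^sup>2 * (\<Sum>k. cm2 (g k x))" for N
   proof -
    have "cmod (\<Sum>k<N. cnj (Q k x) * g k x) <= (\<Sum>k<N. cmod (Q k x) * cmod (g k x))"
     using norm_sum[of "%k. cnj (Q k x) * g k x" "{..<N}"] by (simp add: norm_mult)
    hence "cm2 (\<Sum>k<N. cnj (Q k x) * g k x) <= (\<Sum>k<N. cmod (Q k x) * cmod (g k x))^2"
     by (intro power_mono) auto
    also have "... <= (\<Sum>k<N. cm2 (Q k x)) * (\<Sum>k<N. cm2 (g k x))"
     by (rule Cauchy_Schwarz_ineq_sum)
    also have "... <= s\<^sup>2 * (\<Sum>k. cm2 (g k x))"
     using Qs[OF elim(2)] elim(1) by (intro mult_mono sum_le_suminf) (auto intro: sum_nonneg)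
    finally show ?thesis .
   qed
   thus "\<exists>N. \<forall>n\<ge>N. cm2 (\<Sum>k<n. cnj (Q k x) * g k x) <= s\<^sup>2 * (\<Sum>k. cm2 (g k x))" by blast
  qed
  thus ?case using sm by simp
 qed
 show "F \<in> SQ \<mu>"
 proof (rule SQ_bound[OF Fm])
  show "integrable \<mu> (%x. s\<^sup>2 * (\<Sum>k. cm2 (g k x)))" using gint by (rule integrable_mult_right)
  show "AE x in \<mu>. cm2 (F x) <= s\<^sup>2 * (\<Sum>k. cm2 (g k x))" using ptw by eventually_elim simp
 qed
 assume h: "h \<in> SQ \<mu>"
 have Qb: "cmod (Q k x) <= s" if "x \<in> space \<mu>" for k x
 proof (rule power2_le_imp_le[OF _ s])
  have "cm2 (Q k x) <= (\<Sum>k<Suc k. cm2 (Q k x))" by (simp add: sum_nonneg)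
  thus "cm2 (Q k x) <= s\<^sup>2" using Qs[OF that, of "Suc k"] by linarith
 qed
 have Qh: "(%x. Q k x * h x) \<in> SQ \<mu>" for k
  by (rule SQ_mult_bounded[OF h Q Qb])
 have Qhs: "(\<Sum>k<N. LINT x|\<mu>. cm2 (Q k x * h x)) <= s\<^sup>2 * (LINT x|\<mu>. cm2 (h x))" for N
 proof -
  have "(\<Sum>k<N. LINT x|\<mu>. cm2 (Q k x * h x)) = (LINT x|\<mu>. (\<Sum>k<N. cm2 (Q k x * h x)))"
   by (rule Bochner_Integration.integral_sum[symmetric]) (rule SQ_D(2)[OF Qh])
  also have "... <= (LINT x|\<mu>. s\<^sup>2 * cm2 (h x))"
  proof (rule integral_mono)
   show "integrable \<mu> (%x. \<Sum>k<N. cm2 (Q k x * h x))"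
    by (intro Bochner_Integration.integrable_sum SQ_D(2)[OF Qh])
   show "integrable \<mu> (%x. s\<^sup>2 * cm2 (h x))" by (intro integrable_mult_right SQ_D(2)[OF h])
   fix x assume x: "x \<in> space \<mu>"
   have "(\<Sum>k<N. cm2 (Q k x * h x)) = (\<Sum>k<N. cm2 (Q k x)) * cm2 (h x)"
    by (simp add: norm_mult power_mult_distrib sum_distrib_right)
   also have "... <= s\<^sup>2 * cm2 (h x)" by (intro mult_right_mono Qs x) simp
   finally show "(\<Sum>k<N. cm2 (Q k x * h x)) <= s\<^sup>2 * cm2 (h x)" .
  qed
  also have "... = s\<^sup>2 * (LINT x|\<mu>. cm2 (h x))" by simp
  finally show ?thesis .
 qed
 have Qhn: "0 <= (LINT x|\<mu>. cm2 (Q k x * h x))" for k by (rule integral_nonneg_AE) simp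
 have Qhsum: "summable (%k. LINT x|\<mu>. cm2 (Q k x * h x))"
  by (rule summableI_nonneg_bounded[OF Qhn Qhs])
 let ?f = "%k x. g k x * cnj (Q k x * h x)"
 have fint: "integrable \<mu> (?f k)" for k by (rule SQ_mult[OF g Qh])
 have eqx: "summable (%k. cnj (Q k x) * g k x) ==> (\<Sum>k. ?f k x) = F x * cnj (h x)" for x
 proof -
  assume "summable (%k. cnj (Q k x) * g k x)"
  from suminf_mult2[OF this, of "cnj (h x)"] show ?thesis by (simp add: F_def mult_ac)
 qed
 have "(%k. integral\<^sup>L \<mu> (?f k)) sums (LINT x|\<mu>. (\<Sum>k. ?f k x))"
 proof (rule sums_integral[OF fint])
  show "AE x in \<mu>. summable (%k. norm (?f k x))"
   using gAE AE_space
  proof eventually_elim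
   case (elim x)
   have "summable (%k. (cm2 (g k x) + cm2 (Q k x)) * cmod (h x))"
    by (intro summable_mult2 summable_add elim(1) Qsum elim(2))
   thus ?case
   proof (rule summable_comparison_test')
    fix k
    have "cmod (g k x * cnj (Q k x)) * cmod (h x) <= (cm2 (g k x) + cm2 (Q k x)) * cmod (h x)"
     by (intro mult_right_mono cmod_mult_le_squares) simp
    thus "norm (norm (?f k x)) <= (cm2 (g k x) + cm2 (Q k x)) * cmod (h x)"
     by (simp add: norm_mult mult.assoc)
   qed
  qed
  show "summable (%k. LINT x|\<mu>. norm (?f k x))"
  proof (rule summable_comparison_test'[OF summable_add[OF gs Qhsum]])
   fix k
   have "(LINT x|\<mu>. norm (?f k x)) <= (LINT x|\<mu>. cm2 (g k x) + cm2 (Q k x * h x))"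
    by (intro integral_mono integrable_norm fint Bochner_Integration.integrable_add gi SQ_D(2)[OF Qh] cmod_mult_le_squares)
   also have "... = (LINT x|\<mu>. cm2 (g k x)) + (LINT x|\<mu>. cm2 (Q k x * h x))"
    by (rule Bochner_Integration.integral_add[OF gi SQ_D(2)[OF Qh]])
   finally have "(LINT x|\<mu>. norm (?f k x)) <= (LINT x|\<mu>. cm2 (g k x)) + (LINT x|\<mu>. cm2 (Q k x * h x))" .
   moreover have "0 <= (LINT x|\<mu>. norm (?f k x))" by (rule integral_nonneg_AE) simp
   ultimately show "norm (LINT x|\<mu>. norm (?f k x)) <= (LINT x|\<mu>. cm2 (g k x)) + (LINT x|\<mu>. cm2 (Q k x * h x))" by simp
  qed
 qed
 moreover have "(LINT x|\<mu>. (\<Sum>k. ?f k x)) = (LINT x|\<mu>. F x * cnj (h x))"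
 proof (rule integral_cong_AE)
  show "(%x. \<Sum>k. ?f k x) \<in> borel_measurable \<mu>"
   using borel_measurable_integrable[OF fint] by (rule borel_measurable_suminf)
  show "(%x. F x * cnj (h x)) \<in> borel_measurable \<mu>" using Fm SQ_D(1)[OF h] by measurable
  show "AE x in \<mu>. (\<Sum>k. ?f k x) = F x * cnj (h x)" using ptw by eventually_elim (use eqx in auto)
 qed
 ultimately show "(%k. LINT x|\<mu>. g k x * cnj (Q k x * h x)) sums (LINT x|\<mu>. F x * cnj (h x))" by simp
qed

definition mult_op :: "'g measure => (nat => 'g => complex) => nat => ('g => complex) set => ('g => complex) set"
 where "mult_op \<mu> P k X = L2_class \<mu> (%x. P k x * L2_rep X x)"

text \<open>The operator \<open>\<Sum>\<^sub>k cnj(Q\<^sub>k) A P\<^sub>k\<close>, with the series formed pointwise almost everywhere.\<close>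

definition symbol_op :: "'g measure => (nat => 'g => complex) => (nat => 'g => complex)
  => (('g => complex) set => ('g => complex) set) => ('g => complex) set => ('g => complex) set"
 where "symbol_op \<mu> P Q A = (\<lambda>X\<in>CL \<mu>.
   L2_class \<mu> (%x. \<Sum>k. cnj (Q k x) * L2_rep (A (mult_op \<mu> P k X)) x))"

definition bsymbol :: "'g measure => (nat => 'g => complex) => real => bool"
 where "bsymbol \<mu> P s \<longleftrightarrow> 0 <= s & (\<forall>k. P k \<in> borel_measurable \<mu>) &
   (\<forall>x\<in>space \<mu>. \<forall>N. (\<Sum>k<N. cm2 (P k x)) <= s\<^sup>2)"

lemma bsymbolD:
 assumes "bsymbol \<mu> P s"
 shows "0 <= s" "P k \<in> borel_measurable \<mu>" "x \<in> space \<mu> ==> (\<Sum>k<N. cm2 (P k x)) <= s\<^sup>2"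
  "x \<in> space \<mu> ==> cmod (P k x) <= s"
proof -
 show s: "0 <= s" and "P k \<in> borel_measurable \<mu>" using assms by (auto simp: bsymbol_def)
 show b: "(\<Sum>k<N. cm2 (P k x)) <= s\<^sup>2" if "x \<in> space \<mu>" for N using assms that by (auto simp: bsymbol_def)
 show "cmod (P k x) <= s" if "x \<in> space \<mu>"
 proof (rule power2_le_imp_le[OF _ s])
  have "cm2 (P k x) <= (\<Sum>k<Suc k. cm2 (P k x))" by (simp add: sum_nonneg)
  thus "cm2 (P k x) <= s\<^sup>2" using b[OF that, of "Suc k"] by linarith
 qed
qed

lemma mult_op_class:
 assumes P: "bsymbol \<mu> P s" and f: "f \<in> SQ \<mu>"
 shows "(%x. P k x * f x) \<in> SQ \<mu>"
  and "mult_op \<mu> P k (L2_class \<mu> f) = L2_class \<mu> (%x. P k x * f x)"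
proof -
 note D = bsymbolD[OF P]
 have m: "(%x. P k x * f x) \<in> SQ \<mu>" if "f \<in> SQ \<mu>" for f
  by (rule SQ_mult_bounded[OF that D(2) D(4)])
 thus "(%x. P k x * f x) \<in> SQ \<mu>" using f .
 have "AE x in \<mu>. P k x * L2_rep (L2_class \<mu> f) x = P k x * f x"
  using L2_rep_class(2)[OF f] by eventually_elim simp
 thus "mult_op \<mu> P k (L2_class \<mu> f) = L2_class \<mu> (%x. P k x * f x)"
  unfolding mult_op_def L2_class_eq_iff[OF m[OF L2_rep_class(1)[OF f]] m[OF f]] .
qed

lemma mult_op_mem: "[|bsymbol \<mu> P s; X \<in> CL \<mu>|] ==> mult_op \<mu> P k X \<in> CL \<mu>"
 using mult_op_class(1)[OF _ L2_rep(1)] L2_class_mem unfolding mult_op_def by blast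

lemma mult_op_column:
 assumes P: "bsymbol \<mu> P s" and X: "X \<in> CL \<mu>"
 shows "(\<Sum>k<N. (hnorm (L2 \<mu>) (mult_op \<mu> P k X))\<^sup>2) <= s\<^sup>2 * (hnorm (L2 \<mu>) X)^2"
proof -
 note D = bsymbolD[OF P]
 obtain f where f: "f \<in> SQ \<mu>" "X = L2_class \<mu> f" using L2_cases[OF X] .
 note m = mult_op_class(1)[OF P f(1)]
 have "(\<Sum>k<N. (hnorm (L2 \<mu>) (mult_op \<mu> P k X))\<^sup>2) = (\<Sum>k<N. LINT x|\<mu>. cm2 (P k x * f x))"
  unfolding f(2) mult_op_class(2)[OF P f(1)] L2_norm_square[OF m] ..
 also have "... = (LINT x|\<mu>. (\<Sum>k<N. cm2 (P k x * f x)))"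
  by (rule Bochner_Integration.integral_sum[symmetric]) (rule SQ_D(2)[OF m])
 also have "... <= (LINT x|\<mu>. s\<^sup>2 * cm2 (f x))"
 proof (rule integral_mono)
  show "integrable \<mu> (%x. \<Sum>k<N. cm2 (P k x * f x))"
   by (intro Bochner_Integration.integrable_sum SQ_D(2)[OF m])
  show "integrable \<mu> (%x. s\<^sup>2 * cm2 (f x))" by (intro integrable_mult_right SQ_D(2)[OF f(1)])
  fix x assume x: "x \<in> space \<mu>"
  have "(\<Sum>k<N. cm2 (P k x * f x)) = (\<Sum>k<N. cm2 (P k x)) * cm2 (f x)"
   by (simp add: norm_mult power_mult_distrib sum_distrib_right)
  also have "... <= s\<^sup>2 * cm2 (f x)" by (intro mult_right_mono D(3) x) simp
  finally show "(\<Sum>k<N. cm2 (P k x * f x)) <= s\<^sup>2 * cm2 (f x)" .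
 qed
 also have "... = s\<^sup>2 * (hnorm (L2 \<mu>) X)^2" unfolding f(2) L2_norm_square[OF f(1)] by simp
 finally show ?thesis .
qed

theorem symbol_op_symbol_map:
 assumes P: "bsymbol \<mu> P s" and Q: "bsymbol \<mu> Q s"
 shows "symbol_map (L2 \<mu>) (mult_op \<mu> P) (mult_op \<mu> Q) s (symbol_op \<mu> P Q)"
proof -
 interpret inner_space "L2 \<mu>" by (rule L2_inner_space)
 note DP = bsymbolD[OF P] and DQ = bsymbolD[OF Q]
 have col: "column_bounded (mult_op \<mu> P) s" if "bsymbol \<mu> P s" for P
  unfolding column_bounded_def using mult_op_mem[OF that] mult_op_column[OF that] bsymbolD(1)[OF that] by blast
 have mem: "symbol_op \<mu> P Q A X \<in> CL \<mu>"
  and sums: "Y \<in> CL \<mu> ==> (%k. ip (A (mult_op \<mu> P k X)) (mult_op \<mu> Q k Y)) sums ip (symbol_op \<mu> P Q A X) Y"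
  if A: "bounded_op (L2 \<mu>) A" and X: "X \<in> CL \<mu>" for A X Y
 proof -
  define g where "g k = L2_rep (A (mult_op \<mu> P k X))" for k
  have Am: "A (mult_op \<mu> P k X) \<in> CL \<mu>" for k
   by (rule bounded_opD(1)[OF A mult_op_mem[OF P X]])
  have g: "g k \<in> SQ \<mu>" for k unfolding g_def by (rule L2_rep(1)[OF Am])
  have gB: "(\<Sum>k<N. LINT x|\<mu>. cm2 (g k x)) <= (opnorm (L2 \<mu>) A)^2 * (s\<^sup>2 * (nm X)^2)" for N
  proof -
   have "(\<Sum>k<N. LINT x|\<mu>. cm2 (g k x)) = (\<Sum>k<N. (nm (A (mult_op \<mu> P k X)))\<^sup>2)"
    unfolding g_def L2_norm_rep[OF Am] ..
   also have "... <= (\<Sum>k<N. (opnorm (L2 \<mu>) A)\<^sup>2 * (nm (mult_op \<mu> P k X))^2)"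
    unfolding power_mult_distrib[symmetric]
    by (intro sum_mono power_mono opnorm_upper[OF A] mult_op_mem[OF P X] nm_nonneg[OF Am])
   also have "... <= (opnorm (L2 \<mu>) A)^2 * (s\<^sup>2 * (nm X)^2)"
    unfolding sum_distrib_left[symmetric] by (intro mult_left_mono mult_op_column[OF P X]) simp
   finally show ?thesis .
  qed
  have Q3: "\<forall>x\<in>space \<mu>. \<forall>N. (\<Sum>k<N. cm2 (Q k x)) <= s\<^sup>2" using DQ(3) by blast
  note rc = row_times_column[OF DQ(2) DQ(1) Q3 g gB]
  have eq: "symbol_op \<mu> P Q A X = L2_class \<mu> (%x. \<Sum>k. cnj (Q k x) * g k x)"
   using X by (simp add: symbol_op_def g_def)
  show "symbol_op \<mu> P Q A X \<in> CL \<mu>"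
   unfolding eq by (rule L2_class_mem) (rule rc(1))
  assume Y: "Y \<in> CL \<mu>"
  obtain h where h: "h \<in> SQ \<mu>" "Y = L2_class \<mu> h" using L2_cases[OF Y] .
  have "ip (A (mult_op \<mu> P k X)) (mult_op \<mu> Q k Y) = (LINT x|\<mu>. g k x * cnj (Q k x * h x))" for k
  proof -
   have "A (mult_op \<mu> P k X) = L2_class \<mu> (g k)" unfolding g_def by (rule L2_rep(2)[OF Am, symmetric])
   thus ?thesis unfolding h(2) mult_op_class(2)[OF Q h(1)] by (simp only: L2_inner[OF g mult_op_class(1)[OF Q h(1)]])
  qed
  moreover have "ip (symbol_op \<mu> P Q A X) Y = (LINT x|\<mu>. (\<Sum>k. cnj (Q k x) * g k x) * cnj (h x))"
   unfolding eq h(2) by (rule L2_inner[OF rc(1) h(1)])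
  ultimately show "(%k. ip (A (mult_op \<mu> P k X)) (mult_op \<mu> Q k Y)) sums ip (symbol_op \<mu> P Q A X) Y"
   using rc(2)[OF h(1)] by simp
 qed
 have padd: "mult_op \<mu> P k (X \<oplus>\<^bsub>L2 \<mu>\<^esub> Y) = mult_op \<mu> P k X \<oplus>\<^bsub>L2 \<mu>\<^esub> mult_op \<mu> P k Y"
  if XY: "X \<in> CL \<mu>" "Y \<in> CL \<mu>" for k X Y
 proof -
  obtain f where f: "f \<in> SQ \<mu>" "X = L2_class \<mu> f" using L2_cases[OF XY(1)] .
  obtain g where g: "g \<in> SQ \<mu>" "Y = L2_class \<mu> g" using L2_cases[OF XY(2)] .
  show ?thesis
   unfolding f(2) g(2) L2_add[OF f(1) g(1)] mult_op_class(2)[OF P f(1)] mult_op_class(2)[OF P g(1)]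
    mult_op_class(2)[OF P SQ_add[OF f(1) g(1)]] L2_add[OF mult_op_class(1)[OF P f(1)] mult_op_class(1)[OF P g(1)]]
   by (simp add: distrib_left)
 qed
 have psc: "mult_op \<mu> P k (c \<odot>\<^bsub>L2 \<mu>\<^esub> X) = c \<odot>\<^bsub>L2 \<mu>\<^esub> mult_op \<mu> P k X"
  if X: "X \<in> CL \<mu>" for k c X
 proof -
  obtain f where f: "f \<in> SQ \<mu>" "X = L2_class \<mu> f" using L2_cases[OF X] .
  show ?thesis
   unfolding f(2) L2_smult[OF f(1)] mult_op_class(2)[OF P f(1)]
    mult_op_class(2)[OF P SQ_scale[OF f(1)]] L2_smult[OF mult_op_class(1)[OF P f(1)]]
   by (simp add: mult_ac)
 qed
 have bop: "bounded_op (L2 \<mu>) (symbol_op \<mu> P Q A)" if A: "bounded_op (L2 \<mu>) A" for A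
 proof (rule bounded_opI[where K = "opnorm (L2 \<mu>) A * s\<^sup>2"])
  let ?B = "symbol_op \<mu> P Q A"
  note AD = bounded_opD[OF A] and pm = mult_op_mem[OF P] and qm = mult_op_mem[OF Q]
  show "?B \<in> extensional (CL \<mu>)" by (simp add: symbol_op_def)
  show "?B X \<in> CL \<mu>" if "X \<in> CL \<mu>" for X by (rule mem[OF A that])
 next
  let ?B = "symbol_op \<mu> P Q A"
  note AD = bounded_opD[OF A] and pm = mult_op_mem[OF P] and qm = mult_op_mem[OF Q]
  fix X Y assume X: "X \<in> CL \<mu>" and Y: "Y \<in> CL \<mu>"
  have XY: "X \<oplus>\<^bsub>L2 \<mu>\<^esub> Y \<in> CL \<mu>" using X Y by simp
  show "?B (X \<oplus>\<^bsub>L2 \<mu>\<^esub> Y) = ?B X \<oplus>\<^bsub>L2 \<mu>\<^esub> ?B Y"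
  proof (rule eq_if_ip_eq)
   fix h assume h: "h \<in> CL \<mu>"
   have "(%k. ip (A (mult_op \<mu> P k X)) (mult_op \<mu> Q k h) + ip (A (mult_op \<mu> P k Y)) (mult_op \<mu> Q k h)) sums (ip (?B X) h + ip (?B Y) h)"
    by (intro sums_add sums A X Y h)
   moreover have "ip (A (mult_op \<mu> P k X)) (mult_op \<mu> Q k h) + ip (A (mult_op \<mu> P k Y)) (mult_op \<mu> Q k h)
     = ip (A (mult_op \<mu> P k (X \<oplus>\<^bsub>L2 \<mu>\<^esub> Y))) (mult_op \<mu> Q k h)" for k
    using X Y h by (simp add: padd AD pm qm cinner_add_left)
   ultimately have "ip (?B (X \<oplus>\<^bsub>L2 \<mu>\<^esub> Y)) h = ip (?B X) h + ip (?B Y) h"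
    using sums[OF A XY h] sums_unique2 by fastforce
   thus "ip (?B (X \<oplus>\<^bsub>L2 \<mu>\<^esub> Y)) h = ip (?B X \<oplus>\<^bsub>L2 \<mu>\<^esub> ?B Y) h"
    by (simp add: cinner_add_left[OF mem[OF A X] mem[OF A Y] h])
  qed (use mem[OF A] X Y XY in auto)
 next
  let ?B = "symbol_op \<mu> P Q A"
  note AD = bounded_opD[OF A] and pm = mult_op_mem[OF P] and qm = mult_op_mem[OF Q]
  fix c X assume X: "X \<in> CL \<mu>"
  have cX: "c \<odot>\<^bsub>L2 \<mu>\<^esub> X \<in> CL \<mu>" using X by simp
  show "?B (c \<odot>\<^bsub>L2 \<mu>\<^esub> X) = c \<odot>\<^bsub>L2 \<mu>\<^esub> ?B X"
  proof (rule eq_if_ip_eq)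
   fix h assume h: "h \<in> CL \<mu>"
   have "(%k. c * ip (A (mult_op \<mu> P k X)) (mult_op \<mu> Q k h)) sums (c * ip (?B X) h)"
    by (intro sums_mult sums A X h)
   moreover have "c * ip (A (mult_op \<mu> P k X)) (mult_op \<mu> Q k h) = ip (A (mult_op \<mu> P k (c \<odot>\<^bsub>L2 \<mu>\<^esub> X))) (mult_op \<mu> Q k h)" for k
    using X h by (simp add: psc AD pm qm cinner_smult_left)
   ultimately have "ip (?B (c \<odot>\<^bsub>L2 \<mu>\<^esub> X)) h = c * ip (?B X) h"
    using sums[OF A cX h] sums_unique2 by fastforce
   thus "ip (?B (c \<odot>\<^bsub>L2 \<mu>\<^esub> X)) h = ip (c \<odot>\<^bsub>L2 \<mu>\<^esub> ?B X) h"
    by (simp add: cinner_smult_left[OF mem[OF A X] h])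
  qed (use mem[OF A] X cX in auto)
 next
  let ?B = "symbol_op \<mu> P Q A" and ?a = "opnorm (L2 \<mu>) A"
  note AD = bounded_opD[OF A] and pm = mult_op_mem[OF P] and qm = mult_op_mem[OF Q]
  have a0: "0 <= ?a" by (rule opnorm_nonneg[OF A])
  fix X assume X: "X \<in> CL \<mu>"
  have "nm (?B X) <= ?a * s\<^sup>2 * nm X \<or> ?B X = \<zero>\<^bsub>L2 \<mu>\<^esub>"
  proof (rule nm_le_if_ip_le[OF mem[OF A X]])
   fix h assume h: "h \<in> CL \<mu>"
   let ?t = "%k. ip (A (mult_op \<mu> P k X)) (mult_op \<mu> Q k h)"
   let ?y = "%k. nm (mult_op \<mu> P k X)" and ?z = "%k. nm (mult_op \<mu> Q k h)"
   have "cmod (\<Sum>k<N. ?t k) <= ?a * s\<^sup>2 * nm X * nm h" for N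
   proof -
    have "cmod (?t k) <= ?a * (?y k * ?z k)" for k
    proof -
     have "cmod (?t k) <= nm (A (mult_op \<mu> P k X)) * ?z k" by (rule Cauchy_Schwarz[OF AD(1)[OF pm[OF X]] qm[OF h]])
     also have "... <= (?a * ?y k) * ?z k" by (intro mult_right_mono opnorm_upper[OF A pm[OF X]] nm_nonneg[OF qm[OF h]])
     finally show ?thesis by (simp add: mult.assoc)
    qed
    hence "cmod (\<Sum>k<N. ?t k) <= (\<Sum>k<N. ?a * (?y k * ?z k))"
     by (intro order_trans[OF norm_sum[of ?t] sum_mono])
    also have "... = ?a * (\<Sum>k<N. ?y k * ?z k)" by (simp add: sum_distrib_left)
    also have "... <= ?a * (s\<^sup>2 * nm X * nm h)"
    proof (intro mult_left_mono a0)
     have "(\<Sum>k<N. ?y k * ?z k)^2 <= (\<Sum>k<N. (?y k)\<^sup>2) * (\<Sum>k<N. (?z k)\<^sup>2)" by (rule Cauchy_Schwarz_ineq_sum)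
     also have "... <= (s\<^sup>2 * (nm X)^2) * (s\<^sup>2 * (nm h)^2)"
      using mult_op_column[OF P X] mult_op_column[OF Q h] by (intro mult_mono) (auto intro: sum_nonneg)
     also have "... = (s\<^sup>2 * nm X * nm h)^2" by (simp add: power_mult_distrib power2_eq_square)
     finally show "(\<Sum>k<N. ?y k * ?z k) <= s\<^sup>2 * nm X * nm h"
      by (rule power2_le_imp_le) (use nm_nonneg[OF X] nm_nonneg[OF h] in simp)
    qed
    finally show ?thesis by (simp add: mult_ac)
   qed
   moreover have "(%N. cmod (\<Sum>k<N. ?t k)) \<leadsto> cmod (ip (?B X) h)"
    using sums[OF A X h] unfolding sums_def by (rule tendsto_norm)
   ultimately show "cmod (ip (?B X) h) <= ?a * s\<^sup>2 * nm X * nm h"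
    by (intro LIMSEQ_le_const2) auto
  qed
  thus "nm (?B X) <= ?a * s\<^sup>2 * nm X" using a0 nm_nonneg[OF X] by auto
 qed
 show ?thesis
  by (intro symbol_map.intro symbol_map_axioms.intro L2_inner_space col P Q bop sums)
qed

section \<open>The group von Neumann algebra and its multipliers\<close>

text \<open>A positive kernel on a finite set is a sum of rank one kernels, and for these the inequality is the hypothesis.\<close>

lemma pairing_psd_le:
 assumes F: "finite F" and G: "psd F G"
  and bound: "\<And>u. form_le Z F d u"
 shows "\<bar>pairing Z F G\<bar> <= (\<Sum>p\<in>F. d p * Re (G p p))"
proof (cases "F = {}")
 case True
 thus ?thesis by (simp add: pairing_def)
next
 case False
 obtain e0 :: "nat => 'a" where bij: "bij_betw e0 {..<card F} F"
  using ex_bij_betw_nat_finite[OF F] by (auto simp: atLeast0LessThan)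
 define n where "n = card F"
 have n: "0 < n" using F False by (simp add: n_def card_gt_0_iff)
 define e where "e i = (if i < n then e0 i else e0 0)" for i
 have e: "e i \<in> F" for i using bij n by (auto simp: e_def n_def bij_betw_def)
 have onto: "\<exists>i<n. p = e i" if "p \<in> F" for p
  using bij that by (auto simp: e_def n_def bij_betw_def image_iff)
 let ?v = "feature G e"
 have Gsum: "G p q = (\<Sum>i<n. ?v p i * cnj (?v q i))" if pq: "p \<in> F" "q \<in> F" for p q
 proof -
  obtain i where i: "i < n" "p = e i" using onto[OF pq(1)] by blast
  have "residual G e n p q = 0" unfolding i(2) by (rule residual_zero_row[where X = F, OF G e pq(2) i(1)])
  thus ?thesis using residual_sum[where X = F and e = e and n = n, OF G e pq] by simp
 qed
 have "pairing Z F G = pairing Z F (%p q. \<Sum>i<n. ?v p i * cnj (?v q i))"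
  by (rule pairing_cong) (rule Gsum)
 also have "... = (\<Sum>i<n. Re (sesq Z F (%p. ?v p i) (%p. ?v p i)))"
  by (simp only: pairing_sum pairing_rank_one)
 finally have "\<bar>pairing Z F G\<bar> <= (\<Sum>i<n. \<bar>Re (sesq Z F (%p. ?v p i) (%p. ?v p i))\<bar>)"
  by (simp only: sum_abs)
 also have "... <= (\<Sum>i<n. \<Sum>p\<in>F. d p * cm2 (?v p i))"
  by (intro sum_mono bound)
 also have "... = (\<Sum>p\<in>F. \<Sum>i<n. d p * cm2 (?v p i))" by (rule sum.swap)
 also have "... = (\<Sum>p\<in>F. d p * Re (G p p))"
 proof (intro sum.cong refl)
  fix p assume p: "p \<in> F"
  have "G p p = (\<Sum>i<n. of_real (cm2 (?v p i)))" using Gsum[OF p p] by (simp only: complex_norm_square)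
  hence "Re (G p p) = (\<Sum>i<n. cm2 (?v p i))" by (simp only: Re_sum Re_complex_of_real)
  thus "(\<Sum>i<n. d p * cm2 (?v p i)) = d p * Re (G p p)" by (simp add: sum_distrib_left)
 qed
 finally show ?thesis .
qed

context inner_space
begin

lemma psd_Gram:
 assumes u: "\<And>p. p \<in> F ==> u p \<in> \<H>"
 shows "psd F (%p q. ip (u p) (u q))"
 unfolding psd_def
proof (intro allI impI)
 fix E w assume E: "finite E" "E \<subseteq> F"
 have m: "(%p. w p \<odot> u p) \<in> E \<rightarrow> \<H>" using u E by auto
 let ?s = "\<Oplus>p\<in>E. w p \<odot> u p"
 have sm: "?s \<in> \<H>" by (rule M.finsum_closed[OF m])
 have "ip ?s ?s = (\<Sum>p\<in>E. ip (w p \<odot> u p) ?s)" by (rule ip_finsum_left[OF E(1) m sm])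
 also have "... = (\<Sum>p\<in>E. \<Sum>q\<in>E. ip (w p \<odot> u p) (w q \<odot> u q))"
  using m by (intro sum.cong refl ip_finsum_right[OF E(1) m]) auto
 also have "... = sesq (%p q. ip (u p) (u q)) E w w"
  unfolding sesq_def
 proof (intro sum.cong refl)
  fix p q assume "p \<in> E" "q \<in> E"
  hence "u p \<in> \<H>" "u q \<in> \<H>" using u E by auto
  thus "ip (w p \<odot> u p) (w q \<odot> u q) = w p * cnj (w q) * ip (u p) (u q)"
   by (simp add: cinner_smult_left ip_smult_right)
 qed
 finally have "sesq (%p q. ip (u p) (u q)) E w w = of_real ((nm ?s)^2)" using ip_self[OF sm] by simp
 thus "sesq (%p q. ip (u p) (u q)) E w w \<in> \<real>\<^sub>\<ge>\<^sub>0" by (simp del: of_real_power)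
qed

text \<open>The matrix \<open>Z\<close> acting on vectors of an inner product space obeys the same form bound as on scalars, because only the positive Gram kernel of the vectors enters. Polarization turns the quadratic estimate into a bilinear one.\<close>

lemma form_bound:
 assumes F: "finite F" and Z: "\<And>p q. [|p \<in> F; q \<in> F|] ==> Z q p = cnj (Z p q)"
  and bound: "\<And>u. form_le Z F d u"
  and u: "\<And>p. p \<in> F ==> u p \<in> \<H>" and w: "\<And>p. p \<in> F ==> w p \<in> \<H>"
 shows "2 * cmod (\<Sum>p\<in>F. \<Sum>q\<in>F. Z p q * ip (u p) (w q)) <= (\<Sum>p\<in>F. d p * ((nm (u p))^2 + (nm (w p))^2))"
proof -
 define T where "T a b = (\<Sum>p\<in>F. \<Sum>q\<in>F. Z p q * ip (a p) (b q))" for a b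
 \<comment> \<open>A phase makes the mixed term real, so that it appears in full in the difference of the forms at \<open>a \<plusminus> w\<close>.\<close>
 obtain \<theta> where \<theta>: "cmod \<theta> = 1" "\<theta> * T u w = of_real (cmod (T u w))"
 proof (cases "T u w = 0")
  case True thus ?thesis using that[of 1] by simp
 next
  case False
  have "cnj (T u w) / of_real (cmod (T u w)) * T u w = of_real (cmod (T u w))"
  proof -
   have "cnj (T u w) * T u w = of_real (cm2 (T u w))" by (simp only: complex_norm_square mult.commute)
   thus ?thesis using False by (simp add: power2_eq_square field_simps)
  qed
  moreover have "cmod (cnj (T u w) / of_real (cmod (T u w))) = 1" using False by (simp add: norm_divide)
  ultimately show ?thesis using that by blast
 qed
 define a where "a p = \<theta> \<odot> u p" for p
 have a: "a p \<in> \<H>" if "p \<in> F" for p using u[OF that] by (simp add: a_def)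
 have na: "nm (a p) = nm (u p)" if "p \<in> F" for p using u[OF that] \<theta>(1) by (simp add: a_def nm_scale)
 have Taw: "T a w = of_real (cmod (T u w))"
 proof -
  have "T a w = (\<Sum>p\<in>F. \<Sum>q\<in>F. \<theta> * (Z p q * ip (u p) (w q)))"
   unfolding T_def a_def using u w by (intro sum.cong refl) (simp add: cinner_smult_left)
  also have "... = \<theta> * T u w" unfolding T_def by (simp only: sum_distrib_left)
  finally show ?thesis using \<theta>(2) by simp
 qed
 have Twa: "T w a = cnj (T a w)"
 proof -
  have "T w a = (\<Sum>q\<in>F. \<Sum>p\<in>F. Z p q * ip (w p) (a q))" unfolding T_def by (rule sum.swap)
  also have "... = cnj (T a w)" unfolding T_def cnj_sum
  proof (intro sum.cong refl)
   fix p q assume pq: "p \<in> F" "q \<in> F"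
   show "Z q p * ip (w q) (a p) = cnj (Z p q * ip (a p) (w q))"
    by (simp only: complex_cnj_mult Z[OF pq] cinner_commute[OF a[OF pq(1)] w[OF pq(2)]])
  qed
  finally show ?thesis .
 qed
 define g where "g s p = a p \<oplus> of_real s \<odot> w p" for s :: real and p
 have g: "g s p \<in> \<H>" if "p \<in> F" for s p using a[OF that] w[OF that] by (simp add: g_def)
 have tp: "pairing Z F (%p q. ip (g s p) (g s q)) = Re (T a a) + s\<^sup>2 * Re (T w w) + 2 * s * cmod (T u w)" for s
 proof -
  have "(\<Sum>p\<in>F. \<Sum>q\<in>F. Z p q * ip (g s p) (g s q))
    = (\<Sum>p\<in>F. \<Sum>q\<in>F. Z p q * ip (a p) (a q) + of_real s * (Z p q * ip (a p) (w q))
      + of_real s * (Z p q * ip (w p) (a q)) + of_real (s\<^sup>2) * (Z p q * ip (w p) (w q)))"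
  proof (intro sum.cong refl)
   fix p q assume pq: "p \<in> F" "q \<in> F"
   have "ip (g s p) (g s q) = ip (a p) (a q) + of_real s * ip (a p) (w q) + of_real s * ip (w p) (a q) + of_real (s\<^sup>2) * ip (w p) (w q)"
    unfolding g_def using a[OF pq(1)] a[OF pq(2)] w[OF pq(1)] w[OF pq(2)]
    by (simp add: cinner_add_left ip_add_right cinner_smult_left ip_smult_right power2_eq_square distrib_left mult.assoc)
   thus "Z p q * ip (g s p) (g s q) = Z p q * ip (a p) (a q) + of_real s * (Z p q * ip (a p) (w q))
      + of_real s * (Z p q * ip (w p) (a q)) + of_real (s\<^sup>2) * (Z p q * ip (w p) (w q))"
    by (simp only: distrib_left mult.left_commute)
  qed
  also have "... = T a a + of_real s * T a w + of_real s * T w a + of_real (s\<^sup>2) * T w w"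
   unfolding T_def by (simp only: sum.distrib sum_distrib_left)
  finally have "pairing Z F (%p q. ip (g s p) (g s q)) = Re (T a a + of_real s * T a w + of_real s * T w a + of_real (s\<^sup>2) * T w w)"
   unfolding pairing_def by (rule arg_cong)
  thus ?thesis unfolding Twa Taw by (simp del: of_real_power)
 qed
 have up: "\<bar>pairing Z F (%p q. ip (g s p) (g s q))\<bar> <= (\<Sum>p\<in>F. d p * (nm (g s p))^2)" for s
 proof -
  have "\<bar>pairing Z F (%p q. ip (g s p) (g s q))\<bar> <= (\<Sum>p\<in>F. d p * Re (ip (g s p) (g s p)))"
   by (rule pairing_psd_le[OF F psd_Gram bound]) (rule g)
  also have "... = (\<Sum>p\<in>F. d p * (nm (g s p))^2)" by (intro sum.cong refl) (simp add: nm_square g)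
  finally show ?thesis .
 qed
 have par: "(nm (g 1 p))^2 + (nm (g (-1) p))^2 = 2 * ((nm (u p))^2 + (nm (w p))^2)" if p: "p \<in> F" for p
 proof -
  have "(nm (g s p))^2 = (nm (u p))^2 + 2 * s * Re (ip (a p) (w p)) + s\<^sup>2 * (nm (w p))^2" for s
   unfolding g_def using a[OF p] w[OF p] na[OF p] by (simp add: nm_add_square ip_smult_right nm_scale power_mult_distrib)
  from this[of 1] this[of "-1"] show ?thesis by simp
 qed
 have "4 * cmod (T u w) = pairing Z F (%p q. ip (g 1 p) (g 1 q)) - pairing Z F (%p q. ip (g (-1) p) (g (-1) q))"
  unfolding tp by simp
 also have "... <= (\<Sum>p\<in>F. d p * (nm (g 1 p))^2) + (\<Sum>p\<in>F. d p * (nm (g (-1) p))^2)"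
  using up[of 1] up[of "-1"] by linarith
 also have "... = (\<Sum>p\<in>F. d p * ((nm (g 1 p))^2 + (nm (g (-1) p))^2))"
  by (simp only: sum.distrib distrib_left)
 also have "... = (\<Sum>p\<in>F. d p * (2 * ((nm (u p))^2 + (nm (w p))^2)))"
  by (intro sum.cong refl) (simp only: par)
 also have "... = 2 * (\<Sum>p\<in>F. d p * ((nm (u p))^2 + (nm (w p))^2))" by (simp only: sum_distrib_left mult.left_commute)
 finally show ?thesis unfolding T_def by simp
qed

end

text \<open>Weights that may vanish are perturbed by \<open>1/(n+1)\<close>; positive weights can be divided by.\<close>

lemma schur_bound_if_positive_weights:
 assumes pos: "\<And>F Z d. [|finite F; F \<subseteq> X; \<And>p q. [|p \<in> F; q \<in> F|] ==> Z q p = cnj (Z p q); \<And>p. p \<in> F ==> (0::real) < d p;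
   \<And>u. form_le Z F d u|]
   ==> Re (\<Sum>p\<in>F. \<Sum>q\<in>F. Z p q * \<psi> p q) <= S * (\<Sum>p\<in>F. d p)"
 shows "schur_bound X \<psi> S"
 unfolding schur_bound_def
proof (intro allI impI)
 fix F Z and d :: "'a => real"
 assume F: "finite F" "F \<subseteq> X" and Z: "\<forall>p\<in>F. \<forall>q\<in>F. Z q p = cnj (Z p q)" and d: "\<forall>p\<in>F. 0 <= d p"
  and bd: "\<forall>u. form_le Z F d u"
 let ?L = "Re (\<Sum>p\<in>F. \<Sum>q\<in>F. Z p q * \<psi> p q)"
 have "?L <= S * (\<Sum>p\<in>F. d p + 1 / real (Suc n))" for n
 proof (rule pos[OF F])
  show "Z q p = cnj (Z p q)" if "p \<in> F" "q \<in> F" for p q using Z that by blast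
  show "0 < d p + 1 / real (Suc n)" if "p \<in> F" for p using d that by (intro add_nonneg_pos) auto
  fix u
  have "(\<Sum>p\<in>F. d p * cm2 (u p)) <= (\<Sum>p\<in>F. (d p + 1 / real (Suc n)) * cm2 (u p))"
   by (intro sum_mono mult_right_mono) auto
  thus "\<bar>Re (sesq Z F u u)\<bar> <= (\<Sum>p\<in>F. (d p + 1 / real (Suc n)) * cm2 (u p))"
   using bd by (meson order_trans)
 qed
 moreover have "(%n. S * (\<Sum>p\<in>F. d p + 1 / real (Suc n))) \<leadsto> S * (\<Sum>p\<in>F. d p + 0)"
  using LIMSEQ_inverse_real_of_nat by (intro tendsto_intros) (simp add: inverse_eq_divide)
 ultimately show "?L <= S * (\<Sum>p\<in>F. d p)"
  using LIMSEQ_le_const[of "%n. S * (\<Sum>p\<in>F. d p + 1 / real (Suc n))" "S * (\<Sum>p\<in>F. d p + 0)" ?L] by auto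
qed

context invariant_measure_group
begin

abbreviation \<B> where "\<B> \<equiv> BH (L2 \<mu>)"
abbreviation vN where "vN \<equiv> group_vN G \<mu>"
abbreviation \<M> where "\<M> \<equiv> matrix_opnorm (L2 \<mu>)"
abbreviation in_vN where "in_vN n A \<equiv> \<forall>i<n. \<forall>j<n. A i j \<in> vN"

abbreviation lam :: "'a => ('a => complex) set => ('a => complex) set" where "lam \<equiv> left_regular G \<mu>"

lemma left_mult_measurable: "g \<in> \<G> ==> (%x. g \<otimes> x) \<in> measurable \<mu> \<mu>"
 by (rule continuous_measurable_map[OF continuous_left_mult])

lemma AE_translate: "[|g \<in> \<G>; AE x in \<mu>. R x|] ==> AE x in \<mu>. R (g \<otimes> x)"
 by (rule AE_distrD[OF left_mult_measurable]) (assumption, simp only: distr_translate)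

lemma SQ_translate:
 assumes g: "g \<in> \<G>" and f: "f \<in> SQ \<mu>"
 shows "(%x. f (g \<otimes> x)) \<in> SQ \<mu>"
proof -
 have "(%x. f (g \<otimes> x)) \<in> borel_measurable \<mu>"
  by (rule measurable_compose[OF left_mult_measurable[OF g] SQ_D(1)[OF f]])
 moreover have "integrable \<mu> (%x. cm2 (f (g \<otimes> x)))"
  using integrable_distr[OF left_mult_measurable[OF g], of "%x. cm2 (f x)"] distr_translate[OF g] SQ_D(2)[OF f] by simp
 ultimately show ?thesis by (simp add: sq_integrable_def)
qed

lemma lam_class:
 assumes g: "g \<in> \<G>" and f: "f \<in> SQ \<mu>"
 shows "lam g (L2_class \<mu> f) = L2_class \<mu> (%x. f (inv g \<otimes> x))"
proof -
 have ig: "inv g \<in> \<G>" using g by simp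
 have "AE x in \<mu>. L2_rep (L2_class \<mu> f) (inv g \<otimes> x) = f (inv g \<otimes> x)"
  by (rule AE_translate[OF ig L2_rep_class(2)[OF f]])
 hence "L2_class \<mu> (%x. L2_rep (L2_class \<mu> f) (inv g \<otimes> x)) = L2_class \<mu> (%x. f (inv g \<otimes> x))"
  unfolding L2_class_eq_iff[OF SQ_translate[OF ig L2_rep_class(1)[OF f]] SQ_translate[OF ig f]] .
 thus ?thesis using L2_class_mem[OF f] by (simp add: left_regular_def)
qed

lemma lam_mem: "[|g \<in> \<G>; X \<in> CL \<mu>|] ==> lam g X \<in> CL \<mu>"
 using L2_cases[of X \<mu>] lam_class L2_class_mem SQ_translate inv_closed by metis

lemma lam_inner:
 assumes g: "g \<in> \<G>" and X: "X \<in> CL \<mu>" and Y: "Y \<in> CL \<mu>"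
 shows "cinner (L2 \<mu>) (lam g X) (lam g Y) = cinner (L2 \<mu>) X Y"
proof -
 have ig: "inv g \<in> \<G>" using g by simp
 obtain f where f: "f \<in> SQ \<mu>" "X = L2_class \<mu> f" using L2_cases[OF X] .
 obtain h where h: "h \<in> SQ \<mu>" "Y = L2_class \<mu> h" using L2_cases[OF Y] .
 show ?thesis
  unfolding f(2) h(2) lam_class[OF g f(1)] lam_class[OF g h(1)] L2_inner[OF f(1) h(1)]
   L2_inner[OF SQ_translate[OF ig f(1)] SQ_translate[OF ig h(1)]]
  by (rule integral_translate[OF ig, of "%x. f x * cnj (h x)"])
   (rule borel_measurable_integrable[OF SQ_mult[OF f(1) h(1)]])
qed

lemma lam_norm: "[|g \<in> \<G>; X \<in> CL \<mu>|] ==> hnorm (L2 \<mu>) (lam g X) = hnorm (L2 \<mu>) X"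
 by (simp add: hnorm_def lam_inner)

lemma lam_mult:
 assumes g: "g \<in> \<G>" and h: "h \<in> \<G>" and X: "X \<in> CL \<mu>"
 shows "lam (g \<otimes> h) X = lam g (lam h X)"
proof -
 have i: "inv g \<in> \<G>" "inv h \<in> \<G>" "g \<otimes> h \<in> \<G>" using g h by auto
 obtain f where f: "f \<in> SQ \<mu>" "X = L2_class \<mu> f" using L2_cases[OF X] .
 note t = SQ_translate[OF i(2) f(1)]
 have "lam (g \<otimes> h) X = L2_class \<mu> (%x. f (inv (g \<otimes> h) \<otimes> x))" unfolding f(2) by (rule lam_class[OF i(3) f(1)])
 also have "... = L2_class \<mu> (%x. f (inv h \<otimes> (inv g \<otimes> x)))"
 proof -
  have ii: "inv (g \<otimes> h) \<in> \<G>" using i by simp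
  have "AE x in \<mu>. f (inv (g \<otimes> h) \<otimes> x) = f (inv h \<otimes> (inv g \<otimes> x))"
   using g h i by (intro AE_I2) (simp add: space_haar inv_mult_group m_assoc)
  thus ?thesis
   unfolding L2_class_eq_iff[OF SQ_translate[OF ii f(1)] SQ_translate[OF i(1) t]] .
 qed
 also have "... = lam g (lam h X)" unfolding f(2) lam_class[OF h f(1)] lam_class[OF g t] ..
 finally show ?thesis .
qed

lemma lam_bounded: assumes g: "g \<in> \<G>" shows "bounded_op (L2 \<mu>) (lam g)"
proof -
 interpret inner_space "L2 \<mu>" by (rule L2_inner_space)
 have ig: "inv g \<in> \<G>" using g by simp
 show ?thesis
 proof (rule bounded_opI[where K = 1])
  show "lam g \<in> extensional (CL \<mu>)" by (simp add: left_regular_def)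
  show "lam g X \<in> CL \<mu>" if "X \<in> CL \<mu>" for X by (rule lam_mem[OF g that])
  show "nm (lam g X) <= 1 * nm X" if "X \<in> CL \<mu>" for X using lam_norm[OF g that] by simp
  fix X assume X: "X \<in> CL \<mu>"
  obtain f where f: "f \<in> SQ \<mu>" "X = L2_class \<mu> f" using L2_cases[OF X] .
  note ft = SQ_translate[OF ig f(1)]
  show "lam g (c \<odot>\<^bsub>L2 \<mu>\<^esub> X) = c \<odot>\<^bsub>L2 \<mu>\<^esub> lam g X" for c
   unfolding f(2) L2_smult[OF f(1)] lam_class[OF g f(1)] lam_class[OF g SQ_scale[OF f(1)]] L2_smult[OF ft] ..
  fix Y assume Y: "Y \<in> CL \<mu>"
  obtain h where h: "h \<in> SQ \<mu>" "Y = L2_class \<mu> h" using L2_cases[OF Y] .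
  note ht = SQ_translate[OF ig h(1)]
  show "lam g (X \<oplus>\<^bsub>L2 \<mu>\<^esub> Y) = lam g X \<oplus>\<^bsub>L2 \<mu>\<^esub> lam g Y"
   unfolding f(2) h(2) L2_add[OF f(1) h(1)] lam_class[OF g f(1)] lam_class[OF g h(1)]
    lam_class[OF g SQ_add[OF f(1) h(1)]] L2_add[OF ft ht] ..
 qed
qed

text \<open>The elements of the group algebra inside \<open>B(L\<^sup>2)\<close>, whose \<open>\<sigma>\<close>-weak closure is the group von Neumann algebra.\<close>

definition comb :: "'a set => ('a => complex) => ('a => complex) set => ('a => complex) set"
 where "comb F c = (\<Oplus>\<^bsub>\<B>\<^esub>g\<in>F. c g \<odot>\<^bsub>\<B>\<^esub> lam g)"

definition span :: "(('a => complex) set => ('a => complex) set) set"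
 where "span = {comb F c | F c. finite F & F \<subseteq> \<G>}"

lemma comb_span: "[|finite F; F \<subseteq> \<G>|] ==> comb F c \<in> span"
 unfolding span_def by blast

lemma spanE:
 assumes "A \<in> span"
 obtains F c where "finite F" "F \<subseteq> \<G>" "A = comb F c"
 using assms unfolding span_def by blast

lemma group_vN_eq: "vN = swt (L2 \<mu>) closure_of span"
 by (simp add: group_vN_def span_def comb_def)

sublocale L: inner_space "L2 \<mu>" by (rule L2_inner_space)

lemma scaled_lam_mem: "g \<in> \<G> ==> c \<odot>\<^bsub>\<B>\<^esub> lam g \<in> carrier \<B>"
 by (intro L.BH_scale_closed) (simp add: L.BH_simps lam_bounded)

lemma comb_mem: "F \<subseteq> \<G> ==> comb F c \<in> carrier \<B>"
 unfolding comb_def using scaled_lam_mem by (intro L.BH_finsum_closed) auto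

lemma comb_inner:
 assumes F: "finite F" "F \<subseteq> \<G>" and X: "X \<in> CL \<mu>" and Y: "Y \<in> CL \<mu>"
 shows "L.ip (comb F c X) Y = (\<Sum>g\<in>F. c g * L.ip (lam g X) Y)"
proof -
 have "L.ip (comb F c X) Y = (\<Sum>g\<in>F. L.ip ((c g \<odot>\<^bsub>\<B>\<^esub> lam g) X) Y)"
  unfolding comb_def using F scaled_lam_mem by (intro L.BH_finsum_apply X Y) auto
 also have "... = (\<Sum>g\<in>F. c g * L.ip (lam g X) Y)"
  using F X Y lam_mem by (intro sum.cong refl) (auto simp: L.BH_simps(3) L.cinner_smult_left)
 finally show ?thesis .
qed

lemma comb_bounded: "F \<subseteq> \<G> ==> bounded_op (L2 \<mu>) (comb F c)"
 using comb_mem by (simp add: L.BH_simps)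

lemma span_sub: "span \<subseteq> carrier \<B>"
 using comb_mem by (auto simp: span_def)

lemma vN_sub: "vN \<subseteq> carrier \<B>"
 unfolding group_vN_eq using closure_of_subset_topspace[of "swt (L2 \<mu>)" span] by (simp only: L.topspace_sigma_weak)

lemma span_vN: "span \<subseteq> vN"
 unfolding group_vN_eq by (rule closure_of_subset) (simp only: L.topspace_sigma_weak span_sub)

lemma comb_add:
 assumes F: "finite F" "F \<subseteq> \<G>" and E: "finite E" "E \<subseteq> \<G>"
 shows "comb F c \<oplus>\<^bsub>\<B>\<^esub> comb E h = comb (F \<union> E) (%g. (if g \<in> F then c g else 0) + (if g \<in> E then h g else 0))"
proof (rule L.op_eq_if_ip_eq)
 show "bounded_op (L2 \<mu>) (comb F c \<oplus>\<^bsub>\<B>\<^esub> comb E h)"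
  using L.BH_add_closed[OF comb_mem[OF F(2)] comb_mem[OF E(2)]] by (simp add: L.BH_simps)
 show "bounded_op (L2 \<mu>) (comb (F \<union> E) (%g. (if g \<in> F then c g else 0) + (if g \<in> E then h g else 0)))"
  using F E by (intro comb_bounded) auto
 fix X Y assume X: "X \<in> CL \<mu>" and Y: "Y \<in> CL \<mu>"
 have FE: "finite (F \<union> E)" "F \<union> E \<subseteq> \<G>" using F E by auto
 have 1: "(\<Sum>g\<in>F \<union> E. (if g \<in> F then c g else 0) * L.ip (lam g X) Y) = (\<Sum>g\<in>F. c g * L.ip (lam g X) Y)"
  using FE(1) by (intro sum.mono_neutral_cong_right) auto
 have 2: "(\<Sum>g\<in>F \<union> E. (if g \<in> E then h g else 0) * L.ip (lam g X) Y) = (\<Sum>g\<in>E. h g * L.ip (lam g X) Y)"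
  using FE(1) by (intro sum.mono_neutral_cong_right) auto
 have "L.ip ((comb F c \<oplus>\<^bsub>\<B>\<^esub> comb E h) X) Y = L.ip (comb F c X) Y + L.ip (comb E h X) Y"
  using X Y L.bounded_opD(1)[OF comb_bounded[OF F(2)] X] L.bounded_opD(1)[OF comb_bounded[OF E(2)] X]
  by (simp add: L.BH_simps(2) L.cinner_add_left)
 also have "... = L.ip (comb (F \<union> E) (%g. (if g \<in> F then c g else 0) + (if g \<in> E then h g else 0)) X) Y"
  unfolding comb_inner[OF F X Y] comb_inner[OF E X Y] comb_inner[OF FE X Y] distrib_right sum.distrib 1 2 ..
 finally show "L.ip ((comb F c \<oplus>\<^bsub>\<B>\<^esub> comb E h) X) Y
   = L.ip (comb (F \<union> E) (%g. (if g \<in> F then c g else 0) + (if g \<in> E then h g else 0)) X) Y" .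
qed

lemma comb_scale:
 assumes F: "finite F" "F \<subseteq> \<G>"
 shows "r \<odot>\<^bsub>\<B>\<^esub> comb F c = comb F (%g. r * c g)"
proof (rule L.op_eq_if_ip_eq)
 show "bounded_op (L2 \<mu>) (r \<odot>\<^bsub>\<B>\<^esub> comb F c)"
  using L.BH_scale_closed[OF comb_mem[OF F(2)]] by (simp add: L.BH_simps)
 show "bounded_op (L2 \<mu>) (comb F (%g. r * c g))" by (rule comb_bounded[OF F(2)])
 fix X Y assume X: "X \<in> CL \<mu>" and Y: "Y \<in> CL \<mu>"
 have "L.ip ((r \<odot>\<^bsub>\<B>\<^esub> comb F c) X) Y = r * L.ip (comb F c X) Y"
  using X Y L.bounded_opD(1)[OF comb_bounded[OF F(2)] X] by (simp add: L.BH_simps(3) L.cinner_smult_left)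
 also have "... = L.ip (comb F (%g. r * c g) X) Y"
  unfolding comb_inner[OF F X Y] sum_distrib_left by (simp add: mult.assoc)
 finally show "L.ip ((r \<odot>\<^bsub>\<B>\<^esub> comb F c) X) Y = L.ip (comb F (%g. r * c g) X) Y" .
qed

lemma vN_add: "[|A \<in> vN; B \<in> vN|] ==> A \<oplus>\<^bsub>\<B>\<^esub> B \<in> vN"
 unfolding group_vN_eq
proof (rule L.closure_add[OF span_sub])
 fix A B assume "A \<in> span" "B \<in> span"
 then obtain F c E h where F: "finite F" "F \<subseteq> \<G>" "A = comb F c" and E: "finite E" "E \<subseteq> \<G>" "B = comb E h"
  unfolding span_def by blast
 show "A \<oplus>\<^bsub>\<B>\<^esub> B \<in> span"
  unfolding F(3) E(3) comb_add[OF F(1,2) E(1,2)] using F E by (intro comb_span) auto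
qed

lemma vN_scale: "A \<in> vN ==> r \<odot>\<^bsub>\<B>\<^esub> A \<in> vN"
 unfolding group_vN_eq
proof (rule L.closure_scale)
 fix A assume "A \<in> span"
 then obtain F c where F: "finite F" "F \<subseteq> \<G>" "A = comb F c" unfolding span_def by blast
 show "r \<odot>\<^bsub>\<B>\<^esub> A \<in> span" unfolding F(3) comb_scale[OF F(1,2)] by (rule comb_span[OF F(1,2)])
qed

lemma lam_vN: assumes g: "g \<in> \<G>" shows "lam g \<in> vN"
proof -
 have "comb {g} (%_. 1) = lam g"
 proof (rule L.op_eq_if_ip_eq)
  show "bounded_op (L2 \<mu>) (comb {g} (%_. 1))" "bounded_op (L2 \<mu>) (lam g)" using g comb_bounded lam_bounded by auto
  fix X Y assume "X \<in> CL \<mu>" "Y \<in> CL \<mu>"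
  thus "L.ip (comb {g} (%_. 1) X) Y = L.ip (lam g X) Y" using g by (simp add: comb_inner)
 qed
 moreover have "comb {g} (%_. 1) \<in> span" using g by (intro comb_span) auto
 ultimately have "lam g \<in> span" by simp
 thus ?thesis using span_vN by blast
qed

lemma multiplier_on_span:
 assumes M: "\<And>A B. [|A \<in> vN; B \<in> vN|] ==> M (A \<oplus>\<^bsub>\<B>\<^esub> B) = M A \<oplus>\<^bsub>\<B>\<^esub> M B"
  "\<And>c A. A \<in> vN ==> M (c \<odot>\<^bsub>\<B>\<^esub> A) = c \<odot>\<^bsub>\<B>\<^esub> M A"
  "\<And>g. g \<in> \<G> ==> M (lam g) = \<phi> g \<odot>\<^bsub>\<B>\<^esub> lam g"
  and F: "finite F" "F \<subseteq> \<G>"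
 shows "M (comb F c) = comb F (%g. c g * \<phi> g)"
 using F
proof (induction F rule: finite_induct)
 case empty
 have emb: "comb {} k = (\<lambda>x\<in>CL \<mu>. \<zero>\<^bsub>L2 \<mu>\<^esub>)" for k
  by (simp add: comb_def abelian_monoid.finsum_empty[OF L.BH_abelian_monoid] L.BH_simps)
 have e: "comb {} c \<in> vN" using span_vN comb_span[of "{}"] by blast
 have Mv: "M (lam \<one>) = \<phi> \<one> \<odot>\<^bsub>\<B>\<^esub> lam \<one>" by (rule M(3)) simp
 have z: "0 \<odot>\<^bsub>\<B>\<^esub> A = comb {} k" if "bounded_op (L2 \<mu>) A" for A k
  unfolding emb L.BH_simps(3) using L.bounded_opD(1)[OF that] by (intro restrict_ext) simp
 have "comb {} c = 0 \<odot>\<^bsub>\<B>\<^esub> lam \<one>" using z[OF lam_bounded[OF one_closed]] by simp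
 hence "M (comb {} c) = 0 \<odot>\<^bsub>\<B>\<^esub> (\<phi> \<one> \<odot>\<^bsub>\<B>\<^esub> lam \<one>)"
  using M(2)[OF lam_vN[OF one_closed], of 0] Mv by simp
 also have "... = comb {} (%g. c g * \<phi> g)"
  using scaled_lam_mem[OF one_closed] by (intro z) (simp add: L.BH_simps(1))
 finally show ?case .
next
 case (insert a F)
 have a: "a \<in> \<G>" and F: "F \<subseteq> \<G>" using insert by auto
 have split: "comb (insert a F) k = (k a \<odot>\<^bsub>\<B>\<^esub> lam a) \<oplus>\<^bsub>\<B>\<^esub> comb F k" for k
  unfolding comb_def
  by (rule abelian_monoid.finsum_insert[OF L.BH_abelian_monoid insert(1,2)]) (use scaled_lam_mem a F in auto)
 have FV: "comb F c \<in> vN" using span_vN comb_span[OF insert(1) F] by blast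
 have "M (comb (insert a F) c) = M (c a \<odot>\<^bsub>\<B>\<^esub> lam a) \<oplus>\<^bsub>\<B>\<^esub> M (comb F c)"
  unfolding split by (rule M(1)[OF vN_scale[OF lam_vN[OF a]] FV])
 also have "M (c a \<odot>\<^bsub>\<B>\<^esub> lam a) = c a \<odot>\<^bsub>\<B>\<^esub> (\<phi> a \<odot>\<^bsub>\<B>\<^esub> lam a)"
  unfolding M(2)[OF lam_vN[OF a]] M(3)[OF a] ..
 also have "... = (c a * \<phi> a) \<odot>\<^bsub>\<B>\<^esub> lam a"
  unfolding L.BH_simps(3) using lam_mem[OF a] by (intro restrict_ext) (simp add: L.scale_scale)
 also have "M (comb F c) = comb F (%g. c g * \<phi> g)" by (rule insert(3)[OF F])
 finally show ?case unfolding split .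
qed

lemma fourier_multiplier_opD:
 assumes "fourier_multiplier_op G \<mu> \<phi> M"
 shows "M \<in> vN \<rightarrow>\<^sub>E vN"
  "[|A \<in> vN; B \<in> vN|] ==> M (A \<oplus>\<^bsub>\<B>\<^esub> B) = M A \<oplus>\<^bsub>\<B>\<^esub> M B"
  "A \<in> vN ==> M (c \<odot>\<^bsub>\<B>\<^esub> A) = c \<odot>\<^bsub>\<B>\<^esub> M A"
  "g \<in> \<G> ==> M (lam g) = \<phi> g \<odot>\<^bsub>\<B>\<^esub> lam g"
  "continuous_map (subtopology (swt (L2 \<mu>)) (vN)) (subtopology (swt (L2 \<mu>)) (vN)) M"
proof -
 note D = assms[unfolded fourier_multiplier_op_def Let_def]
 show "M \<in> vN \<rightarrow>\<^sub>E vN" by (rule D[THEN conjunct1])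
 show "M (A \<oplus>\<^bsub>\<B>\<^esub> B) = M A \<oplus>\<^bsub>\<B>\<^esub> M B" if "A \<in> vN" "B \<in> vN"
  by (rule D[THEN conjunct2, THEN conjunct1, THEN bspec, OF that(1), THEN bspec, OF that(2)])
 show "M (c \<odot>\<^bsub>\<B>\<^esub> A) = c \<odot>\<^bsub>\<B>\<^esub> M A" if "A \<in> vN"
  by (rule D[THEN conjunct2, THEN conjunct2, THEN conjunct1, THEN spec, THEN bspec, OF that])
 show "M (lam g) = \<phi> g \<odot>\<^bsub>\<B>\<^esub> lam g" if "g \<in> \<G>"
  by (rule D[THEN conjunct2, THEN conjunct2, THEN conjunct2, THEN conjunct2, THEN conjunct2, THEN bspec, OF that])
 show "continuous_map (subtopology (swt (L2 \<mu>)) (vN)) (subtopology (swt (L2 \<mu>)) (vN)) M"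
  by (rule D[THEN conjunct2, THEN conjunct2, THEN conjunct2, THEN conjunct1])
qed

text \<open>Two continuous maps into a Hausdorff space that agree on a dense set.\<close>

lemma fourier_multiplier_op_unique:
 assumes M: "fourier_multiplier_op G \<mu> \<phi> M" and N: "fourier_multiplier_op G \<mu> \<phi> N"
 shows "M = N"
proof -
 let ?V = "vN" let ?W = "subtopology (swt (L2 \<mu>)) ?V"
 note DM = fourier_multiplier_opD[OF M] and DN = fourier_multiplier_opD[OF N]
 have on_span: "M A = N A" if A: "A \<in> span" for A
 proof -
  obtain F c where F: "finite F" "F \<subseteq> \<G>" "A = comb F c" using spanE[OF A] .
  have "M (comb F c) = comb F (%g. c g * \<phi> g)" by (rule multiplier_on_span[OF DM(2) DM(3) DM(4) F(1,2)])
  moreover have "N (comb F c) = comb F (%g. c g * \<phi> g)" by (rule multiplier_on_span[OF DN(2) DN(3) DN(4) F(1,2)])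
  ultimately show ?thesis using F(3) by simp
 qed
 have cl: "?W closure_of span = ?V"
  using span_vN by (simp add: closure_of_subtopology group_vN_eq Int_absorb1)
 show ?thesis
 proof (rule extensionalityI[of _ ?V])
  show "M \<in> extensional ?V" "N \<in> extensional ?V" using DM(1) DN(1) by (auto simp: PiE_iff)
  fix A assume "A \<in> ?V"
  hence "A \<in> ?W closure_of span" using cl by simp
  thus "M A = N A"
   by (rule forall_in_closure_of_eq[OF _ Hausdorff_space_subtopology[OF L.Hausdorff_sigma_weak] DM(5) DN(5) on_span])
 qed
qed

lemma M0A_norm_eq: "fourier_multiplier_op G \<mu> \<phi> M ==> M0A_norm G \<mu> \<phi> = cb_norm (L2 \<mu>) (vN) M"
 unfolding M0A_norm_def using fourier_multiplier_op_unique by (metis the_equality)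

text \<open>The symbol map of \<open>P\<close> and \<open>Q\<close> multiplies \<open>\<lambda>(g)\<close> by the constant \<open>\<Sum>\<^sub>k P\<^sub>k(g\<inverse> x) cnj(Q\<^sub>k(x)) = \<phi>(g)\<close>. It preserves the span of \<open>\<lambda>(G)\<close>, hence by normality its closure.\<close>

theorem multiplier_from_factorization:
 assumes P: "bsymbol \<mu> P s" and Q: "bsymbol \<mu> Q s"
  and fac: "\<And>g x. [|g \<in> \<G>; x \<in> \<G>|] ==> (%k. P k (inv g \<otimes> x) * cnj (Q k x)) sums \<phi> g"
 shows "\<exists>M. fourier_multiplier_op G \<mu> \<phi> M &
  (\<forall>n A. (in_vN n A) -->
    \<M> n (%i j. M (A i j)) <= s\<^sup>2 * \<M> n A)"
proof -
 interpret S: symbol_map "L2 \<mu>" "mult_op \<mu> P" "mult_op \<mu> Q" s "symbol_op \<mu> P Q"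
  by (rule symbol_op_symbol_map[OF P Q])
 let ?\<Phi> = "symbol_op \<mu> P Q" and ?V = "vN"
 have Vb: "bounded_op (L2 \<mu>) A" if "A \<in> ?V" for A using vN_sub that by (auto simp: L.BH_simps(1))
 have on_lam: "?\<Phi> (lam g) = \<phi> g \<odot>\<^bsub>\<B>\<^esub> lam g" if g: "g \<in> \<G>" for g
 proof (rule L.op_eqI)
  have ig: "inv g \<in> \<G>" using g by simp
  show "bounded_op (L2 \<mu>) (?\<Phi> (lam g))" by (rule S.\<Phi>[OF lam_bounded[OF g]])
  show "bounded_op (L2 \<mu>) (\<phi> g \<odot>\<^bsub>\<B>\<^esub> lam g)" using scaled_lam_mem[OF g] by (simp add: L.BH_simps(1))
  fix X assume X: "X \<in> CL \<mu>"
  obtain f where f: "f \<in> SQ \<mu>" "X = L2_class \<mu> f" using L2_cases[OF X] .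
  note ft = SQ_translate[OF ig f(1)]
  have Pf: "(%x. P k x * f x) \<in> SQ \<mu>" for k by (rule mult_op_class(1)[OF P f(1)])
  have lp: "lam g (mult_op \<mu> P k X) = L2_class \<mu> (%x. P k (inv g \<otimes> x) * f (inv g \<otimes> x))" for k
   unfolding f(2) mult_op_class(2)[OF P f(1)] by (rule lam_class[OF g Pf])
  have "AE x in \<mu>. \<forall>k. L2_rep (lam g (mult_op \<mu> P k X)) x = P k (inv g \<otimes> x) * f (inv g \<otimes> x)"
   unfolding AE_all_countable lp using L2_rep_class(2)[OF SQ_translate[OF ig Pf]] by blast
  hence ae: "AE x in \<mu>. (\<Sum>k. cnj (Q k x) * L2_rep (lam g (mult_op \<mu> P k X)) x) = \<phi> g * f (inv g \<otimes> x)"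
   using AE_space
  proof eventually_elim
   case (elim x)
   have "(%k. P k (inv g \<otimes> x) * cnj (Q k x) * f (inv g \<otimes> x)) sums (\<phi> g * f (inv g \<otimes> x))"
    using elim(2) by (intro sums_mult2 fac g) (simp add: space_haar)
   thus ?case using elim(1) by (simp add: sums_iff mult_ac)
  qed
  define F where "F = (%x. \<Sum>k. cnj (Q k x) * L2_rep (lam g (mult_op \<mu> P k X)) x)"
  have Fm: "F \<in> SQ \<mu>"
  proof (rule SQ_bound)
   have "L2_rep (lam g (mult_op \<mu> P k X)) \<in> borel_measurable \<mu>" for k
    unfolding lp by (rule SQ_D(1)[OF L2_rep_class(1)[OF SQ_translate[OF ig Pf]]])
   thus "F \<in> borel_measurable \<mu>" unfolding F_def using bsymbolD(2)[OF Q] by measurable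
   show "integrable \<mu> (%x. cm2 (\<phi> g * f (inv g \<otimes> x)))" by (rule SQ_D(2)[OF SQ_scale[OF ft]])
   show "AE x in \<mu>. cm2 (F x) <= cm2 (\<phi> g * f (inv g \<otimes> x))"
    using ae by eventually_elim (simp add: F_def)
  qed
  have "L2_class \<mu> F = L2_class \<mu> (%x. \<phi> g * f (inv g \<otimes> x))"
   unfolding L2_class_eq_iff[OF Fm SQ_scale[OF ft]] using ae by eventually_elim (simp add: F_def)
  moreover have "?\<Phi> (lam g) X = L2_class \<mu> F" using X by (simp add: symbol_op_def F_def)
  moreover have "(\<phi> g \<odot>\<^bsub>\<B>\<^esub> lam g) X = L2_class \<mu> (%x. \<phi> g * f (inv g \<otimes> x))"
   using X by (simp add: L.BH_simps(3)) (simp add: f(2) lam_class[OF g f(1)] L2_smult[OF ft])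
  ultimately show "?\<Phi> (lam g) X = (\<phi> g \<odot>\<^bsub>\<B>\<^esub> lam g) X" by simp
 qed
 have on_span: "?\<Phi> (comb F c) = comb F (%g. c g * \<phi> g)" if "finite F" "F \<subseteq> \<G>" for F c
  by (rule multiplier_on_span[OF _ _ on_lam that]) (use S.symbol_map_add S.symbol_map_scale Vb in auto)
 have "?\<Phi> ` ?V \<subseteq> swt (L2 \<mu>) closure_of (?\<Phi> ` span)"
  unfolding group_vN_eq by (rule continuous_map_image_closure_subset[OF S.symbol_map_continuous])
 also have "... \<subseteq> ?V"
  unfolding group_vN_eq
 proof (intro closure_of_mono subsetI)
  fix B assume "B \<in> ?\<Phi> ` span"
  then obtain A where A: "A \<in> span" "B = ?\<Phi> A" by blast
  obtain F c where F': "finite F" "F \<subseteq> \<G>" "A = comb F c" using spanE[OF A(1)] .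
  have F: "finite F" "F \<subseteq> \<G>" "B = ?\<Phi> (comb F c)" using F' A(2) by auto
  show "B \<in> span" unfolding F(3) on_span[OF F(1,2)] by (rule comb_span[OF F(1,2)])
 qed
 finally have VV: "?\<Phi> A \<in> ?V" if "A \<in> ?V" for A using that by blast
 define M where "M = restrict ?\<Phi> ?V"
 have ME: "M A = ?\<Phi> A" if "A \<in> ?V" for A using that by (simp add: M_def)
 have cb: "\<M> n (%i j. M (A i j)) <= s\<^sup>2 * \<M> n A"
  if A: "\<forall>i<n. \<forall>j<n. A i j \<in> ?V" for n A
 proof -
  have "matrix_op (L2 \<mu>) n (%i j. M (A i j)) = matrix_op (L2 \<mu>) n (%i j. ?\<Phi> (A i j))"
  proof -
   have "(\<Oplus>\<^bsub>L2 \<mu>\<^esub>j\<in>{..<n}. M (A i j) (x j)) = (\<Oplus>\<^bsub>L2 \<mu>\<^esub>j\<in>{..<n}. ?\<Phi> (A i j) (x j))"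
    if i: "i < n" and x: "x \<in> carrier (hilbert_power (L2 \<mu>) n)" for i x
   proof (rule L.M.finsum_cong')
    show "(%j. ?\<Phi> (A i j) (x j)) \<in> {..<n} \<rightarrow> CL \<mu>"
     using i A Vb L.bounded_opD(1)[OF S.\<Phi>] L.power_comp[OF x] by auto
   qed (use i A ME in auto)
   thus ?thesis unfolding matrix_op_def by (intro restrict_ext) auto
  qed
  moreover have "\<M> n (%i j. ?\<Phi> (A i j)) <= s\<^sup>2 * \<M> n A"
   using A Vb by (intro S.matrix_opnorm_le) auto
  ultimately show ?thesis by (simp add: matrix_opnorm_def)
 qed
 have "fourier_multiplier_op G \<mu> \<phi> M"
  unfolding fourier_multiplier_op_def Let_def
 proof (intro conjI ballI allI)
  show "M \<in> ?V \<rightarrow>\<^sub>E ?V" using VV by (auto simp: M_def)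
  show "M (A \<oplus>\<^bsub>\<B>\<^esub> B) = M A \<oplus>\<^bsub>\<B>\<^esub> M B" if "A \<in> ?V" "B \<in> ?V" for A B
   using that by (simp add: ME vN_add S.symbol_map_add Vb)
  show "M (c \<odot>\<^bsub>\<B>\<^esub> A) = c \<odot>\<^bsub>\<B>\<^esub> M A" if "A \<in> ?V" for c A
   using that by (simp add: ME vN_scale S.symbol_map_scale Vb)
  show "continuous_map (subtopology (swt (L2 \<mu>)) ?V) (subtopology (swt (L2 \<mu>)) ?V) M"
  proof (rule continuous_map_into_subtopology)
   have tsp: "topspace (subtopology (swt (L2 \<mu>)) ?V) = ?V"
    using vN_sub by (simp add: topspace_subtopology L.topspace_sigma_weak Int_absorb1)
   show "continuous_map (subtopology (swt (L2 \<mu>)) ?V) (swt (L2 \<mu>)) M"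
    by (rule continuous_map_eq[OF continuous_map_from_subtopology[OF S.symbol_map_continuous]]) (simp add: tsp ME)
   show "M \<in> topspace (subtopology (swt (L2 \<mu>)) ?V) \<rightarrow> ?V" unfolding tsp using ME VV by auto
  qed
  show "completely_bounded (L2 \<mu>) ?V M"
   unfolding completely_bounded_def using cb by blast
  show "M (lam g) = \<phi> g \<odot>\<^bsub>\<B>\<^esub> lam g" if "g \<in> \<G>" for g
   using that lam_vN on_lam ME by simp
 qed
 thus ?thesis using cb by blast
qed

text \<open>The second inequality rests on the supremum that defines the norm being finite.\<close>

lemma cb_norm_le:
 assumes "\<And>n A. in_vN n A ==> \<M> n (%i j. M (A i j)) <= K * \<M> n A"
  and K: "0 <= K"
 shows "cb_norm (L2 \<mu>) (vN) M <= K"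
  and "[|in_vN n A; \<M> n A <= 1|]
   ==> \<M> n (%i j. M (A i j)) <= cb_norm (L2 \<mu>) (vN) M"
proof -
 let ?S = "{\<M> n (%i j. M (A i j)) | n A.
      (in_vN n A) & \<M> n A <= 1}"
 have le: "x <= K" if xS: "x \<in> ?S" for x
 proof -
  obtain n A where x: "x = \<M> n (%i j. M (A i j))" and
   A: "in_vN n A" "\<M> n A <= 1" using xS by auto
  have "x <= K * \<M> n A" unfolding x by (rule assms(1)[OF A(1)])
  also have "... <= K" using A(2) K by (simp add: mult_left_le)
  finally show ?thesis .
 qed
 have "\<exists>x. x \<in> ?S"
 proof -
  interpret P: inner_space "hilbert_power (L2 \<mu>) 0" by (rule L.power_inner_space)
  have "\<M> 0 (%i j. lam \<one>) <= 1"
   unfolding matrix_opnorm_def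
  proof (rule P.opnorm_le)
   fix x assume x: "x \<in> carrier (hilbert_power (L2 \<mu>) 0)"
   have "matrix_op (L2 \<mu>) 0 (%i j. lam \<one>) x \<in> carrier (hilbert_power (L2 \<mu>) 0)" by (rule L.matrix_op_mem[OF _ x]) simp
   thus "P.nm (matrix_op (L2 \<mu>) 0 (%i j. lam \<one>) x) <= 1 * P.nm x"
    using x by (simp add: hnorm_def L.power_simps(5))
  qed simp
  thus ?thesis by blast
 qed
 hence ne: "?S ~= {}" by blast
 show "cb_norm (L2 \<mu>) (vN) M <= K"
  unfolding cb_norm_def by (rule cSup_least[OF ne le])
 assume A: "in_vN n A" "\<M> n A <= 1"
 show "\<M> n (%i j. M (A i j)) <= cb_norm (L2 \<mu>) (vN) M"
  unfolding cb_norm_def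
 proof (rule cSup_upper)
  show "\<M> n (%i j. M (A i j)) \<in> ?S" using A by (intro CollectI exI[of _ n] exI[of _ A] conjI refl)
  show "bdd_above ?S" by (rule bdd_aboveI[OF le])
 qed
qed

end

section \<open>Square summable functions on a set\<close>

lemma (in inner_space) scalar_form_bound:
 assumes e: "e \<in> carrier H" "nm e = 1"
  and F: "finite F" and Z: "\<And>p q. [|p \<in> F; q \<in> F|] ==> Z q p = cnj (Z p q)"
  and bound: "\<And>u. form_le Z F d u"
 shows "2 * cmod (\<Sum>p\<in>F. \<Sum>q\<in>F. Z p q * (u p * cnj (w q))) <= (\<Sum>p\<in>F. d p * (cm2 (u p) + cm2 (w p)))"
proof -
 have n: "nm (c \<odot> e) = cmod c" for c using e by (simp add: nm_scale)
 have "ip (x \<odot> e) (y \<odot> e) = x * cnj y" for x y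
  using e by (simp add: cinner_smult_left ip_smult_right ip_self)
 thus ?thesis
  using form_bound[OF F Z bound, of "%p. u p \<odot> e" "%p. w p \<odot> e"] e by (simp add: n)
qed

text \<open>Dividing by the square roots of the weights turns \<open>\<plusminus>Z \<le> diag(d)\<close> into the statement that a matrix is a contraction.\<close>

lemma normalized_form_contraction:
 fixes Z :: "'x => 'x => complex"
 assumes F: "finite F" and Z: "\<And>p q. [|p \<in> F; q \<in> F|] ==> Z q p = cnj (Z p q)"
  and d: "\<And>p. p \<in> F ==> 0 < d p"
  and bound: "\<And>u. form_le Z F d u"
 shows "(\<Sum>p\<in>F. cm2 (\<Sum>q\<in>F. Z p q / of_real (sqrt (d p) * sqrt (d q)) * f q)) <= (\<Sum>q\<in>F. cm2 (f q))"
proof -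
 interpret H: inner_space "Ltwo UNIV" by (rule l2_inner_space)
 define e :: "nat => complex" where "e i = (if i = 0 then 1 else 0)" for i
 have e: "e \<in> l2 UNIV" unfolding l2_def using summable_finite[of "{0::nat}" "%i. cm2 (e i)"] by (simp add: e_def)
 have "(H.nm e)^2 = (\<Sum>i\<in>{0}. cm2 (e i))"
  unfolding l2_norm_square[OF e] by (rule suminf_finite) (auto simp: e_def)
 hence "(H.nm e)^2 = 1" by (simp add: e_def)
 hence ne: "H.nm e = 1" using l2_norm_nonneg[OF e] by (simp add: power2_eq_1_iff)
 define g where "g p = (\<Sum>q\<in>F. Z p q / of_real (sqrt (d p) * sqrt (d q)) * f q)" for p
 define N where "N = (\<Sum>p\<in>F. cm2 (g p))"
 define u where "u p = cnj (g p) / of_real (sqrt (d p))" for p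
 define w where "w p = cnj (f p) / of_real (sqrt (d p))" for p
 have "of_real N = (\<Sum>p\<in>F. cnj (g p) * g p)"
  unfolding N_def of_real_sum by (intro sum.cong refl) (simp only: complex_norm_square mult.commute)
 also have "... = (\<Sum>p\<in>F. \<Sum>q\<in>F. Z p q * (u p * cnj (w q)))"
  unfolding u_def w_def
 proof (intro sum.cong refl)
  fix p assume "p \<in> F"
  show "cnj (g p) * g p = (\<Sum>q\<in>F. Z p q * (cnj (g p) / of_real (sqrt (d p)) * cnj (cnj (f q) / of_real (sqrt (d q)))))"
   unfolding g_def[of p] sum_distrib_left by (intro sum.cong refl) simp
 qed
 finally have N: "of_real N = (\<Sum>p\<in>F. \<Sum>q\<in>F. Z p q * (u p * cnj (w q)))" .
 have N0: "0 <= N" unfolding N_def by (intro sum_nonneg) simp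
 have "2 * N = 2 * cmod (of_real N)" using N0 by simp
 also have "... <= (\<Sum>p\<in>F. d p * (cm2 (u p) + cm2 (w p)))"
  unfolding N by (rule H.scalar_form_bound[where e = e, OF _ ne F Z bound]) (simp add: Ltwo_simps e)
 also have "... = (\<Sum>p\<in>F. cm2 (g p) + cm2 (f p))"
 proof (intro sum.cong refl)
  fix p assume "p \<in> F"
  hence "0 < d p" by (rule d)
  thus "d p * (cm2 (u p) + cm2 (w p)) = cm2 (g p) + cm2 (f p)"
   by (simp add: u_def w_def norm_divide power_divide field_simps)
 qed
 also have "... = N + (\<Sum>p\<in>F. cm2 (f p))" by (simp add: N_def sum.distrib)
 finally show ?thesis by (simp add: N_def g_def)
qed

lemma ell2_simps:
 "carrier (ell2 Y) = {f \<in> extensional Y. (%y. cm2 (f y)) summable_on Y}"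
 "\<zero>\<^bsub>ell2 Y\<^esub> = (\<lambda>y\<in>Y. 0)"
 "f \<oplus>\<^bsub>ell2 Y\<^esub> g = (\<lambda>y\<in>Y. f y + g y)"
 "c \<odot>\<^bsub>ell2 Y\<^esub> f = (\<lambda>y\<in>Y. c * f y)"
 "cinner (ell2 Y) f g = (\<Sum>\<^sub>\<infinity>y\<in>Y. f y * cnj (g y))"
 by (simp_all add: ell2_def)

lemma ell2_memI:
 assumes "f \<in> extensional Y" "\<And>E. finite E ==> E \<subseteq> Y ==> (\<Sum>y\<in>E. cm2 (f y)) <= B"
 shows "f \<in> carrier (ell2 Y)" and "(\<Sum>\<^sub>\<infinity>y\<in>Y. cm2 (f y)) <= B"
proof -
 have s: "(%y. cm2 (f y)) summable_on Y"
  by (rule nonneg_bdd_above_summable_on) (use assms(2) in \<open>auto intro!: bdd_aboveI\<close>)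
 show "f \<in> carrier (ell2 Y)" using s assms(1) by (simp add: ell2_simps)
 show "(\<Sum>\<^sub>\<infinity>y\<in>Y. cm2 (f y)) <= B" by (rule infsum_le_finite_sums[OF s assms(2)])
qed

lemma ell2_summable: "f \<in> carrier (ell2 Y) ==> (%y. cm2 (f y)) summable_on Y"
 and ell2_extensional: "f \<in> carrier (ell2 Y) ==> f \<in> extensional Y"
 by (simp_all add: ell2_simps)

lemma ell2_restrictI: "(%y. cm2 (f y)) summable_on Y ==> (\<lambda>y\<in>Y. f y) \<in> carrier (ell2 Y)"
 using summable_on_cong[of Y "%y. cm2 ((\<lambda>y\<in>Y. f y) y)" "%y. cm2 (f y)"] by (simp add: ell2_simps)

lemma ell2_mult_summable:
 assumes "f \<in> carrier (ell2 Y)" "g \<in> carrier (ell2 Y)"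
 shows "(%y. f y * cnj (g y)) summable_on Y"
 by (rule abs_summable_summable[OF Infinite_Sum.abs_summable_on_comparison_test'[OF summable_on_add[OF ell2_summable[OF assms(1)] ell2_summable[OF assms(2)]]]])
  (rule cmod_mult_le_squares)

lemma ell2_add: assumes "f \<in> carrier (ell2 Y)" "g \<in> carrier (ell2 Y)" shows "(\<lambda>y\<in>Y. f y + g y) \<in> carrier (ell2 Y)"
 by (rule ell2_restrictI, rule summable_on_comparison_test[OF summable_on_add[OF
   summable_on_cmult_right[OF ell2_summable[OF assms(1)], of 2] summable_on_cmult_right[OF ell2_summable[OF assms(2)], of 2]]])
  (simp_all add: cmod_add_square_le)

lemma ell2_scale: "f \<in> carrier (ell2 Y) ==> (\<lambda>y\<in>Y. c * f y) \<in> carrier (ell2 Y)"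
 using summable_on_cmult_right[OF ell2_summable, of f Y "cm2 c"]
 by (intro ell2_restrictI) (simp add: norm_mult power_mult_distrib)

lemma ell2_abelian_group: "abelian_group (ell2 Y)"
proof (rule abelian_groupI)
 fix f assume f: "f \<in> carrier (ell2 Y)"
 show "\<exists>g\<in>carrier (ell2 Y). g \<oplus>\<^bsub>ell2 Y\<^esub> f = \<zero>\<^bsub>ell2 Y\<^esub>"
  by (rule bexI[OF _ ell2_scale[OF f, of "-1"]]) (auto simp: ell2_simps)
 show "\<zero>\<^bsub>ell2 Y\<^esub> \<oplus>\<^bsub>ell2 Y\<^esub> f = f"
  using ell2_extensional[OF f] by (auto simp: ell2_simps(2,3) extensional_def fun_eq_iff)
next
 show "\<zero>\<^bsub>ell2 Y\<^esub> \<in> carrier (ell2 Y)" unfolding ell2_simps(2) by (rule ell2_restrictI) simp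
qed (auto simp: ell2_simps(2,3,4) ell2_add fun_eq_iff algebra_simps)

lemma ell2_inner_self: assumes "f \<in> carrier (ell2 Y)" shows "cinner (ell2 Y) f f = of_real (\<Sum>\<^sub>\<infinity>y\<in>Y. cm2 (f y))"
proof -
 have "cinner (ell2 Y) f f = (\<Sum>\<^sub>\<infinity>y\<in>Y. of_real (cm2 (f y)))"
  by (simp only: ell2_simps complex_norm_square)
 also have "... = of_real (\<Sum>\<^sub>\<infinity>y\<in>Y. cm2 (f y))"
  by (rule infsumI[OF has_sum_of_real[OF has_sum_infsum[OF ell2_summable[OF assms]]]])
 finally show ?thesis .
qed

lemma ell2_inner_space: "inner_space (ell2 Y)"
proof -
 have ext: "f y = undefined" if "f \<in> carrier (ell2 Y)" "y \<notin> Y" for f y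
  using ell2_extensional[OF that(1)] that(2) by (simp add: extensional_def)
 have "Module.module complex_ring (ell2 Y)"
  by (rule moduleI[OF cring_complex_ring ell2_abelian_group])
   (auto simp: ell2_simps(2,3,4) ell2_scale ell2_add fun_eq_iff algebra_simps ext)
 thus ?thesis
 proof (rule inner_space.intro, unfold_locales)
  fix f g h assume m: "f \<in> carrier (ell2 Y)" "g \<in> carrier (ell2 Y)" "h \<in> carrier (ell2 Y)"
  have "(\<Sum>\<^sub>\<infinity>y\<in>Y. (\<lambda>y\<in>Y. f y + g y) y * cnj (h y)) = (\<Sum>\<^sub>\<infinity>y\<in>Y. f y * cnj (h y) + g y * cnj (h y))"
   by (rule infsum_cong) (simp add: algebra_simps)
  thus "cinner (ell2 Y) (f \<oplus>\<^bsub>ell2 Y\<^esub> g) h = cinner (ell2 Y) f h + cinner (ell2 Y) g h"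
   unfolding ell2_simps using infsum_add[OF ell2_mult_summable[OF m(1,3)] ell2_mult_summable[OF m(2,3)]] by simp
 next
  fix f g c assume m: "f \<in> carrier (ell2 Y)" "g \<in> carrier (ell2 Y)"
  have "(\<Sum>\<^sub>\<infinity>y\<in>Y. (\<lambda>y\<in>Y. c * f y) y * cnj (g y)) = (\<Sum>\<^sub>\<infinity>y\<in>Y. c * (f y * cnj (g y)))"
   by (rule infsum_cong) (simp add: algebra_simps)
  thus "cinner (ell2 Y) (c \<odot>\<^bsub>ell2 Y\<^esub> f) g = c * cinner (ell2 Y) f g"
   unfolding ell2_simps infsum_cmult_right' .
 next
  fix f g assume m: "f \<in> carrier (ell2 Y)" "g \<in> carrier (ell2 Y)"
  show "cinner (ell2 Y) g f = cnj (cinner (ell2 Y) f g)"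
   unfolding ell2_simps infsum_cnj[symmetric] by (simp add: mult.commute)
 next
  fix f assume f: "f \<in> carrier (ell2 Y)" "f ~= \<zero>\<^bsub>ell2 Y\<^esub>"
  obtain y where y: "y \<in> Y" "f y ~= 0"
   proof -
   obtain y where y: "f y ~= (\<lambda>y\<in>Y. 0) y" using f(2) unfolding ell2_simps(2) by blast
   thus ?thesis using that ext[OF f(1), of y] by (cases "y \<in> Y") auto
  qed
  have "0 < (\<Sum>z\<in>{y}. cm2 (f z))" using y by simp
  also have "... <= (\<Sum>\<^sub>\<infinity>y\<in>Y. cm2 (f y))"
   by (rule finite_sum_le_infsum[OF ell2_summable[OF f(1)]]) (use y in auto)
  finally show "0 < Re (cinner (ell2 Y) f f)" by (simp add: ell2_inner_self[OF f(1)])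
 qed
qed

lemma ell2_norm_square: assumes "f \<in> carrier (ell2 Y)" shows "(hnorm (ell2 Y) f)^2 = (\<Sum>\<^sub>\<infinity>y\<in>Y. cm2 (f y))"
proof -
 interpret H: inner_space "ell2 Y" by (rule ell2_inner_space)
 show ?thesis using H.nm_square[OF assms] ell2_inner_self[OF assms] by simp
qed

lemma ell2_unit_mem: "ell2_unit Y y \<in> carrier (ell2 Y)"
 unfolding ell2_unit_def
proof (rule ell2_memI(1)[where B = 1])
 fix E assume "finite E" "E \<subseteq> Y"
 hence "(\<Sum>z\<in>E. cm2 ((\<lambda>z\<in>Y. if z = y then 1 else 0) z)) = (\<Sum>z\<in>E. if z = y then 1 else 0)"
  by (intro sum.cong refl) auto
 also have "... <= (1::real)" using \<open>finite E\<close> by simp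
 finally show "(\<Sum>z\<in>E. cm2 ((\<lambda>z\<in>Y. if z = y then 1 else 0) z)) <= 1" .
qed simp

lemma ell2_inner_unit:
 assumes "y \<in> Y" shows "cinner (ell2 Y) f (ell2_unit Y y) = f y"
proof -
 have "((%z. f z * cnj (ell2_unit Y y z)) has_sum f y) Y"
  by (rule has_sum_finite_neutralI[of "{y}"]) (use assms in \<open>auto simp: ell2_unit_def\<close>)
 thus ?thesis unfolding ell2_simps by (rule infsumI)
qed

lemma matrix_entry_form_bound:
 assumes B: "bounded_op (ell2 Y) B"
 obtains K where "0 <= K" "\<And>F u. [|finite F; F \<subseteq> Y|] ==>
   Re (\<Sum>p\<in>F. \<Sum>q\<in>F. matrix_entry Y B p q * of_real (u p * u q)) <= K * (\<Sum>p\<in>F. (u p)\<^sup>2)"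
proof -
 interpret H: inner_space "ell2 Y" by (rule ell2_inner_space)
 obtain K where K: "0 <= K" "\<And>x. x \<in> carrier (ell2 Y) ==> H.nm (B x) <= K * H.nm x"
  using H.bounded_op_bound[OF B] by blast
 show ?thesis
 proof (rule that[OF K(1)])
  fix F and u :: "'a => real" assume F: "finite F" "F \<subseteq> Y"
  have um: "ell2_unit Y p \<in> carrier (ell2 Y)" for p by (rule ell2_unit_mem)
  let ?e = "%p. of_real (u p) \<odot>\<^bsub>ell2 Y\<^esub> ell2_unit Y p"
  let ?s = "\<Oplus>\<^bsub>ell2 Y\<^esub>p\<in>F. ?e p"
  have e: "?e \<in> F \<rightarrow> carrier (ell2 Y)" by (intro Pi_I H.scale_closed ell2_unit_mem)
  have s: "?s \<in> carrier (ell2 Y)" by (rule H.M.finsum_closed[OF e])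
  have Be: "(%p. B (?e p)) \<in> F \<rightarrow> carrier (ell2 Y)" using e H.bounded_opD(1)[OF B] by auto
  have "H.ip (B ?s) ?s = (\<Sum>q\<in>F. H.ip (B (?e q)) ?s)"
   unfolding H.bounded_op_finsum[OF B F(1) e] by (rule H.ip_finsum_left[OF F(1) Be s])
  also have "... = (\<Sum>q\<in>F. \<Sum>p\<in>F. H.ip (B (?e q)) (?e p))"
   using Be by (intro sum.cong refl H.ip_finsum_right[OF F(1) e]) auto
  also have "... = (\<Sum>q\<in>F. \<Sum>p\<in>F. matrix_entry Y B p q * of_real (u p * u q))"
   using H.bounded_opD(1,3)[OF B] um
   by (simp add: matrix_entry_def H.cinner_smult_left H.ip_smult_right mult_ac)
  also have "... = (\<Sum>p\<in>F. \<Sum>q\<in>F. matrix_entry Y B p q * of_real (u p * u q))" by (rule sum.swap)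
  finally have form: "H.ip (B ?s) ?s = (\<Sum>p\<in>F. \<Sum>q\<in>F. matrix_entry Y B p q * of_real (u p * u q))" .
  have "H.ip ?s ?s = (\<Sum>q\<in>F. H.ip (?e q) ?s)" by (rule H.ip_finsum_left[OF F(1) e s])
  also have "... = (\<Sum>q\<in>F. \<Sum>p\<in>F. H.ip (?e q) (?e p))"
   using e by (intro sum.cong refl H.ip_finsum_right[OF F(1) e]) auto
  also have "... = (\<Sum>q\<in>F. \<Sum>p\<in>F. if p = q then of_real ((u q)^2) else 0)"
  proof (intro sum.cong refl)
   fix q p assume "q \<in> F" "p \<in> F"
   hence "p \<in> Y" "q \<in> Y" using F by auto
   thus "H.ip (?e q) (?e p) = (if p = q then of_real ((u q)^2) else 0)"
    using ell2_unit_mem[of Y p] ell2_unit_mem[of Y q] ell2_inner_unit[of p Y "ell2_unit Y q"]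
    by (simp add: H.cinner_smult_left H.ip_smult_right ell2_unit_def power2_eq_square)
  qed
  also have "... = of_real (\<Sum>q\<in>F. (u q)\<^sup>2)" using F(1) by simp
  finally have ns: "(H.nm ?s)^2 = (\<Sum>q\<in>F. (u q)\<^sup>2)" using H.nm_square[OF s] by simp
  have "Re (H.ip (B ?s) ?s) <= H.nm (B ?s) * H.nm ?s"
   using H.Cauchy_Schwarz[OF H.bounded_opD(1)[OF B s] s] complex_Re_le_cmod[of "H.ip (B ?s) ?s"] by linarith
  also have "... <= K * H.nm ?s * H.nm ?s" by (intro mult_right_mono K(2) s H.nm_nonneg)
  also have "... = K * (\<Sum>q\<in>F. (u q)\<^sup>2)" unfolding ns[symmetric] by (simp add: power2_eq_square)
  finally show "Re (\<Sum>p\<in>F. \<Sum>q\<in>F. matrix_entry Y B p q * of_real (u p * u q)) <= K * (\<Sum>p\<in>F. (u p)\<^sup>2)"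
   unfolding form .
 qed
qed

section \<open>Schur multipliers satisfy a Schur bound\<close>

lemma normalized_form_entry:
 assumes F: "finite F" and Z: "\<And>p q. [|p \<in> F; q \<in> F|] ==> Z q p = cnj (Z p q)"
  and d: "\<And>p. p \<in> F ==> 0 < d p"
  and bound: "\<And>u. form_le Z F d u"
  and p: "p \<in> F" and q: "q \<in> F"
 shows "cmod (Z p q) <= d p + d q"
proof -
 let ?f = "%r. if r = q then 1 else 0 :: complex"
 let ?g = "%p. \<Sum>r\<in>F. Z p r / of_real (sqrt (d p) * sqrt (d r)) * ?f r"
 have g: "?g p = Z p q / of_real (sqrt (d p) * sqrt (d q))"
  using F q by (simp add: if_distrib cong: if_cong)
 have "cm2 (?g p) <= (\<Sum>p\<in>F. cm2 (?g p))" by (rule member_le_sum[OF p _ F]) simp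
 also have "... <= (\<Sum>r\<in>F. cm2 (?f r))"
  by (rule normalized_form_contraction[OF F Z d bound])
 also have "... = (\<Sum>r\<in>F. if r = q then 1 else 0)" by (intro sum.cong) auto
 also have "... = 1" using F q by simp
 finally have "cmod (?g p) <= 1" by (simp add: power_le_one_iff abs_square_le_1)
 hence "cmod (Z p q) <= sqrt (d p) * sqrt (d q)"
  unfolding g using d[OF p] d[OF q] by (simp add: norm_divide norm_mult divide_simps)
 also have "... <= d p + d q"
 proof -
  have "0 <= (sqrt (d p) - sqrt (d q))^2" by simp
  also have "(sqrt (d p) - sqrt (d q))^2 = d p + d q - 2 * (sqrt (d p) * sqrt (d q))"
   using d[OF p] d[OF q] by (simp add: power2_diff)
  finally show ?thesis using mult_nonneg_nonneg[of "sqrt (d p)" "sqrt (d q)"] d[OF p] d[OF q] by simp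
 qed
 finally show ?thesis .
qed

text \<open>A violation of the Schur bound \<open>S\<close>.\<close>

definition bad_test :: "'x set => ('x => 'x => complex) => real => 'x set => ('x => 'x => complex) => ('x => real) => bool"
 where "bad_test X \<psi> S F Z d \<longleftrightarrow> finite F & F \<subseteq> X & (\<forall>p\<in>F. \<forall>q\<in>F. Z q p = cnj (Z p q)) & (\<forall>p\<in>F. 0 < d p) &
  (\<forall>u. form_le Z F d u) & S * (\<Sum>p\<in>F. d p) < Re (\<Sum>p\<in>F. \<Sum>q\<in>F. Z p q * \<psi> p q)"

lemma bad_testD:
 assumes "bad_test X \<psi> S F Z d"
 shows "finite F" "F \<subseteq> X" "[|p \<in> F; q \<in> F|] ==> Z q p = cnj (Z p q)" "p \<in> F ==> 0 < d p"
  "form_le Z F d u"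
  "S * (\<Sum>p\<in>F. d p) < Re (\<Sum>p\<in>F. \<Sum>q\<in>F. Z p q * \<psi> p q)"
proof -
 note D1 = assms[unfolded bad_test_def]
 note D2 = D1[THEN conjunct2] note D3 = D2[THEN conjunct2] note D4 = D3[THEN conjunct2] note D5 = D4[THEN conjunct2]
 show "finite F" by (rule D1[THEN conjunct1])
 show "F \<subseteq> X" by (rule D2[THEN conjunct1])
 show "Z q p = cnj (Z p q)" if "p \<in> F" "q \<in> F"
  by (rule D3[THEN conjunct1, THEN bspec, OF that(1), THEN bspec, OF that(2)])
 show "0 < d p" if "p \<in> F" by (rule D4[THEN conjunct1, THEN bspec, OF that])
 show "form_le Z F d u" by (rule D5[THEN conjunct1, THEN spec])
 show "S * (\<Sum>p\<in>F. d p) < Re (\<Sum>p\<in>F. \<Sum>q\<in>F. Z p q * \<psi> p q)" by (rule D5[THEN conjunct2])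
qed

lemma bad_test_exists:
 assumes "\<not> schur_bound X \<psi> S"
 shows "\<exists>F Z d. bad_test X \<psi> S F Z d"
proof (rule ccontr)
 assume no: "\<not> ?thesis"
 have "schur_bound X \<psi> S"
 proof (rule schur_bound_if_positive_weights, rule ccontr)
  fix F Z and d :: "'a => real"
  assume h: "finite F" "F \<subseteq> X" "\<And>p q. [|p \<in> F; q \<in> F|] ==> Z q p = cnj (Z p q)" "\<And>p. p \<in> F ==> 0 < d p"
   "\<And>u. form_le Z F d u"
   "\<not> Re (\<Sum>p\<in>F. \<Sum>q\<in>F. Z p q * \<psi> p q) <= S * (\<Sum>p\<in>F. d p)"
  have "bad_test X \<psi> S F Z d"
   unfolding bad_test_def
  proof (intro conjI ballI allI)
   show "Z q p = cnj (Z p q)" if "p \<in> F" "q \<in> F" for p q by (rule h(3)[OF that])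
   show "S * (\<Sum>p\<in>F. d p) < Re (\<Sum>p\<in>F. \<Sum>q\<in>F. Z p q * \<psi> p q)" using h(6) by (simp only: not_le)
  qed (rule h(1), rule h(2), erule h(4), rule h(5))
  thus False using no by blast
 qed
 thus False using assms by contradiction
qed

text \<open>Contractive blocks on disjoint finite sets assemble to a contraction.\<close>

lemma block_diagonal_operator:
 fixes F :: "nat => 'y set" and a :: "nat => 'y => 'y => complex"
 assumes F: "\<And>k. finite (F k)" "\<And>k. F k \<subseteq> Y" and disj: "\<And>j k. j ~= k ==> F j \<inter> F k = {}"
  and a: "\<And>k f. (\<Sum>p\<in>F k. cm2 (\<Sum>q\<in>F k. a k p q * f q)) <= (\<Sum>q\<in>F k. cm2 (f q))"
 shows "\<exists>A. bounded_op (ell2 Y) A & (\<forall>k. \<forall>p\<in>F k. \<forall>q\<in>F k. matrix_entry Y A p q = a k p q)"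
proof -
 interpret H: inner_space "ell2 Y" by (rule ell2_inner_space)
 define idx where "idx x = (THE k. x \<in> F k)" for x
 have idx: "idx x = k" if "x \<in> F k" for x k
  unfolding idx_def by (rule the_equality) (use disj that in blast)+
 define T where "T f x = (if x \<in> F (idx x) then \<Sum>q\<in>F (idx x). a (idx x) x q * f q else 0)" for f x
 have T: "T f x = (\<Sum>q\<in>F k. a k x q * f q)" if "x \<in> F k" for f x k
  using that idx[OF that] by (simp add: T_def)
 define A where "A = (\<lambda>f\<in>carrier (ell2 Y). \<lambda>x\<in>Y. T f x)"
 have partial: "(\<Sum>x\<in>E. cm2 ((\<lambda>x\<in>Y. T f x) x)) <= (\<Sum>\<^sub>\<infinity>y\<in>Y. cm2 (f y))"
  if f: "f \<in> carrier (ell2 Y)" and E: "finite E" "E \<subseteq> Y" for f E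
 proof -
  \<comment> \<open>Any bound for the finitely many block numbers occurring in \<open>E\<close>.\<close>
  define m where "m = Suc (\<Sum>x\<in>E. idx x)"
  have m: "idx x < m" if "x \<in> E" for x
   using member_le_sum[OF that, of idx] E(1) by (simp add: m_def)
  let ?U = "\<Union>k\<in>{..<m}. F k"
  have U: "finite ?U" "?U \<subseteq> Y" using F by auto
  have split: "(\<Sum>x\<in>?U. h x) = (\<Sum>k<m. \<Sum>x\<in>F k. h x)" for h :: "'y => real"
   by (rule sum.UNION_disjoint) (use F(1) disj in auto)
  have "(\<Sum>x\<in>E. cm2 ((\<lambda>x\<in>Y. T f x) x)) = (\<Sum>x\<in>E. cm2 (T f x))"
   using E(2) by (intro sum.cong refl) auto
  also have "... = (\<Sum>x\<in>E \<inter> ?U. cm2 (T f x))"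
  proof (rule sum.mono_neutral_right[OF E(1)])
   show "\<forall>x\<in>E - E \<inter> ?U. cm2 (T f x) = 0"
   proof
    fix x assume "x \<in> E - E \<inter> ?U"
    hence "x \<notin> F (idx x)" using m[of x] by blast
    thus "cm2 (T f x) = 0" by (simp add: T_def)
   qed
  qed simp
  also have "... <= (\<Sum>x\<in>?U. cm2 (T f x))" using U(1) by (intro sum_mono2) auto
  also have "... = (\<Sum>k<m. \<Sum>x\<in>F k. cm2 (T f x))" by (rule split)
  also have "... = (\<Sum>k<m. \<Sum>x\<in>F k. cm2 (\<Sum>q\<in>F k. a k x q * f q))" using T by (intro sum.cong refl) simp
  also have "... <= (\<Sum>k<m. \<Sum>x\<in>F k. cm2 (f x))" by (intro sum_mono a)
  also have "... = (\<Sum>x\<in>?U. cm2 (f x))" by (rule split[symmetric])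
  also have "... <= (\<Sum>\<^sub>\<infinity>y\<in>Y. cm2 (f y))"
   by (rule finite_sum_le_infsum[OF ell2_summable[OF f] U]) simp
  finally show ?thesis .
 qed
 have Tm: "(\<lambda>x\<in>Y. T f x) \<in> carrier (ell2 Y)" "(\<Sum>\<^sub>\<infinity>y\<in>Y. cm2 ((\<lambda>x\<in>Y. T f x) y)) <= (\<Sum>\<^sub>\<infinity>y\<in>Y. cm2 (f y))"
  if f: "f \<in> carrier (ell2 Y)" for f
  by (rule ell2_memI[OF restrict_extensional], rule partial[OF f], assumption+)+
 have AE: "A f = (\<lambda>x\<in>Y. T f x)" if "f \<in> carrier (ell2 Y)" for f using that by (simp add: A_def)
 have bA: "bounded_op (ell2 Y) A"
 proof (rule H.bounded_opI[where K = 1])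
  show "A \<in> extensional (carrier (ell2 Y))" by (simp add: A_def)
  fix f assume f: "f \<in> carrier (ell2 Y)"
  show "A f \<in> carrier (ell2 Y)" unfolding AE[OF f] by (rule Tm(1)[OF f])
  show "H.nm (A f) <= 1 * H.nm f"
   unfolding AE[OF f] mult_1
   by (rule power2_le_imp_le[OF _ H.nm_nonneg[OF f]]) (simp only: ell2_norm_square[OF f] ell2_norm_square[OF Tm(1)[OF f]] Tm(2)[OF f])
  have J: "q \<in> Y" if "q \<in> F k" for q k using F that by blast
  show "A (c \<odot>\<^bsub>ell2 Y\<^esub> f) = c \<odot>\<^bsub>ell2 Y\<^esub> A f" for c
   unfolding AE[OF f] AE[OF H.scale_closed[OF f]] unfolding ell2_simps(4)
   by (intro restrict_ext) (auto simp: T_def sum_distrib_left J mult.left_commute intro!: sum.cong)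
  fix g assume g: "g \<in> carrier (ell2 Y)"
  show "A (f \<oplus>\<^bsub>ell2 Y\<^esub> g) = A f \<oplus>\<^bsub>ell2 Y\<^esub> A g"
   unfolding AE[OF f] AE[OF g] AE[OF H.M.a_closed[OF f g]] unfolding ell2_simps(3)
   by (intro restrict_ext) (auto simp: T_def sum.distrib[symmetric] J distrib_left intro!: sum.cong)
 qed
 have "matrix_entry Y A p q = a k p q" if pq: "p \<in> F k" "q \<in> F k" for p q k
 proof -
  have p: "p \<in> Y" using F pq by blast
  have "matrix_entry Y A p q = T (ell2_unit Y q) p"
   unfolding matrix_entry_def AE[OF ell2_unit_mem] ell2_inner_unit[OF p] using p by simp
  also have "... = (\<Sum>r\<in>F k. if r = q then a k p q else 0)"
   unfolding T[OF pq(1)] using F(2)[of k] by (intro sum.cong refl) (auto simp: ell2_unit_def)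
  also have "... = a k p q" using F(1) pq by simp
  finally show ?thesis .
 qed
 thus ?thesis using bA by blast
qed

lemma (in Group.group) bad_test_translate:
 assumes bad: "bad_test (carrier G) \<psi> S F Z d" and g: "g \<in> carrier G"
  and inv: "\<And>x y. [|x \<in> carrier G; y \<in> carrier G|] ==> \<psi> (g \<otimes> x) (g \<otimes> y) = \<psi> x y"
 shows "bad_test (carrier G) \<psi> S ((%x. g \<otimes> x) ` F) (%p q. Z (inv g \<otimes> p) (inv g \<otimes> q)) (%p. d (inv g \<otimes> p))"
proof -
 note D = bad_testD[OF bad]
 have FG: "p \<in> F ==> p \<in> carrier G" for p using D(2) by blast
 have c: "inv g \<otimes> (g \<otimes> p) = p" if "p \<in> F" for p using g FG[OF that] by (simp add: m_assoc[symmetric])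
 have inj: "inj_on (%x. g \<otimes> x) F" using g FG by (auto intro!: inj_onI)
 have re: "(\<Sum>p\<in>(%x. g \<otimes> x) ` F. h p) = (\<Sum>p\<in>F. h (g \<otimes> p))" for h :: "'a => 'c::comm_monoid_add"
  using sum.reindex[OF inj, of h] by simp
 show ?thesis
  unfolding bad_test_def
 proof (intro conjI ballI allI)
  show "finite ((%x. g \<otimes> x) ` F)" using D(1) by simp
  show "(%x. g \<otimes> x) ` F \<subseteq> carrier G" using FG g by auto
  show "Z (inv g \<otimes> q) (inv g \<otimes> p) = cnj (Z (inv g \<otimes> p) (inv g \<otimes> q))"
   if pq: "p \<in> (%x. g \<otimes> x) ` F" "q \<in> (%x. g \<otimes> x) ` F" for p q
  proof -
   obtain p' q' where h: "p' \<in> F" "q' \<in> F" "p = g \<otimes> p'" "q = g \<otimes> q'" using pq by blast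
   show ?thesis unfolding h(3,4) c[OF h(1)] c[OF h(2)] by (rule D(3)[OF h(1,2)])
  qed
  show "0 < d (inv g \<otimes> p)" if "p \<in> (%x. g \<otimes> x) ` F" for p using that c D(4) by auto
  have s1: "sesq (%p q. Z (inv g \<otimes> p) (inv g \<otimes> q)) ((%x. g \<otimes> x) ` F) u u = sesq Z F (%p. u (g \<otimes> p)) (%p. u (g \<otimes> p))" for u
   unfolding sesq_def re by (intro sum.cong refl) (simp add: c)
  have s2: "(\<Sum>p\<in>(%x. g \<otimes> x) ` F. d (inv g \<otimes> p) * h p) = (\<Sum>p\<in>F. d p * h (g \<otimes> p))" for h
   unfolding re by (intro sum.cong refl) (simp add: c)
  show "\<bar>Re (sesq (%p q. Z (inv g \<otimes> p) (inv g \<otimes> q)) ((%x. g \<otimes> x) ` F) u u)\<bar>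
    <= (\<Sum>p\<in>(%x. g \<otimes> x) ` F. d (inv g \<otimes> p) * cm2 (u p))" for u
   unfolding s1 s2 by (rule D(5))
  have "(\<Sum>p\<in>(%x. g \<otimes> x) ` F. \<Sum>q\<in>(%x. g \<otimes> x) ` F. Z (inv g \<otimes> p) (inv g \<otimes> q) * \<psi> p q) = (\<Sum>p\<in>F. \<Sum>q\<in>F. Z p q * \<psi> p q)"
   unfolding re by (intro sum.cong refl) (simp add: c inv FG)
  moreover have "(\<Sum>p\<in>(%x. g \<otimes> x) ` F. d (inv g \<otimes> p)) = (\<Sum>p\<in>F. d p)"
   unfolding re by (intro sum.cong refl) (simp add: c)
  ultimately show "S * (\<Sum>p\<in>(%x. g \<otimes> x) ` F. d (inv g \<otimes> p))
    < Re (\<Sum>p\<in>(%x. g \<otimes> x) ` F. \<Sum>q\<in>(%x. g \<otimes> x) ` F. Z (inv g \<otimes> p) (inv g \<otimes> q) * \<psi> p q)"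
   using D(6) by simp
 qed
qed

text \<open>Were there no Schur bound, violations for the bounds \<open>0, 1, 2, \<dots>\<close> could be moved by translation to disjoint finite sets of an infinite group. They form the blocks of one contraction, and its Schur product with \<open>\<psi>\<close> would not be bounded. Building one operator from all violations plays the part of the closed graph theorem.\<close>

theorem (in Group.group) schur_multiplier_bounded:
 assumes \<psi>: "schur_multiplier (carrier G) \<psi>"
  and inv: "\<And>g x y. [|g \<in> carrier G; x \<in> carrier G; y \<in> carrier G|] ==> \<psi> (g \<otimes> x) (g \<otimes> y) = \<psi> x y"
 shows "\<exists>S\<ge>0. schur_bound (carrier G) \<psi> S"
proof (rule ccontr)
 assume no: "\<not> ?thesis"
 have ex: "\<exists>F Z d. bad_test (carrier G) \<psi> S F Z d" if "0 <= S" for S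
  using bad_test_exists no that by blast
 show False
 proof (cases "finite (carrier G)")
  case True
  define m where "m = (\<Sum>x\<in>carrier G. \<Sum>y\<in>carrier G. cmod (\<psi> x y))"
  define N where "N = real (card (carrier G))"
  have m0: "0 <= m" unfolding m_def by (intro sum_nonneg) auto
  have m: "cmod (\<psi> x y) <= m" if "x \<in> carrier G" "y \<in> carrier G" for x y
  proof -
   have "cmod (\<psi> x y) <= (\<Sum>y\<in>carrier G. cmod (\<psi> x y))" by (rule member_le_sum[OF that(2) _ True]) simp
   also have "... <= m" unfolding m_def by (rule member_le_sum[OF that(1) _ True]) (simp add: sum_nonneg)
   finally show ?thesis .
  qed
  obtain F Z d where bad: "bad_test (carrier G) \<psi> (2 * N * m) F Z d" using ex[of "2 * N * m"] m0 by (auto simp: N_def)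
  note D = bad_testD[OF bad]
  have dn: "0 <= (\<Sum>p\<in>F. d p)" using D(4) by (intro sum_nonneg less_imp_le)
  have "Re (\<Sum>p\<in>F. \<Sum>q\<in>F. Z p q * \<psi> p q) <= cmod (\<Sum>p\<in>F. \<Sum>q\<in>F. Z p q * \<psi> p q)" by (rule complex_Re_le_cmod)
  also have "... <= (\<Sum>p\<in>F. \<Sum>q\<in>F. cmod (Z p q * \<psi> p q))" by (rule norm_double_sum_le)
  also have "... <= (\<Sum>p\<in>F. \<Sum>q\<in>F. (d p + d q) * m)"
  proof (intro sum_mono)
   fix p q assume pq: "p \<in> F" "q \<in> F"
   have "cmod (Z p q) <= d p + d q" by (rule normalized_form_entry[OF D(1,3,4,5) pq])
   moreover have "cmod (\<psi> p q) <= m" using D(2) pq by (intro m) auto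
   ultimately show "cmod (Z p q * \<psi> p q) <= (d p + d q) * m"
    unfolding norm_mult by (intro mult_mono') auto
  qed
  also have "... = 2 * real (card F) * m * (\<Sum>p\<in>F. d p)"
   by (simp add: sum_distrib_right[symmetric] sum.distrib sum_distrib_left[symmetric] algebra_simps)
  also have "... <= 2 * N * m * (\<Sum>p\<in>F. d p)"
   using card_mono[OF True D(2)] m0 dn by (intro mult_right_mono) (auto simp: N_def)
  finally show False using D(6) by simp
 next
  case False
  have away: "\<exists>F Z d. bad_test (carrier G) \<psi> (real k) F Z d & F \<inter> E = {}" if E: "finite E" for k E
  proof -
   obtain F Z d where bad: "bad_test (carrier G) \<psi> (real k) F Z d" using ex[of "real k"] by auto
   have "finite ((%(e, f). e \<otimes> inv f) ` (E \<times> F))" using E bad_testD(1)[OF bad] by simp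
   hence "\<exists>g. g \<in> carrier G - (%(e, f). e \<otimes> inv f) ` (E \<times> F)"
    using False by (metis Diff_eq_empty_iff all_not_in_conv finite_subset)
   then obtain g where g: "g \<in> carrier G" and ng: "g \<notin> (%(e, f). e \<otimes> inv f) ` (E \<times> F)" by blast
   have "(%x. g \<otimes> x) ` F \<inter> E = {}"
   proof (rule ccontr)
    assume "\<not> ?thesis"
    then obtain f where f: "f \<in> F" "g \<otimes> f \<in> E" by blast
    hence "f \<in> carrier G" using bad_testD(2)[OF bad] by blast
    hence "(g \<otimes> f) \<otimes> inv f = g" using g by (simp add: m_assoc)
    thus False using ng f by force
   qed
   thus ?thesis using bad_test_translate[OF bad g inv[OF g]] by blast
  qed
  define good where "good k E t \<longleftrightarrow> bad_test (carrier G) \<psi> (real k) (fst t) (fst (snd t)) (snd (snd t)) & fst t \<inter> E = {}"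
   for k E and t :: "'a set \<times> ('a => 'a => complex) \<times> ('a => real)"
  define pick where "pick k E = (SOME t. good k E t)" for k E
  have pick: "good k E (pick k E)" if "finite E" for k E
  proof -
   have "\<exists>t. good k E t" using away[OF that, of k] by (auto simp: good_def)
   thus ?thesis unfolding pick_def by (rule someI_ex)
  qed
  \<comment> \<open>The union of the finite sets chosen so far, which the next one has to avoid.\<close>
  define used where "used = rec_nat {} (%k E. E \<union> fst (pick k E))"
  have used: "used 0 = {}" "used (Suc k) = used k \<union> fst (pick k (used k))" for k by (simp_all add: used_def)
  have fin: "finite (used k)" for k
  proof (induction k)
   case (Suc k)
   thus ?case using pick[OF Suc, of k] bad_testD(1) by (auto simp: used good_def)
  qed (simp add: used)
  define F where "F k = fst (pick k (used k))" for k
  define Z where "Z k = fst (snd (pick k (used k)))" for k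
  define d where "d k = snd (snd (pick k (used k)))" for k
  have bad: "bad_test (carrier G) \<psi> (real k) (F k) (Z k) (d k)" and new: "F k \<inter> used k = {}" for k
   using pick[OF fin[of k], of k] by (auto simp: good_def F_def Z_def d_def)
  note D = bad_testD[OF bad]
  have mono: "used j \<subseteq> used k" if "j <= k" for j k
   using that by (induction rule: dec_induct) (auto simp: used)
  have less: "F j \<inter> F k = {}" if "j < k" for j k
  proof -
   have "F j \<subseteq> used (Suc j)" by (simp add: used F_def)
   also have "... \<subseteq> used k" using that by (intro mono) simp
   finally show ?thesis using new[of k] by blast
  qed
  have disj: "F j \<inter> F k = {}" if "j ~= k" for j k
   using less[of j k] less[of k j] that by (metis inf_commute nat_neq_iff)
  define a where "a k p q = Z k p q / of_real (sqrt (d k p) * sqrt (d k q))" for k p q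
  obtain A where A: "bounded_op (ell2 (carrier G)) A" "\<forall>k. \<forall>p\<in>F k. \<forall>q\<in>F k. matrix_entry (carrier G) A p q = a k p q"
  proof -
   have "\<exists>A. bounded_op (ell2 (carrier G)) A & (\<forall>k. \<forall>p\<in>F k. \<forall>q\<in>F k. matrix_entry (carrier G) A p q = a k p q)"
   proof (rule block_diagonal_operator)
    show "finite (F k)" "F k \<subseteq> carrier G" for k by (rule D(1), rule D(2))
    show "F j \<inter> F k = {}" if "j ~= k" for j k by (rule disj[OF that])
    show "(\<Sum>p\<in>F k. cm2 (\<Sum>q\<in>F k. a k p q * f q)) <= (\<Sum>q\<in>F k. cm2 (f q))" for k f
     unfolding a_def by (rule normalized_form_contraction[OF D(1) D(3) D(4) D(5)])
   qed
   thus ?thesis using that by blast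
  qed
  have "A \<in> carrier (BH (ell2 (carrier G)))" using A(1) by (simp add: BH_def)
  then obtain B where B: "B \<in> carrier (BH (ell2 (carrier G)))"
   "\<forall>x\<in>carrier G. \<forall>y\<in>carrier G. matrix_entry (carrier G) B x y = \<psi> x y * matrix_entry (carrier G) A x y"
   using \<psi> unfolding schur_multiplier_def by blast
  have "bounded_op (ell2 (carrier G)) B" using B(1) by (simp add: BH_def)
  then obtain K where K: "0 <= K" "\<And>F u. [|finite F; F \<subseteq> carrier G|] ==>
   Re (\<Sum>p\<in>F. \<Sum>q\<in>F. matrix_entry (carrier G) B p q * of_real (u p * u q)) <= K * (\<Sum>p\<in>F. (u p)\<^sup>2)"
   by (rule matrix_entry_form_bound) blast
  obtain k :: nat where k: "K <= real k" using real_arch_simple by blast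
  have "(\<Sum>p\<in>F k. \<Sum>q\<in>F k. matrix_entry (carrier G) B p q * of_real (sqrt (d k p) * sqrt (d k q)))
    = (\<Sum>p\<in>F k. \<Sum>q\<in>F k. Z k p q * \<psi> p q)"
  proof (intro sum.cong refl)
   fix p q assume pq: "p \<in> F k" "q \<in> F k"
   have "p \<in> carrier G" "q \<in> carrier G" using pq D(2)[of k] by blast+
   hence "matrix_entry (carrier G) B p q = \<psi> p q * matrix_entry (carrier G) A p q" using B(2) by blast
   also have "matrix_entry (carrier G) A p q = a k p q" using A(2) pq by blast
   finally have "matrix_entry (carrier G) B p q = \<psi> p q * a k p q" .
   moreover have "sqrt (d k p) * sqrt (d k q) ~= 0" using D(4)[OF pq(1)] D(4)[OF pq(2)] by simp
   ultimately show "matrix_entry (carrier G) B p q * of_real (sqrt (d k p) * sqrt (d k q)) = Z k p q * \<psi> p q"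
    by (simp add: a_def)
  qed
  hence "Re (\<Sum>p\<in>F k. \<Sum>q\<in>F k. Z k p q * \<psi> p q) <= K * (\<Sum>p\<in>F k. (sqrt (d k p))\<^sup>2)"
   using K(2)[OF D(1)[of k] D(2)[of k], of "%p. sqrt (d k p)"] by simp
  also have "... = K * (\<Sum>p\<in>F k. d k p)"
   by (intro arg_cong2[where f = times] sum.cong refl) (use D(4) in \<open>simp add: less_imp_le\<close>)
  also have "... <= real k * (\<Sum>p\<in>F k. d k p)"
   by (rule mult_right_mono[OF k], rule sum_nonneg, rule less_imp_le, rule D(4))
  finally show False using D(6)[of k] by simp
 qed
qed

context invariant_measure_group
begin

text \<open>The matrix \<open>(Z(x\<^sub>j, x\<^sub>i)/\<surd>(d\<^sub>i d\<^sub>j)) \<lambda>(x\<^sub>i\<inverse> x\<^sub>j)\<close> over the group von Neumann algebra is a contraction by the form bound, and its image under \<open>M\<^sub>\<phi>\<close>, evaluated at a suitable vector, is the quantity to be estimated.\<close>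

lemma schur_bound_if_cb:
 assumes M: "fourier_multiplier_op G \<mu> \<phi> M"
  and C: "\<And>n A. [|in_vN n A; \<M> n A <= 1|]
   ==> \<M> n (%i j. M (A i j)) <= C"
  and f0: "f0 \<in> CL \<mu>" "L.nm f0 = 1"
 shows "schur_bound (\<G>) (%x y. \<phi> (inv y \<otimes> x)) C"
proof (rule schur_bound_if_positive_weights)
 fix F Z and d :: "'a => real"
 assume F: "finite F" "F \<subseteq> \<G>" and Z: "\<And>p q. [|p \<in> F; q \<in> F|] ==> Z q p = cnj (Z p q)" and d: "\<And>p. p \<in> F ==> 0 < d p"
  and bound: "\<And>u. form_le Z F d u"
 define n where "n = card F"
 obtain x where bij: "bij_betw x {..<n} F"
  using ex_bij_betw_nat_finite[OF F(1)] by (auto simp: atLeast0LessThan n_def)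
 have xF: "x i \<in> F" if "i < n" for i using bij_betwE[OF bij] that by auto
 hence xG: "x i \<in> \<G>" if "i < n" for i using F(2) that by blast
 have re: "(\<Sum>p\<in>F. h p) = (\<Sum>i<n. h (x i))" for h :: "'a => 'v::comm_monoid_add"
  by (rule sum.reindex_bij_betw[OF bij, symmetric])
 define s where "s i = sqrt (d (x i))" for i
 have s: "0 < s i" "s i * s i = d (x i)" if "i < n" for i using d[OF xF[OF that]] by (auto simp: s_def)
 have Z': "Z (x j) (x i) = cnj (Z (x i) (x j))" if "i \<in> {..<n}" "j \<in> {..<n}" for i j
  by (rule Z) (use xF that in auto)
 have bound': "\<bar>Re (sesq (%i j. Z (x i) (x j)) {..<n} u u)\<bar> <= (\<Sum>i<n. d (x i) * cm2 (u i))" for u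
 proof -
  define u' where "u' p = u (the_inv_into {..<n} x p)" for p
  have u': "u' (x i) = u i" if "i < n" for i
   using that bij by (simp add: u'_def the_inv_into_f_f bij_betw_def)
  have "sesq Z F u' u' = sesq (%i j. Z (x i) (x j)) {..<n} u u"
   unfolding sesq_def re by (intro sum.cong refl) (simp add: u')
  moreover have "(\<Sum>p\<in>F. d p * cm2 (u' p)) = (\<Sum>i<n. d (x i) * cm2 (u i))"
   unfolding re by (intro sum.cong refl) (simp add: u')
  ultimately show ?thesis using bound[of u'] by simp
 qed
 define t where "t i j = inv (x i) \<otimes> x j" for i j
 have tG: "t i j \<in> \<G>" if "i < n" "j < n" for i j using xG that by (simp add: t_def)
 define \<alpha> where "\<alpha> i j = Z (x j) (x i) / of_real (s i * s j)" for i j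
 define A where "A i j = \<alpha> i j \<odot>\<^bsub>\<B>\<^esub> lam (t i j)" for i j
 have AV: "in_vN n A" using tG vN_scale lam_vN by (auto simp: A_def)
 have Ab: "\<forall>i<n. \<forall>j<n. bounded_op (L2 \<mu>) (A i j)" using AV vN_sub by (auto simp: L.BH_simps(1))
 interpret P: inner_space "hilbert_power (L2 \<mu>) n" by (rule L.power_inner_space)
 have norm: "\<M> n A <= 1"
  unfolding matrix_opnorm_def
 proof (rule P.opnorm_le)
  fix f assume f: "f \<in> carrier (hilbert_power (L2 \<mu>) n)"
  define h where "h = matrix_op (L2 \<mu>) n A f"
  have h: "h \<in> carrier (hilbert_power (L2 \<mu>) n)" unfolding h_def by (rule L.matrix_op_mem[OF Ab f])
  define u where "u j = of_real (1 / s j) \<odot>\<^bsub>L2 \<mu>\<^esub> lam (x j) (f j)" for j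
  define w where "w i = of_real (1 / s i) \<odot>\<^bsub>L2 \<mu>\<^esub> lam (x i) (h i)" for i
  have fc: "f j \<in> CL \<mu>" and hc: "h j \<in> CL \<mu>" if "j < n" for j
   using L.power_comp[OF f that] L.power_comp[OF h that] .
  have lf: "lam (x j) (f j) \<in> CL \<mu>" and lh: "lam (x j) (h j) \<in> CL \<mu>" if "j < n" for j
   using lam_mem xG fc hc that by auto
  have u: "u j \<in> CL \<mu>" "(L.nm (u j))^2 = (L.nm (f j))^2 / d (x j)"
   and w: "w j \<in> CL \<mu>" "(L.nm (w j))^2 = (L.nm (h j))^2 / d (x j)" if "j < n" for j
   using lf[OF that] lh[OF that] s(1)[OF that] that
   by (simp_all add: s(2)[OF that, symmetric] norm_divide u_def w_def L.nm_scale lam_norm[OF xG fc] lam_norm[OF xG hc] power_mult_distrib power_divide power2_eq_square)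
  have "P.ip h h = (\<Sum>i<n. \<Sum>j<n. L.ip (A i j (f j)) (h i))"
   unfolding h_def[of] by (rule L.matrix_op_inner[OF Ab f]) (rule L.matrix_op_mem[OF Ab f])
  also have "... = (\<Sum>i<n. \<Sum>j<n. Z (x j) (x i) * L.ip (u j) (w i))"
  proof (intro sum.cong refl)
   fix i j assume "i \<in> {..<n}" "j \<in> {..<n}"
   hence i: "i < n" and j: "j < n" by auto
   have lt: "lam (t i j) (f j) \<in> CL \<mu>" by (rule lam_mem[OF tG[OF i j] fc[OF j]])
   have "lam (x i) (lam (t i j) (f j)) = lam (x i \<otimes> t i j) (f j)"
    by (rule lam_mult[OF xG[OF i] tG[OF i j] fc[OF j], symmetric])
   also have "x i \<otimes> t i j = x j" using xG[OF i] xG[OF j] by (simp add: t_def m_assoc[symmetric])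
   finally have "L.ip (lam (t i j) (f j)) (h i) = L.ip (lam (x j) (f j)) (lam (x i) (h i))"
    using lam_inner[OF xG[OF i] lt hc[OF i]] by simp
   hence "L.ip (A i j (f j)) (h i) = \<alpha> i j * L.ip (lam (x j) (f j)) (lam (x i) (h i))"
    using lt fc[OF j] hc[OF i] by (simp add: A_def L.BH_simps(3) L.cinner_smult_left)
   also have "... = Z (x j) (x i) * L.ip (u j) (w i)"
    using lf[OF j] lh[OF i] by (simp add: u_def w_def \<alpha>_def L.cinner_smult_left L.ip_smult_right)
   finally show "L.ip (A i j (f j)) (h i) = Z (x j) (x i) * L.ip (u j) (w i)" .
  qed
  also have "... = (\<Sum>j<n. \<Sum>i<n. Z (x j) (x i) * L.ip (u j) (w i))" by (rule sum.swap)
  finally have form: "P.ip h h = (\<Sum>j<n. \<Sum>i<n. Z (x j) (x i) * L.ip (u j) (w i))" .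
  have "2 * (P.nm h)^2 <= 2 * cmod (P.ip h h)"
   using P.nm_square[OF h] complex_Re_le_cmod[of "P.ip h h"] by simp
  also have "... <= (\<Sum>j<n. d (x j) * ((L.nm (u j))^2 + (L.nm (w j))^2))"
   unfolding form
   by (rule L.form_bound[where Z = "%i j. Z (x i) (x j)" and d = "%i. d (x i)", OF _ Z' bound']) (use u w in auto)
  also have "... = (\<Sum>j<n. (L.nm (f j))\<^sup>2 + (L.nm (h j))^2)"
  proof (intro sum.cong refl)
   fix j assume "j \<in> {..<n}"
   hence j: "j < n" by simp
   show "d (x j) * ((L.nm (u j))^2 + (L.nm (w j))^2) = (L.nm (f j))^2 + (L.nm (h j))^2"
    unfolding u(2)[OF j] w(2)[OF j] using d[OF xF[OF j]] by (simp add: distrib_left)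
  qed
  also have "... = (P.nm f)^2 + (P.nm h)^2"
   by (simp add: L.power_norm_square[OF f] L.power_norm_square[OF h] sum.distrib)
  finally have "(P.nm h)^2 <= (P.nm f)^2" by simp
  thus "P.nm (matrix_op (L2 \<mu>) n A f) <= 1 * P.nm f"
   unfolding h_def[symmetric] mult_1 by (rule power2_le_imp_le[OF _ P.nm_nonneg[OF f]])
 qed simp
 have MV: "\<forall>i<n. \<forall>j<n. M (A i j) \<in> vN" using AV fourier_multiplier_opD(1)[OF M] by auto
 hence Mb: "\<forall>i<n. \<forall>j<n. bounded_op (L2 \<mu>) (M (A i j))" using vN_sub by (auto simp: L.BH_simps(1))
 \<comment> \<open>The translations cancel: all \<open>\<lambda>(x\<^sub>i\<inverse> x\<^sub>j)\<close> contribute the same vector \<open>\<lambda>(x\<^sub>i\<inverse>) f\<^sub>0\<close> in row \<open>i\<close>.\<close>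
 define f where "f = (\<lambda>j\<in>{..<n}. of_real (s j) \<odot>\<^bsub>L2 \<mu>\<^esub> lam (inv (x j)) f0)"
 have l0: "lam (inv (x j)) f0 \<in> CL \<mu>" "L.nm (lam (inv (x j)) f0) = 1" if "j < n" for j
  using lam_mem lam_norm xG[OF that] f0 by auto
 have f: "f \<in> carrier (hilbert_power (L2 \<mu>) n)" unfolding L.power_simps f_def using l0 by auto
 have nf: "(P.nm f)^2 = (\<Sum>i<n. d (x i))"
  unfolding L.power_norm_square[OF f]
 proof (intro sum.cong refl)
  fix i assume "i \<in> {..<n}"
  hence i: "i < n" by simp
  show "(L.nm (f i))^2 = d (x i)"
   using i l0[OF i] s[OF i] by (simp add: f_def L.nm_scale power2_eq_square)
 qed
 have "P.ip (matrix_op (L2 \<mu>) n (%i j. M (A i j)) f) f = (\<Sum>i<n. \<Sum>j<n. L.ip (M (A i j) (f j)) (f i))"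
  by (rule L.matrix_op_inner[OF Mb f f])
 also have "... = (\<Sum>i<n. \<Sum>j<n. Z (x j) (x i) * \<phi> (inv (x i) \<otimes> x j))"
 proof (intro sum.cong refl)
  fix i j assume "i \<in> {..<n}" "j \<in> {..<n}"
  hence i: "i < n" and j: "j < n" by auto
  have v: "f j \<in> CL \<mu>" "f i \<in> CL \<mu>" using L.power_comp[OF f] i j by auto
  have lt: "lam (t i j) (f j) \<in> CL \<mu>" by (rule lam_mem[OF tG[OF i j] v(1)])
  have "M (A i j) = \<alpha> i j \<odot>\<^bsub>\<B>\<^esub> (\<phi> (t i j) \<odot>\<^bsub>\<B>\<^esub> lam (t i j))"
   unfolding A_def fourier_multiplier_opD(3)[OF M lam_vN[OF tG[OF i j]]] fourier_multiplier_opD(4)[OF M tG[OF i j]] ..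
  hence "L.ip (M (A i j) (f j)) (f i) = \<alpha> i j * \<phi> (t i j) * L.ip (lam (t i j) (f j)) (f i)"
   using v lt by (simp add: L.BH_simps(3) L.cinner_smult_left)
  also have "lam (t i j) (f j) = of_real (s j) \<odot>\<^bsub>L2 \<mu>\<^esub> lam (inv (x i)) f0"
  proof -
   have "lam (t i j) (f j) = of_real (s j) \<odot>\<^bsub>L2 \<mu>\<^esub> lam (t i j) (lam (inv (x j)) f0)"
    using j L.bounded_opD(3)[OF lam_bounded[OF tG[OF i j]] l0(1)[OF j]] by (simp add: f_def)
   also have "lam (t i j) (lam (inv (x j)) f0) = lam (t i j \<otimes> inv (x j)) f0"
    using xG[OF j] by (intro lam_mult[symmetric] tG i j f0) simp
   also have "t i j \<otimes> inv (x j) = inv (x i)" using xG[OF i] xG[OF j] by (simp add: t_def m_assoc)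
   finally show ?thesis .
  qed
  also have "L.ip (of_real (s j) \<odot>\<^bsub>L2 \<mu>\<^esub> lam (inv (x i)) f0) (f i) = of_real (s i * s j)"
   using i l0[OF i] by (simp add: f_def L.cinner_smult_left L.ip_smult_right L.ip_self)
  finally show "L.ip (M (A i j) (f j)) (f i) = Z (x j) (x i) * \<phi> (inv (x i) \<otimes> x j)"
   using s(1)[OF i] s(1)[OF j] by (simp add: \<alpha>_def t_def)
 qed
 also have "... = (\<Sum>p\<in>F. \<Sum>q\<in>F. Z p q * \<phi> (inv q \<otimes> p))" unfolding re by (rule sum.swap)
 finally have test: "(\<Sum>p\<in>F. \<Sum>q\<in>F. Z p q * \<phi> (inv q \<otimes> p)) = P.ip (matrix_op (L2 \<mu>) n (%i j. M (A i j)) f) f" by simp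
 have "Re (\<Sum>p\<in>F. \<Sum>q\<in>F. Z p q * \<phi> (inv q \<otimes> p)) <= P.nm (matrix_op (L2 \<mu>) n (%i j. M (A i j)) f) * P.nm f"
  unfolding test using P.Cauchy_Schwarz[OF L.matrix_op_mem[OF Mb f] f] complex_Re_le_cmod order_trans by blast
 also have "... <= \<M> n (%i j. M (A i j)) * P.nm f * P.nm f"
  unfolding matrix_opnorm_def by (intro mult_right_mono P.opnorm_upper[OF L.matrix_op_bounded[OF Mb] f] P.nm_nonneg[OF f])
 also have "... = \<M> n (%i j. M (A i j)) * (\<Sum>p\<in>F. d p)"
  unfolding re nf[symmetric] by (simp add: power2_eq_square)
 also have "... <= C * (\<Sum>p\<in>F. d p)"
  using d by (intro mult_right_mono C AV norm sum_nonneg less_imp_le)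
 finally show "Re (\<Sum>p\<in>F. \<Sum>q\<in>F. Z p q * \<phi> (inv q \<otimes> p)) <= C * (\<Sum>p\<in>F. d p)" .
qed

end

text \<open>The square root of the normalized weight.\<close>

lemma (in exponential_growth_group) L2_unit_vector:
 obtains f0 where "f0 \<in> CL \<mu>" "hnorm (L2 \<mu>) f0 = 1"
proof -
 let ?f = "%x. complex_of_real (sqrt (weight x))"
 have sq: "cm2 (?f x) = weight x" for x using weight_nonneg[of x] by simp
 have "?f \<in> borel_measurable \<mu>" using weight_measurable by measurable
 hence f: "?f \<in> SQ \<mu>" unfolding sq_integrable_def mem_Collect_eq sq using weight_integrable by simp
 have m: "L2_class \<mu> ?f \<in> CL \<mu>" by (rule L2_class_mem[OF f])
 have "(hnorm (L2 \<mu>) (L2_class \<mu> ?f))^2 = 1" unfolding L2_norm_square[OF f] sq by (rule weight_integral)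
 hence "hnorm (L2 \<mu>) (L2_class \<mu> ?f) = 1" using L.nm_nonneg[OF m] by (simp add: power2_eq_1_iff)
 thus ?thesis using that m by blast
qed

section \<open>Weak limits of square summable sequences\<close>

lemma l2_norm_sum_le:
 assumes "finite F" "\<And>p. p \<in> F ==> u p \<in> l2 I"
 shows "l2n I (%i. \<Sum>p\<in>F. c p * u p i) <= (\<Sum>p\<in>F. cmod (c p) * l2n I (u p))"
 using assms
proof (induction F rule: finite_induct)
 case empty
 show ?case using l2_norm_eq_0[OF l2_zero, of I] by simp
next
 case (insert p F)
 have m: "(%i. c p * u p i) \<in> l2 I" "(%i. \<Sum>p\<in>F. c p * u p i) \<in> l2 I"
  using insert by (auto intro!: l2_scale l2_sum)
 have "l2n I (%i. c p * u p i + (\<Sum>p\<in>F. c p * u p i))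
   <= cmod (c p) * l2n I (u p) + (\<Sum>p\<in>F. cmod (c p) * l2n I (u p))"
  using l2_norm_triangle[OF m] l2_norm_scale[of "u p" I "c p"] insert by simp
 thus ?case using insert(1,2) by simp
qed

text \<open>The operators share a bound, so one approximation of \<open>x\<close> by a finite combination of the spanning vectors serves all of them.\<close>

lemma strong_convergence_on_span:
 assumes sp: "spanning v X I" and v: "\<And>p. p \<in> X ==> v p \<in> l2 I"
  and A: "\<And>l. bounded_op (Ltwo I) (A l)" "\<And>l x. x \<in> l2 I ==> l2n I (A l x) <= B * l2n I x"
  and T: "bounded_op (Ltwo I) T" "\<And>x. x \<in> l2 I ==> l2n I (T x) <= B * l2n I x"
  and B: "0 <= B"
  and conv: "\<And>p. p \<in> X ==> (%l. l2n I (%i. A l (v p) i - T (v p) i)) \<leadsto> 0"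
  and x: "x \<in> l2 I"
 shows "(%l::nat. l2n I (%i. A l x i - T x i)) \<leadsto> 0"
proof -
 let ?n = "l2n I"
 note mA = bounded_op_l2[OF A(1)] and mT = bounded_op_l2[OF T(1)]
 have on_span: "(%l. ?n (%i. A l a i - T a i)) \<leadsto> 0" if "graph v v X a b" for a b
 proof -
  obtain F c where F: "finite F" "F \<subseteq> X" and a: "a = (%i. \<Sum>p\<in>F. c p * v p i)"
   using \<open>graph v v X a b\<close> unfolding graph_def by blast
  have vF: "v p \<in> l2 I" if "p \<in> F" for p using v F that by blast
  have eq: "(%i. A l a i - T a i) = (%i. \<Sum>p\<in>F. c p * (A l (v p) i - T (v p) i))" for l
  proof -
   have "A l a = (%i. \<Sum>p\<in>F. c p * A l (v p) i)" unfolding a by (rule mA(3)) (rule vF)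
   moreover have "T a = (%i. \<Sum>p\<in>F. c p * T (v p) i)" unfolding a by (rule mT(3)) (rule vF)
   ultimately show ?thesis by (simp add: sum_subtractf right_diff_distrib)
  qed
  have dm: "(%i. A l (v p) i - T (v p) i) \<in> l2 I" if "p \<in> F" for p l
   using vF[OF that] by (intro l2_diff mA(1) mT(1))
  have "(%l. \<Sum>p\<in>F. cmod (c p) * ?n (%i. A l (v p) i - T (v p) i)) \<leadsto> (\<Sum>p\<in>F. cmod (c p) * 0)"
   using F(2) by (intro tendsto_intros conv) auto
  hence lim: "(%l. \<Sum>p\<in>F. cmod (c p) * ?n (%i. A l (v p) i - T (v p) i)) \<leadsto> 0" by simp
  show ?thesis
  proof (rule Lim_null_comparison[OF always_eventually lim], rule allI)
   fix l
   have "0 <= ?n (%i. \<Sum>p\<in>F. c p * (A l (v p) i - T (v p) i))" by (intro l2_norm_nonneg l2_sum dm)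
   thus "norm (?n (%i. A l a i - T a i)) <= (\<Sum>p\<in>F. cmod (c p) * ?n (%i. A l (v p) i - T (v p) i))"
    unfolding eq using l2_norm_sum_le[OF F(1), of "%p i. A l (v p) i - T (v p) i" I c, OF dm] by simp
  qed
 qed
 show ?thesis
 proof (rule LIMSEQ_I)
  fix r :: real assume r: "0 < r"
  define s where "s = r / (3 * (B + 1))"
  have s: "0 < s" and Bs: "B * s <= r / 3" using r B by (auto simp: s_def field_simps)
  obtain a b where ab: "graph v v X a b" "?n (%i. x i - a i) < s" using spanning_dense[OF sp x s] by blast
  have a: "a \<in> l2 I" using ab(1) v unfolding graph_def by (auto intro!: l2_sum)
  note xa = l2_diff[OF x a]
  obtain N where N: "\<And>l. l >= N ==> norm (?n (%i. A l a i - T a i) - 0) < r / 3"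
   using LIMSEQ_D[OF on_span[OF ab(1)], of "r / 3"] r by auto
  have "norm (?n (%i. A l x i - T x i) - 0) < r" if l: "l >= N" for l
  proof -
   have m: "(%i. A l x i - A l a i) \<in> l2 I" "(%i. A l a i - T a i) \<in> l2 I" "(%i. T a i - T x i) \<in> l2 I"
    using x a by (auto intro!: l2_diff mA(1) mT(1))
   have e: "(%i. A l x i - T x i) = (%i. ((A l x i - A l a i) + (A l a i - T a i)) + (T a i - T x i))" by auto
   have "?n (%i. A l x i - T x i) <= ?n (%i. (A l x i - A l a i) + (A l a i - T a i)) + ?n (%i. T a i - T x i)"
    unfolding e by (rule l2_norm_triangle[OF l2_add[OF m(1,2)] m(3)])
   also have "... <= ?n (%i. A l x i - A l a i) + ?n (%i. A l a i - T a i) + ?n (%i. T a i - T x i)"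
    using l2_norm_triangle[OF m(1,2)] by simp
   also have "?n (%i. T a i - T x i) = ?n (%i. T x i - T a i)"
    by (rule l2_norm_minus_commute[OF mT(1)[OF a] mT(1)[OF x]])
   also have "... <= B * ?n (%i. x i - a i)" using T(2)[OF xa] mT(2)[OF x a] by simp
   also have "... <= B * s" using ab(2) B by (intro mult_left_mono) auto
   also have "?n (%i. A l x i - A l a i) <= B * ?n (%i. x i - a i)" using A(2)[OF xa, of l] mA(2)[OF x a, of l] by simp
   also have "... <= B * s" using ab(2) B by (intro mult_left_mono) auto
   also have "?n (%i. A l a i - T a i) < r / 3" using N[OF l] by simp
   finally have "?n (%i. A l x i - T x i) < r" using Bs by simp
   thus ?thesis using l2_norm_nonneg[OF l2_diff[OF mA(1)[OF x, of l] mT(1)[OF x]]] by simp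
  qed
  thus "\<exists>N. \<forall>l\<ge>N. norm (?n (%i. A l x i - T x i) - 0) < r" by blast
 qed
qed

lemma l2_inner_bound: "[|x \<in> l2 I; y \<in> l2 I|] ==> cmod (\<Sum>i. x i * cnj (y i)) <= l2n I x * l2n I y"
 using inner_space.Cauchy_Schwarz[OF l2_inner_space, of x I y] by (simp add: Ltwo_simps)

lemma weak_inner_tendsto:
 assumes z: "\<And>n. z n \<in> l2 I" "\<And>n. l2n I (z n) <= R" and w: "w \<in> l2 I"
  and lim: "\<And>i. (%n. z n i) \<leadsto> w i" and b: "b \<in> l2 I"
 shows "(%n::nat. \<Sum>i. z n i * cnj (b i)) \<leadsto> (\<Sum>i. w i * cnj (b i))"
proof (rule LIMSEQ_I)
 let ?n = "l2n I"
 fix r :: real assume r: "0 < r"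
 define C where "C = \<bar>R\<bar> + ?n w + 1"
 have nw: "0 <= ?n w" by (rule l2_norm_nonneg[OF w])
 have C: "0 < C" using nw by (simp add: C_def)
 obtain N where N: "?n (%i. b i - trunc N b i) < r / (3 * C)"
  using order_tendstoD(2)[OF trunc_converges[OF b], of "r / (3 * C)"] r C by (auto simp: eventually_sequentially)
 note bt = trunc_l2[OF b, of N] note bd = l2_diff[OF b bt]
 have split: "(\<Sum>i. x i * cnj (b i)) = (\<Sum>i<N. x i * cnj (b i)) + (\<Sum>i. x i * cnj (b i - trunc N b i))" if x: "x \<in> l2 I" for x
 proof -
  have "(\<Sum>i. x i * cnj (b i)) = (\<Sum>i. x i * cnj (trunc N b i) + x i * cnj (b i - trunc N b i))"
   by (simp add: algebra_simps)
  also have "... = (\<Sum>i. x i * cnj (trunc N b i)) + (\<Sum>i. x i * cnj (b i - trunc N b i))"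
   by (rule suminf_add[OF l2_mult_summable[OF x bt] l2_mult_summable[OF x bd], symmetric])
  also have "(\<Sum>i. x i * cnj (trunc N b i)) = (\<Sum>i<N. x i * cnj (trunc N b i))"
   by (rule suminf_finite) (auto simp: trunc_def)
  also have "... = (\<Sum>i<N. x i * cnj (b i))" by (intro sum.cong) (auto simp: trunc_def)
  finally show ?thesis .
 qed
 have tail: "cmod (\<Sum>i. x i * cnj (b i - trunc N b i)) < r / 3" if x: "x \<in> l2 I" "?n x <= C" for x
 proof -
  have "cmod (\<Sum>i. x i * cnj (b i - trunc N b i)) <= ?n x * ?n (%i. b i - trunc N b i)" by (rule l2_inner_bound[OF x(1) bd])
  also have "... <= C * ?n (%i. b i - trunc N b i)" using x(2) l2_norm_nonneg[OF bd] by (intro mult_right_mono) auto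
  also have "... < r / 3" using N C by (simp add: field_simps)
  finally show ?thesis .
 qed
 have fin: "(%n. \<Sum>i<N. z n i * cnj (b i)) \<leadsto> (\<Sum>i<N. w i * cnj (b i))" by (intro tendsto_intros lim)
 have r3: "0 < r / 3" using r by simp
 obtain M where M: "\<And>n. n >= M ==> cmod ((\<Sum>i<N. z n i * cnj (b i)) - (\<Sum>i<N. w i * cnj (b i))) < r / 3"
  using LIMSEQ_D[OF fin r3] by blast
 have "norm ((\<Sum>i. z n i * cnj (b i)) - (\<Sum>i. w i * cnj (b i))) < r" if n: "n >= M" for n
 proof -
  let ?a = "(\<Sum>i<N. z n i * cnj (b i)) - (\<Sum>i<N. w i * cnj (b i))"
  let ?p = "\<Sum>i. z n i * cnj (b i - trunc N b i)" and ?q = "\<Sum>i. w i * cnj (b i - trunc N b i)"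
  have "cmod ?p < r / 3" using nw z(2)[of n] by (intro tail z(1)) (auto simp: C_def)
  moreover have "cmod ?q < r / 3" by (intro tail w) (simp add: C_def)
  moreover have "(\<Sum>i. z n i * cnj (b i)) - (\<Sum>i. w i * cnj (b i)) = ?a + ?p - ?q"
   unfolding split[OF z(1)] split[OF w] by simp
  moreover have "cmod (?a + ?p - ?q) <= cmod ?a + cmod ?p + cmod ?q"
   using norm_triangle_ineq4[of "?a + ?p" ?q] norm_triangle_ineq[of ?a ?p] by linarith
  ultimately show ?thesis using M[OF n] by simp
 qed
 thus "\<exists>M. \<forall>n\<ge>M. norm ((\<Sum>i. z n i * cnj (b i)) - (\<Sum>i. w i * cnj (b i))) < r" by blast
qed

text \<open>The Riesz representation of the functional \<open>x \<mapsto> (A x)\<^sub>i\<close>, read off from the values on coordinate vectors.\<close>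

lemma coordinate_functional:
 assumes A: "bounded_op (Ltwo I) A"
 shows "\<exists>a\<in>l2 I. \<forall>x\<in>l2 I. A x i = (\<Sum>m. x m * cnj (a m))"
proof -
 interpret H: inner_space "Ltwo I" by (rule l2_inner_space)
 obtain R where R: "0 <= R" "\<And>x. x \<in> carrier (Ltwo I) ==> H.nm (A x) <= R * H.nm x"
  using H.bounded_op_bound[OF A] by blast
 note m = bounded_op_l2[OF A]
 define e where "e m = (if m \<in> I then basis_vec m else (%_. 0))" for m
 have e: "e m \<in> l2 I" for m
 proof (cases "m \<in> I")
  case True
  have "summable (%i. cm2 (basis_vec m i))" by (rule summable_finite[of "{m}"]) auto
  thus ?thesis using True by (auto simp: e_def l2_def)
 qed (simp add: e_def l2_zero)
 define a where "a m = cnj (A (e m) i)" for m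
 have comb: "trunc n x = (%j. \<Sum>m<n. x m * e m j)" if x: "x \<in> l2 I" for x n
 proof
  fix j
  have "(\<Sum>m<n. x m * e m j) = (\<Sum>m<n. if m = j then x j else 0)"
   using x by (intro sum.cong refl) (auto simp: e_def l2_outside)
  thus "trunc n x j = (\<Sum>m<n. x m * e m j)" by (simp add: trunc_def)
 qed
 have At: "A (trunc n x) i = (\<Sum>m<n. x m * cnj (a m))" if x: "x \<in> l2 I" for x n
  unfolding comb[OF x] m(3)[of "{..<n}" e x, OF e] by (simp add: a_def)
 have A0: "a j = 0" if "j \<notin> I" for j
  using that m(3)[of "{}" e "%_. 0"] by (simp add: a_def e_def)
 have part: "(\<Sum>j<n. cm2 (a j)) <= R\<^sup>2" for n
 proof -
  define x where "x = (%j. \<Sum>m<n. a m * e m j)"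
  have x: "x \<in> l2 I" unfolding x_def by (rule l2_sum[OF e])
  have xj: "x j = (if j < n then a j else 0)" for j
  proof -
   have "x j = (\<Sum>m<n. if m = j then a j else 0)"
    unfolding x_def using A0 by (intro sum.cong refl) (auto simp: e_def)
   thus ?thesis by simp
  qed
  let ?q = "\<Sum>j<n. cm2 (a j)"
  have q0: "0 <= ?q" by (intro sum_nonneg) simp
  have "(H.nm x)^2 = (\<Sum>j<n. cm2 (x j))"
   unfolding l2_norm_square[OF x] by (rule suminf_finite) (auto simp: xj)
  hence nx: "(H.nm x)^2 = ?q" by (simp add: xj)
  have "A x i = (\<Sum>m<n. a m * cnj (a m))"
   unfolding x_def m(3)[of "{..<n}" e a, OF e] by (simp add: a_def)
  also have "... = of_real ?q" unfolding of_real_sum by (simp only: complex_norm_square)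
  finally have Aq: "A x i = of_real ?q" .
  have "?q = cmod (A x i)" unfolding Aq norm_of_real using q0 by (rule abs_of_nonneg[symmetric])
  also have "... <= R * H.nm x" using l2_coord_le[OF m(1)[OF x], of i] R(2)[of x] x by (simp add: Ltwo_simps)
  finally have "?q\<^sup>2 <= (R * H.nm x)^2" using q0 by (intro power_mono)
  hence "?q * ?q <= R\<^sup>2 * ?q" unfolding power_mult_distrib nx by (simp only: power2_eq_square[of ?q])
  thus ?thesis using q0 by (cases "?q = 0") auto
 qed
 have a: "a \<in> l2 I" by (rule l2_norm_leI(1)[OF A0 part R(1)])
 have "A x i = (\<Sum>m. x m * cnj (a m))" if x: "x \<in> l2 I" for x
 proof -
  have lim: "(%n. R * H.nm (%j. x j - trunc n x j)) \<leadsto> 0"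
   using tendsto_mult_right_zero[OF trunc_converges[OF x]] by simp
  have "(%n. A x i - A (trunc n x) i) \<leadsto> 0"
  proof (rule Lim_null_comparison[OF always_eventually lim], rule allI)
   fix n
   note t = trunc_l2[OF x, of n] note xt = l2_diff[OF x t]
   have "cmod (A x i - A (trunc n x) i) <= H.nm (A (%j. x j - trunc n x j))"
    using l2_coord_le[OF m(1)[OF xt], of i] unfolding m(2)[OF x t] .
   also have "... <= R * H.nm (%j. x j - trunc n x j)" using R(2) xt by (simp add: Ltwo_simps)
   finally show "cmod (A x i - A (trunc n x) i) <= R * H.nm (%j. x j - trunc n x j)" .
  qed
  hence "(%n. A x i - (A x i - A (trunc n x) i)) \<leadsto> A x i - 0" by (intro tendsto_intros)
  hence "(%n. \<Sum>m<n. x m * cnj (a m)) \<leadsto> A x i" by (simp add: At[OF x])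
  thus ?thesis using sums_unique unfolding sums_def by blast
 qed
 thus ?thesis using a by blast
qed

lemma weak_continuity:
 assumes A: "bounded_op (Ltwo I) A"
  and z: "\<And>n. z n \<in> l2 I" "\<And>n. l2n I (z n) <= R" and w: "w \<in> l2 I"
  and lim: "\<And>i. (%n. z n i) \<leadsto> w i"
 shows "(%n::nat. A (z n) i) \<leadsto> A w i"
proof -
 obtain a where a: "a \<in> l2 I" "\<And>x. x \<in> l2 I ==> A x i = (\<Sum>m. x m * cnj (a m))"
  using coordinate_functional[OF A, of i] by blast
 show ?thesis unfolding a(2)[OF z(1)] a(2)[OF w] by (rule weak_inner_tendsto[OF z w lim a(1)])
qed

lemma coordinatewise_subsequence:
 fixes f :: "nat => 'i::countable => complex"
 assumes "\<And>n i. cmod (f n i) <= R"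
 shows "\<exists>r z. strict_mono r & (\<forall>i. (%n. f (r n) i) \<leadsto> z i)"
proof -
 let ?C = "Pi\<^sub>E UNIV (%_::'i. cball (0::complex) R)"
 have "seq_compact ?C" by (intro compact_imp_seq_compact compact_box) simp
 moreover have "\<forall>n. f n \<in> ?C" using assms by (simp add: PiE_iff)
 ultimately obtain z r where r: "strict_mono r" "(f \<circ> r) \<leadsto> z" unfolding seq_compact_def by blast
 have "(%n. f (r n) i) \<leadsto> z i" for i
 proof -
  have "continuous_on UNIV (%x::'i => complex. x i)" by (rule continuous_on_product_coordinates)
  from continuous_on_tendsto_compose[OF this r(2)] show ?thesis by (simp add: comp_def)
 qed
 thus ?thesis using r(1) by blast
qed

lemma l2_weak_limit:
 assumes z: "\<And>n. z n \<in> l2 I" "\<And>n. l2n I (z n) <= R"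
  and lim: "\<And>i. (%n. z n i) \<leadsto> w i"
 shows "w \<in> l2 I" and "l2n I w <= R"
proof -
 have R: "0 <= R" using order_trans[OF l2_norm_nonneg[OF z(1)] z(2)] .
 have o: "w i = 0" if "i \<notin> I" for i
  using lim[of i] l2_outside[OF z(1) that] by (simp add: LIMSEQ_const_iff)
 have p: "(\<Sum>i<N. cm2 (w i)) <= R\<^sup>2" for N
 proof (rule LIMSEQ_le_const2)
  show "(%n. \<Sum>i<N. cm2 (z n i)) \<leadsto> (\<Sum>i<N. cm2 (w i))" by (intro tendsto_intros lim)
  have "(\<Sum>i<N. cm2 (z n i)) <= R\<^sup>2" for n
   using l2_partial_sum_le[OF z(1), of "{..<N}" n] power_mono[OF z(2) l2_norm_nonneg[OF z(1)], of n 2] by simp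
  thus "\<exists>N'. \<forall>n\<ge>N'. (\<Sum>i<N. cm2 (z n i)) <= R\<^sup>2" by blast
 qed
 show "w \<in> l2 I" by (rule l2_norm_leI(1)[OF o p R])
 show "l2n I w <= R" by (rule l2_norm_leI(2)[OF o p R])
qed

text \<open>Inner products are only separately continuous for weak limits. Here the double sequence of inner products is close to \<open>c\<close> uniformly in both indices, so taking one limit after the other suffices.\<close>

lemma weak_iterated_limit:
 assumes z: "\<And>n. z n \<in> l2 I" "\<And>n. l2n I (z n) <= R" and z0: "\<And>i. (%n. z n i) \<leadsto> z0 i"
  and w: "\<And>n. w n \<in> l2 I" "\<And>n. l2n I (w n) <= R'" and w0: "\<And>i. (%n. w n i) \<leadsto> w0 i"
  and close: "\<And>\<epsilon>. 0 < \<epsilon> ==> \<exists>N. \<forall>n\<ge>N. \<forall>m\<ge>N. cmod ((\<Sum>i. z n i * cnj (w m i)) - c) <= \<epsilon>"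
 shows "(\<Sum>i. z0 i * cnj (w0 i)) = c"
proof -
 note z0m = l2_weak_limit(1)[OF z z0] and w0m = l2_weak_limit(1)[OF w w0]
 have swap: "(\<Sum>i. x i * cnj (y i)) = cnj (\<Sum>i. y i * cnj (x i))" if "x \<in> l2 I" "y \<in> l2 I" for x y
 proof -
  have "(%i. cnj (y i * cnj (x i))) sums cnj (\<Sum>i. y i * cnj (x i))"
   using summable_sums[OF l2_mult_summable[OF that(2,1)]] by (simp only: sums_cnj)
  thus ?thesis by (simp add: sums_iff mult.commute)
 qed
 have inner: "(%m. \<Sum>i. z n i * cnj (w m i)) \<leadsto> (\<Sum>i. z n i * cnj (w0 i))" for n
  unfolding swap[OF z(1) w(1)] swap[OF z(1) w0m] by (intro tendsto_cnj weak_inner_tendsto[OF w w0m w0 z(1)])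
 have outer: "(%n. \<Sum>i. z n i * cnj (w0 i)) \<leadsto> (\<Sum>i. z0 i * cnj (w0 i))"
  by (rule weak_inner_tendsto[OF z z0m z0 w0m])
 have "cmod ((\<Sum>i. z0 i * cnj (w0 i)) - c) <= \<epsilon>" if \<epsilon>: "0 < \<epsilon>" for \<epsilon>
 proof -
  obtain N where N: "\<And>n m. n >= N ==> m >= N ==> cmod ((\<Sum>i. z n i * cnj (w m i)) - c) <= \<epsilon>"
   using close[OF \<epsilon>] by blast
  have "cmod ((\<Sum>i. z n i * cnj (w0 i)) - c) <= \<epsilon>" if n: "n >= N" for n
  proof (rule LIMSEQ_le_const2)
   show "(%m. cmod ((\<Sum>i. z n i * cnj (w m i)) - c)) \<leadsto> cmod ((\<Sum>i. z n i * cnj (w0 i)) - c)"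
    by (intro tendsto_intros inner)
  qed (use N[OF n] in blast)
  moreover have "(%n. cmod ((\<Sum>i. z n i * cnj (w0 i)) - c)) \<leadsto> cmod ((\<Sum>i. z0 i * cnj (w0 i)) - c)"
   by (intro tendsto_intros outer)
  ultimately show ?thesis by (blast intro: LIMSEQ_le_const2)
 qed
 hence "cmod ((\<Sum>i. z0 i * cnj (w0 i)) - c) <= 0" by (rule field_le_epsilon[of _ 0, simplified])
 thus ?thesis by simp
qed

lemma bounded_op_compose:
 assumes A: "bounded_op (Ltwo I) A" and B: "bounded_op (Ltwo I) B"
 shows "bounded_op (Ltwo I) (compose (carrier (Ltwo I)) A B)"
proof -
 interpret H: inner_space "Ltwo I" by (rule l2_inner_space)
 obtain R where R: "0 <= R" "\<And>x. x \<in> carrier (Ltwo I) ==> H.nm (A x) <= R * H.nm x"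
  using H.bounded_op_bound[OF A] by blast
 obtain S where S: "0 <= S" "\<And>x. x \<in> carrier (Ltwo I) ==> H.nm (B x) <= S * H.nm x"
  using H.bounded_op_bound[OF B] by blast
 note a = H.bounded_opD[OF A] and b = H.bounded_opD[OF B]
 show ?thesis
 proof (rule H.bounded_opI[where K = "R * S"])
  show "compose (carrier (Ltwo I)) A B \<in> extensional (carrier (Ltwo I))" by (rule compose_extensional)
  fix x assume x: "x \<in> carrier (Ltwo I)"
  show "compose (carrier (Ltwo I)) A B x \<in> carrier (Ltwo I)" using a b x by (simp add: compose_eq)
  have "H.nm (A (B x)) <= R * H.nm (B x)" using b x by (intro R(2))
  also have "... <= R * (S * H.nm x)" using R(1) S(2)[OF x] by (rule mult_left_mono[rotated])
  finally show "H.nm (compose (carrier (Ltwo I)) A B x) <= R * S * H.nm x" using x by (simp add: compose_eq mult.assoc)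
  show "compose (carrier (Ltwo I)) A B (c \<odot>\<^bsub>Ltwo I\<^esub> x) = c \<odot>\<^bsub>Ltwo I\<^esub> compose (carrier (Ltwo I)) A B x" for c
   using x a b by (simp add: compose_eq)
  fix y assume y: "y \<in> carrier (Ltwo I)"
  show "compose (carrier (Ltwo I)) A B (x \<oplus>\<^bsub>Ltwo I\<^esub> y)
    = compose (carrier (Ltwo I)) A B x \<oplus>\<^bsub>Ltwo I\<^esub> compose (carrier (Ltwo I)) A B y"
   using x y a b by (simp add: compose_eq)
 qed
qed

text \<open>The orthogonal direct sum: the Boolean component labels the two summands.\<close>

definition kernel_sum :: "('x => 'x => complex) => ('x => 'x => complex) => bool \<times> 'x => bool \<times> 'x => complex"
 where "kernel_sum K L p q = (if fst p = fst q then if fst p then K (snd p) (snd q) else L (snd p) (snd q) else 0)"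

lemma psd_sum_blocks:
 assumes K: "psd X K" and L: "psd X L"
 shows "psd (UNIV \<times> X) (kernel_sum K L)"
proof -
 let ?c = "%s p (_::'a). if fst p = s then 1 else 0 :: complex"
 have 1: "psd (UNIV \<times> X) (%p q. \<Sum>i\<in>{snd p}. \<Sum>j\<in>{snd q}. ?c True p i * cnj (?c True q j) * K i j)"
  by (rule psd_linear_image[OF K]) auto
 have 2: "psd (UNIV \<times> X) (%p q. \<Sum>i\<in>{snd p}. \<Sum>j\<in>{snd q}. ?c False p i * cnj (?c False q j) * L i j)"
  by (rule psd_linear_image[OF L]) auto
 have eq: "kernel_sum K L p q = (\<Sum>i\<in>{snd p}. \<Sum>j\<in>{snd q}. ?c True p i * cnj (?c True q j) * K i j)
   + (\<Sum>i\<in>{snd p}. \<Sum>j\<in>{snd q}. ?c False p i * cnj (?c False q j) * L i j)" for p q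
  by (auto simp: kernel_sum_def)
 show ?thesis unfolding eq[abs_def] by (rule psd_add[OF 1 2])
qed

section \<open>From kernels to representations\<close>

lemma (in Metric_space) conv_from_rate:
 assumes "x \<in> M" "\<And>l. \<sigma> l \<in> M" "\<And>l. d x (\<sigma> l) < 1 / real (Suc l)"
 shows "conv \<sigma> x"
proof -
 have lim: "(%l. 1 / real (Suc l)) \<leadsto> 0" using LIMSEQ_inverse_real_of_nat by (simp add: inverse_eq_divide)
 have "(%l. d (\<sigma> l) x) \<leadsto> 0"
  by (rule Lim_null_comparison[OF always_eventually lim]) (use assms(3) commute in \<open>auto simp: less_imp_le\<close>)
 thus ?thesis using assms(1,2) by (auto simp: conv_def)
qed

lemma (in Metric_space) less_if_conv_null:
 assumes x: "x \<in> M" and e: "0 < e"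
  and null: "\<And>\<sigma>. conv \<sigma> x ==> (%l. h (\<sigma> l)) \<leadsto> (0::real)"
 shows "\<exists>\<delta>>0. \<forall>y\<in>M. d x y < \<delta> --> h y < e"
proof (rule ccontr)
 assume no: "\<not> ?thesis"
 have "\<exists>y\<in>M. d x y < 1 / real (Suc l) & \<not> h y < e" for l :: nat
 proof -
  have "0 < 1 / real (Suc l)" by simp
  thus ?thesis using no by blast
 qed
 then obtain \<sigma> where \<sigma>: "\<And>l. \<sigma> l \<in> M" "\<And>l. d x (\<sigma> l) < 1 / real (Suc l)" "\<And>l. \<not> h (\<sigma> l) < e" by metis
 have "\<forall>\<^sub>F l in sequentially. h (\<sigma> l) < e"
  using order_tendstoD(2)[OF null[OF conv_from_rate[OF x \<sigma>(1,2)]] e] .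
 thus False using \<sigma>(3) by (simp add: eventually_sequentially)
qed

context invariant_metric_group
begin

lemma conv_inv_mult_conv:
 assumes \<sigma>: "conv \<sigma> x" and \<tau>: "conv \<tau> y"
 shows "conv (%l. inv (\<tau> l) \<otimes> \<sigma> l) (inv y \<otimes> x)"
proof -
 note s = convD[OF \<sigma>] and t = convD[OF \<tau>]
 have cx: "conv (%l. inv (\<tau> l) \<otimes> x) (inv y \<otimes> x)" by (rule conv_inv_mult[OF \<tau> s(2)])
 have lim: "(%l. d (\<sigma> l) x + d (inv (\<tau> l) \<otimes> x) (inv y \<otimes> x)) \<leadsto> 0"
  using tendsto_add[OF s(3) convD(3)[OF cx]] by simp
 have "(%l. d (inv (\<tau> l) \<otimes> \<sigma> l) (inv y \<otimes> x)) \<leadsto> 0"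
 proof (rule Lim_null_comparison[OF always_eventually lim], rule allI)
  fix l
  have "d (inv (\<tau> l) \<otimes> \<sigma> l) (inv y \<otimes> x) <= d (inv (\<tau> l) \<otimes> \<sigma> l) (inv (\<tau> l) \<otimes> x) + d (inv (\<tau> l) \<otimes> x) (inv y \<otimes> x)"
   using s(1,2) t(1,2) by (intro triangle) auto
  also have "d (inv (\<tau> l) \<otimes> \<sigma> l) (inv (\<tau> l) \<otimes> x) = d (\<sigma> l) x" using s(1,2) t(1) by (intro left_invariant) auto
  finally show "norm (d (inv (\<tau> l) \<otimes> \<sigma> l) (inv y \<otimes> x)) <= d (\<sigma> l) x + d (inv (\<tau> l) \<otimes> x) (inv y \<otimes> x)" by simp
 qed
 thus ?thesis using s(1,2) t(1,2) by (auto simp: conv_def)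
qed

text \<open>The oscillation of \<open>\<phi>(v\<inverse> u)\<close> near \<open>(x, y)\<close> tends to zero because \<open>\<phi>\<close> is continuous.\<close>

lemma kernel_limit:
 assumes \<phi>: "continuous_map mtopology euclidean (\<phi> :: 'a => complex)"
  and ap: "approximates (\<G>) d (%x y. \<phi> (inv y \<otimes> x)) D"
  and x: "x \<in> \<G>" and y: "y \<in> \<G>" and e: "0 < e"
 shows "\<exists>N. \<forall>n\<ge>N. \<forall>m\<ge>N. cmod (D (x, n) (y, m) - \<phi> (inv y \<otimes> x)) <= e"
proof -
 have "\<exists>N. \<forall>u\<in>\<G>. \<forall>v\<in>\<G>. d x u < 1 / real (Suc N) --> d y v < 1 / real (Suc N) --> cmod (\<phi> (inv v \<otimes> u) - \<phi> (inv y \<otimes> x)) <= e"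
 proof (rule ccontr)
  assume no: "\<not> ?thesis"
  have "\<forall>N. \<exists>uv. fst uv \<in> \<G> & snd uv \<in> \<G> & d x (fst uv) < 1 / real (Suc N) & d y (snd uv) < 1 / real (Suc N) & \<not> cmod (\<phi> (inv (snd uv) \<otimes> fst uv) - \<phi> (inv y \<otimes> x)) <= e"
   using no by fastforce
  then obtain w where w: "\<And>N. fst (w N) \<in> \<G>" "\<And>N. snd (w N) \<in> \<G>" "\<And>N. d x (fst (w N)) < 1 / real (Suc N)"
   "\<And>N. d y (snd (w N)) < 1 / real (Suc N)" "\<And>N. \<not> cmod (\<phi> (inv (snd (w N)) \<otimes> fst (w N)) - \<phi> (inv y \<otimes> x)) <= e"
   using choice[of "%N uv. fst uv \<in> \<G> & snd uv \<in> \<G> & d x (fst uv) < 1 / real (Suc N) & d y (snd uv) < 1 / real (Suc N) & \<not> cmod (\<phi> (inv (snd uv) \<otimes> fst uv) - \<phi> (inv y \<otimes> x)) <= e"] by blast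
  have "conv (%N. inv (snd (w N)) \<otimes> fst (w N)) (inv y \<otimes> x)"
   by (rule conv_inv_mult_conv[OF conv_from_rate[OF x w(1,3)] conv_from_rate[OF y w(2,4)]])
  from conv_tendsto[OF \<phi> this] have "(%N. \<phi> (inv (snd (w N)) \<otimes> fst (w N))) \<leadsto> \<phi> (inv y \<otimes> x)" .
  from LIMSEQ_D[OF this e] obtain N where "cmod (\<phi> (inv (snd (w N)) \<otimes> fst (w N)) - \<phi> (inv y \<otimes> x)) < e" by blast
  thus False using w(5)[of N] by simp
 qed
 then obtain N where N: "\<And>u v. [|u \<in> \<G>; v \<in> \<G>; d x u < 1 / real (Suc N); d y v < 1 / real (Suc N)|] ==> cmod (\<phi> (inv v \<otimes> u) - \<phi> (inv y \<otimes> x)) <= e"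
  by blast
 have "cmod (D (x, n) (y, m) - \<phi> (inv y \<otimes> x)) <= e" if nm: "n >= N" "m >= N" for n m
 proof -
  have le: "1 / real (Suc k) <= 1 / real (Suc N)" if "k >= N" for k using that by (intro divide_left_mono) auto
  have "\<forall>u\<in>\<G>. \<forall>v\<in>\<G>. d x u < 1 / real (Suc n) --> d y v < 1 / real (Suc m) --> cmod (\<phi> (inv v \<otimes> u) - \<phi> (inv y \<otimes> x)) <= e"
   using N le[OF nm(1)] le[OF nm(2)] by (meson less_le_trans)
  thus ?thesis using ap x y unfolding approximates_def by blast
 qed
 thus ?thesis by blast
qed

definition act2 :: "'a => bool \<times> 'a \<times> nat => bool \<times> 'a \<times> nat" where "act2 g p = (fst p, act g (snd p))"

lemma act2_closed: "[|g \<in> \<G>; p \<in> UNIV \<times> GN|] ==> act2 g p \<in> UNIV \<times> GN"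
 by (auto simp: act2_def act_def)

lemma act2_mult: "[|g \<in> \<G>; h \<in> \<G>; p \<in> UNIV \<times> GN|] ==> act2 (g \<otimes> h) p = act2 g (act2 h p)"
 by (auto simp: act2_def act_def m_assoc)

lemma act2_one: "p \<in> UNIV \<times> GN ==> act2 \<one> p = p"
 by (auto simp: act2_def act_def)

text \<open>Here \<open>c\<close> is the growth rate of the representation and \<open>S\<close> bounds the squared norms of the two orbits.\<close>

abbreviation realizes where "realizes c \<phi> S I \<pi> \<xi> \<eta> \<equiv>
  \<pi> \<in> hom G (units_of (BH (Ltwo I))) &
  (\<forall>g\<in>\<G>. opnorm (Ltwo I) (\<pi> g) <= exp (c / 2 * d g \<one>)) & \<xi> \<in> l2 I & \<eta> \<in> l2 I &
  (\<forall>\<sigma> x \<zeta>. conv \<sigma> x --> \<zeta> \<in> l2 I --> (%l. l2n I (%i. \<pi> (\<sigma> l) \<zeta> i - \<pi> x \<zeta> i)) \<leadsto> 0) &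
  (\<forall>x\<in>\<G>. \<forall>y\<in>\<G>. \<phi> (inv y \<otimes> x) = cinner (Ltwo I) (\<pi> x \<xi>) (\<pi> y \<eta>)) &
  (\<forall>x\<in>\<G>. l2n I (\<pi> x \<xi>) <= sqrt S & l2n I (\<pi> x \<eta>) = l2n I (\<pi> x \<xi>))"

text \<open>The vectors \<open>\<xi>\<^sub>\<plusminus>\<close> are weak limits as the scale tends to zero. Since \<open>\<pi>(x)\<close> is weakly continuous, \<open>\<pi>(x)\<xi>\<^sub>\<plusminus>\<close> is the weak limit of \<open>v(\<plusminus>, x, n)\<close>, and inner products of these tend to \<open>\<phi>\<close>. The orbits of \<open>\<xi>\<^sub>+\<close> and \<open>\<xi>\<^sub>-\<close> stay orthogonal, so the norms of the sum and the difference agree.\<close>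

theorem representation_from_kernels:
 fixes \<phi> :: "'a => complex"
 assumes sc: "second_countable mtopology" and \<phi>: "continuous_map mtopology euclidean \<phi>"
  and K: "psd GN K" "seq_cont K"
  and L: "psd GN L" "seq_cont L"
  and S: "\<And>p. p \<in> GN ==> Re (K p p) + Re (L p p) <= S"
  and ap: "approximates (\<G>) d (%x y. \<phi> (inv y \<otimes> x)) (%p q. K p q - L p q)"
  and growth: "\<And>g. g \<in> \<G> ==> psd GN (%p q. of_real (exp (c * d g \<one>)) * K p q - K (act g p) (act g q))"
   "\<And>g. g \<in> \<G> ==> psd GN (%p q. of_real (exp (c * d g \<one>)) * L p q - L (act g p) (act g q))"
 shows "\<exists>I \<pi> \<xi> \<eta>. realizes c \<phi> S I \<pi> \<xi> \<eta>"
proof -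
 let ?X = "(UNIV :: bool set) \<times> GN" and ?J = "kernel_sum K L"
 have J: "psd ?X ?J" by (rule psd_sum_blocks[OF K(1) L(1)])
 have Jc: "(%l. ?J (s, (\<sigma> l, n)) (t, (\<tau> l, m))) \<leadsto> ?J (s, (x, n)) (t, (y, m))"
  if "conv \<sigma> x" "conv \<tau> y" for s t \<sigma> x \<tau> y n m
  using K(2) L(2) that unfolding seq_cont_def kernel_sum_def by (cases s; cases t) simp_all
 have kd: "(%l. kdist ?J (s, (x, n)) (s, (\<sigma> l, n))) \<leadsto> 0" if \<sigma>: "conv \<sigma> x" for s n \<sigma> x
 proof -
  note cx = conv_const[OF convD(2)[OF \<sigma>]]
  have "(%l. kdist ?J (s, (x, n)) (s, (\<sigma> l, n))) \<leadsto> Re (?J (s, (x, n)) (s, (x, n))) + Re (?J (s, (x, n)) (s, (x, n))) - 2 * Re (?J (s, (x, n)) (s, (x, n)))"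
   unfolding kdist_def by (intro tendsto_intros Jc[OF \<sigma> \<sigma>] Jc[OF cx \<sigma>])
  thus ?thesis by simp
 qed
 obtain \<rho> :: "nat => 'a" where \<rho>: "range \<rho> \<subseteq> \<G>" "\<forall>x\<in>\<G>. \<forall>e>0. \<exists>i. d x (\<rho> i) < e"
 proof -
  have "\<G> ~= {}" using one_closed by blast
  from separable_sequence[OF sc this] show ?thesis using that by blast
 qed
 \<comment> \<open>A dense sequence for the kernel distance: it runs through both labels, all scales and a dense sequence of \<open>G\<close>.\<close>
 define e where "e k = (fst (prod_decode k) = 0, \<rho> (fst (prod_decode (snd (prod_decode k)))), snd (prod_decode (snd (prod_decode k))))" for k
 have eX: "e k \<in> ?X" for k using \<rho>(1) by (auto simp: e_def)
 have dense: "\<exists>k. kdist ?J p (e k) < r" if p: "p \<in> ?X" and r: "0 < r" for p r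
 proof -
  obtain s x n where pe: "p = (s, (x, n))" and x: "x \<in> \<G>" using p by auto
  have "\<forall>l. \<exists>i. d x (\<rho> i) < 1 / real (Suc l)" using \<rho>(2) x by simp
  then obtain i where i: "\<And>l. d x (\<rho> (i l)) < 1 / real (Suc l)" by metis
  have "conv (%l. \<rho> (i l)) x" by (rule conv_from_rate[OF x _ i]) (use \<rho>(1) in blast)
  from order_tendstoD(2)[OF kd[OF this, of s n] r] obtain l where l: "kdist ?J p (s, (\<rho> (i l), n)) < r"
   by (auto simp: eventually_sequentially pe)
  have "e (prod_encode (if s then 0 else 1, prod_encode (i l, n))) = (s, (\<rho> (i l), n))" by (simp add: e_def)
  thus ?thesis using l by metis
 qed
 have Kol: "\<exists>I v. (\<forall>p\<in>?X. v p \<in> l2 I) & spanning v ?X I & (\<forall>p\<in>?X. \<forall>q\<in>?X. (%i. v p i * cnj (v q i)) sums ?J p q)"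
 proof (rule Kolmogorov_decomposition[where e = e, OF J])
  show "e k \<in> ?X" for k by (rule eX)
  show "\<exists>k. kdist ?J p (e k) < r" if "p \<in> ?X" "0 < r" for p r by (rule dense[OF that])
 qed
 obtain I v where v0: "\<forall>p\<in>?X. v p \<in> l2 I" and sp: "spanning v ?X I"
  and vJ0: "\<forall>p\<in>?X. \<forall>q\<in>?X. (%i. v p i * cnj (v q i)) sums ?J p q"
  using Kol by (elim exE conjE)
 have v: "v p \<in> l2 I" if "p \<in> ?X" for p by (rule bspec[OF v0 that])
 have vJ: "(%i. v p i * cnj (v q i)) sums ?J p q" if "p \<in> ?X" "q \<in> ?X" for p q
  by (rule bspec[OF bspec[OF vJ0 that(1)] that(2)])
 interpret H: inner_space "Ltwo I" by (rule l2_inner_space)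
 note lc = Ltwo_simps(1)
 have vp: "v (s, (x, n)) \<in> l2 I" if "x \<in> \<G>" for s x n using that by (intro v) auto
 have S0: "0 <= S"
  using S[of "(\<one>, 0)"] psd_diag(1)[OF K(1), of "(\<one>, 0)"] psd_diag(1)[OF L(1), of "(\<one>, 0)"] by auto
 have comb2: "(H.nm (%i. v (True, p) i + of_real t * v (False, p) i))^2 = Re (K p p) + t\<^sup>2 * Re (L p p)"
  if p: "p \<in> GN" for p and t :: real
 proof -
  let ?F = "{(True, p), (False, p)}" and ?c = "%q. if fst q then 1 else of_real t"
  have F: "?F \<subseteq> ?X" using p by auto
  have "(H.nm (%i. \<Sum>q\<in>?F. ?c q * v q i))^2 = Re (sesq ?J ?F ?c ?c)" by (rule combination_norm[OF v vJ F])
  thus ?thesis by (simp add: sesq_def kernel_sum_def power2_eq_square)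
 qed
 have nv: "H.nm (v (s, p)) <= sqrt S" if p: "p \<in> GN" for s p
 proof -
  have "(H.nm (%i. \<Sum>q\<in>{(s, p)}. 1 * v q i))^2 = Re (sesq ?J {(s, p)} (%_. 1) (%_. 1))"
   by (rule combination_norm[OF v vJ]) (use p in auto)
  hence "(H.nm (v (s, p)))^2 = Re (?J (s, p) (s, p))" by (simp add: sesq_singleton)
  also have "... <= S"
   using S[OF p] psd_diag(1)[OF K(1) p] psd_diag(1)[OF L(1) p] by (simp add: kernel_sum_def)
  finally show ?thesis by (rule real_le_rsqrt)
 qed
 have op_ex: "\<forall>g\<in>\<G>. \<exists>A. bounded_op (Ltwo I) A & (\<forall>p\<in>?X. A (v p) = v (act2 g p)) &
   (\<forall>x\<in>l2 I. H.nm (A x) <= exp (c / 2 * d g \<one>) * H.nm x)"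
 proof
  fix g assume g: "g \<in> \<G>"
  have e2: "(exp (c / 2 * d g \<one>))^2 = exp (c * d g \<one>)" by (simp add: exp_double[symmetric])
  have eq: "of_real ((exp (c / 2 * d g \<one>))^2) * ?J p q - ?J (act2 g p) (act2 g q)
    = kernel_sum (%p q. of_real (exp (c * d g \<one>)) * K p q - K (act g p) (act g q))
     (%p q. of_real (exp (c * d g \<one>)) * L p q - L (act g p) (act g q)) p q" for p q
   unfolding e2 by (simp add: kernel_sum_def act2_def)
  show "\<exists>A. bounded_op (Ltwo I) A & (\<forall>p\<in>?X. A (v p) = v (act2 g p)) &
   (\<forall>x\<in>l2 I. H.nm (A x) <= exp (c / 2 * d g \<one>) * H.nm x)"
  proof (rule operator_from_graph[where w = "%p. v (act2 g p)" and L = "%p q. ?J (act2 g p) (act2 g q)", OF v _ vJ _ sp])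
   show "v (act2 g p) \<in> l2 I" if "p \<in> ?X" for p by (rule v[OF act2_closed[OF g that]])
   show "(%i. v (act2 g p) i * cnj (v (act2 g q) i)) sums ?J (act2 g p) (act2 g q)" if "p \<in> ?X" "q \<in> ?X" for p q
    by (rule vJ[OF act2_closed[OF g that(1)] act2_closed[OF g that(2)]])
   show "psd ?X (%p q. of_real ((exp (c / 2 * d g \<one>))^2) * ?J p q - ?J (act2 g p) (act2 g q))"
    unfolding eq by (rule psd_sum_blocks[OF growth(1)[OF g] growth(2)[OF g]])
  qed simp_all
 qed
 obtain \<pi> where \<pi>: "\<forall>g\<in>\<G>. bounded_op (Ltwo I) (\<pi> g) & (\<forall>p\<in>?X. \<pi> g (v p) = v (act2 g p)) &
   (\<forall>x\<in>l2 I. H.nm (\<pi> g x) <= exp (c / 2 * d g \<one>) * H.nm x)"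
  using bchoice[OF op_ex] by (elim exE)
 have pb: "bounded_op (Ltwo I) (\<pi> g)" if "g \<in> \<G>" for g using \<pi> that by blast
 have pv: "\<pi> g (v p) = v (act2 g p)" if "g \<in> \<G>" "p \<in> ?X" for g p using \<pi> that by blast
 have pn: "H.nm (\<pi> g x) <= exp (c / 2 * d g \<one>) * H.nm x" if "g \<in> \<G>" "x \<in> l2 I" for g x using \<pi> that by blast
 have pm: "\<pi> (g \<otimes> h) = compose (carrier (Ltwo I)) (\<pi> g) (\<pi> h)" if g: "g \<in> \<G>" and h: "h \<in> \<G>" for g h
 proof (rule spanning_op_eq[OF sp v])
  show "bounded_op (Ltwo I) (\<pi> (g \<otimes> h))" by (rule pb) (use g h in simp)
  show "bounded_op (Ltwo I) (compose (carrier (Ltwo I)) (\<pi> g) (\<pi> h))" by (rule bounded_op_compose[OF pb[OF g] pb[OF h]])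
  fix p assume p: "p \<in> ?X"
  have "\<pi> (g \<otimes> h) (v p) = v (act2 g (act2 h p))" using pv[OF m_closed[OF g h] p] act2_mult[OF g h p] by simp
  also have "... = \<pi> g (\<pi> h (v p))" using pv[OF h p] pv[OF g act2_closed[OF h p]] by simp
  also have "... = compose (carrier (Ltwo I)) (\<pi> g) (\<pi> h) (v p)" using v[OF p] by (simp add: compose_eq lc)
  finally show "\<pi> (g \<otimes> h) (v p) = compose (carrier (Ltwo I)) (\<pi> g) (\<pi> h) (v p)" .
 qed
 have p1: "\<pi> \<one> = (\<lambda>x\<in>carrier (Ltwo I). x)"
 proof (rule spanning_op_eq[OF sp v])
  show "bounded_op (Ltwo I) (\<pi> \<one>)" by (rule pb) simp
  show "bounded_op (Ltwo I) (\<lambda>x\<in>carrier (Ltwo I). x)" by (rule H.bounded_opI[where K = 1]) auto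
  fix p assume p: "p \<in> ?X"
  show "\<pi> \<one> (v p) = (\<lambda>x\<in>carrier (Ltwo I). x) (v p)" using pv[OF one_closed p] act2_one[OF p] v[OF p] by (simp add: lc)
 qed
 have pU: "\<pi> g \<in> Units (BH (Ltwo I))" if g: "g \<in> \<G>" for g
 proof -
  have ig: "inv g \<in> \<G>" using g by simp
  have "compose (carrier (Ltwo I)) (\<pi> (inv g)) (\<pi> g) = \<pi> \<one>" "compose (carrier (Ltwo I)) (\<pi> g) (\<pi> (inv g)) = \<pi> \<one>"
   using pm[OF ig g] pm[OF g ig] g by simp_all
  thus ?thesis unfolding Units_def using pb[OF g] pb[OF ig] p1 by (auto simp: H.BH_simps)
 qed
 have hom: "\<pi> \<in> hom G (units_of (BH (Ltwo I)))"
  unfolding hom_def using pU pm by (auto simp: units_of_carrier units_of_mult H.BH_simps(4))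
 have opn: "opnorm (Ltwo I) (\<pi> g) <= exp (c / 2 * d g \<one>)" if g: "g \<in> \<G>" for g
  by (rule H.opnorm_le) (use pn[OF g] in \<open>auto simp: lc\<close>)
 have strong: "(%l. H.nm (%i. \<pi> (\<sigma> l) \<zeta> i - \<pi> x \<zeta> i)) \<leadsto> 0" if \<sigma>: "conv \<sigma> x" and \<zeta>: "\<zeta> \<in> l2 I" for \<sigma> x \<zeta>
 proof -
  note s = convD[OF \<sigma>]
  have "(%l. exp (c / 2 * d (\<sigma> l) \<one>)) \<leadsto> exp (c / 2 * d x \<one>)"
   by (intro tendsto_intros conv_mdist_tendsto[OF \<sigma> one_closed])
  hence "Bseq (%l. exp (c / 2 * d (\<sigma> l) \<one>))" by (intro convergent_imp_Bseq convergentI)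
  then obtain B0 where B0: "0 < B0" "\<And>l. norm (exp (c / 2 * d (\<sigma> l) \<one>)) <= B0" by (auto simp: Bseq_def)
  define B where "B = max B0 (exp (c / 2 * d x \<one>))"
  show ?thesis
  proof (rule strong_convergence_on_span[where A = "%l. \<pi> (\<sigma> l)" and T = "\<pi> x" and B = B, OF sp v])
   show "bounded_op (Ltwo I) (\<pi> (\<sigma> l))" "bounded_op (Ltwo I) (\<pi> x)" for l using pb s by auto
   show "H.nm (\<pi> (\<sigma> l) z) <= B * H.nm z" if z: "z \<in> l2 I" for l z
   proof -
    have "exp (c / 2 * d (\<sigma> l) \<one>) <= B" using B0(2)[of l] by (simp add: B_def)
    thus ?thesis using pn[OF s(1)[of l] z] mult_right_mono[OF _ l2_norm_nonneg[OF z]] order_trans by blast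
   qed
   show "H.nm (\<pi> x z) <= B * H.nm z" if z: "z \<in> l2 I" for z
   proof -
    have "exp (c / 2 * d x \<one>) <= B" by (simp add: B_def)
    thus ?thesis using pn[OF s(2) z] mult_right_mono[OF _ l2_norm_nonneg[OF z]] order_trans by blast
   qed
   show "0 <= B" using B0(1) by (simp add: B_def)
   fix p assume p: "p \<in> ?X"
   obtain t y n where pe: "p = (t, (y, n))" and y: "y \<in> \<G>" using p by auto
   have eq: "H.nm (%i. \<pi> (\<sigma> l) (v p) i - \<pi> x (v p) i) = sqrt (kdist ?J (t, (x \<otimes> y, n)) (t, (\<sigma> l \<otimes> y, n)))" for l
   proof -
    have a: "\<pi> (\<sigma> l) (v p) = v (t, (\<sigma> l \<otimes> y, n))" "\<pi> x (v p) = v (t, (x \<otimes> y, n))"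
     using pv[OF s(1) p] pv[OF s(2) p] by (simp_all add: pe act2_def act_def)
    have m: "\<sigma> l \<otimes> y \<in> \<G>" "x \<otimes> y \<in> \<G>" using s(1,2) y by auto
    have "(H.nm (%i. v (t, (x \<otimes> y, n)) i - v (t, (\<sigma> l \<otimes> y, n)) i))^2 = kdist ?J (t, (x \<otimes> y, n)) (t, (\<sigma> l \<otimes> y, n))"
     by (rule kdist_norm[OF v vJ]) (use m in auto)
    thus ?thesis
     unfolding a l2_norm_minus_commute[OF vp[OF m(1)] vp[OF m(2)]]
     using l2_norm_nonneg[OF l2_diff[OF vp[OF m(2)] vp[OF m(1)]]] by (metis real_sqrt_unique)
   qed
   show "(%l. H.nm (%i. \<pi> (\<sigma> l) (v p) i - \<pi> x (v p) i)) \<leadsto> 0"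
    unfolding eq using tendsto_real_sqrt[OF kd[OF conv_right_mult[OF \<sigma> y], of t n]] by simp
  qed (assumption | rule \<zeta>)+
 qed
 have bnd: "cmod (v (fst si, (\<one>, n)) (snd si)) <= sqrt S" for n si
  using l2_coord_le[OF vp[OF one_closed]] nv[of "(\<one>, n)" "fst si"] by (meson SigmaI UNIV_I one_closed order_trans)
 obtain r z where r: "strict_mono r" and z: "\<And>si. (%n. v (fst si, (\<one>, r n)) (snd si)) \<leadsto> z si"
  using coordinatewise_subsequence[of "%n si. v (fst si, (\<one>, n)) (snd si)" "sqrt S", OF bnd] by blast
 define zz where "zz s i = z (s, i)" for s i
 have zl: "(%n. v (s, (\<one>, r n)) i) \<leadsto> zz s i" for s i using z[of "(s, i)"] by (simp add: zz_def)
 have n1: "H.nm (v (s, (x, n))) <= sqrt S" if "x \<in> \<G>" for s x n using that by (intro nv) auto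
 have zm: "zz s \<in> l2 I" for s by (rule l2_weak_limit(1)[OF vp[OF one_closed] n1[OF one_closed] zl])
 have W: "(%n. v (s, (x, r n)) i) \<leadsto> \<pi> x (zz s) i" if x: "x \<in> \<G>" for s x i
 proof -
  have "\<pi> x (v (s, (\<one>, n))) = v (s, (x, n))" for n
   using pv[OF x, of "(s, (\<one>, n))"] x by (simp add: act2_def act_def)
  thus ?thesis using weak_continuity[OF pb[OF x] vp[OF one_closed] n1[OF one_closed] zm zl, of s i] by simp
 qed
 have pz: "\<pi> x (zz s) \<in> l2 I" if "x \<in> \<G>" for x s using bounded_op_l2(1)[OF pb[OF that] zm] .
 define \<xi> where "\<xi> = (%i. zz True i + zz False i)"
 define \<eta> where "\<eta> = (%i. zz True i - zz False i)"
 have \<xi>m: "\<xi> \<in> l2 I" and \<eta>m: "\<eta> \<in> l2 I" unfolding \<xi>_def \<eta>_def by (intro l2_add l2_diff zm)+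
 have p\<xi>: "\<pi> x \<xi> = (%i. \<pi> x (zz True) i + \<pi> x (zz False) i)" if x: "x \<in> \<G>" for x
  using H.bounded_opD(2)[OF pb[OF x], of "zz True" "zz False"] zm pz[OF x] by (simp add: Ltwo_simps \<xi>_def)
 have p\<eta>: "\<pi> x \<eta> = (%i. \<pi> x (zz True) i - \<pi> x (zz False) i)" if x: "x \<in> \<G>" for x
  unfolding \<eta>_def by (rule bounded_op_l2(2)[OF pb[OF x] zm zm])
 have Zn: "H.nm (%i. v (True, (x, n)) i + v (False, (x, n)) i) <= sqrt S"
  "H.nm (%i. v (True, (x, n)) i - v (False, (x, n)) i) <= sqrt S" if x: "x \<in> \<G>" for x n
  using comb2[of "(x, n)" 1] comb2[of "(x, n)" "-1"] S[of "(x, n)"] x by (auto intro!: real_le_rsqrt)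
 have ip: "cinner (Ltwo I) a b = (\<Sum>i. a i * cnj (b i))" if "a \<in> l2 I" "b \<in> l2 I" for a b
  using that by (simp add: Ltwo_simps)
 have form: "\<phi> (inv y \<otimes> x) = cinner (Ltwo I) (\<pi> x \<xi>) (\<pi> y \<eta>)" if x: "x \<in> \<G>" and y: "y \<in> \<G>" for x y
 proof -
  have Jsum: "(\<Sum>i. (v (True, (x, n)) i + v (False, (x, n)) i) * cnj (v (True, (y, m)) i - v (False, (y, m)) i)) = K (x, n) (y, m) - L (x, n) (y, m)" for n m
  proof -
   have vs: "(%i. v (s, (x, n)) i * cnj (v (t, (y, m)) i)) sums ?J (s, (x, n)) (t, (y, m))" for s t
    by (rule vJ) (use x y in auto)
   have "(%i. (v (True, (x, n)) i * cnj (v (True, (y, m)) i) - v (True, (x, n)) i * cnj (v (False, (y, m)) i))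
      + (v (False, (x, n)) i * cnj (v (True, (y, m)) i) - v (False, (x, n)) i * cnj (v (False, (y, m)) i)))
     sums ((?J (True, (x, n)) (True, (y, m)) - ?J (True, (x, n)) (False, (y, m))) + (?J (False, (x, n)) (True, (y, m)) - ?J (False, (x, n)) (False, (y, m))))"
    by (intro sums_add sums_diff vs)
   thus ?thesis by (simp add: kernel_sum_def sums_iff algebra_simps)
  qed
  have "(\<Sum>i. \<pi> x \<xi> i * cnj (\<pi> y \<eta> i)) = \<phi> (inv y \<otimes> x)"
  proof (rule weak_iterated_limit[where z = "%n i. v (True, (x, r n)) i + v (False, (x, r n)) i" and w = "%n i. v (True, (y, r n)) i - v (False, (y, r n)) i" and R = "sqrt S" and R' = "sqrt S"])
   show "(%i. v (True, (x, r n)) i + v (False, (x, r n)) i) \<in> l2 I" for n by (intro l2_add vp x)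
   show "(%i. v (True, (y, r n)) i - v (False, (y, r n)) i) \<in> l2 I" for n by (intro l2_diff vp y)
   show "(%n. v (True, (x, r n)) i + v (False, (x, r n)) i) \<leadsto> \<pi> x \<xi> i" for i
    unfolding p\<xi>[OF x] by (intro tendsto_intros W x)
   show "(%n. v (True, (y, r n)) i - v (False, (y, r n)) i) \<leadsto> \<pi> y \<eta> i" for i
    unfolding p\<eta>[OF y] by (intro tendsto_intros W y)
   fix \<epsilon> :: real assume "0 < \<epsilon>"
   from kernel_limit[OF \<phi> ap x y this] obtain N where N: "\<forall>n\<ge>N. \<forall>m\<ge>N. cmod (K (x, n) (y, m) - L (x, n) (y, m) - \<phi> (inv y \<otimes> x)) <= \<epsilon>" by blast
   have rN: "r n >= N" if "n >= N" for n using seq_suble[OF r, of n] that by linarith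
   show "\<exists>N. \<forall>n\<ge>N. \<forall>m\<ge>N. cmod ((\<Sum>i. (v (True, (x, r n)) i + v (False, (x, r n)) i) * cnj (v (True, (y, r m)) i - v (False, (y, r m)) i)) - \<phi> (inv y \<otimes> x)) <= \<epsilon>"
    unfolding Jsum using N rN by blast
  qed (use Zn x y in auto)
  thus ?thesis
   by (simp add: ip[OF bounded_op_l2(1)[OF pb[OF x] \<xi>m] bounded_op_l2(1)[OF pb[OF y] \<eta>m]])
 qed
 have norm\<xi>: "H.nm (\<pi> x \<xi>) <= sqrt S" if x: "x \<in> \<G>" for x
 proof (rule l2_weak_limit(2)[where z = "%n i. v (True, (x, r n)) i + v (False, (x, r n)) i"])
  show "(%i. v (True, (x, r n)) i + v (False, (x, r n)) i) \<in> l2 I" for n by (intro l2_add vp x)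
  show "(%n. v (True, (x, r n)) i + v (False, (x, r n)) i) \<leadsto> \<pi> x \<xi> i" for i
   unfolding p\<xi>[OF x] by (intro tendsto_intros W x)
 qed (rule Zn(1)[OF x])
 have orth: "cinner (Ltwo I) (\<pi> x (zz True)) (\<pi> x (zz False)) = 0" if x: "x \<in> \<G>" for x
  unfolding ip[OF pz[OF x] pz[OF x]]
 proof (rule weak_iterated_limit[where z = "%n. v (True, (x, r n))" and w = "%n. v (False, (x, r n))" and R = "sqrt S" and R' = "sqrt S"])
  have "(\<Sum>i. v (True, (x, n)) i * cnj (v (False, (x, m)) i)) = 0" for n m
   using vJ[of "(True, (x, n))" "(False, (x, m))"] x by (simp add: kernel_sum_def sums_iff)
  thus "\<exists>N. \<forall>n\<ge>N. \<forall>m\<ge>N. cmod ((\<Sum>i. v (True, (x, r n)) i * cnj (v (False, (x, r m)) i)) - 0) <= \<epsilon>" if "0 < \<epsilon>" for \<epsilon>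
   using that by simp
 qed (use vp n1 W x in auto)
 have norm\<eta>: "H.nm (\<pi> x \<eta>) = H.nm (\<pi> x \<xi>)" if x: "x \<in> \<G>" for x
 proof -
  let ?a = "\<pi> x (zz True)" and ?b = "\<pi> x (zz False)"
  have m: "?a \<in> carrier (Ltwo I)" "?b \<in> carrier (Ltwo I)" using pz[OF x] by (simp_all add: lc)
  have "(H.nm (?a \<oplus>\<^bsub>Ltwo I\<^esub> (s \<odot>\<^bsub>Ltwo I\<^esub> ?b)))^2 = (H.nm ?a)^2 + (cmod s * H.nm ?b)^2" for s
   using m orth[OF x] by (simp add: H.nm_add_square H.ip_smult_right H.nm_scale)
  from this[of 1] this[of "-1"] have "(H.nm (\<pi> x \<eta>))^2 = (H.nm (\<pi> x \<xi>))^2"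
   unfolding p\<xi>[OF x] p\<eta>[OF x] using pz[OF x] l2_scale[OF pz[OF x], of "-1"] by (simp add: Ltwo_simps)
  thus ?thesis
   using l2_norm_nonneg[OF bounded_op_l2(1)[OF pb[OF x] \<xi>m]] l2_norm_nonneg[OF bounded_op_l2(1)[OF pb[OF x] \<eta>m]]
   by (metis power2_eq_iff_nonneg)
 qed
 show ?thesis
  using hom opn \<xi>m \<eta>m strong form norm\<xi> norm\<eta> by (intro exI[of _ I] exI[of _ \<pi>] exI[of _ \<xi>] exI[of _ \<eta>] conjI ballI allI impI)
qed

end

section \<open>Representations with optimal norms\<close>

lemma schur_bound_nonneg:
 assumes "schur_bound X \<psi> C" "x \<in> X" shows "0 <= C"
proof -
 have "Re (\<Sum>p\<in>{x}. \<Sum>q\<in>{x}. (%_ _. 0) p q * \<psi> p q) <= C * (\<Sum>p\<in>{x}. (%_. 1) p)"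
  by (rule assms(1)[unfolded schur_bound_def, THEN spec, THEN spec, THEN spec, THEN mp, THEN mp, THEN mp, THEN mp, THEN mp])
   (use assms(2) in \<open>auto simp: sesq_def\<close>)
 thus ?thesis by simp
qed

context exponential_growth_group
begin

theorem representation_from_schur_bound:
 fixes \<phi> :: "'a => complex"
 assumes sc: "second_countable mtopology" and \<phi>: "continuous_map mtopology euclidean \<phi>"
  and herm: "hermitian_fun G \<phi>"
  and schur: "schur_bound (\<G>) (%x y. \<phi> (inv y \<otimes> x)) S"
 shows "\<exists>I \<pi> \<xi> \<eta>. realizes c \<phi> S I \<pi> \<xi> \<eta>"
proof -
 have S: "0 <= S" by (rule schur_bound_nonneg[OF schur one_closed])
 have herm': "\<phi> (inv x \<otimes> y) = cnj (\<phi> (inv y \<otimes> x))" if x: "x \<in> \<G>" and y: "y \<in> \<G>" for x y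
 proof -
  have g: "inv x \<otimes> y \<in> \<G>" using x y by simp
  have "inv (inv x \<otimes> y) = inv y \<otimes> x" using x y by (simp add: inv_mult_group)
  thus ?thesis using bspec[OF herm[unfolded hermitian_fun_def] g] by simp
 qed
 have "\<exists>k l. psd (\<G>) k & psd (\<G>) l & (\<forall>x\<in>\<G>. Re (k x x) + Re (l x x) <= S) &
   (\<forall>x\<in>\<G>. \<forall>y\<in>\<G>. k x y - l x y = \<phi> (inv y \<otimes> x))"
  by (rule schur_bound_decomposition[OF schur S]) (rule herm')
 then obtain k l where k: "psd (\<G>) k" and l: "psd (\<G>) l"
  and kS: "\<forall>x\<in>\<G>. Re (k x x) + Re (l x x) <= S"
  and kl: "\<forall>x\<in>\<G>. \<forall>y\<in>\<G>. k x y - l x y = \<phi> (inv y \<otimes> x)" by (elim exE conjE)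
 have ne: "\<G> ~= {}" using one_closed by blast
 have "\<exists>K L. psd GN K & psd GN L &
   (\<forall>p\<in>GN. Re (K p p) + Re (L p p) <= S) & seq_cont K & seq_cont L &
   approximates (\<G>) d (%x y. \<phi> (inv y \<otimes> x)) (%p q. K p q - L p q)"
  by (rule smooth_decomposition[OF sc ne k l]) (use kS kl in blast)+
 then obtain K0 L0 where K0: "psd GN K0" "seq_cont K0"
  and L0: "psd GN L0" "seq_cont L0"
  and S0: "\<forall>p\<in>GN. Re (K0 p p) + Re (L0 p p) <= S"
  and ap0: "approximates (\<G>) d (%x y. \<phi> (inv y \<otimes> x)) (%p q. K0 p q - L0 p q)" by (elim exE conjE)
 have "\<exists>K L. psd GN K & psd GN L &
   seq_cont K & seq_cont L &
   (\<forall>p\<in>GN. Re (K p p) + Re (L p p) <= S) &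
   approximates (\<G>) d (%x y. \<phi> (inv y \<otimes> x)) (%p q. K p q - L p q) &
   (\<forall>g\<in>\<G>. psd GN (%p q. of_real (exp (c * d g \<one>)) * K p q - K (act g p) (act g q)) &
    psd GN (%p q. of_real (exp (c * d g \<one>)) * L p q - L (act g p) (act g q)))"
  by (rule average_decomposition[OF K0 L0 bspec[OF S0] ap0])
 then obtain K L where K: "psd GN K" "psd GN L"
   "seq_cont K" "seq_cont L" "\<forall>p\<in>GN. Re (K p p) + Re (L p p) <= S"
   "approximates (\<G>) d (%x y. \<phi> (inv y \<otimes> x)) (%p q. K p q - L p q)"
  and gr: "\<forall>g\<in>\<G>. psd GN (%p q. of_real (exp (c * d g \<one>)) * K p q - K (act g p) (act g q)) &
    psd GN (%p q. of_real (exp (c * d g \<one>)) * L p q - L (act g p) (act g q))"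
  by (elim exE conjE)
 show ?thesis
  by (rule representation_from_kernels[OF sc \<phi> K(1,3) K(2,4) bspec[OF K(5)] K(6)])
   (use gr in blast)+
qed

text \<open>The functions \<open>x \<mapsto> (\<pi>(x\<inverse>)\<xi>)\<^sub>k\<close> and \<open>x \<mapsto> (\<pi>(x\<inverse>)\<eta>)\<^sub>k\<close> factor \<open>\<phi>\<close>.\<close>

lemma multiplier_from_representation:
 assumes hom: "\<pi> \<in> hom G (units_of (BH (Ltwo I)))" and \<xi>: "\<xi> \<in> l2 I" and \<eta>: "\<eta> \<in> l2 I"
  and strong: "\<And>\<sigma> x \<zeta>. [|conv \<sigma> x; \<zeta> \<in> l2 I|] ==> (%l. l2n I (%i. \<pi> (\<sigma> l) \<zeta> i - \<pi> x \<zeta> i)) \<leadsto> 0"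
  and form: "\<And>x y. [|x \<in> \<G>; y \<in> \<G>|] ==> \<phi> (inv y \<otimes> x) = cinner (Ltwo I) (\<pi> x \<xi>) (\<pi> y \<eta>)"
  and norms: "\<And>x. x \<in> \<G> ==> l2n I (\<pi> x \<xi>) <= s" "\<And>x. x \<in> \<G> ==> l2n I (\<pi> x \<eta>) <= s"
 shows "\<exists>M. fourier_multiplier_op G \<mu> \<phi> M &
  (\<forall>n A. (in_vN n A) -->
    \<M> n (%i j. M (A i j)) <= s\<^sup>2 * \<M> n A)"
proof -
 interpret H: inner_space "Ltwo I" by (rule l2_inner_space)
 have pb: "bounded_op (Ltwo I) (\<pi> g)" if "g \<in> \<G>" for g
  using hom_in_carrier[OF hom that] by (auto simp: units_of_carrier Units_def H.BH_simps)
 have pm: "\<pi> g z \<in> l2 I" if "g \<in> \<G>" "z \<in> l2 I" for g z by (rule bounded_op_l2(1)[OF pb[OF that(1)] that(2)])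
 have symbol: "bsymbol \<mu> (%k x. \<pi> (inv x) z k) s"
  if z: "z \<in> l2 I" and n: "\<And>x. x \<in> \<G> ==> l2n I (\<pi> x z) <= s" for z
  unfolding bsymbol_def
 proof (intro conjI allI ballI)
  show "0 <= s" using order_trans[OF l2_norm_nonneg[OF pm[OF one_closed z]] n[OF one_closed]] .
  fix k
  show "(%x. \<pi> (inv x) z k) \<in> borel_measurable \<mu>"
  proof (intro continuous_measurable continuous_map_if_conv)
   fix \<sigma> x assume \<sigma>: "conv \<sigma> x"
   have ci: "conv (%l. inv (\<sigma> l)) (inv x)"
    using conv_inv_mult[OF \<sigma> one_closed] convD(1,2)[OF \<sigma>] by simp
   note s = convD[OF ci]
   have "(%l. \<pi> (inv (\<sigma> l)) z k - \<pi> (inv x) z k) \<leadsto> 0"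
    by (rule Lim_null_comparison[OF always_eventually strong[OF ci z]])
     (use l2_coord_le[OF l2_diff[OF pm[OF s(1) z] pm[OF s(2) z]]] in auto)
   thus "(%l. \<pi> (inv (\<sigma> l)) z k) \<leadsto> \<pi> (inv x) z k" by (simp add: LIM_zero_iff)
  qed
 next
  fix x N assume "x \<in> space \<mu>"
  hence x: "inv x \<in> \<G>" by (simp add: space_haar)
  have "(\<Sum>k<N. cm2 (\<pi> (inv x) z k)) <= (l2n I (\<pi> (inv x) z))^2"
   by (rule l2_partial_sum_le[OF pm[OF x z]]) simp
  also have "... <= s\<^sup>2" using n[OF x] l2_norm_nonneg[OF pm[OF x z]] by (rule power_mono)
  finally show "(\<Sum>k<N. cm2 (\<pi> (inv x) z k)) <= s\<^sup>2" .
 qed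
 show ?thesis
 proof (rule multiplier_from_factorization)
  show "bsymbol \<mu> (%k x. \<pi> (inv x) \<xi> k) s" "bsymbol \<mu> (%k x. \<pi> (inv x) \<eta> k) s"
   by (rule symbol[OF \<xi> norms(1)], assumption) (rule symbol[OF \<eta> norms(2)])
  fix g x assume g: "g \<in> \<G>" and x: "x \<in> \<G>"
  have gx: "inv (inv g \<otimes> x) \<in> \<G>" and ix: "inv x \<in> \<G>" using g x by auto
  have "inv (inv x) \<otimes> inv (inv g \<otimes> x) = g" using g x by (simp add: inv_mult_group m_assoc[symmetric])
  hence "\<phi> g = cinner (Ltwo I) (\<pi> (inv (inv g \<otimes> x)) \<xi>) (\<pi> (inv x) \<eta>)"
   using form[OF gx ix] by simp
  also have "... = (\<Sum>k. \<pi> (inv (inv g \<otimes> x)) \<xi> k * cnj (\<pi> (inv x) \<eta> k))"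
   using pm[OF gx \<xi>] pm[OF ix \<eta>] by (simp add: Ltwo_simps)
  finally show "(%k. \<pi> (inv (inv g \<otimes> x)) \<xi> k * cnj (\<pi> (inv x) \<eta> k)) sums \<phi> g"
   using summable_sums[OF l2_mult_summable[OF pm[OF gx \<xi>] pm[OF ix \<eta>]]] by simp
 qed
qed

lemma strongly_continuousI:
 assumes hom: "\<pi> \<in> hom G (units_of (BH (Ltwo I)))"
  and strong: "\<And>\<sigma> x \<zeta>. [|conv \<sigma> x; \<zeta> \<in> l2 I|] ==> (%l. l2n I (%i. \<pi> (\<sigma> l) \<zeta> i - \<pi> x \<zeta> i)) \<leadsto> 0"
 shows "strongly_continuous mtopology (Ltwo I) \<pi>"
proof -
 interpret H: inner_space "Ltwo I" by (rule l2_inner_space)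
 interpret N: Metric_space "carrier (Ltwo I)" "hdist (Ltwo I)" by (rule l2_Metric_space)
 have pb: "bounded_op (Ltwo I) (\<pi> g)" if "g \<in> \<G>" for g
  using hom_in_carrier[OF hom that] by (auto simp: units_of_carrier Units_def H.BH_simps)
 have pm: "\<pi> g z \<in> l2 I" if "g \<in> \<G>" "z \<in> l2 I" for g z by (rule bounded_op_l2(1)[OF pb[OF that(1)] that(2)])
 have comp: "continuous_map mtopology N.mtopology (%g. \<pi> g \<zeta>)" if \<zeta>: "\<zeta> \<in> carrier (Ltwo I)" for \<zeta>
 proof -
  have \<zeta>': "\<zeta> \<in> l2 I" using \<zeta> by (simp add: Ltwo_simps)
  have dist: "hdist (Ltwo I) (\<pi> x \<zeta>) (\<pi> y \<zeta>) = l2n I (%i. \<pi> y \<zeta> i - \<pi> x \<zeta> i)"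
   if "x \<in> \<G>" "y \<in> \<G>" for x y
   unfolding l2_hdist using l2_norm_minus_commute[OF pm[OF that(1) \<zeta>'] pm[OF that(2) \<zeta>']] pm[OF that(1) \<zeta>'] pm[OF that(2) \<zeta>'] by simp
  have "\<exists>\<delta>>0. \<forall>y\<in>\<G>. d x y < \<delta> --> l2n I (%i. \<pi> y \<zeta> i - \<pi> x \<zeta> i) < e"
   if "x \<in> \<G>" "0 < e" for x e
   by (rule less_if_conv_null[OF that]) (rule strong[OF _ \<zeta>'])
  hence "\<exists>\<delta>>0. \<forall>y. y \<in> \<G> & d x y < \<delta> --> hdist (Ltwo I) (\<pi> x \<zeta>) (\<pi> y \<zeta>) < e"
   if "x \<in> \<G>" "0 < e" for x e using that dist by (metis (no_types, lifting))
  thus ?thesis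
   unfolding metric_continuous_map[OF N.Metric_space_axioms] using pm[OF _ \<zeta>'] by (auto simp: Ltwo_simps(1))
 qed
 have "continuous_map mtopology (product_topology (%_. N.mtopology) (carrier (Ltwo I))) \<pi>"
  unfolding continuous_map_componentwise using comp H.bounded_opD(4)[OF pb] by auto
 thus ?thesis
  unfolding strongly_continuous_def strong_op_topology_def continuous_map_in_subtopology
  using pb by (auto simp: H.BH_simps)
qed

text \<open>The first use of the construction yields \<open>M\<^sub>\<phi>\<close>, the second uses its norm as Schur bound; a smaller bound for the orbits would produce a smaller completely bounded norm, contradicting uniqueness of \<open>M\<^sub>\<phi>\<close>.\<close>

theorem representing_triple_exists:
 fixes \<phi> :: "'a => complex"
 assumes sc: "second_countable mtopology" and hs: "herz_schur_multiplier G mtopology \<phi>" and herm: "hermitian_fun G \<phi>"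
 shows "\<exists>(H :: (nat => complex) hilbert) \<pi> \<xi> \<eta>. represents_multiplier G mtopology \<mu> \<phi> H \<pi> \<xi> \<eta> &
    (\<forall>g\<in>\<G>. opnorm H (\<pi> g) <= exp (c / 2 * d g \<one>))"
proof -
 let ?\<psi> = "%x y. \<phi> (inv y \<otimes> x)"
 have \<phi>: "continuous_map mtopology euclidean \<phi>" and sm: "schur_multiplier (\<G>) ?\<psi>"
  using hs by (auto simp: herz_schur_multiplier_def)
 have inv: "?\<psi> (g \<otimes> x) (g \<otimes> y) = ?\<psi> x y" if "g \<in> \<G>" "x \<in> \<G>" "y \<in> \<G>" for g x y
 proof -
  have "inv (g \<otimes> y) \<otimes> (g \<otimes> x) = inv y \<otimes> (inv g \<otimes> (g \<otimes> x))" using that by (simp add: inv_mult_group m_assoc)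
  also have "inv g \<otimes> (g \<otimes> x) = x" using that by (simp add: m_assoc[symmetric])
  finally show ?thesis by simp
 qed
 obtain S where S: "0 <= S" "schur_bound (\<G>) ?\<psi> S" using schur_multiplier_bounded[OF sm inv] by blast
 obtain M where M: "fourier_multiplier_op G \<mu> \<phi> M"
  and MS: "\<And>n A. in_vN n A ==>
    \<M> n (%i j. M (A i j)) <= (sqrt S)^2 * \<M> n A"
 proof -
  obtain I \<pi> \<xi> \<eta> where h: "\<pi> \<in> hom G (units_of (BH (Ltwo I)))" "\<xi> \<in> l2 I" "\<eta> \<in> l2 I"
   "\<forall>\<sigma> x \<zeta>. conv \<sigma> x --> \<zeta> \<in> l2 I --> (%l. l2n I (%i. \<pi> (\<sigma> l) \<zeta> i - \<pi> x \<zeta> i)) \<leadsto> 0"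
   "\<forall>x\<in>\<G>. \<forall>y\<in>\<G>. \<phi> (inv y \<otimes> x) = cinner (Ltwo I) (\<pi> x \<xi>) (\<pi> y \<eta>)"
   "\<forall>x\<in>\<G>. l2n I (\<pi> x \<xi>) <= sqrt S & l2n I (\<pi> x \<eta>) = l2n I (\<pi> x \<xi>)"
   using representation_from_schur_bound[OF sc \<phi> herm S(2)] by (elim exE conjE)
  have "\<exists>M. fourier_multiplier_op G \<mu> \<phi> M &
   (\<forall>n A. (in_vN n A) -->
    \<M> n (%i j. M (A i j)) <= (sqrt S)^2 * \<M> n A)"
   by (rule multiplier_from_representation[OF h(1,2,3)]) (use h(4,5,6) in auto)
  thus thesis using that by blast
 qed
 define C where "C = cb_norm (L2 \<mu>) (vN) M"
 have normC: "M0A_norm G \<mu> \<phi> = C" unfolding C_def by (rule M0A_norm_eq[OF M])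
 obtain f0 where f0: "f0 \<in> CL \<mu>" "hnorm (L2 \<mu>) f0 = 1" by (rule L2_unit_vector)
 have schurC: "schur_bound (\<G>) ?\<psi> C"
  unfolding C_def by (rule schur_bound_if_cb[OF M cb_norm_le(2)[OF MS] f0]) simp_all
 obtain I \<pi> \<xi> \<eta> where hom: "\<pi> \<in> hom G (units_of (BH (Ltwo I)))"
  and opn: "\<forall>g\<in>\<G>. opnorm (Ltwo I) (\<pi> g) <= exp (c / 2 * d g \<one>)"
  and \<xi>: "\<xi> \<in> l2 I" and \<eta>: "\<eta> \<in> l2 I"
  and strong: "\<forall>\<sigma> x \<zeta>. conv \<sigma> x --> \<zeta> \<in> l2 I --> (%l. l2n I (%i. \<pi> (\<sigma> l) \<zeta> i - \<pi> x \<zeta> i)) \<leadsto> 0"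
  and form: "\<forall>x\<in>\<G>. \<forall>y\<in>\<G>. \<phi> (inv y \<otimes> x) = cinner (Ltwo I) (\<pi> x \<xi>) (\<pi> y \<eta>)"
  and nrm: "\<forall>x\<in>\<G>. l2n I (\<pi> x \<xi>) <= sqrt C & l2n I (\<pi> x \<eta>) = l2n I (\<pi> x \<xi>)"
  using representation_from_schur_bound[OF sc \<phi> herm schurC] by (elim exE conjE)
 have strong': "(%l. l2n I (%i. \<pi> (\<sigma> l) \<zeta> i - \<pi> x \<zeta> i)) \<leadsto> 0" if "conv \<sigma> x" "\<zeta> \<in> l2 I" for \<sigma> x \<zeta>
  using strong that by blast
 have sharp: "sqrt C <= s" if s: "0 <= s" "\<And>x. x \<in> \<G> ==> l2n I (\<pi> x \<xi>) <= s" for s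
 proof -
  have "\<exists>M. fourier_multiplier_op G \<mu> \<phi> M &
   (\<forall>n A. (in_vN n A) -->
    \<M> n (%i j. M (A i j)) <= s\<^sup>2 * \<M> n A)"
   by (rule multiplier_from_representation[OF hom \<xi> \<eta> strong']) (use form s nrm in auto)
  then obtain M' where M': "fourier_multiplier_op G \<mu> \<phi> M'"
   and b: "\<And>n A. in_vN n A ==>
    \<M> n (%i j. M' (A i j)) <= s\<^sup>2 * \<M> n A" by blast
  have "cb_norm (L2 \<mu>) (vN) M' <= s\<^sup>2" by (rule cb_norm_le(1)[OF b]) simp_all
  hence "C <= s\<^sup>2" using M0A_norm_eq[OF M'] normC by simp
  thus ?thesis using s(1) by (rule real_le_lsqrt[rotated 1])
 qed
 have sup: "(SUP x\<in>\<G>. ereal (l2n I (\<pi> x \<xi>))) = ereal (sqrt (M0A_norm G \<mu> \<phi>))"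
  unfolding normC
 proof (rule SUP_eqI)
  show "ereal (l2n I (\<pi> x \<xi>)) <= ereal (sqrt C)" if "x \<in> \<G>" for x using nrm that by simp
  fix y assume y: "\<And>x. x \<in> \<G> ==> ereal (l2n I (\<pi> x \<xi>)) <= y"
  show "ereal (sqrt C) <= y"
  proof (cases y)
   case (real s)
   have le: "l2n I (\<pi> x \<xi>) <= s" if "x \<in> \<G>" for x using y[OF that] real by simp
   interpret H: inner_space "Ltwo I" by (rule l2_inner_space)
   have "bounded_op (Ltwo I) (\<pi> \<one>)"
    using hom_in_carrier[OF hom one_closed] by (auto simp: units_of_carrier Units_def H.BH_simps)
   from l2_norm_nonneg[OF bounded_op_l2(1)[OF this \<xi>]] have "0 <= s" using le[OF one_closed] by linarith
   thus ?thesis using sharp le real by simp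
  next
   case MInf
   thus ?thesis using y[OF one_closed] by simp
  qed simp
 qed
 have sup': "(SUP y\<in>\<G>. ereal (l2n I (\<pi> y \<eta>))) = ereal (sqrt (M0A_norm G \<mu> \<phi>))"
  unfolding sup[symmetric] using nrm by (intro SUP_cong) auto
 have "represents_multiplier G mtopology \<mu> \<phi> (Ltwo I) \<pi> \<xi> \<eta>"
  unfolding represents_multiplier_def representation_def
  using l2_hilbert hom strongly_continuousI[OF hom strong'] \<xi> \<eta> form sup sup' by (simp add: Ltwo_simps(1))
 thus ?thesis using opn by blast
qed

end

theorem theorem1p1:
  fixes G :: "('g, 'm) monoid_scheme" (structure)
    and T :: "'g topology" and d :: "'g \<Rightarrow> 'g \<Rightarrow> real" and \<mu> :: "'g measure"
    and \<phi> :: "'g \<Rightarrow> complex" and a b :: real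
  assumes "locally_compact_group G T"
    and "second_countable T"
    and "herz_schur_multiplier G T \<phi>"
    and "hermitian_fun G \<phi>"
    and "Metric_space (carrier G) d"
    and "Metric_space.mtopology (carrier G) d = T"
    and "\<forall>g\<in>carrier G. \<forall>x\<in>carrier G. \<forall>y\<in>carrier G. d (g \<otimes> x) (g \<otimes> y) = d x y"
    and "\<forall>x\<in>carrier G. \<forall>r. compactin T (Metric_space.mcball (carrier G) d x r)"
    and "haar_measure G T \<mu>"
    and "a > 0" and "b > 0"
    and "\<forall>n::nat. emeasure \<mu> {g \<in> carrier G. d g \<one> < real n} \<le> ennreal (a * exp (b * real n))"
  shows "(\<exists>(H :: (nat \<Rightarrow> complex) hilbert) \<pi> \<xi> \<eta>. represents_multiplier G T \<mu> \<phi> H \<pi> \<xi> \<eta>) \<and>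
    (\<forall>c>b. \<exists>(H :: (nat \<Rightarrow> complex) hilbert) \<pi> \<xi> \<eta>.
       represents_multiplier G T \<mu> \<phi> H \<pi> \<xi> \<eta> \<and>
       (\<forall>g\<in>carrier G. opnorm H (\<pi> g) \<le> exp (c / 2 * d g \<one>)))"
proof -
  interpret LC: locally_compact_group G T by (rule assms(1))
  have group: "Group.group G" by unfold_locales
  have top: "topological_group G T" by unfold_locales
  have main: "\<exists>(H :: (nat \<Rightarrow> complex) hilbert) \<pi> \<xi> \<eta>. represents_multiplier G T \<mu> \<phi> H \<pi> \<xi> \<eta> \<and>
       (\<forall>g\<in>carrier G. opnorm H (\<pi> g) \<le> exp (c / 2 * d g \<one>))" if c: "c > b" for c
  proof -
    interpret exponential_growth_group G d \<mu> a b c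
      by (intro exponential_growth_group.intro invariant_measure_group.intro invariant_metric_group.intro
          invariant_metric_group_axioms.intro invariant_measure_group_axioms.intro exponential_growth_group_axioms.intro group assms(5))
        (use assms(6,7,9-12) top c in auto)
    show ?thesis using representing_triple_exists assms(2-4) unfolding assms(6) by blast
  qed
  from main[of "b + 1"] have "\<exists>(H :: (nat \<Rightarrow> complex) hilbert) \<pi> \<xi> \<eta>. represents_multiplier G T \<mu> \<phi> H \<pi> \<xi> \<eta>"
    by auto
  then show ?thesis using main by blast
qed

end
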